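(* Let $G=(V,E,J)$ be an infinite, connected, transitive, nonamenable, unimodular weighted graph with root vertex $o$, and let $q\ge1$. Then there exist positive constants $C$ and $\delta$ such that \[ \phi^\#_{q,\beta,h}\bigl(n\le|K_o|<\infty\bigr)\le Cn^{-\delta} \] for every $n\ge1$, $\beta,h\ge0$ and $\#\in\{f,w\}$.
   Context: A weighted graph $G=(V,E,J)$ is a countable graph $(V,E)$ (parallel edges allowed) with positive coupling constants $(J_e)$ such that $\sum_{e\ni v}J_e<\infty$ for every $v$. Automorphisms preserve $J$; transitive means $\mathrm{Aut}(G)$ acts transitively on $V$; unimodular means $\mathrm{Aut}(G)$ (topology of pointwise convergence) is unimodular; nonamenable means $\inf\{\sum_{e\in\partial_EK}J_e/\sum_{e\in E(K)}J_e:K\subseteq V\text{ finite nonempty}\}>0$, with $\partial_EK$ the edges with exactly one endpoint in $K$ and $E(K)$ the edges with at least one endpoint in $K$. Random cluster model: for $V$ finite, $q>0$, $\beta,h\ge0$, $\phi_{G,q,\beta,h}(\{\omega\})\propto q^{k(\omega)}\prod_{e}(e^{2\beta J_e}-1)^{\omega(e)}\prod_v(e^{2\beta h}-1)^{\omega(v)}$ on $\{0,1\}^E\times\{0,1\}^V$, where $k(\omega)$ is the number of clusters of $\{e:\omega(e)=1\}$ containing no vertex $v$ with $\omega(v)=1$. For infinite connected $G$, with finite $V_n\uparrow V$, $G_n$ the induced subgraph and $G_n^*$ obtained by contracting $V\setminus V_n$ to one vertex (deleting self-loops), $\phi^f_{q,\beta,h}=\operatorname{w-lim}\phi_{G_n,q,\beta,h}$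 and $\phi^w_{q,\beta,h}=\operatorname{w-lim}\phi_{G^*_n,q,\beta,h}$. $K_o$ is the set of vertices connected to $o$ by edges with $\omega(e)=1$. *)

theory Defs
  imports "HOL-Analysis.Analysis" "HOL-Probability.Probability"
begin

section \<open>Weighted graphs\<close>

text \<open>A weighted graph: vertex type 'v, edge type 'e (every element of 'e is an edge),
  endpoint sets ep e (two distinct vertices; parallel edges allowed), couplings J.\<close>

definition weighted_graph :: "('e \<Rightarrow> 'v set) \<Rightarrow> ('e \<Rightarrow> real) \<Rightarrow> bool" where
  "weighted_graph ep J \<longleftrightarrow>
     countable (UNIV :: 'v set) \<and> countable (UNIV :: 'e set) \<and>
     (\<forall>e. card (ep e) = 2) \<and> (\<forall>e. J e > 0) \<and>
     (\<forall>v. J summable_on {e. v \<in> ep e})"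

definition graph_adj :: "('e \<Rightarrow> 'v set) \<Rightarrow> ('v \<times> 'v) set" where
  "graph_adj ep = {(a, b). \<exists>e. ep e = {a, b}}"

definition graph_connected :: "('e \<Rightarrow> 'v set) \<Rightarrow> bool" where
  "graph_connected ep \<longleftrightarrow> (\<forall>u v. (u, v) \<in> (graph_adj ep)\<^sup>*)"

text \<open>Automorphisms: pairs (vertex bijection, edge bijection) preserving incidence and J.\<close>

definition Aut :: "('e \<Rightarrow> 'v set) \<Rightarrow> ('e \<Rightarrow> real) \<Rightarrow> (('v \<Rightarrow> 'v) \<times> ('e \<Rightarrow> 'e)) set" where
  "Aut ep J = {(\<sigma>, \<tau>). bij \<sigma> \<and> bij \<tau> \<and> (\<forall>e. ep (\<tau> e) = \<sigma> ` ep e) \<and> (\<forall>e. J (\<tau> e) = J e)}"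

definition aut_mult :: "(('v \<Rightarrow> 'v) \<times> ('e \<Rightarrow> 'e)) \<Rightarrow> (('v \<Rightarrow> 'v) \<times> ('e \<Rightarrow> 'e))
    \<Rightarrow> (('v \<Rightarrow> 'v) \<times> ('e \<Rightarrow> 'e))" where
  "aut_mult g k = (fst g \<circ> fst k, snd g \<circ> snd k)"

definition vertex_transitive :: "('e \<Rightarrow> 'v set) \<Rightarrow> ('e \<Rightarrow> real) \<Rightarrow> bool" where
  "vertex_transitive ep J \<longleftrightarrow> (\<forall>u v. \<exists>g\<in>Aut ep J. fst g u = v)"

text \<open>Topology of pointwise convergence on Aut(G) (pointwise convergence of the action on
  vertices and on edges, both carrying the discrete topology).\<close>

definition aut_topology :: "('e \<Rightarrow> 'v set) \<Rightarrow> ('e \<Rightarrow> real) \<Rightarrow> (('v \<Rightarrow> 'v) \<times> ('e \<Rightarrow> 'e)) topology" where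
  "aut_topology ep J = subtopology
     (prod_topology (product_topology (\<lambda>_. discrete_topology UNIV) UNIV)
                    (product_topology (\<lambda>_. discrete_topology UNIV) UNIV)) (Aut ep J)"

text \<open>Unimodular: the (left) Haar measure is also right invariant, i.e. there is a nonzero Borel
  measure on Aut(G), finite on compact sets, invariant under both left and right translations.\<close>

definition unimodular :: "('e \<Rightarrow> 'v set) \<Rightarrow> ('e \<Rightarrow> real) \<Rightarrow> bool" where
  "unimodular ep J \<longleftrightarrow>
    (\<exists>\<mu>. space \<mu> = Aut ep J \<and>
         sets \<mu> = sigma_sets (Aut ep J) {U. openin (aut_topology ep J) U} \<and>
         (\<forall>K. compactin (aut_topology ep J) K \<longrightarrow> emeasure \<mu> K < \<infinity>) \<and>
         emeasure \<mu> (Aut ep J) \<noteq> 0 \<and>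
         (\<forall>g\<in>Aut ep J. \<forall>A\<in>sets \<mu>.
             emeasure \<mu> (aut_mult g ` A) = emeasure \<mu> A \<and>
             emeasure \<mu> ((\<lambda>k. aut_mult k g) ` A) = emeasure \<mu> A))"

text \<open>Nonamenability.\<close>

definition edge_boundary :: "('e \<Rightarrow> 'v set) \<Rightarrow> 'v set \<Rightarrow> 'e set" where
  "edge_boundary ep K = {e. card (ep e \<inter> K) = 1}"

definition edges_meeting :: "('e \<Rightarrow> 'v set) \<Rightarrow> 'v set \<Rightarrow> 'e set" where
  "edges_meeting ep K = {e. ep e \<inter> K \<noteq> {}}"

definition nonamenable :: "('e \<Rightarrow> 'v set) \<Rightarrow> ('e \<Rightarrow> real) \<Rightarrow> bool" where
  "nonamenable ep J \<longleftrightarrow>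
     (INF K\<in>{K. finite K \<and> K \<noteq> {}}.
        infsum J (edge_boundary ep K) / infsum J (edges_meeting ep K)) > 0"

section \<open>Random cluster model on a graph with finitely many vertices\<close>

text \<open>Generic finite-vertex graph: vertex set W (finite), edge set F (countable, possibly
  infinite), endpoint sets ep.  Configurations are pairs (edge states, vertex/ghost states);
  they are supported on F and W.  Configurations with infinitely many open edges get weight 0
  (the infinite product of the factors e^{2 beta J_e}-1 over open edges vanishes), so the measure
  is the discrete measure on configurations with finitely many open edges.\<close>

definition rc_adj :: "('e \<Rightarrow> 'w set) \<Rightarrow> 'e set \<Rightarrow> ('e \<Rightarrow> bool) \<Rightarrow> ('w \<times> 'w) set" where
  "rc_adj ep F \<omega>E = {(a, b). \<exists>e\<in>F. \<omega>E e \<and> ep e = {a, b}}"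

definition rc_conn :: "('e \<Rightarrow> 'w set) \<Rightarrow> 'e set \<Rightarrow> 'w set \<Rightarrow> ('e \<Rightarrow> bool) \<Rightarrow> ('w \<times> 'w) set" where
  "rc_conn ep F W \<omega>E = {(a, b). a \<in> W \<and> b \<in> W \<and> (a, b) \<in> (rc_adj ep F \<omega>E)\<^sup>*}"

text \<open>k(omega): number of open clusters containing no vertex with omega(v)=1.\<close>
definition rc_k :: "('e \<Rightarrow> 'w set) \<Rightarrow> 'e set \<Rightarrow> 'w set \<Rightarrow> ('e \<Rightarrow> bool) \<times> ('w \<Rightarrow> bool) \<Rightarrow> nat" where
  "rc_k ep F W \<omega> = card {C \<in> W // rc_conn ep F W (fst \<omega>). \<forall>w\<in>C. \<not> snd \<omega> w}"

definition rc_conf :: "'e set \<Rightarrow> 'w set \<Rightarrow> (('e \<Rightarrow> bool) \<times> ('w \<Rightarrow> bool)) set" where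
  "rc_conf F W = {\<omega>. finite {e. fst \<omega> e} \<and> {e. fst \<omega> e} \<subseteq> F \<and> {w. snd \<omega> w} \<subseteq> W}"

definition rc_weight :: "real \<Rightarrow> real \<Rightarrow> real \<Rightarrow> ('e \<Rightarrow> real) \<Rightarrow> ('e \<Rightarrow> 'w set) \<Rightarrow> 'e set \<Rightarrow> 'w set
    \<Rightarrow> ('e \<Rightarrow> bool) \<times> ('w \<Rightarrow> bool) \<Rightarrow> real" where
  "rc_weight q \<beta> h J ep F W \<omega> =
     q ^ rc_k ep F W \<omega> *
     (\<Prod>e\<in>{e. fst \<omega> e}. exp (2 * \<beta> * J e) - 1) *
     (\<Prod>w\<in>{w. snd \<omega> w}. exp (2 * \<beta> * h) - 1)"

definition rc_pmf :: "real \<Rightarrow> real \<Rightarrow> real \<Rightarrow> ('e \<Rightarrow> real) \<Rightarrow> ('e \<Rightarrow> 'w set) \<Rightarrow> 'e set \<Rightarrow> 'w set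
    \<Rightarrow> (('e \<Rightarrow> bool) \<times> ('w \<Rightarrow> bool)) pmf" where
  "rc_pmf q \<beta> h J ep F W = embed_pmf (\<lambda>\<omega>.
     if \<omega> \<in> rc_conf F W
     then rc_weight q \<beta> h J ep F W \<omega> / infsum (rc_weight q \<beta> h J ep F W) (rc_conf F W)
     else 0)"

section \<open>Free and wired measures on the infinite graph\<close>

text \<open>G_n: subgraph induced by V_n.\<close>
definition rc_free_fin :: "real \<Rightarrow> real \<Rightarrow> real \<Rightarrow> ('e \<Rightarrow> real) \<Rightarrow> ('e \<Rightarrow> 'v set) \<Rightarrow> 'v set
    \<Rightarrow> (('e \<Rightarrow> bool) \<times> ('v \<Rightarrow> bool)) pmf" where
  "rc_free_fin q \<beta> h J ep Vn = rc_pmf q \<beta> h J ep {e. ep e \<subseteq> Vn} Vn"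

text \<open>G_n^*: V \ V_n contracted to the single vertex None, self-loops deleted.  The state of the
  contracted vertex is marginalised out when viewing the measure on the configurations of G.\<close>
definition rc_wired_fin :: "real \<Rightarrow> real \<Rightarrow> real \<Rightarrow> ('e \<Rightarrow> real) \<Rightarrow> ('e \<Rightarrow> 'v set) \<Rightarrow> 'v set
    \<Rightarrow> (('e \<Rightarrow> bool) \<times> ('v \<Rightarrow> bool)) pmf" where
  "rc_wired_fin q \<beta> h J ep Vn = map_pmf (\<lambda>(\<omega>E, \<omega>W). (\<omega>E, \<lambda>v. \<omega>W (Some v)))
     (rc_pmf q \<beta> h J (\<lambda>e. (\<lambda>v. if v \<in> Vn then Some v else None) ` ep e)
        {e. ep e \<inter> Vn \<noteq> {}} (insert None (Some ` Vn)))"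

definition exhaustion :: "(nat \<Rightarrow> 'v set) \<Rightarrow> bool" where
  "exhaustion Vs \<longleftrightarrow> (\<forall>n. finite (Vs n) \<and> Vs n \<subseteq> Vs (Suc n)) \<and> (\<Union>n. Vs n) = UNIV"

text \<open>Weak convergence of probability measures on the configuration space
  {0,1}^E x {0,1}^V (product topology).\<close>
definition weak_limit :: "(nat \<Rightarrow> 'a::topological_space measure) \<Rightarrow> 'a measure \<Rightarrow> bool" where
  "weak_limit M \<mu> \<longleftrightarrow> prob_space \<mu> \<and> sets \<mu> = sets borel \<and>
     (\<forall>f :: 'a \<Rightarrow> real. continuous_on UNIV f \<and> bounded (range f) \<longrightarrow>
        (\<lambda>n. \<integral>\<omega>. f \<omega> \<partial>(M n)) \<longlonglongrightarrow> (\<integral>\<omega>. f \<omega> \<partial>\<mu>))"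

definition is_rc_free :: "real \<Rightarrow> real \<Rightarrow> real \<Rightarrow> ('e \<Rightarrow> real) \<Rightarrow> ('e \<Rightarrow> 'v set) \<Rightarrow> (nat \<Rightarrow> 'v set)
    \<Rightarrow> (('e \<Rightarrow> bool) \<times> ('v \<Rightarrow> bool)) measure \<Rightarrow> bool" where
  "is_rc_free q \<beta> h J ep Vs \<mu> \<longleftrightarrow>
     weak_limit (\<lambda>n. measure_pmf (rc_free_fin q \<beta> h J ep (Vs n))) \<mu>"

definition is_rc_wired :: "real \<Rightarrow> real \<Rightarrow> real \<Rightarrow> ('e \<Rightarrow> real) \<Rightarrow> ('e \<Rightarrow> 'v set) \<Rightarrow> (nat \<Rightarrow> 'v set)
    \<Rightarrow> (('e \<Rightarrow> bool) \<times> ('v \<Rightarrow> bool)) measure \<Rightarrow> bool" where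
  "is_rc_wired q \<beta> h J ep Vs \<mu> \<longleftrightarrow>
     weak_limit (\<lambda>n. measure_pmf (rc_wired_fin q \<beta> h J ep (Vs n))) \<mu>"

text \<open>The cluster K_o of o (ghost field not used).\<close>
definition cluster :: "('e \<Rightarrow> 'v set) \<Rightarrow> 'v \<Rightarrow> ('e \<Rightarrow> bool) \<times> ('v \<Rightarrow> bool) \<Rightarrow> 'v set" where
  "cluster ep r \<omega> = {v. (r, v) \<in> {(a, b). \<exists>e. fst \<omega> e \<and> ep e = {a, b}}\<^sup>*}"

end

theory Submission
 imports Defs
begin

text \<open>
  Cluster-size fluctuations drive the proof. Averaging over independent red and blue colours of
  the other clusters, the signed number of closed minus expected closed edges at the cluster of
  the root becomes a martingale increment under exploration, so an exponential moment of it is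
  at most one; this bounds its expectation, weighted by a truncated cluster size, by a multiple
  of the inverse square root of the size. Mass transport rewrites that expectation as a sum over
  the edges at the root and bounds from below the probability that the edge joins two distinct
  large clusters, one of them finite. Insertion tolerance extends the resulting estimate to
  distant pairs of vertices. Finally, nonamenability makes the random walk along edges of coupling
  at least \<open>\<epsilon>\<close> leave every finite cluster exponentially fast, so that if the cluster of the root is
  finite and large with probability \<open>p\<close>, then two walkers after \<open>log (1 / p)\<close> steps are in distinct
  such clusters with probability of order \<open>p^2\<close>; this forces a power law for \<open>p\<close>. For small
  \<open>\<beta>\<close> the cluster has bounded expected size. Edges have infinite degree in general, so limits from
  finite volumes use that only finitely many open paths of bounded length matter.
\<close>

section \<open>Clusters of finite edge configurations\<close>

text \<open>The obstacle is that the random cluster measure is not a product measure, so a cluster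
  cannot be explored through independent edges. Summing out the ghost leaves a factor
  \<open>1 + (q - 1) * ucl u C\<close> for each cluster \<open>C\<close>. Expanding the product is
  the colouring: the term 1 is red, the other term blue. Red clusters then have no interaction left,
  and given the blue vertices the red part is ordinary percolation. The truncated cluster size is
  \<open>gg\<close>, a difference of two powers \<open>a ^ card K - b ^ card K\<close>. Powers
  multiply when clusters merge, so the configurations with an edge closed and open cancel up to the
  explicit defect \<open>GG\<close>; with \<open>b = 1 - 1/N\<close> and \<open>a\<close> tending to
  1 this defect is bounded below when both clusters are large and one is finite. As long as
  \<open>a < 1\<close>, infinite clusters weigh nothing. Uniformity comes from bookkeeping: the
  field enters only through a number \<open>t\<close> in (0, 1], and the inverse temperature only
  through a lower bound \<open>b\<close>; values up to \<open>b\<close> are left to path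
  counting.\<close>

definition adj :: "('e => 'w set) => 'e set => ('w \<times> 'w) set" where
 "adj en A = {(a, b). \<exists>e\<in>A. en e = {a, b}}"

definition cl :: "('e => 'w set) => 'e set => 'w => 'w set" where
 "cl en A a = {b. (a, b) : (adj en A)\<^sup>*}"

text \<open>Singletons are allowed, since contracting vertices turns edges into loops.\<close>

definition edgy :: "('e => 'w set) => bool" where
 "edgy en \<longleftrightarrow> (\<forall>e. \<exists>a b. en e = {a, b})"

lemma sym_adj: "sym (adj en A)" by (auto simp: sym_def adj_def doubleton_eq_iff)

lemma cl_refl [simp]: "a : cl en A a" by (simp add: cl_def)

lemma cl_sym: "b : cl en A a ==> a : cl en A b" using sym_rtrancl[OF sym_adj, of en A] by (auto simp: cl_def sym_def)

lemma cl_eq: "b : cl en A a ==> cl en A b = cl en A a"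
proof -
 assume b: "b : cl en A a"
 then have "a : cl en A b" by (rule cl_sym)
 with b show ?thesis by (auto simp: cl_def)
qed

lemma cl_eq_iff: "cl en A a = cl en A b \<longleftrightarrow> b : cl en A a" by (metis cl_eq cl_refl)

lemma cl_disjoint: "cl en A a ~= cl en A b ==> cl en A a Int cl en A b = {}" by (metis cl_eq disjoint_iff)

lemma cl_mono: "A \<subseteq> B ==> cl en A a <= cl en B a" unfolding cl_def by (auto elim!: rtrancl_mono[THEN subsetD, rotated] simp: adj_def)

text \<open>Clusters are bounded from above by exhibiting a set that no edge of \<open>A\<close>
  leaves.\<close>

lemma cl_least:
 assumes "a : X" "!!e. e : A ==> en e Int X ~= {} ==> en e \<subseteq> X"
 shows "cl en A a \<subseteq> X"
proof
 fix b assume "b : cl en A a"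
 then have "(a, b) : (adj en A)\<^sup>*" by (simp add: cl_def)
 then show "b : X"
 proof induction
  case base then show ?case by fact
 next
  case (step y z)
  then obtain e where "e : A" "en e = {y, z}" by (auto simp: adj_def)
  with assms(2)[of e] step show ?case by auto
 qed
qed

lemma cl_edge:
 assumes "edgy en" "e : A" "b : en e" "b : cl en A a"
 shows "en e <= cl en A a"
proof -
 obtain x y where xy: "en e = {x, y}" using assms(1) unfolding edgy_def by blast
 then have "(x, y) : adj en A" "(y, x) : adj en A" using assms(2) by (auto simp: adj_def doubleton_eq_iff)
 then have *: "x : cl en A y" "y : cl en A x" by (auto simp: cl_def)
 have "cl en A b = cl en A a" by (rule cl_eq) fact
 moreover have "en e <= cl en A b" using assms(3) xy * by auto
 ultimately show ?thesis by simp
qed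

lemma cl_insert:
 assumes en: "edgy en" and e: "en e = {a, b}"
 shows "cl en (insert e A) x =
  (if x : cl en A a Un cl en A b then cl en A a Un cl en A b else cl en A x)"
proof (cases "x : cl en A a Un cl en A b")
 case True
 have ab: "a : cl en (insert e A) b" "b : cl en (insert e A) a" using e by (auto simp: cl_def adj_def intro!: r_into_rtrancl)
 have sub: "cl en A c <= cl en (insert e A) c" for c by (rule cl_mono) auto
 have cb: "cl en (insert e A) b = cl en (insert e A) a" by (rule cl_eq) (rule ab)
 have ss: "cl en A a Un cl en A b <= cl en (insert e A) a" using sub[of a] sub[of b] cb by blast
 have "cl en (insert e A) x = cl en (insert e A) a" by (rule cl_eq) (use True ss in blast)
 moreover note ss
 moreover have "cl en (insert e A) a <= cl en A a Un cl en A b"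
 proof (rule cl_least)
  fix f assume f: "f : insert e A" "en f Int (cl en A a Un cl en A b) ~= {}"
  show "en f <= cl en A a Un cl en A b"
  proof (cases "f = e")
   case True then show ?thesis using e by auto
  next
   case False
   with f obtain c where "f : A" "c : en f" "c : cl en A a | c : cl en A b" by auto
   then show ?thesis using cl_edge[OF en, of f A c a] cl_edge[OF en, of f A c b] by auto
  qed
 qed simp
 ultimately have "cl en (insert e A) x = cl en A a Un cl en A b" by blast
 then show ?thesis using True by simp
next
 case False
 have "cl en (insert e A) x <= cl en A x"
 proof (rule cl_least)
  fix f assume f: "f : insert e A" "en f Int cl en A x ~= {}"
  have "f ~= e"
  proof
   assume "f = e"
   then have "a : cl en A x | b : cl en A x" using f e by auto
   then show False using False cl_sym[of a en A x] cl_sym[of b en A x] by auto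
  qed
  then show "en f <= cl en A x" using f cl_edge[OF en, of f A] by blast
 qed simp
 moreover have "cl en A x <= cl en (insert e A) x" by (rule cl_mono) auto
 ultimately show ?thesis using False by auto
qed

lemma cl_subset:
 assumes "a : W" "!!e. e : A ==> en e \<subseteq> W"
 shows "cl en A a \<subseteq> W" using assms by (intro cl_least) auto

lemma cl_cong: "(!!e. e : A ==> en e = en' e) ==> cl en A a = cl en' A a"
proof -
 assume "!!e. e : A ==> en e = en' e"
 then have "adj en A = adj en' A" by (auto simp: adj_def)
 then show ?thesis by (simp add: cl_def)
qed

lemma cl_image:
 assumes "edgy en" "!!e. e : A ==> en' (ta e) = ph ` en e"
 shows "ph ` cl en A a <= cl en' (ta ` A) (ph a)"
proof safe
 fix b assume "b : cl en A a"
 then have "(a, b) : (adj en A)\<^sup>*" by (simp add: cl_def)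
 then have "(ph a, ph b) : (adj en' (ta ` A))\<^sup>*"
 proof induction
  case base then show ?case by simp
 next
  case (step y z)
  then obtain e where "e : A" "en e = {y, z}" by (auto simp: adj_def)
  then have "en' (ta e) = {ph y, ph z}" using assms(2) by auto
  then have "(ph y, ph z) : adj en' (ta ` A)" using \<open>e : A\<close> by (auto simp: adj_def)
  then show ?case using step by simp
 qed
 then show "ph b : cl en' (ta ` A) (ph a)" by (simp add: cl_def)
qed

lemma cl_image_inj:
 assumes "edgy en" "inj ph" "!!e. e : A ==> en' (ta e) = ph ` en e"
 shows "cl en' (ta ` A) (ph a) = ph ` cl en A a"
proof
 show "cl en' (ta ` A) (ph a) \<subseteq> ph ` cl en A a"
 proof (rule cl_least)
  fix f assume f: "f : ta ` A" "en' f Int ph ` cl en A a ~= {}"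
  then obtain e where e: "e : A" "f = ta e" by auto
  have "en e Int cl en A a ~= {}" using f(2) e assms(2) assms(3)[OF e(1)] by (auto dest: injD)
  then have "en e <= cl en A a" using cl_edge[OF assms(1) e(1)] by blast
  then show "en' f \<subseteq> ph ` cl en A a" using assms(3)[OF e(1)] e by auto
 qed simp
next
 show "ph ` cl en A a <= cl en' (ta ` A) (ph a)" by (rule cl_image) (use assms in auto)
qed

lemma edgy_image: "edgy en ==> edgy (%e. ph ` en e)" unfolding edgy_def by (metis image_insert image_empty)

section \<open>The random cluster weight with the ghost states summed out\<close>

text \<open>For \<open>u v = 1 / (1 + s)\<close> this is the probability that no vertex of
  \<open>C\<close> is tied to the ghost when each is so independently with odds \<open>s\<close>.
  The values may depend on the vertex because the contracted outer vertex will later be given the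
  value 0.\<close>

definition ucl :: "('w => real) => 'w set => real" where
 "ucl u C = (\<Prod>v\<in>C. u v)"

text \<open>\<open>Q\<close> stands for \<open>q - 1\<close>. The ghost states of one cluster sum to
  \<open>(1 + s) ^ card C - 1 + q\<close>, which is \<open>(1 + s) ^ card C\<close> times the factor
  used here.\<close>

definition kap :: "('e => 'w set) => 'w set => real => ('w => real) => 'e set => real" where
 "kap en W Q u A = (\<Prod>C\<in>cl en A ` W. 1 + Q * ucl u C)"

text \<open>The factor by which opening \<open>e\<close> multiplies \<open>kap\<close>. Both
  products run over the set of clusters that meet \<open>e\<close>, so they have a single factor,
  and the ratio is 1, when the endpoints are already joined.\<close>

definition rat :: "('e => 'w set) => real => ('w => real) => 'e set => 'e => real" where
 "rat en Q u A e = (1 + Q * (\<Prod>C\<in>cl en A ` en e. ucl u C)) / (\<Prod>C\<in>cl en A ` en e. 1 + Q * ucl u C)"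

locale fk_model =
 fixes en :: "'e => 'w set" and W :: "'w set" and Q :: real and u :: "'w => real"
 assumes edgy: "edgy en" and fin_W: "finite W" and Q: "Q \<ge> 0"
  and u: "!!v. 0 <= u v & u v <= 1"
begin

lemma ucl_bounds: "0 <= ucl u C" "ucl u C <= 1" unfolding ucl_def by (auto intro!: prod_nonneg prod_le_1 simp: u)

lemma one_le: "1 <= 1 + Q * ucl u C" "1 + Q * ucl u C <= 1 + Q" using ucl_bounds[of C] Q by (auto simp: mult_left_le)

lemma kap_ge_1: "kap en W Q u A \<ge> 1" unfolding kap_def by (rule prod_ge_1) (rule one_le)

lemma kap_pos: "kap en W Q u A > 0" using kap_ge_1[of A] by linarith

lemma rat_same:
 assumes "en e = {a, b}" "cl en A a = cl en A b"
 shows "rat en Q u A e = 1" using assms one_le(1)[of "cl en A b"] by (simp add: rat_def)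

lemma rat_diff:
 assumes "en e = {a, b}" "cl en A a ~= cl en A b"
 shows "rat en Q u A e = (1 + Q * (ucl u (cl en A a) * ucl u (cl en A b))) /
  ((1 + Q * ucl u (cl en A a)) * (1 + Q * ucl u (cl en A b)))" using assms by (simp add: rat_def)

lemma rat_le_1: "rat en Q u A e <= 1"
proof -
 obtain a b where ab: "en e = {a, b}" using edgy unfolding edgy_def by blast
 show ?thesis
 proof (cases "cl en A a = cl en A b")
  case True then show ?thesis using rat_same ab by simp
 next
  case False
  let ?x = "ucl u (cl en A a)" and ?y = "ucl u (cl en A b)"
  have "Q * (?x * ?y) <= Q * ?x" "0 <= Q * ?y" "0 <= Q * ?x * (Q * ?y)"
   using ucl_bounds[of "cl en A a"] ucl_bounds[of "cl en A b"] Q by (auto simp: mult_left_le mult_left_mono)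
  then have "1 + Q * (?x * ?y) <= (1 + Q * ?x) * (1 + Q * ?y)" unfolding distrib_left distrib_right by simp
  then show ?thesis using rat_diff[OF ab False] one_le(1)[of "cl en A a"] one_le(1)[of "cl en A b"] by (simp add: divide_le_eq_1)
 qed
qed

text \<open>The extreme case is that of two clusters of value 1, where merging replaces
  \<open>(1 + Q)\<close> squared by \<open>1 + Q\<close>. The general case is
  \<open>Q * (1 - x) * (1 - y) >= 0\<close>.\<close>

lemma rat_ge: "rat en Q u A e \<ge> 1 / (1 + Q)"
proof -
 obtain a b where ab: "en e = {a, b}" using edgy unfolding edgy_def by blast
 show ?thesis
 proof (cases "cl en A a = cl en A b")
  case True then show ?thesis using rat_same[OF ab True] Q by simp
 next
  case False
  let ?x = "ucl u (cl en A a)" and ?y = "ucl u (cl en A b)"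
  have xy: "0 <= ?x" "?x <= 1" "0 <= ?y" "?y <= 1" using ucl_bounds by auto
  have "0 <= Q * ((1 - ?x) * (1 - ?y))" using xy Q by simp
  then have "(1 + Q * ?x) * (1 + Q * ?y) <= (1 + Q) * (1 + Q * (?x * ?y))" by (simp add: algebra_simps)
  moreover have "0 < (1 + Q * ?x) * (1 + Q * ?y)" using one_le(1)[of "cl en A a"] one_le(1)[of "cl en A b"] by (intro mult_pos_pos) linarith+
  ultimately show ?thesis unfolding rat_diff[OF ab False] using Q by (simp add: divide_le_eq le_divide_eq mult.commute)
 qed
qed

lemma rat_pos: "rat en Q u A e > 0" using rat_ge[of A e] Q divide_pos_pos[of 1 "1 + Q"] by linarith

lemma ucl_Un:
 assumes "finite C" "finite D" "C Int D = {}"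
 shows "ucl u (C Un D) = ucl u C * ucl u D" unfolding ucl_def using assms by (rule prod.union_disjoint)

lemma finite_cl: "a : W ==> (!!e. e : A ==> en e \<subseteq> W) ==> finite (cl en A a)" using cl_subset[of a W A en] fin_W finite_subset[of _ W] by blast

lemma kap_insert:
 assumes A: "!!f. f : A ==> en f \<subseteq> W" and e: "en e \<subseteq> W"
 shows "kap en W Q u (insert e A) = kap en W Q u A * rat en Q u A e"
proof -
 obtain a b where ab: "en e = {a, b}" using edgy unfolding edgy_def by blast
 have abW: "a : W" "b : W" using e ab by auto
 let ?Ca = "cl en A a" and ?Cb = "cl en A b"
 have cli: "cl en (insert e A) x = (if x : ?Ca Un ?Cb then ?Ca Un ?Cb else cl en A x)" for x by (rule cl_insert[OF edgy ab])
 show ?thesis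
 proof (cases "?Ca = ?Cb")
  case True
  have "cl en (insert e A) x = cl en A x" for x using cli[of x] True cl_eq[of x en A b] by auto
  then show ?thesis using rat_same[OF ab True] by (simp add: kap_def)
 next
  case False
  let ?R = "cl en A ` W - {?Ca, ?Cb}"
  have fin: "finite ?Ca" "finite ?Cb" using finite_cl abW A by auto
  have notin: "?Ca Un ?Cb ~: ?R"
  proof
   assume "?Ca Un ?Cb : ?R"
   then obtain c where "?Ca Un ?Cb = cl en A c" by auto
   then show False using False by (metis UnCI cl_eq cl_refl)
  qed
  have im: "cl en (insert e A) ` W = insert (?Ca Un ?Cb) ?R"
  proof (intro equalityI subsetI)
   fix C assume "C : cl en (insert e A) ` W"
   then obtain x where x: "x : W" "C = cl en (insert e A) x" by auto
   show "C : insert (?Ca Un ?Cb) ?R" using x cli[of x] cl_refl[of x en A] by (cases "x : ?Ca Un ?Cb") auto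
  next
   fix C assume "C : insert (?Ca Un ?Cb) ?R"
   then consider "C = ?Ca Un ?Cb" | x where "x : W" "C = cl en A x" "C ~= ?Ca" "C ~= ?Cb" by auto
   then show "C : cl en (insert e A) ` W"
   proof cases
   case 1 then show ?thesis using abW(1) cli[of a] by auto
   next
   case 2
   then have "x ~: ?Ca Un ?Cb" using cl_eq by (metis UnE)
   then show ?thesis using 2 cli[of x] by auto
   qed
  qed
  have im2: "cl en A ` W = insert ?Ca (insert ?Cb ?R)" using abW by auto
  have fR: "finite ?R" using fin_W by auto
  have "kap en W Q u (insert e A) = (1 + Q * ucl u (?Ca Un ?Cb)) * (\<Prod>C\<in>?R. 1 + Q * ucl u C)" unfolding kap_def im using notin fR by simp
  moreover have "kap en W Q u A = (1 + Q * ucl u ?Ca) * ((1 + Q * ucl u ?Cb) * (\<Prod>C\<in>?R. 1 + Q * ucl u C))"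
   unfolding kap_def by (subst im2) (use False fR in simp)
  moreover have "ucl u (?Ca Un ?Cb) = ucl u ?Ca * ucl u ?Cb" using ucl_Un fin cl_disjoint[OF False] by blast
  moreover have "1 + Q * ucl u ?Ca ~= 0" "1 + Q * ucl u ?Cb ~= 0" using one_le(1)[of ?Ca] one_le(1)[of ?Cb] by linarith+
  ultimately show ?thesis unfolding rat_diff[OF ab False] by simp
 qed
qed

end

section \<open>The four functions theorem and stochastic comparison\<close>

text \<open>One-element case of the four functions theorem. With \<open>P = c1 * d0\<close>, the
  mixed products \<open>X\<close> and \<open>Y\<close> are at most \<open>P\<close>, and
  \<open>X * Y\<close> is at most \<open>P * (c0 * d1)\<close>; expanding
  \<open>(P - X) * (P - Y) >= 0\<close> then bounds \<open>X + Y\<close>.\<close>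

lemma four_numbers:
 fixes a0 a1 b0 b1 c0 c1 d0 d1 :: real
 assumes nn: "0 <= a0" "0 <= a1" "0 <= b0" "0 <= b1" "0 <= c0" "0 <= c1" "0 <= d0" "0 <= d1"
  and h: "a0 * b0 <= c0 * d0" "a1 * b0 <= c1 * d0" "a0 * b1 <= c1 * d0" "a1 * b1 <= c1 * d1"
 shows "(a0 + a1) * (b0 + b1) <= (c0 + c1) * (d0 + d1)"
proof (cases "c1 * d0 = 0")
 case True
 then have "a1 * b0 = 0" "a0 * b1 = 0" using h nn mult_nonneg_nonneg[of a1 b0] mult_nonneg_nonneg[of a0 b1] by linarith+
 moreover have "0 <= c0 * d1" using nn by simp
 moreover have "(a0 + a1) * (b0 + b1) = a0 * b0 + a1 * b0 + a0 * b1 + a1 * b1"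
  "(c0 + c1) * (d0 + d1) = c0 * d0 + c1 * d0 + c0 * d1 + c1 * d1" by (simp_all add: algebra_simps)
 ultimately show ?thesis using h True by linarith
next
 case False
 let ?P = "c1 * d0" and ?X = "a1 * b0" and ?Y = "a0 * b1"
 have P: "?P > 0" using False nn using mult_nonneg_nonneg[of c1 d0] by linarith
 have X: "0 <= ?X" "?X <= ?P" "0 <= ?Y" "?Y <= ?P" using h nn by auto
 have "?X * ?Y = (a0 * b0) * (a1 * b1)" by (simp add: algebra_simps)
 also have "... <= (c0 * d0) * (c1 * d1)" using mult_mono[OF h(1) h(4)] nn by simp
 also have "... = ?P * (c0 * d1)" by (simp add: algebra_simps)
 finally have XY: "?X * ?Y <= ?P * (c0 * d1)" .
 have "0 <= (?P - ?X) * (?P - ?Y)" using X by simp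
 then have "?P * (?X + ?Y) <= ?P * ?P + ?X * ?Y" by (simp add: algebra_simps)
 also have "... <= ?P * (?P + c0 * d1)" using XY by (simp add: algebra_simps)
 finally have "?X + ?Y <= ?P + c0 * d1" using mult_le_cancel_left_pos[OF P] by blast
 then show ?thesis using h by (simp add: algebra_simps)
qed

lemma sum_Pow_insert:
 assumes "finite F" "e ~: F"
 shows "(\<Sum>A\<in>Pow (insert e F). f A) = (\<Sum>A\<in>Pow F. f A + f (insert e A))"
proof -
 have "(\<Sum>A\<in>Pow (insert e F). f A) = (\<Sum>A\<in>Pow F. f A) + (\<Sum>A\<in>insert e ` Pow F. f A)"
  unfolding Pow_insert using assms by (intro sum.union_disjoint) auto
 also have "(\<Sum>A\<in>insert e ` Pow F. f A) = (\<Sum>A\<in>Pow F. f (insert e A))"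
  by (rule sum.reindex_cong[of "insert e"]) (use assms in \<open>auto simp: inj_on_def\<close>)
 finally show ?thesis by (simp add: sum.distrib)
qed

text \<open>The Ahlswede-Daykin inequality. Summing out one element of the ground set preserves the
  hypothesis, by \<open>four_numbers\<close>.\<close>

theorem four_functions:
 fixes al bt \<gamma> dl :: "'e set => real"
 assumes "finite F"
  and "!!A. A \<subseteq> F ==> 0 <= al A" "!!A. A \<subseteq> F ==> 0 <= bt A"
  and "!!A. A \<subseteq> F ==> 0 <= \<gamma> A" "!!A. A \<subseteq> F ==> 0 <= dl A"
  and "!!A B. A \<subseteq> F ==> B \<subseteq> F ==> al A * bt B <= \<gamma> (A Un B) * dl (A Int B)"
 shows "sum al (Pow F) * sum bt (Pow F) <= sum \<gamma> (Pow F) * sum dl (Pow F)" using assms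
proof (induction F arbitrary: al bt \<gamma> dl rule: finite_induct)
 case empty
 from empty(5)[of "{}" "{}"] show ?case by simp
next
 case (insert e F)
 have nn: "0 <= al A" "0 <= al (insert e A)" "0 <= bt A" "0 <= bt (insert e A)"
  "0 <= \<gamma> A" "0 <= \<gamma> (insert e A)" "0 <= dl A" "0 <= dl (insert e A)" if "A \<subseteq> F" for A
  using that insert.prems(1-4)[of A] insert.prems(1-4)[of "insert e A"] by auto
 have main: "(al A + al (insert e A)) * (bt B + bt (insert e B)) \<le>
   (\<gamma> (A Un B) + \<gamma> (insert e (A Un B))) * (dl (A Int B) + dl (insert e (A Int B)))"
  if AB: "A \<subseteq> F" "B \<subseteq> F" for A B
 proof (rule four_numbers)
  have e: "e ~: A" "e ~: B" using AB insert.hyps by auto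
  have U: "A Un B \<subseteq> F" "A Int B \<subseteq> F" using AB by auto
  show "0 <= al A" "0 <= al (insert e A)" "0 <= bt B" "0 <= bt (insert e B)" using nn AB by auto
  show "0 <= \<gamma> (A Un B)" "0 <= \<gamma> (insert e (A Un B))" "0 <= dl (A Int B)" "0 <= dl (insert e (A Int B))" using nn U by auto
  have eqs: "insert e A Int B = A Int B" "A Int insert e B = A Int B" "insert e A Un B = insert e (A Un B)"
   "A Un insert e B = insert e (A Un B)" "insert e A Un insert e B = insert e (A Un B)"
   "insert e A Int insert e B = insert e (A Int B)" using e by auto
  note P = insert.prems(5)
  show "al A * bt B <= \<gamma> (A Un B) * dl (A Int B)" using P[of A B] AB by auto
  show "al (insert e A) * bt B <= \<gamma> (insert e (A Un B)) * dl (A Int B)" using P[of "insert e A" B] AB eqs by auto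
  show "al A * bt (insert e B) <= \<gamma> (insert e (A Un B)) * dl (A Int B)" using P[of A "insert e B"] AB eqs by auto
  show "al (insert e A) * bt (insert e B) <= \<gamma> (insert e (A Un B)) * dl (insert e (A Int B))"
   proof -
   have i: "insert e A \<subseteq> insert e F" "insert e B \<subseteq> insert e F" using AB by auto
   show ?thesis using P[OF i] unfolding eqs .
  qed
 qed
 show ?case unfolding sum_Pow_insert[OF insert.hyps]
 proof (rule insert.IH)
  fix A assume A: "A \<subseteq> F"
  note n = nn[OF A]
  show "0 <= al A + al (insert e A)" "0 <= bt A + bt (insert e A)"
   "0 <= \<gamma> A + \<gamma> (insert e A)" "0 <= dl A + dl (insert e A)" using n by auto
 qed (rule main)
qed

text \<open>The four functions are \<open>ph * f\<close>, \<open>g\<close>, \<open>ph * g\<close>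
  and \<open>f\<close>. After normalisation \<open>g\<close> stochastically dominates
  \<open>f\<close>.\<close>

lemma holley:
 fixes f g ph :: "'e set => real"
 assumes F: "finite F"
  and nn: "!!A. A \<subseteq> F ==> 0 <= f A" "!!A. A \<subseteq> F ==> 0 <= g A" "!!A. A \<subseteq> F ==> 0 <= ph A"
  and fg: "!!A B. A \<subseteq> F ==> B \<subseteq> F ==> f A * g B <= g (A Un B) * f (A Int B)"
  and mono: "!!A B. A \<subseteq> B ==> B \<subseteq> F ==> ph A <= ph B"
 shows "(\<Sum>A\<in>Pow F. ph A * f A) * sum g (Pow F) <= (\<Sum>A\<in>Pow F. ph A * g A) * sum f (Pow F)"
proof (rule four_functions[OF F])
 fix A B assume AB: "A \<subseteq> F" "B \<subseteq> F"
 have "ph A * f A * g B = ph A * (f A * g B)" by simp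
 also have "... <= ph (A Un B) * (g (A Un B) * f (A Int B))" using AB by (intro mult_mono mono fg nn mult_nonneg_nonneg) auto
 finally show "ph A * f A * g B <= ph (A Un B) * g (A Un B) * f (A Int B)" by (simp add: mult.assoc)
qed (use nn in auto)

text \<open>Passing from \<open>A Int B\<close> to \<open>A\<close> and from \<open>B\<close> to
  \<open>A Un B\<close> adds the same edges, and each added edge multiplies \<open>k1\<close> by no
  more than it multiplies \<open>k2\<close>. Every stochastic comparison below is reduced in this
  way to ratios for one edge.\<close>

lemma lattice_from_ratio:
 fixes k1 k2 :: "'e set => real"
 assumes F: "finite F" and AB: "A \<subseteq> F" "B \<subseteq> F"
  and pos: "!!A. A \<subseteq> F ==> 0 <= k1 A" "!!A. A \<subseteq> F ==> 0 <= k2 A"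
  and k1: "!!S e. S \<subseteq> F ==> e : F ==> k1 (insert e S) = k1 S * r1 S e"
  and k2: "!!S e. S \<subseteq> F ==> e : F ==> k2 (insert e S) = k2 S * r2 S e"
  and r0: "!!S e. S \<subseteq> F ==> e : F ==> 0 <= r1 S e"
  and r: "!!S T e. S \<subseteq> T ==> T \<subseteq> F ==> e : F ==> r1 S e <= r2 T e"
 shows "k1 A * k2 B <= k2 (A Un B) * k1 (A Int B)"
proof -
 have "k1 (D Un S) * k2 T <= k2 (D Un T) * k1 S"
  if "finite D" "D \<subseteq> F" "S \<subseteq> T" "T \<subseteq> F" for D S T using that
 proof (induction D rule: finite_induct)
  case empty then show ?case by simp
 next
  case (insert e D)
  have IH: "k1 (D Un S) * k2 T <= k2 (D Un T) * k1 S" using insert by auto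
  have e: "e : F" "D Un S \<subseteq> F" "D Un T \<subseteq> F" "S \<subseteq> F" using insert by auto
  have r': "0 <= r1 (D Un S) e" "r1 (D Un S) e <= r2 (D Un T) e" using r0 r e insert.prems by (auto intro!: r)
  have "k1 (insert e D Un S) * k2 T = (k1 (D Un S) * k2 T) * r1 (D Un S) e" using k1[OF e(2,1)] by simp
  also have "... <= (k2 (D Un T) * k1 S) * r2 (D Un T) e" using mult_mono[OF IH r'(2)] pos e r' by auto
  also have "... = k2 (insert e D Un T) * k1 S" using k2[OF e(3,1)] by simp
  finally show ?case .
 qed
 moreover have "finite (A - B)" using AB F finite_subset by blast
 moreover have "A - B Un A Int B = A" "A - B Un B = A Un B" by auto
 ultimately show ?thesis using AB by (metis Diff_subset Int_lower2 subset_trans)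
qed

lemma sum_Pow_prod:
 fixes a b :: "'e => real"
 assumes "finite F"
 shows "(\<Sum>A\<in>Pow F. \<Prod>e\<in>F. if e : A then a e else b e) = (\<Prod>e\<in>F. a e + b e)" using assms
proof (induction F rule: finite_induct)
 case empty then show ?case by simp
next
 case (insert e F)
 have "(\<Sum>A\<in>Pow (insert e F). \<Prod>f\<in>insert e F. if f : A then a f else b f) =
  (\<Sum>A\<in>Pow F. (a e + b e) * (\<Prod>f\<in>F. if f : A then a f else b f))" unfolding sum_Pow_insert[OF insert.hyps]
 proof (rule sum.cong)
  fix A assume "A : Pow F"
  then have "e ~: A" using insert.hyps by auto
  moreover have "(\<Prod>f\<in>F. if f : insert e A then a f else b f) = (\<Prod>f\<in>F. if f : A then a f else b f)" using insert.hyps by (intro prod.cong) auto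
  ultimately show "(\<Prod>f\<in>insert e F. if f : A then a f else b f) +
   (\<Prod>f\<in>insert e F. if f : insert e A then a f else b f) =
   (a e + b e) * (\<Prod>f\<in>F. if f : A then a f else b f)" using insert.hyps by (simp add: distrib_right)
 qed simp
 also have "... = (\<Prod>f\<in>insert e F. a f + b f)" using insert by (simp add: sum_distrib_left[symmetric])
 finally show ?case .
qed

lemma prod_subset_if:
 fixes a :: "'e => real"
 assumes "finite F" "A \<subseteq> F"
 shows "(\<Prod>e\<in>A. a e) = (\<Prod>e\<in>F. if e : A then a e else 1)" using assms by (simp add: prod.If_cases Int_absorb1)

lemma sum_Pow_prod1:
 fixes a :: "'e => real"
 assumes "finite F"
 shows "(\<Sum>A\<in>Pow F. \<Prod>e\<in>A. a e) = (\<Prod>e\<in>F. 1 + a e)"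
proof -
 have "(\<Sum>A\<in>Pow F. \<Prod>e\<in>A. a e) = (\<Sum>A\<in>Pow F. \<Prod>e\<in>F. if e : A then a e else 1)" by (intro sum.cong refl prod_subset_if[OF assms]) auto
 then show ?thesis using sum_Pow_prod[OF assms, of a "%_. 1"] by (simp add: add.commute)
qed

lemma sum_Pow_Un:
 assumes "finite F1" "finite F2" "F1 Int F2 = {}"
 shows "(\<Sum>A\<in>Pow (F1 Un F2). f A) = (\<Sum>A2\<in>Pow F2. \<Sum>A1\<in>Pow F1. f (A1 Un A2))"
proof -
 have "(\<Sum>A2\<in>Pow F2. \<Sum>A1\<in>Pow F1. f (A1 Un A2)) = (\<Sum>(A2, A1)\<in>Pow F2 \<times> Pow F1. f (A1 Un A2))" by (rule sum.cartesian_product)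
 also have "... = (\<Sum>A\<in>Pow (F1 Un F2). f A)" by (rule sum.reindex_bij_witness[of _ "%A. (A Int F2, A Int F1)" "%(A2, A1). A1 Un A2"])
   (use assms in \<open>auto simp: Int_Un_distrib2 Int_absorb2 intro!: arg_cong[of _ _ f]\<close>)
 finally show ?thesis by simp
qed

lemma exp_quadratic_bound:
 fixes z :: real
 assumes "\<bar>z\<bar> <= 1"
 shows "exp z <= 1 + z + z\<^sup>2"
proof (cases "z \<ge> 0")
 case True then show ?thesis using exp_bound[of z] assms by auto
next
 case False
 define y where "y = - z"
 have y: "0 <= y" "y <= 1" "z = - y" using False assms by (auto simp: y_def)
 have "1 <= (1 + y) * (1 - y + y\<^sup>2)" using y by (simp add: algebra_simps power2_eq_square)
 also have "... <= exp y * (1 - y + y\<^sup>2)" using y exp_ge_add_one_self[of y] by (intro mult_right_mono) auto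
 finally have "exp (-y) * 1 <= exp (-y) * (exp y * (1 - y + y\<^sup>2))" by (intro mult_left_mono) auto
 then show ?thesis using y by (simp add: exp_minus field_simps)
qed

section \<open>Expectations in a finite model and their comparison with product measures\<close>

definition wt :: "('e => 'w set) => 'w set => real => ('w => real) => ('e => real) => 'e set => real" where
 "wt en W Q u x A = (\<Prod>e\<in>A. x e) * kap en W Q u A"

definition EE :: "('e => 'w set) => 'w set => real => ('w => real) => ('e => real) => 'e set
  => ('e set => real) => real" where
 "EE en W Q u x F f = (\<Sum>A\<in>Pow F. f A * wt en W Q u x A) / (\<Sum>A\<in>Pow F. wt en W Q u x A)"

locale fk_finite = fk_model en W Q u for en :: "'e => 'w set" and W Q u +
 fixes x :: "'e => real" and F :: "'e set"
 assumes x: "!!e. x e \<ge> 0" and finF: "finite F" and FW: "!!e. e : F ==> en e \<subseteq> W"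
begin

abbreviation "w \<equiv> wt en W Q u x"
abbreviation "E \<equiv> EE en W Q u x F"

lemma wt_nonneg: "0 <= w A" unfolding wt_def using kap_pos[of A] by (auto intro!: mult_nonneg_nonneg prod_nonneg x)

lemma wt_sum_pos: "0 < (\<Sum>A\<in>Pow F. w A)"
proof -
 have "w {} <= (\<Sum>A\<in>Pow F. w A)" by (rule member_le_sum) (use finF wt_nonneg in auto)
 moreover have "w {} > 0" using kap_pos[of "{}"] by (simp add: wt_def)
 ultimately show ?thesis by linarith
qed

lemma wt_insert:
 assumes "A \<subseteq> F" "e : F" "e ~: A"
 shows "w (insert e A) = w A * (x e * rat en Q u A e)"
proof -
 have "finite A" using assms finF finite_subset by blast
 then show ?thesis unfolding wt_def using assms kap_insert[of A e] FW by auto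
qed

lemma EE_mono: "(!!A. A \<subseteq> F ==> f A <= g A) ==> E f <= E g" unfolding EE_def using wt_sum_pos wt_nonneg
 by (intro divide_right_mono sum_mono mult_right_mono) auto

lemma EE_add: "E (%A. f A + g A) = E f + E g" unfolding EE_def by (simp add: distrib_right sum.distrib add_divide_distrib)

lemma EE_cmult: "E (%A. c * f A) = c * E f" unfolding EE_def by (simp add: sum_distrib_left mult.assoc)

lemma EE_const: "E (%A. c) = c" unfolding EE_def using wt_sum_pos by (simp add: sum_distrib_left[symmetric])

lemma EE_diff: "E (%A. f A - g A) = E f - E g" unfolding EE_def by (simp add: left_diff_distrib sum_subtractf diff_divide_distrib)

lemma EE_nonneg: "(!!A. A \<subseteq> F ==> 0 <= f A) ==> 0 <= E f" using EE_mono[of "%_. 0" f] EE_const[of 0] by simp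

lemma EE_abs_diff:
 assumes "!!A. A \<subseteq> F ==> \<bar>f A - g A\<bar> <= h A"
 shows "\<bar>E f - E g\<bar> <= E h"
proof -
 have "f A - g A <= h A" "g A - f A <= h A" if "A \<subseteq> F" for A using assms[OF that] by (auto simp: abs_le_iff)
 from EE_mono[of "%A. f A - g A" h, OF this(1)] EE_mono[of "%A. g A - f A" h, OF this(2)]
 show ?thesis unfolding EE_diff by (simp add: abs_le_iff)
qed

text \<open>The model is dominated by independent edges of odds \<open>x\<close>, because opening an
  edge never multiplies \<open>kap\<close> by more than 1.\<close>

lemma EE_dominated:
 assumes "P \<subseteq> F"
 shows "E (%A. of_bool (P \<subseteq> A)) <= (\<Prod>e\<in>P. x e / (1 + x e))"
proof -
 let ?g = "%A. \<Prod>e\<in>A. x e"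
 have "(\<Sum>A\<in>Pow F. of_bool (P \<subseteq> A) * w A) * sum ?g (Pow F) \<le>
   (\<Sum>A\<in>Pow F. of_bool (P \<subseteq> A) * ?g A) * (\<Sum>A\<in>Pow F. w A)"
 proof (rule holley[OF finF])
  fix A B assume AB: "A \<subseteq> F" "B \<subseteq> F"
  have fin: "finite A" "finite B" using AB finF finite_subset by blast+
  have "kap en W Q u A * 1 <= 1 * kap en W Q u (A Int B)"
  proof (rule lattice_from_ratio[OF finF AB, where ?r1.0 = "rat en Q u" and ?r2.0 = "%_ _. 1"
   and ?k1.0 = "kap en W Q u" and ?k2.0 = "%_. 1"])
   show "kap en W Q u (insert e S) = kap en W Q u S * rat en Q u S e" if "S \<subseteq> F" "e : F" for S e by (rule kap_insert) (use that FW in auto)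
  qed (use kap_pos rat_pos rat_le_1 in \<open>auto intro: less_imp_le\<close>)
  then have "?g A * ?g B * kap en W Q u A <= ?g A * ?g B * kap en W Q u (A Int B)" by (intro mult_left_mono mult_nonneg_nonneg prod_nonneg) (auto simp: x)
  moreover have "?g A * ?g B = ?g (A Un B) * ?g (A Int B)" using prod.union_inter[OF fin, of x] by simp
  ultimately have "?g A * ?g B * kap en W Q u A <= ?g (A Un B) * ?g (A Int B) * kap en W Q u (A Int B)" by simp
  moreover have "w A * ?g B = ?g A * ?g B * kap en W Q u A"
   "?g (A Un B) * w (A Int B) = ?g (A Un B) * ?g (A Int B) * kap en W Q u (A Int B)" unfolding wt_def by (simp_all only: mult_ac)
  ultimately show "w A * ?g B <= ?g (A Un B) * w (A Int B)" by (simp only:)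
 qed (auto simp: wt_nonneg prod_nonneg x)
 moreover have "(\<Sum>A\<in>Pow F. of_bool (P \<subseteq> A) * ?g A) =
  (\<Sum>A\<in>Pow F. \<Prod>e\<in>F. if e : A then x e else (if e : P then 0 else 1))"
 proof (rule sum.cong)
  fix A assume A: "A : Pow F"
  show "of_bool (P \<subseteq> A) * ?g A = (\<Prod>e\<in>F. if e : A then x e else (if e : P then 0 else 1))"
  proof (cases "P \<subseteq> A")
   case True
   then have "(\<Prod>e\<in>F. if e : A then x e else (if e : P then 0 else 1)) = (\<Prod>e\<in>F. if e : A then x e else 1)" by (intro prod.cong) auto
   then show ?thesis using True A prod_subset_if[OF finF, of A x] by auto
  next
   case False
   then obtain e where "e : P" "e ~: A" by auto
   then have "\<exists>e\<in>F. (if e : A then x e else (if e : P then 0 else 1)) = 0" using assms by auto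
   then have "(\<Prod>e\<in>F. if e : A then x e else (if e : P then 0 else 1)) = 0" by (rule prod_zero[OF finF])
   then show ?thesis using False by simp
  qed
 qed simp
 moreover have "... = (\<Prod>e\<in>F. x e + (if e : P then 0 else 1))" by (rule sum_Pow_prod[OF finF])
 moreover have "sum ?g (Pow F) = (\<Prod>e\<in>F. 1 + x e)" by (rule sum_Pow_prod1[OF finF])
 moreover have "(\<Prod>e\<in>F. x e + (if e : P then 0 else 1)) = (\<Prod>e\<in>P. x e / (1 + x e)) * (\<Prod>e\<in>F. 1 + x e)"
 proof -
  have "(\<Prod>e\<in>P. x e / (1 + x e)) * (\<Prod>e\<in>F. 1 + x e) =
   (\<Prod>e\<in>F. (if e : P then x e / (1 + x e) else 1) * (1 + x e))" unfolding prod.distrib by (subst prod_subset_if[OF finF assms]) simp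
  also have "... = (\<Prod>e\<in>F. x e + (if e : P then 0 else 1))"
  proof (rule prod.cong)
   fix e show "(if e : P then x e / (1 + x e) else 1) * (1 + x e) = x e + (if e : P then 0 else 1)" using x[of e] by auto
  qed simp
  finally show ?thesis by simp
 qed
 moreover have "(\<Prod>e\<in>F. 1 + x e) > 0" by (rule prod_pos) (use x in \<open>auto intro: add_pos_nonneg\<close>)
 ultimately have "(\<Sum>A\<in>Pow F. of_bool (P \<subseteq> A) * w A) * (\<Prod>e\<in>F. 1 + x e) \<le>
   ((\<Prod>e\<in>P. x e / (1 + x e)) * (\<Sum>A\<in>Pow F. w A)) * (\<Prod>e\<in>F. 1 + x e)" by (simp add: mult_ac)
 then have "(\<Sum>A\<in>Pow F. of_bool (P \<subseteq> A) * w A) <= (\<Prod>e\<in>P. x e / (1 + x e)) * (\<Sum>A\<in>Pow F. w A)"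
  using \<open>(\<Prod>e\<in>F. 1 + x e) > 0\<close> mult_le_cancel_right_pos by blast
 then show ?thesis unfolding EE_def using wt_sum_pos by (simp add: divide_le_eq)
qed

text \<open>The model dominates independent edges of odds \<open>x e / (1 + Q)\<close>, because the
  cluster ratio is at least \<open>1 / (1 + Q)\<close>. The functional decreases in
  \<open>A\<close>, so Holley's inequality is applied to 1 minus it. The base on the right is the
  mean of a variable equal to \<open>t\<close> if an edge of odds \<open>m / (1 + Q)\<close> is open
  and to 1 otherwise.\<close>

lemma EE_closed_bound:
 assumes T: "T \<subseteq> F" and t: "0 <= t" "t <= 1" and m: "0 <= m" "!!e. e : T ==> m <= x e"
 shows "E (%A. \<Prod>e\<in>T. if e : A then t else 1) <= ((1 + Q + t * m) / (1 + Q + m)) ^ card T"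
proof -
 let ?q = "1 + Q" and ?psi = "%A. \<Prod>e\<in>T. if e : A then t else 1"
 let ?f = "%A. \<Prod>e\<in>A. x e / ?q"
 have q: "?q > 0" using Q by simp
 have finT: "finite T" using T finF finite_subset by blast
 have psi1: "?psi A <= 1" for A by (rule prod_le_1) (use t in auto)
 have psi_mono: "?psi B <= ?psi A" if "A \<subseteq> B" for A B by (rule prod_mono) (use that t in auto)
 have "(\<Sum>A\<in>Pow F. (1 - ?psi A) * ?f A) * (\<Sum>A\<in>Pow F. w A) \<le>
   (\<Sum>A\<in>Pow F. (1 - ?psi A) * w A) * sum ?f (Pow F)"
 proof (rule holley[OF finF])
  fix A B assume AB: "A \<subseteq> F" "B \<subseteq> F"
  have fin: "finite A" "finite B" using AB finF finite_subset by blast+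
  have "(1/?q) ^ card A * kap en W Q u B <= kap en W Q u (A Un B) * (1/?q) ^ card (A Int B)"
  proof (rule lattice_from_ratio[OF finF AB, where ?r2.0 = "rat en Q u"
   and ?r1.0 = "%S e. if e : S then 1 else 1/?q"
   and ?k2.0 = "kap en W Q u" and ?k1.0 = "%A. (1/?q) ^ card A"])
   show "kap en W Q u (insert e S) = kap en W Q u S * rat en Q u S e" if "S \<subseteq> F" "e : F" for S e by (rule kap_insert) (use that FW in auto)
   show "(1/?q) ^ card (insert e S) = (1/?q) ^ card S * (if e : S then 1 else 1/?q)"
   if "S \<subseteq> F" for S e using that finF finite_subset[of S F] by (auto simp: card_insert_if)
   \<comment> \<open>The ratio hypothesis also concerns edges already present; for those both sides
     are 1.\<close>
   show "(if e : S then 1 else 1/?q) <= rat en Q u T e" if "S \<subseteq> T" for S T e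
   proof (cases "e : S")
   case True
   obtain a b where ab: "en e = {a, b}" using edgy unfolding edgy_def by blast
   then have "b : cl en T a" using True that cl_edge[OF edgy, of e T a a] by auto
   then show ?thesis using True rat_same[OF ab] cl_eq_iff[of en T a b] by simp
   qed (use rat_ge in auto)
  qed (use kap_pos q in \<open>auto intro: less_imp_le\<close>)
  then have "(\<Prod>e\<in>A. x e) * (\<Prod>e\<in>B. x e) * ((1/?q) ^ card A * kap en W Q u B) \<le>
   (\<Prod>e\<in>A. x e) * (\<Prod>e\<in>B. x e) * (kap en W Q u (A Un B) * (1/?q) ^ card (A Int B))"
   by (intro mult_left_mono mult_nonneg_nonneg prod_nonneg) (auto simp: x)
  moreover have "(\<Prod>e\<in>A. x e) * (\<Prod>e\<in>B. x e) = (\<Prod>e\<in>A Un B. x e) * (\<Prod>e\<in>A Int B. x e)" using prod.union_inter[OF fin, of x] by simp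
  ultimately have "(\<Prod>e\<in>A. x e) * (\<Prod>e\<in>B. x e) * ((1/?q) ^ card A * kap en W Q u B) \<le>
   (\<Prod>e\<in>A Un B. x e) * (\<Prod>e\<in>A Int B. x e) * (kap en W Q u (A Un B) * (1/?q) ^ card (A Int B))" by simp
  moreover have "?f C = (\<Prod>e\<in>C. x e) * (1/?q) ^ card C" for C by (simp add: prod_dividef power_divide)
  then have "?f A * w B = (\<Prod>e\<in>A. x e) * (\<Prod>e\<in>B. x e) * ((1/?q) ^ card A * kap en W Q u B)"
   "w (A Un B) * ?f (A Int B) =
   (\<Prod>e\<in>A Un B. x e) * (\<Prod>e\<in>A Int B. x e) * (kap en W Q u (A Un B) * (1/?q) ^ card (A Int B))" unfolding wt_def by (simp_all only: mult_ac)
  ultimately show "?f A * w B <= w (A Un B) * ?f (A Int B)" by (simp only:)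
 qed (use psi1 psi_mono q in \<open>auto simp: wt_nonneg prod_nonneg x\<close>)
 then have 1: "(\<Sum>A\<in>Pow F. ?psi A * w A) * sum ?f (Pow F) <= (\<Sum>A\<in>Pow F. ?psi A * ?f A) * (\<Sum>A\<in>Pow F. w A)"
  by (simp add: left_diff_distrib sum_subtractf algebra_simps)
 have 2: "sum ?f (Pow F) = (\<Prod>e\<in>F. 1 + x e / ?q)" by (rule sum_Pow_prod1[OF finF])
 have "(\<Sum>A\<in>Pow F. ?psi A * ?f A) = (\<Sum>A\<in>Pow F. \<Prod>e\<in>A. (if e : T then t else 1) * (x e / ?q))"
 proof (rule sum.cong)
  fix A assume "A : Pow F"
  then have A: "A \<subseteq> F" by simp
  have "?psi A = (\<Prod>e\<in>F. if e : T then (if e : A then t else 1) else 1)" by (rule prod_subset_if[OF finF T])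
  also have "... = (\<Prod>e\<in>F. if e : A then (if e : T then t else 1) else 1)" by (rule prod.cong) auto
  also have "... = (\<Prod>e\<in>A. if e : T then t else 1)" by (rule prod_subset_if[OF finF A, symmetric])
  finally show "?psi A * ?f A = (\<Prod>e\<in>A. (if e : T then t else 1) * (x e / ?q))" by (simp only: prod.distrib)
 qed simp
 also have "... = (\<Prod>e\<in>F. 1 + (if e : T then t else 1) * (x e / ?q))" by (rule sum_Pow_prod1[OF finF])
 also have "... <= (\<Prod>e\<in>F. (if e : T then (1 + Q + t * m) / (1 + Q + m) else 1) * (1 + x e / ?q))"
 proof (rule prod_mono)
  fix e assume "e : F"
  have "(1 + t * (x e / ?q)) * (1 + Q + m) <= (1 + Q + t * m) * (1 + x e / ?q)" if "e : T"
  proof -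
   have "0 <= (1 - t) * (x e - m)" using m(2)[OF that] t by simp
   moreover have "(1 + Q + t * m) * (1 + x e / ?q) - (1 + t * (x e / ?q)) * (1 + Q + m) = (1 - t) * (x e - m)"
   proof -
   define z where "z = x e / ?q"
   have z: "x e = z * ?q" using q by (simp add: z_def)
   show ?thesis unfolding z_def[symmetric] unfolding z by (simp add: algebra_simps)
   qed
   ultimately show ?thesis by (metis diff_ge_0_iff_ge)
  qed
  then show "0 <= 1 + (if e : T then t else 1) * (x e / ?q) & 1 + (if e : T then t else 1) * (x e / ?q) \<le>
   (if e : T then (1 + Q + t * m) / (1 + Q + m) else 1) * (1 + x e / ?q)" using x[of e] q t m(1) by (auto simp: le_divide_eq)
 qed
 also have "... = ((1 + Q + t * m) / (1 + Q + m)) ^ card T * (\<Prod>e\<in>F. 1 + x e / ?q)" unfolding prod.distrib by (simp add: prod_subset_if[OF finF T, symmetric])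
 finally have 3: "(\<Sum>A\<in>Pow F. ?psi A * ?f A) <= ((1 + Q + t * m) / (1 + Q + m)) ^ card T * (\<Prod>e\<in>F. 1 + x e / ?q)" .
 have pos: "(\<Prod>e\<in>F. 1 + x e / ?q) > 0" by (rule prod_pos) (use x q in \<open>auto intro: add_pos_nonneg\<close>)
 have "(\<Sum>A\<in>Pow F. ?psi A * w A) * (\<Prod>e\<in>F. 1 + x e / ?q) \<le>
  (((1 + Q + t * m) / (1 + Q + m)) ^ card T * (\<Prod>e\<in>F. 1 + x e / ?q)) * (\<Sum>A\<in>Pow F. w A)"
  using 1 3 wt_sum_pos unfolding 2 by (meson less_imp_le mult_right_mono order_trans)
 then have "(\<Sum>A\<in>Pow F. ?psi A * w A) * (\<Prod>e\<in>F. 1 + x e / ?q) \<le>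
  (((1 + Q + t * m) / (1 + Q + m)) ^ card T * (\<Sum>A\<in>Pow F. w A)) * (\<Prod>e\<in>F. 1 + x e / ?q)" by (simp only: mult_ac)
 then have "(\<Sum>A\<in>Pow F. ?psi A * w A) <= ((1 + Q + t * m) / (1 + Q + m)) ^ card T * (\<Sum>A\<in>Pow F. w A)" using pos mult_le_cancel_right_pos by blast
 then show ?thesis unfolding EE_def using wt_sum_pos by (simp add: divide_le_eq)
qed

text \<open>Insertion tolerance. A configuration without \<open>e\<close> weighs at most
  \<open>(1 + Q) / x e\<close> times the same configuration with \<open>e\<close> opened, and a
  configuration containing \<open>e\<close> is reached only from itself and from the one without
  \<open>e\<close>.\<close>

lemma EE_insert:
 assumes e: "e : F" "x e > 0"
 shows "E (%A. of_bool (P (insert e A))) <= (1 + (1 + Q) / x e) * E (%A. of_bool (P A))"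
proof -
 define F' where "F' = F - {e}"
 have F: "F = insert e F'" "finite F'" "e ~: F'" using e finF by (auto simp: F'_def)
 have "(\<Sum>A\<in>Pow F. of_bool (P (insert e A)) * w A) = (\<Sum>A\<in>Pow F'. of_bool (P (insert e A)) * (w A + w (insert e A)))"
  unfolding F(1) sum_Pow_insert[OF F(2,3)] by (simp add: distrib_left)
 also have "... <= (\<Sum>A\<in>Pow F'. (1 + (1 + Q) / x e) * (of_bool (P A) * w A + of_bool (P (insert e A)) * w (insert e A)))"
 proof (rule sum_mono)
  fix A assume "A : Pow F'"
  then have A: "A \<subseteq> F" "e ~: A" using F by auto
  have "w A * 1 <= w A * ((1 + Q) * rat en Q u A e)" using rat_ge[of A e] Q wt_nonneg by (intro mult_left_mono) (auto simp: divide_le_eq mult.commute)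
  then have "w A <= (1 + Q) / x e * w (insert e A)" unfolding wt_insert[OF A(1) e(1) A(2)] using e(2) by (simp add: mult_ac)
  moreover have "0 <= (1 + (1 + Q) / x e) * (of_bool (P A) * w A)" using Q e(2) wt_nonneg by (intro mult_nonneg_nonneg add_nonneg_nonneg divide_nonneg_nonneg) auto
  ultimately show "of_bool (P (insert e A)) * (w A + w (insert e A)) \<le>
   (1 + (1 + Q) / x e) * (of_bool (P A) * w A + of_bool (P (insert e A)) * w (insert e A))" by (auto simp: algebra_simps)
 qed
 also have "... = (1 + (1 + Q) / x e) * (\<Sum>A\<in>Pow F. of_bool (P A) * w A)" unfolding F(1) sum_Pow_insert[OF F(2,3)] by (simp add: sum_distrib_left)
 finally show ?thesis unfolding EE_def using wt_sum_pos by (simp add: divide_right_mono)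
qed

text \<open>Each configuration without \<open>e\<close> is paired with the one in which
  \<open>e\<close> is opened, whose relative weight is \<open>x e * rat\<close>.\<close>

lemma EE_edge_nonneg:
 assumes e: "e : F"
  and pair: "!!A. A \<subseteq> F ==> e ~: A ==> 0 <= f A + x e * rat en Q u A e * f (insert e A)"
 shows "0 <= E f"
proof -
 define F' where "F' = F - {e}"
 have F: "F = insert e F'" "finite F'" "e ~: F'" using e finF by (auto simp: F'_def)
 have "0 <= (\<Sum>A\<in>Pow F'. w A * (f A + x e * rat en Q u A e * f (insert e A)))"
 proof (intro sum_nonneg mult_nonneg_nonneg wt_nonneg pair)
  fix A assume "A : Pow F'" then show "A \<subseteq> F" "e ~: A" using F by auto
 qed
 also have "... = (\<Sum>A\<in>Pow F'. f A * w A + f (insert e A) * w (insert e A))"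
 proof (rule sum.cong)
  fix A assume "A : Pow F'"
  then have A: "A \<subseteq> F" "e ~: A" using F by auto
  show "w A * (f A + x e * rat en Q u A e * f (insert e A)) = f A * w A + f (insert e A) * w (insert e A)"
   unfolding wt_insert[OF A(1) e A(2)] by (simp add: algebra_simps)
 qed simp
 also have "... = (\<Sum>A\<in>Pow F. f A * w A)" unfolding F(1) sum_Pow_insert[OF F(2,3)] by simp
 finally show ?thesis unfolding EE_def using wt_sum_pos by simp
qed

end

section \<open>Truncated cluster sizes and the gain from one edge\<close>

definition pw :: "real => 'w set => real" where
 "pw t K = (if finite K then t ^ card K else if t = 1 then 1 else 0)"

definition rr :: "real => real => 'w set => real" where
 "rr Q t K = 1 / (1 + Q * pw t K)"

text \<open>With \<open>b = 1 - 1/N\<close> and \<open>a\<close> close to 1 this is comparable to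
  the smaller of 1 and \<open>card K / N\<close> on finite \<open>K\<close>. For \<open>a\<close>
  and \<open>b\<close> below 1 it vanishes on infinite \<open>K\<close>, where \<open>pw\<close> is
  0.\<close>

definition gg :: "real => real => 'w set => real" where
 "gg a b K = pw a K - pw b K"

text \<open>For disjoint finite sets this equals
  \<open>gg a b K + gg a b L - gg a b (K Un L)\<close>, the loss caused by merging. When
  \<open>a\<close> tends to 1 the second product disappears as soon as one of the sets is finite,
  while the first is bounded below if both are large.\<close>

definition GG :: "real => real => 'w set => 'w set => real" where
 "GG a b K L = (1 - pw b K) * (1 - pw b L) - (1 - pw a K) * (1 - pw a L)"

lemma pw_bounds: "0 <= t ==> t <= 1 ==> 0 <= pw t K & pw t K <= 1" by (auto simp: pw_def power_le_one)

lemma pw_mono: "0 <= b ==> b <= a ==> a < 1 ==> pw b K <= pw a K" by (auto simp: pw_def power_mono)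

lemma gg_bounds: "0 <= b ==> b <= a ==> a < 1 ==> 0 <= gg a b K & gg a b K <= 1" using pw_mono[of b a K] pw_bounds[of a K] pw_bounds[of b K] by (auto simp: gg_def)

lemma GG_bounds: "0 <= b ==> b <= a ==> a < 1 ==> 0 <= GG a b K L & GG a b K L <= 1"
proof -
 assume ab: "0 <= b" "b <= a" "a < 1"
 have "pw b K <= pw a K" "pw b L <= pw a L" using ab pw_mono by auto
 moreover have "0 <= pw b K" "0 <= pw b L" "pw a K <= 1" "pw a L <= 1"
  "pw b K <= 1" "pw b L <= 1" using ab pw_bounds[of a K] pw_bounds[of a L] pw_bounds[of b K] pw_bounds[of b L] by auto
 ultimately have "(1 - pw a K) * (1 - pw a L) <= (1 - pw b K) * (1 - pw b L)"
  "(1 - pw b K) * (1 - pw b L) <= 1" "0 <= (1 - pw a K) * (1 - pw a L)" by (auto intro!: mult_mono mult_le_one)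
 then show ?thesis by (auto simp: GG_def)
qed

lemma rr_bounds: "0 <= Q ==> 0 <= t ==> t <= 1 ==> 1 / (1 + Q) <= rr Q t K & rr Q t K <= 1"
proof -
 assume a: "0 <= Q" "0 <= t" "t <= 1"
 have "0 <= Q * pw t K" "Q * pw t K <= Q" using pw_bounds[OF a(2,3), of K] a(1) by (auto simp: mult_left_le)
 then show ?thesis using a(1) by (auto simp: rr_def intro!: divide_left_mono)
qed

lemma rr_nonneg: "0 <= Q ==> 0 <= t ==> t <= 1 ==> 0 <= rr Q t K" using pw_bounds[of t K] by (simp add: rr_def)

lemma ucl_const: "finite C ==> ucl (%_. t) C = pw t C" by (simp add: ucl_def pw_def)

text \<open>The contribution of the edge \<open>e\<close> with endpoints \<open>a, b\<close> to the total signed fluctuation of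
 the adjacent clusters, averaged over independent cluster colours: a cluster \<open>K\<close> is coloured
 red with probability \<open>rr Q t K\<close>, and only edges between red vertices count.\<close>

definition Zf :: "('e => 'w set) => real => real => real => real => real => 'e => 'w => 'w => 'e set => real" where
 "Zf en Q t p al al' e a b A =
  (let K = cl en A a; L = cl en A b in
  if b : K then (p - of_bool (e : A)) * (rr Q t K * gg al al' K)
  else p * (rr Q t K * rr Q t L * (gg al al' K + gg al al' L)))"

definition Yf :: "('e => 'w set) => real => real => 'w => 'w => 'e set => real" where
 "Yf en al al' a b A = (if b : cl en A a then 0 else GG al al' (cl en A a) (cl en A b))"

locale fk_const = fk_finite en W Q "%_. t" x F
 for en :: "'e => 'w set" and W Q t x F
begin

text \<open>Compare \<open>A\<close> with \<open>insert e A\<close>. If the endpoints are already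
  joined, the two terms cancel because \<open>x e * (1 - p) = p\<close>. Otherwise opening
  \<open>e\<close> merges the two clusters, and the pair contributes
  \<open>p * rr K * rr L * GG\<close>, where each \<open>rr\<close> is at least
  \<open>1 / (1 + Q)\<close>.\<close>

lemma edge_fluctuation:
 assumes e: "e : F" "en e = {a, b}" and al: "0 <= al'" "al' <= al" "al < 1"
 defines "p \<equiv> x e / (1 + x e)"
 shows "p / (1 + Q)\<^sup>2 * E (Yf en al al' a b) <= E (Zf en Q t p al al' e a b)"
proof -
 have t: "0 <= t" "t <= 1" using u by auto
 have px: "x e * (1 - p) = p" "0 <= p" using x[of e] by (auto simp: p_def field_simps)
 let ?h = "%A. Zf en Q t p al al' e a b A - p / (1 + Q)\<^sup>2 * Yf en al al' a b A"
 have "0 <= E ?h"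
 proof (rule EE_edge_nonneg[OF e(1)])
  fix A assume A: "A \<subseteq> F" "e ~: A"
  let ?K = "cl en A a" and ?L = "cl en A b"
  have cli: "cl en (insert e A) y = (if y : ?K Un ?L then ?K Un ?L else cl en A y)" for y by (rule cl_insert[OF edgy e(2)])
  have fin: "finite ?K" "finite ?L" using e A FW[OF e(1)] FW finite_cl[of a A] finite_cl[of b A] by auto
  show "0 <= ?h A + x e * rat en Q (%_. t) A e * ?h (insert e A)"
  proof (cases "b : ?K")
   case True
   then have KL: "?L = ?K" by (rule cl_eq)
   have r: "rat en Q (%_. t) A e = 1" by (rule rat_same[OF e(2)]) (simp add: KL)
   have cK: "cl en (insert e A) a = ?K" using cli[of a] KL by simp
   have "?h A = p * (rr Q t ?K * gg al al' ?K)" using True A by (simp add: Zf_def Yf_def Let_def)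
   moreover have "?h (insert e A) = (p - 1) * (rr Q t ?K * gg al al' ?K)" using True cK by (simp add: Zf_def Yf_def Let_def)
   ultimately have "?h A + x e * rat en Q (%_. t) A e * ?h (insert e A) =
   p * (rr Q t ?K * gg al al' ?K) + x e * 1 * ((p - 1) * (rr Q t ?K * gg al al' ?K))" unfolding r by (simp only:)
   also have "... = (p - x e * (1 - p)) * (rr Q t ?K * gg al al' ?K)" by (simp add: algebra_simps)
   finally show ?thesis using px by simp
  next
   case False
   have KL: "?K ~= ?L" using False cl_eq_iff[of en A a b] by auto
   have dis: "?K Int ?L = {}" by (rule cl_disjoint[OF KL])
   let ?r = "rr Q t ?K" and ?s = "rr Q t ?L" and ?M = "?K Un ?L"
   have pwM: "pw z ?M = pw z ?K * pw z ?L" for z using fin dis by (simp add: pw_def card_Un_disjoint power_add)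
   have cM: "cl en (insert e A) a = ?M" "b : ?M" using cli[of a] by auto
   have pwt: "0 <= pw t ?K" "0 <= pw t ?L" using pw_bounds t by auto
   have pos: "1 + Q * pw t ?K > 0" "1 + Q * pw t ?L > 0" "1 + Q * (pw t ?K * pw t ?L) > 0" using Q pwt by (auto intro!: add_pos_nonneg)
   \<comment> \<open>The red term of every cluster factor is 1, so the weight does not notice that
     two red clusters merge.\<close>
   have "rat en Q (%_. t) A e * rr Q t ?M = ?r * ?s" using pos(3) unfolding rat_diff[OF e(2) KL] ucl_const[OF fin(1)] ucl_const[OF fin(2)] rr_def pwM
   by (simp del: mult_eq_0_iff)
   moreover have "?h (insert e A) = - (1 - p) * (rr Q t ?M * gg al al' ?M)" using cM by (simp add: Zf_def Yf_def Let_def algebra_simps)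
   moreover have "x e * R * (- (1 - p) * (S * g)) = - (x e * (1 - p)) * ((R * S) * g)" for R S g :: real by (simp add: algebra_simps)
   ultimately have "x e * rat en Q (%_. t) A e * ?h (insert e A) =
   - (x e * (1 - p)) * (?r * ?s * gg al al' ?M)" by (simp only:)
   then have 1: "x e * rat en Q (%_. t) A e * ?h (insert e A) = - p * (?r * ?s * gg al al' ?M)" unfolding px .
   have 2: "?h A = p * (?r * ?s * (gg al al' ?K + gg al al' ?L)) - p / (1 + Q)\<^sup>2 * GG al al' ?K ?L" using False by (simp add: Zf_def Yf_def Let_def)
   have 3: "gg al al' ?K + gg al al' ?L - gg al al' ?M = GG al al' ?K ?L" by (simp add: gg_def GG_def pwM algebra_simps)
   have "p * (?r * ?s * (gg al al' ?K + gg al al' ?L)) - p * (?r * ?s * gg al al' ?M) =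
   p * (?r * ?s * (gg al al' ?K + gg al al' ?L - gg al al' ?M))" by (simp only: right_diff_distrib)
   then have eq: "?h A + x e * rat en Q (%_. t) A e * ?h (insert e A) =
   p * (?r * ?s * GG al al' ?K ?L) - p / (1 + Q)\<^sup>2 * GG al al' ?K ?L" unfolding 1 2 3 by linarith
   have "1 / (1 + Q) * (1 / (1 + Q)) <= ?r * ?s" using rr_bounds[OF Q t] rr_nonneg[OF Q t] Q by (intro mult_mono) auto
   then have "p * (1 / (1 + Q) * (1 / (1 + Q)) * GG al al' ?K ?L) <= p * (?r * ?s * GG al al' ?K ?L)"
   using px GG_bounds[OF al] by (intro mult_left_mono mult_right_mono) auto
   then show ?thesis unfolding eq by (simp add: power2_eq_square)
  qed
 qed
 then show ?thesis unfolding EE_diff EE_cmult by linarith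
qed

end

text \<open>Query an edge that meets \<open>S\<close>: if it is closed, continue with the same
  \<open>S\<close>, and if it is open, add its endpoints. Each queried edge brings a factor whose
  mean under odds \<open>x e\<close> is at most 1, so the product is a supermartingale. The edges
  queried are exactly those touching the final cluster, each of them once.\<close>

lemma explore:
 fixes x ta0 ta1 :: "'e => real"
 assumes "finite F" "edgy en"
  and "!!e. e : F ==> 0 <= x e & 0 <= ta0 e & 0 <= ta1 e & ta0 e + x e * ta1 e <= 1 + x e"
 shows "(\<Sum>A\<in>Pow F. (\<Prod>e\<in>A. x e) *
   (\<Prod>e\<in>{e : F. en e Int (\<Union>a\<in>S. cl en A a) ~= {}}. if e : A then ta1 e else ta0 e)) <= (\<Prod>e\<in>F. 1 + x e)" using assms(1,3)
proof (induction "card F" arbitrary: F S)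
 case 0
 then show ?case by simp
next
 case (Suc n)
 let ?K = "%S A. \<Union>a\<in>S. cl en A a"
 show ?case
 proof (cases "\<exists>e\<in>F. en e Int S ~= {}")
  case False
  have "?K S A = S" if "A \<subseteq> F" for A
  proof -
   have "cl en A a \<subseteq> S" if "a : S" for a using that False \<open>A \<subseteq> F\<close> by (intro cl_least) auto
   then show ?thesis using cl_refl[of _ en A] by blast
  qed
  then have emp: "{e : F. en e Int ?K S A ~= {}} = {}" if "A \<subseteq> F" for A using False that by auto
  have "(\<Sum>A\<in>Pow F. (\<Prod>e\<in>A. x e) *
   (\<Prod>e\<in>{e : F. en e Int ?K S A ~= {}}. if e : A then ta1 e else ta0 e)) = (\<Sum>A\<in>Pow F. \<Prod>e\<in>A. x e)"
  proof (rule sum.cong)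
   fix A assume "A : Pow F"
   then have A: "A \<subseteq> F" by simp
   show "(\<Prod>e\<in>A. x e) * (\<Prod>e\<in>{e : F. en e Int ?K S A ~= {}}. if e : A then ta1 e else ta0 e) = (\<Prod>e\<in>A. x e)" unfolding emp[OF A] by simp
  qed simp
  then show ?thesis using sum_Pow_prod1[OF Suc.prems(1), of x] by simp
 next
  case True
  then obtain e where e: "e : F" "en e Int S ~= {}" by auto
  define F' where "F' = F - {e}"
  have F: "F = insert e F'" "finite F'" "e ~: F'" "n = card F'" using e Suc.hyps(2) Suc.prems(1) by (auto simp: F'_def)
  let ?p = "%S A. \<Prod>f\<in>{f : F'. en f Int ?K S A ~= {}}. if f : A then ta1 f else ta0 f"
  let ?g = "%S A. \<Prod>f\<in>{f : F. en f Int ?K S A ~= {}}. if f : A then ta1 f else ta0 f"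
  have e': "0 <= x e" "0 <= ta0 e" "0 <= ta1 e" "ta0 e + x e * ta1 e <= 1 + x e" using Suc.prems(2)[OF e(1)] by auto
  have sub: "S <= ?K S A" for A using cl_refl[of _ en A] by blast
  have t1: "(\<Prod>f\<in>A. x f) * ?g S A = ta0 e * ((\<Prod>f\<in>A. x f) * ?p S A)" if A: "A \<subseteq> F'" for A
  proof -
   have "en e Int ?K S A ~= {}" using e(2) sub[of A] by blast
   then have "{f : F. en f Int ?K S A ~= {}} = insert e {f : F'. en f Int ?K S A ~= {}}" using F(1) by auto
   moreover have "e ~: A" using A F by auto
   ultimately show ?thesis using F by simp
  qed
  have t2: "(\<Prod>f\<in>insert e A. x f) * ?g S (insert e A) = x e * ta1 e * ((\<Prod>f\<in>A. x f) * ?p (S Un en e) A)"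
   if A: "A \<subseteq> F'" for A
  proof -
   have K: "?K S (insert e A) = ?K (S Un en e) A"
   proof
   show "?K S (insert e A) <= ?K (S Un en e) A"
   proof (rule UN_least)
   fix a assume "a : S"
   show "cl en (insert e A) a <= ?K (S Un en e) A"
   proof (rule cl_least)
   show "a : ?K (S Un en e) A" using \<open>a : S\<close> cl_refl[of a en A] by blast
   fix f assume f: "f : insert e A" "en f Int ?K (S Un en e) A ~= {}"
   show "en f <= ?K (S Un en e) A"
   proof (cases "f = e")
   case True then show ?thesis using cl_refl[of _ en A] by blast
   next
   case False
   then obtain c d where "f : A" "c : S Un en e" "d : en f" "d : cl en A c" using f by blast
   then show ?thesis using cl_edge[OF assms(2), of f A d c] by blast
   qed
   qed
   qed
   obtain a where a: "a : S" "a : en e" using e(2) by auto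
   have ea: "en e <= cl en (insert e A) a" using cl_edge[OF assms(2), of e "insert e A" a a] a by simp
   have "cl en A c <= ?K S (insert e A)" if "c : S Un en e" for c
   proof -
   have "cl en A c <= cl en (insert e A) c" by (rule cl_mono) auto
   moreover have "c : S | cl en (insert e A) c = cl en (insert e A) a" using that ea cl_eq[of c en "insert e A" a] by blast
   ultimately show ?thesis using a(1) by blast
   qed
   then show "?K (S Un en e) A <= ?K S (insert e A)" by blast
   qed
   have "en e Int ?K S (insert e A) ~= {}" using e(2) sub[of "insert e A"] by blast
   then have s: "{f : F. en f Int ?K S (insert e A) ~= {}} = insert e {f : F'. en f Int ?K S (insert e A) ~= {}}" using F(1) by auto
   have "?g S (insert e A) = ta1 e * (\<Prod>f\<in>{f : F'. en f Int ?K S (insert e A) ~= {}}. if f : insert e A then ta1 f else ta0 f)" unfolding s using F by simp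
   also have "(\<Prod>f\<in>{f : F'. en f Int ?K S (insert e A) ~= {}}. if f : insert e A then ta1 f else ta0 f) = ?p (S Un en e) A"
   unfolding K using F(3) by (intro prod.cong) auto
   finally have "?g S (insert e A) = ta1 e * ?p (S Un en e) A" .
   moreover have "e ~: A" "finite A" using A F finite_subset by auto
   ultimately show ?thesis by simp
  qed
  have IH: "(\<Sum>A\<in>Pow F'. (\<Prod>f\<in>A. x f) * ?p S' A) <= (\<Prod>f\<in>F'. 1 + x f)" for S'
   by (rule Suc.hyps(1)[OF F(4,2)]) (use Suc.prems(2) F(1) in auto)
  have P: "0 <= (\<Prod>f\<in>F'. 1 + x f)" using Suc.prems(2) F(1) by (intro prod_nonneg) (auto intro: add_nonneg_nonneg)
  have "(\<Sum>A\<in>Pow F. (\<Prod>f\<in>A. x f) * ?g S A) =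
   (\<Sum>A\<in>Pow F'. (\<Prod>f\<in>A. x f) * ?g S A + (\<Prod>f\<in>insert e A. x f) * ?g S (insert e A))"
   using sum_Pow_insert[OF F(2,3), of "%A. (\<Prod>f\<in>A. x f) * ?g S A"] F(1) by simp
  also have "... = (\<Sum>A\<in>Pow F'. ta0 e * ((\<Prod>f\<in>A. x f) * ?p S A) + x e * ta1 e * ((\<Prod>f\<in>A. x f) * ?p (S Un en e) A))"
   by (intro sum.cong refl arg_cong2[where f="(+)"] t1 t2) auto
  also have "... = ta0 e * (\<Sum>A\<in>Pow F'. (\<Prod>f\<in>A. x f) * ?p S A) +
   x e * ta1 e * (\<Sum>A\<in>Pow F'. (\<Prod>f\<in>A. x f) * ?p (S Un en e) A)" by (simp only: sum.distrib sum_distrib_left)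
  also have "... <= ta0 e * (\<Prod>f\<in>F'. 1 + x f) + x e * ta1 e * (\<Prod>f\<in>F'. 1 + x f)" using e' by (intro add_mono mult_left_mono mult_nonneg_nonneg IH)
  also have "... = (ta0 e + x e * ta1 e) * (\<Prod>f\<in>F'. 1 + x f)" by (simp add: distrib_right)
  also have "... <= (1 + x e) * (\<Prod>f\<in>F'. 1 + x f)" using e' P by (intro mult_right_mono) auto
  also have "... = (\<Prod>f\<in>F. 1 + x f)" using F by simp
  finally show ?thesis .
 qed
qed

definition touch :: "('e => 'w set) => 'e set => 'w set => 'e set" where
 "touch en T K = {e : T. en e Int K ~= {}}"

text \<open>Given a red root, this is the colour average of the sum of
  \<open>p e - of_bool (e : A)\<close> over the touched edges of \<open>T\<close> with both
  endpoints red. An edge leaving the cluster is closed and counts with the probability that its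
  outer endpoint, the only element of the inner index set, is red.\<close>

definition HH :: "('e => 'w set) => ('w set => real) => ('e => real) => 'e set => 'w => 'e set => real" where
 "HH en r p T a A = (\<Sum>e\<in>touch en T (cl en A a).
  if en e <= cl en A a then p e - of_bool (e : A)
  else p e * (\<Sum>v\<in>en e - cl en A a. r (cl en A v)))"

text \<open>This is the mean-at-most-1 condition for one explored edge. The linear term in
  \<open>th\<close> cancels because \<open>p * (1 + x) = x\<close>, and the subtracted
  \<open>th\<close> squared pays for the quadratic one.\<close>

lemma two_point_exp:
 fixes th x :: real
 assumes "0 <= th" "th <= 1" "0 <= x"
 defines "p \<equiv> x / (1 + x)"
 shows "exp (th * p - th\<^sup>2) + x * exp (th * (p - 1) - th\<^sup>2) <= 1 + x"
proof -
 have p: "0 <= p" "p <= 1" "p * (1 + x) = x" using assms by (auto simp: p_def)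
 have a: "\<bar>th * p\<bar> <= 1" "\<bar>th * (p - 1)\<bar> <= 1" using p assms(1,2) mult_le_one[of th p] mult_le_one[of th "1 - p"] by (simp_all add: abs_mult)
 have "exp (th * p) + x * exp (th * (p - 1)) \<le>
   (1 + th * p + (th * p)\<^sup>2) + x * (1 + th * (p - 1) + (th * (p - 1))\<^sup>2)" using exp_quadratic_bound[OF a(1)] exp_quadratic_bound[OF a(2)] assms(3)
  by (intro add_mono mult_left_mono) auto
 also have "... = (1 + x) + th * (p * (1 + x) - x) + th\<^sup>2 * (p\<^sup>2 + x * (1 - p)\<^sup>2)" by (simp add: power2_eq_square algebra_simps)
 also have "... <= (1 + x) + th\<^sup>2 * (1 + x)"
 proof -
  have "p\<^sup>2 <= 1" "(1 - p)\<^sup>2 <= 1" using p by (auto intro!: power_le_one)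
  then have "p\<^sup>2 + x * (1 - p)\<^sup>2 <= 1 + x * 1" using assms(3) by (intro add_mono mult_left_mono) auto
  then have "th\<^sup>2 * (p\<^sup>2 + x * (1 - p)\<^sup>2) <= th\<^sup>2 * (1 + x)" by (intro mult_left_mono) auto
  then show ?thesis using p(3) by simp
 qed
 also have "... <= (1 + x) * exp (th\<^sup>2)" using exp_ge_add_one_self[of "th\<^sup>2"] assms(3) mult_left_mono[of "1 + th\<^sup>2" "exp (th\<^sup>2)" "1 + x"]
  by (simp add: algebra_simps)
 finally have "(exp (th * p) + x * exp (th * (p - 1))) * exp (- th\<^sup>2) <= (1 + x) * exp (th\<^sup>2) * exp (- th\<^sup>2)" by (intro mult_right_mono) auto
 then show ?thesis by (simp add: exp_diff exp_minus divide_inverse distrib_right mult.assoc)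
qed

section \<open>Red and blue colourings and the exponential moment\<close>

context fk_finite
begin

text \<open>The possible sets of blue vertices when the root \<open>a\<close> is red: unions of
  clusters that avoid \<open>a\<close>.\<close>

definition sat :: "'w => 'e set => 'w set set" where
 "sat a A = {Y. Y \<subseteq> W - {a} & (\<forall>e\<in>A. en e Int Y = {} | en e \<subseteq> Y)}"

definition blue :: "'e set => 'w set => real" where
 "blue A Y = (\<Prod>C\<in>cl en A ` Y. Q * ucl u C)"

lemma blue_nonneg: "0 <= blue A Y" unfolding blue_def using ucl_bounds Q by (auto intro!: prod_nonneg)

lemma sat_cl:
 assumes "Y : sat a A" "y : Y" shows "cl en A y \<subseteq> Y" using assms by (intro cl_least) (auto simp: sat_def)

lemma sat_cl_root:
 assumes "Y : sat a A" shows "cl en A a Int Y = {}"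
proof -
 have "cl en A a \<subseteq> - Y" using assms by (intro cl_least) (auto simp: sat_def)
 then show ?thesis by auto
qed

text \<open>A set of clusters other than that of the root and the union of these clusters determine
  each other. The vertex set is the convenient datum once the order of summation is changed.\<close>

lemma sum_sat:
 assumes A: "A \<subseteq> F" and a: "a : W"
 shows "(\<Sum>B\<in>Pow (cl en A ` W - {cl en A a}). (\<Prod>C\<in>B. Q * ucl u C) * f (\<Union>B)) =
   (\<Sum>Y\<in>sat a A. blue A Y * f Y)"
proof (rule sum.reindex_bij_witness[of _ "%Y. cl en A ` Y" "%B. \<Union>B"])
 have AW: "!!e. e : A ==> en e \<subseteq> W" using A FW by auto
 {
  fix B assume "B : Pow (cl en A ` W - {cl en A a})"
  then have B: "!!C. C : B ==> \<exists>c\<in>W. C = cl en A c" "cl en A a ~: B" by auto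
  show im: "cl en A ` \<Union>B = B"
  proof
   show "cl en A ` \<Union>B \<subseteq> B"
   proof clarify
   fix y C assume "y : C" "C : B"
   then show "cl en A y : B" using B(1) cl_eq by metis
   qed
   show "B <= cl en A ` \<Union>B"
   proof
   fix C assume C: "C : B"
   then obtain c where "C = cl en A c" using B(1) by auto
   then show "C : cl en A ` \<Union>B" using C cl_refl[of c en A] by blast
   qed
  qed
  show "\<Union>B : sat a A" unfolding sat_def
  proof (intro CollectI conjI ballI)
   show "\<Union>B \<subseteq> W - {a}"
   proof
   fix y assume "y : \<Union>B"
   then obtain C where C: "C : B" "y : C" by auto
   then obtain c where c: "c : W" "C = cl en A c" using B(1) by auto
   have "y ~= a" using B(2) C c cl_eq[of y en A c] by auto
   then show "y : W - {a}" using C c cl_subset[of c W A en, OF c(1) AW] by auto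
   qed
   fix e assume e: "e : A"
   show "en e Int \<Union>B = {} | en e \<subseteq> \<Union>B"
   proof (rule disjCI)
   assume n: "\<not> en e \<subseteq> \<Union>B"
   show "en e Int \<Union>B = {}"
   proof (rule ccontr)
   assume "en e Int \<Union>B ~= {}"
   then obtain y C where y: "y : en e" "y : C" "C : B" by auto
   then obtain c where "C = cl en A c" using B(1) by auto
   then show False using n y cl_edge[OF edgy e, of y c] by auto
   qed
   qed
  qed
  show "blue A (\<Union>B) * f (\<Union>B) = (\<Prod>C\<in>B. Q * ucl u C) * f (\<Union>B)" unfolding blue_def im ..
 }
 fix Y assume Y: "Y : sat a A"
 show "\<Union>(cl en A ` Y) = Y" using sat_cl[OF Y] cl_refl[of _ en A] by blast
 show "cl en A ` Y : Pow (cl en A ` W - {cl en A a})"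
 proof -
  have "cl en A y ~= cl en A a" if "y : Y" for y using sat_cl_root[OF Y] that cl_refl[of y en A] by auto
  then show ?thesis using Y by (auto simp: sat_def)
 qed
qed

text \<open>Dividing by the factor of the root's cluster keeps the colourings with a red root; the
  remaining factors expand into a choice of blue clusters.\<close>

lemma wt_root:
 assumes A: "A \<subseteq> F" and a: "a : W"
 shows "w A * (1 / (1 + Q * ucl u (cl en A a))) =
  (\<Prod>e\<in>A. x e) * (\<Sum>B\<in>Pow (cl en A ` W - {cl en A a}). \<Prod>C\<in>B. Q * ucl u C)"
proof -
 have "kap en W Q u A = (1 + Q * ucl u (cl en A a)) * (\<Prod>C\<in>cl en A ` W - {cl en A a}. 1 + Q * ucl u C)"
  unfolding kap_def using a fin_W by (subst prod.remove[of _ "cl en A a"]) auto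
 moreover have "1 + Q * ucl u (cl en A a) ~= 0" using one_le(1)[of "cl en A a"] by linarith
 ultimately show ?thesis unfolding wt_def using fin_W by (simp add: sum_Pow_prod1)
qed

definition touchY :: "'e set => 'w => 'e set => 'w set => 'e set" where
 "touchY T a A Y = {e : touch en T (cl en A a). en e Int Y = {}}"

text \<open>Jensen's inequality for the colour average, in the form of the tangent
  \<open>1 + z <= exp z\<close> at the mean \<open>?H\<close>. Passing from all touched edges to
  those without a blue endpoint lowers their number, which can only raise the exponential with the
  penalty \<open>th\<close> squared per edge.\<close>

lemma jensen_colours:
 assumes A: "A \<subseteq> F" and a: "a : W" and T: "T \<subseteq> F" and th: "0 <= th"
 defines "r \<equiv> %C. 1 / (1 + Q * ucl u C)"
 shows "w A * (r (cl en A a) * exp (th * HH en r p T a A - th\<^sup>2 * card (touch en T (cl en A a))))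
  <= (\<Prod>e\<in>A. x e) * (\<Sum>Y\<in>sat a A. blue A Y *
   exp (\<Sum>e\<in>touchY T a A Y. th * (p e - of_bool (e : A)) - th\<^sup>2))"
proof -
 let ?K = "cl en A a"
 let ?D = "cl en A ` W - {?K}"
 let ?b = "%B. \<Prod>C\<in>B. Q * ucl u C"
 let ?S = "touch en T ?K"
 let ?h = "%B. \<Sum>e\<in>touchY T a A (\<Union>B). p e - of_bool (e : A)"
 let ?N = "real (card ?S)" and ?H = "HH en r p T a A"
 have AW: "!!e. e : A ==> en e \<subseteq> W" using A FW by auto
 have finS: "finite ?S" using T finF finite_subset unfolding touch_def by fastforce
 have finD: "finite ?D" using fin_W by auto
 have b0: "0 <= ?b B" for B using ucl_bounds Q by (auto intro!: prod_nonneg)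
 have dis: "?K Int \<Union>B = {}" if "B \<subseteq> ?D" for B
 proof -
  have "?K Int C = {}" if C: "C : B" for C
  proof -
   obtain c where c: "C = cl en A c" "C ~= ?K" using C \<open>B \<subseteq> ?D\<close> by blast
   then show ?thesis using cl_disjoint[of en A a c] by auto
  qed
  then show ?thesis by auto
 qed
 have mean: "(\<Sum>B\<in>Pow ?D. ?b B * ?h B) = (\<Sum>B\<in>Pow ?D. ?b B) * ?H"
 proof -
  have h: "?h B = (\<Sum>e\<in>?S. of_bool (en e Int \<Union>B = {}) * (p e - of_bool (e : A)))" for B
   unfolding touchY_def sum.inter_filter[OF finS] by (intro sum.cong) auto
  have "(\<Sum>B\<in>Pow ?D. ?b B * ?h B) =
   (\<Sum>e\<in>?S. (p e - of_bool (e : A)) * (\<Sum>B\<in>Pow ?D. ?b B * of_bool (en e Int \<Union>B = {})))"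
   unfolding h sum_distrib_left by (subst sum.swap) (simp add: mult_ac)
  also have "... = (\<Sum>e\<in>?S. (\<Sum>B\<in>Pow ?D. ?b B) * (if en e <= ?K then p e - of_bool (e : A)
   else p e * (\<Sum>v\<in>en e - ?K. r (cl en A v))))"
  proof (rule sum.cong)
   fix e assume "e : ?S"
   then have e: "e : F" "en e Int ?K ~= {}" using T by (auto simp: touch_def)
   show "(p e - of_bool (e : A)) * (\<Sum>B\<in>Pow ?D. ?b B * of_bool (en e Int \<Union>B = {})) =
   (\<Sum>B\<in>Pow ?D. ?b B) * (if en e <= ?K then p e - of_bool (e : A)
   else p e * (\<Sum>v\<in>en e - ?K. r (cl en A v)))"
   proof (cases "en e <= ?K")
   case True
   then have "(\<Sum>B\<in>Pow ?D. ?b B * of_bool (en e Int \<Union>B = {})) = (\<Sum>B\<in>Pow ?D. ?b B)" using dis by (intro sum.cong) auto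
   then show ?thesis using True by simp
   next
   case False
   obtain y v where yv: "en e = {y, v}" "y : ?K" "v ~: ?K"
   proof -
   obtain c d where "en e = {c, d}" using edgy unfolding edgy_def by blast
   then show ?thesis using that[of c d] that[of d c] e(2) False by auto
   qed
   let ?L = "cl en A v"
   have eA: "e ~: A" using cl_edge[OF edgy, of e A y a] yv by auto
   have L: "?L : ?D" using yv FW[OF e(1)] cl_eq_iff[of en A a v] by auto
   have inter: "en e Int \<Union>B = {} \<longleftrightarrow> ?L ~: B" if "B \<subseteq> ?D" for B
   proof
   assume "en e Int \<Union>B = {}" then show "?L ~: B" using yv cl_refl[of v en A] by auto
   next
   assume n: "?L ~: B"
   have "v ~: C" if CB: "C : B" for C
   proof
   assume "v : C"
   obtain c where "C = cl en A c" using CB \<open>B \<subseteq> ?D\<close> by auto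
   then show False using n CB \<open>v : C\<close> cl_eq[of v en A c] by auto
   qed
   then show "en e Int \<Union>B = {}" using yv dis[OF that] by auto
   qed
   have D: "?D = insert ?L (?D - {?L})" using L by auto
   have fin': "finite (?D - {?L})" using finD by auto
   have "(\<Sum>B\<in>Pow ?D. ?b B * of_bool (en e Int \<Union>B = {})) = (\<Sum>B\<in>Pow ?D. ?b B * of_bool (?L ~: B))" by (intro sum.cong) (auto simp: inter)
   also have "... = (\<Sum>B\<in>Pow (?D - {?L}). ?b B)"
   proof -
   have "Pow (?D - {?L}) = {B : Pow ?D. ?L ~: B}" by auto
   moreover have "finite (Pow ?D)" using finD by simp
   ultimately show ?thesis by (simp only: sum.inter_filter) (intro sum.cong, auto)
   qed
   also have "... = (\<Prod>C\<in>?D - {?L}. 1 + Q * ucl u C)" by (rule sum_Pow_prod1[OF fin'])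
   finally have 1: "(\<Sum>B\<in>Pow ?D. ?b B * of_bool (en e Int \<Union>B = {})) = (\<Prod>C\<in>?D - {?L}. 1 + Q * ucl u C)" .
   \<comment> \<open>Leaving out the factor of \<open>?L\<close> amounts to colouring
     \<open>?L\<close> red, so the quotient of 1 by 2 is the probability
     \<open>r ?L\<close>.\<close>
   have 2: "(\<Sum>B\<in>Pow ?D. ?b B) = (1 + Q * ucl u ?L) * (\<Prod>C\<in>?D - {?L}. 1 + Q * ucl u C)"
   unfolding sum_Pow_prod1[OF finD] by (rule prod.remove[OF finD L])
   have "en e - ?K = {v}" using yv by auto
   moreover have "1 + Q * ucl u ?L ~= 0" using one_le(1)[of ?L] by linarith
   ultimately show ?thesis unfolding 1 2 using False eA by (simp add: r_def)
   qed
  qed simp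
  also have "... = (\<Sum>B\<in>Pow ?D. ?b B) * ?H" unfolding HH_def by (simp add: sum_distrib_left)
  finally show ?thesis .
 qed
 have "(\<Sum>B\<in>Pow ?D. ?b B) * exp (th * ?H - th\<^sup>2 * ?N) =
  (\<Sum>B\<in>Pow ?D. ?b B * (exp (th * ?H - th\<^sup>2 * ?N) * (1 + th * (?h B - ?H))))"
 proof -
  have "(\<Sum>B\<in>Pow ?D. ?b B * (exp (th * ?H - th\<^sup>2 * ?N) * (1 + th * (?h B - ?H)))) =
   (\<Sum>B\<in>Pow ?D. exp (th * ?H - th\<^sup>2 * ?N) * (?b B + th * (?b B * ?h B - ?b B * ?H)))" by (intro sum.cong) (auto simp: algebra_simps)
  also have "... = exp (th * ?H - th\<^sup>2 * ?N) * ((\<Sum>B\<in>Pow ?D. ?b B) + th * ((\<Sum>B\<in>Pow ?D. ?b B * ?h B) - (\<Sum>B\<in>Pow ?D. ?b B) * ?H))"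
   by (simp only: sum_distrib_left[symmetric] sum.distrib sum_subtractf sum_distrib_right[symmetric])
  finally show ?thesis unfolding mean by simp
 qed
 also have "... <= (\<Sum>B\<in>Pow ?D. ?b B * exp (\<Sum>e\<in>touchY T a A (\<Union>B). th * (p e - of_bool (e : A)) - th\<^sup>2))"
 proof (intro sum_mono mult_left_mono b0)
  fix B
  let ?n = "real (card (touchY T a A (\<Union>B)))"
  have "exp (th * ?H - th\<^sup>2 * ?N) * (1 + th * (?h B - ?H)) <= exp (th * ?H - th\<^sup>2 * ?N) * exp (th * (?h B - ?H))"
   by (intro mult_left_mono exp_ge_add_one_self) auto
  also have "... = exp (th * ?h B - th\<^sup>2 * ?N)" unfolding exp_add[symmetric] by (simp add: algebra_simps)
  also have "... <= exp (th * ?h B - th\<^sup>2 * ?n)"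
  proof -
   have "?n <= ?N" unfolding touchY_def by (intro of_nat_mono card_mono finS) auto
   then show ?thesis by (simp add: mult_left_mono)
  qed
  also have "th * ?h B - th\<^sup>2 * ?n = (\<Sum>e\<in>touchY T a A (\<Union>B). th * (p e - of_bool (e : A)) - th\<^sup>2)"
   by (simp only: right_diff_distrib sum_subtractf sum_distrib_left sum_constant) (simp add: mult.commute)
  finally show "exp (th * ?H - th\<^sup>2 * ?N) * (1 + th * (?h B - ?H)) \<le>
   exp (\<Sum>e\<in>touchY T a A (\<Union>B). th * (p e - of_bool (e : A)) - th\<^sup>2)" .
 qed
 also have "... = (\<Sum>Y\<in>sat a A. blue A Y * exp (\<Sum>e\<in>touchY T a A Y. th * (p e - of_bool (e : A)) - th\<^sup>2))"
  by (rule sum_sat[OF A a, of "%Y. exp (\<Sum>e\<in>touchY T a A Y. th * (p e - of_bool (e : A)) - th\<^sup>2)"])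
 finally have "(\<Prod>e\<in>A. x e) * ((\<Sum>B\<in>Pow ?D. ?b B) * exp (th * ?H - th\<^sup>2 * ?N)) <= (\<Prod>e\<in>A. x e) *
  (\<Sum>Y\<in>sat a A. blue A Y * exp (\<Sum>e\<in>touchY T a A Y. th * (p e - of_bool (e : A)) - th\<^sup>2))" by (intro mult_left_mono prod_nonneg) (auto simp: x)
 then show ?thesis unfolding r_def mult.assoc[symmetric] wt_root[OF A a] .
qed

text \<open>Sum over the blue vertex set \<open>Y\<close> first. No open edge joins red to blue, so
  the configuration splits into edges inside \<open>Y\<close>, which carry the blue weight, and
  edges disjoint from \<open>Y\<close>, whose weight is a pure product. The observable sees only the
  latter.\<close>

lemma colour_swap:
 assumes a: "a : W"
  and f: "!!A A' Y. A \<subseteq> F ==> A' = {e : A. en e Int Y = {}} ==> Y : sat a A ==> f A Y = g A' Y"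
 shows "(\<Sum>A\<in>Pow F. (\<Prod>e\<in>A. x e) * (\<Sum>Y\<in>sat a A. blue A Y * f A Y)) =
  (\<Sum>Y\<in>Pow (W - {a}). \<Sum>A2\<in>Pow {e : F. en e Int Y ~= {} & en e \<subseteq> Y}. (\<Prod>e\<in>A2. x e) * blue A2 Y *
   (\<Sum>A1\<in>Pow {e : F. en e Int Y = {}}. (\<Prod>e\<in>A1. x e) * g A1 Y))"
proof -
 have fin: "finite (Pow (W - {a}))" using fin_W by auto
 have satY: "Y : sat a A \<longleftrightarrow> Y : Pow (W - {a}) & A <= {e : F. en e Int Y = {}} Un {e : F. en e Int Y ~= {} & en e \<subseteq> Y}"
  if "A \<subseteq> F" for A Y using that by (auto simp: sat_def)
 have "(\<Sum>A\<in>Pow F. (\<Prod>e\<in>A. x e) * (\<Sum>Y\<in>sat a A. blue A Y * f A Y)) =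
  (\<Sum>A\<in>Pow F. \<Sum>Y\<in>Pow (W - {a}). if Y : sat a A then (\<Prod>e\<in>A. x e) * (blue A Y * f A Y) else 0)"
 proof (rule sum.cong)
  fix A assume "A : Pow F"
  have "sat a A = {Y : Pow (W - {a}). Y : sat a A}" by (auto simp: sat_def)
  then have "(\<Sum>Y\<in>sat a A. blue A Y * f A Y) = (\<Sum>Y\<in>Pow (W - {a}). if Y : sat a A then blue A Y * f A Y else 0)"
   using sum.inter_filter[OF fin, of "%Y. blue A Y * f A Y" "%Y. Y : sat a A"] by simp
  then show "(\<Prod>e\<in>A. x e) * (\<Sum>Y\<in>sat a A. blue A Y * f A Y) =
   (\<Sum>Y\<in>Pow (W - {a}). if Y : sat a A then (\<Prod>e\<in>A. x e) * (blue A Y * f A Y) else 0)" by (simp add: sum_distrib_left if_distrib cong: if_cong)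
 qed simp
 also have "... = (\<Sum>Y\<in>Pow (W - {a}). \<Sum>A\<in>Pow F. if Y : sat a A then (\<Prod>e\<in>A. x e) * (blue A Y * f A Y) else 0)" by (rule sum.swap)
 also have "... = (\<Sum>Y\<in>Pow (W - {a}). \<Sum>A2\<in>Pow {e : F. en e Int Y ~= {} & en e \<subseteq> Y}. (\<Prod>e\<in>A2. x e) * blue A2 Y *
   (\<Sum>A1\<in>Pow {e : F. en e Int Y = {}}. (\<Prod>e\<in>A1. x e) * g A1 Y))"
 proof (rule sum.cong)
  fix Y assume Y: "Y : Pow (W - {a})"
  let ?F1 = "{e : F. en e Int Y = {}}" and ?F2 = "{e : F. en e Int Y ~= {} & en e \<subseteq> Y}"
  have F12: "finite ?F1" "finite ?F2" "?F1 Int ?F2 = {}" using finF by auto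
  have "Pow (?F1 Un ?F2) = {A : Pow F. Y : sat a A}"
  proof -
   have "?F1 Un ?F2 \<subseteq> F" by auto
   then show ?thesis using satY[of _ Y] Y by blast
  qed
  then have "(\<Sum>A\<in>Pow F. if Y : sat a A then (\<Prod>e\<in>A. x e) * (blue A Y * f A Y) else 0) =
   (\<Sum>A\<in>Pow (?F1 Un ?F2). (\<Prod>e\<in>A. x e) * (blue A Y * f A Y))"
   using sum.inter_filter[of "Pow F" "%A. (\<Prod>e\<in>A. x e) * (blue A Y * f A Y)" "%A. Y : sat a A"] finF by simp
  also have "... = (\<Sum>A2\<in>Pow ?F2. \<Sum>A1\<in>Pow ?F1. (\<Prod>e\<in>A1 Un A2. x e) * (blue (A1 Un A2) Y * f (A1 Un A2) Y))" by (rule sum_Pow_Un[OF F12])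
  also have "... = (\<Sum>A2\<in>Pow ?F2. \<Sum>A1\<in>Pow ?F1. (\<Prod>e\<in>A2. x e) * blue A2 Y * ((\<Prod>e\<in>A1. x e) * g A1 Y))"
  proof (intro sum.cong refl)
   fix A2 A1 assume A: "A2 : Pow ?F2" "A1 : Pow ?F1"
   have A12: "finite A1" "finite A2" "A1 Int A2 = {}" "A1 Un A2 \<subseteq> F" using A F12 by (auto intro: finite_subset)
   have s: "Y : sat a (A1 Un A2)" using satY[OF A12(4)] Y A by auto
   have "cl en (A1 Un A2) y = cl en A2 y" if "y : Y" for y
   proof
   have Y2: "cl en A2 y \<subseteq> Y" using that A by (intro cl_least) auto
   show "cl en (A1 Un A2) y <= cl en A2 y"
   proof (rule cl_least)
   fix e assume e: "e : A1 Un A2" "en e Int cl en A2 y ~= {}"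
   have "en e Int Y ~= {}" using e(2) Y2 by blast
   then have "e : A2" using e(1) A by blast
   then show "en e <= cl en A2 y" using e cl_edge[OF edgy, of e A2 _ y] by blast
   qed simp
   qed (rule cl_mono, auto)
   then have bl: "blue (A1 Un A2) Y = blue A2 Y" unfolding blue_def by simp
   have "{e : A1 Un A2. en e Int Y = {}} = A1" using A by auto
   then have "f (A1 Un A2) Y = g A1 Y" using f[OF A12(4) _ s] by simp
   then show "(\<Prod>e\<in>A1 Un A2. x e) * (blue (A1 Un A2) Y * f (A1 Un A2) Y) =
   (\<Prod>e\<in>A2. x e) * blue A2 Y * ((\<Prod>e\<in>A1. x e) * g A1 Y)" using A12 bl by (simp add: prod.union_disjoint)
  qed
  finally show "(\<Sum>A\<in>Pow F. if Y : sat a A then (\<Prod>e\<in>A. x e) * (blue A Y * f A Y) else 0) =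
   (\<Sum>A2\<in>Pow ?F2. (\<Prod>e\<in>A2. x e) * blue A2 Y * (\<Sum>A1\<in>Pow ?F1. (\<Prod>e\<in>A1. x e) * g A1 Y))" by (simp add: sum_distrib_left)
 qed simp
 finally show ?thesis .
qed

text \<open>Colour every cluster blue with odds \<open>Q * ucl u C\<close> and red otherwise. Given the set of blue
 vertices, the edges between red vertices are independent, so exploring the cluster of a red
 vertex gives an exponential supermartingale.\<close>

lemma tilt:
 assumes a: "a : W" and T: "T \<subseteq> F" and th: "0 <= th" "th <= 1"
 defines "r \<equiv> %C. 1 / (1 + Q * ucl u C)" and "p \<equiv> %e. x e / (1 + x e)"
 shows "E (%A. r (cl en A a) * exp (th * HH en r p T a A - th\<^sup>2 * card (touch en T (cl en A a)))) <= 1"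
proof -
 let ?t0 = "%e. if e : T then exp (th * p e - th\<^sup>2) else 1"
 let ?t1 = "%e. if e : T then exp (th * (p e - 1) - th\<^sup>2) else 1"
 let ?f = "%A Y. exp (\<Sum>e\<in>touchY T a A Y. th * (p e - of_bool (e : A)) - th\<^sup>2)"
 let ?g = "%A Y. \<Prod>e\<in>{e : {e : F. en e Int Y = {}}. en e Int (\<Union>a\<in>{a}. cl en A a) ~= {}}. if e : A then ?t1 e else ?t0 e"
 \<comment> \<open>The cluster of the red root uses no edge that meets \<open>Y\<close>, so it can
   be computed in the red part alone.\<close>
 have fg: "?f A Y = ?g A' Y" if A: "A \<subseteq> F" "A' = {e : A. en e Int Y = {}}" "Y : sat a A" for A A' Y
 proof -
  have c: "cl en A a = cl en A' a"
  proof
   show "cl en A a <= cl en A' a"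
   proof (rule cl_least)
   fix e assume e: "e : A" "en e Int cl en A' a ~= {}"
   have "cl en A' a <= cl en A a" by (rule cl_mono) (use A in auto)
   then have "\<not> en e \<subseteq> Y" using e(2) sat_cl_root[OF A(3)] by blast
   then have "en e Int Y = {}" using e(1) A(3) unfolding sat_def by blast
   then have "e : A'" using A e by auto
   then show "en e <= cl en A' a" using e cl_edge[OF edgy, of e A' _ a] by blast
   qed simp
  qed (rule cl_mono, use A in auto)
  have fin: "finite {e : F. en e Int Y = {} & en e Int cl en A' a ~= {}}" using finF by auto
  have "?f A Y = (\<Prod>e\<in>touchY T a A Y. exp (th * (p e - of_bool (e : A)) - th\<^sup>2))"
   by (rule exp_sum) (use T finF finite_subset in \<open>fastforce simp: touchY_def touch_def\<close>)
  also have "... = (\<Prod>e\<in>{e : F. en e Int Y = {} & en e Int cl en A' a ~= {}}.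
   if e : T then exp (th * (p e - of_bool (e : A)) - th\<^sup>2) else 1)"
  proof (rule prod.mono_neutral_cong_left[OF fin])
   show "touchY T a A Y <= {e : F. en e Int Y = {} & en e Int cl en A' a ~= {}}" using T c by (auto simp: touchY_def touch_def)
  qed (auto simp: touchY_def touch_def c)
  also have "... = ?g A' Y" by (rule prod.cong) (use A in auto)
  finally show ?thesis .
 qed
 have "(\<Sum>A\<in>Pow F. (r (cl en A a) * exp (th * HH en r p T a A - th\<^sup>2 * card (touch en T (cl en A a)))) * w A) \<le>
   (\<Sum>A\<in>Pow F. (\<Prod>e\<in>A. x e) * (\<Sum>Y\<in>sat a A. blue A Y * ?f A Y))"
  using jensen_colours[OF _ a T th(1), of _ p] by (intro sum_mono) (auto simp: r_def mult.commute)
 also have "... = (\<Sum>Y\<in>Pow (W - {a}). \<Sum>A2\<in>Pow {e : F. en e Int Y ~= {} & en e \<subseteq> Y}. (\<Prod>e\<in>A2. x e) * blue A2 Y *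
   (\<Sum>A1\<in>Pow {e : F. en e Int Y = {}}. (\<Prod>e\<in>A1. x e) * ?g A1 Y))" by (rule colour_swap[OF a fg])
 also have "... <= (\<Sum>Y\<in>Pow (W - {a}). \<Sum>A2\<in>Pow {e : F. en e Int Y ~= {} & en e \<subseteq> Y}. (\<Prod>e\<in>A2. x e) * blue A2 Y *
   (\<Sum>A1\<in>Pow {e : F. en e Int Y = {}}. (\<Prod>e\<in>A1. x e) * 1))"
 proof (rule sum_mono, rule sum_mono, rule mult_left_mono)
  fix Y A2
  have "(\<Sum>A1\<in>Pow {e : F. en e Int Y = {}}. (\<Prod>e\<in>A1. x e) * ?g A1 Y) <= (\<Prod>e\<in>{e : F. en e Int Y = {}}. 1 + x e)"
   by (rule explore) (use finF edgy x two_point_exp[OF th x] in \<open>auto simp: p_def\<close>)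
  also have "... = (\<Sum>A1\<in>Pow {e : F. en e Int Y = {}}. (\<Prod>e\<in>A1. x e) * 1)" using finF by (simp add: sum_Pow_prod1)
  finally show "(\<Sum>A1\<in>Pow {e : F. en e Int Y = {}}. (\<Prod>e\<in>A1. x e) * ?g A1 Y) \<le>
   (\<Sum>A1\<in>Pow {e : F. en e Int Y = {}}. (\<Prod>e\<in>A1. x e) * 1)" .
  show "0 <= (\<Prod>e\<in>A2. x e) * blue A2 Y" by (intro mult_nonneg_nonneg prod_nonneg blue_nonneg) (auto simp: x)
 qed
 also have "... = (\<Sum>A\<in>Pow F. (\<Prod>e\<in>A. x e) * (\<Sum>Y\<in>sat a A. blue A Y * 1))" by (rule colour_swap[OF a, symmetric]) simp
 also have "... <= (\<Sum>A\<in>Pow F. w A)"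
 proof (rule sum_mono)
  fix A assume "A : Pow F"
  then have A: "A \<subseteq> F" by simp
  have "(\<Prod>e\<in>A. x e) * (\<Sum>Y\<in>sat a A. blue A Y * 1) = w A * r (cl en A a)" using wt_root[OF A a] sum_sat[OF A a, of "%_. 1"] by (simp add: r_def)
  also have "... <= w A * 1" using wt_nonneg one_le(1) by (intro mult_left_mono) (auto simp: r_def divide_le_eq)
  finally show "(\<Prod>e\<in>A. x e) * (\<Sum>Y\<in>sat a A. blue A Y * 1) <= w A" by simp
 qed
 finally show ?thesis unfolding EE_def using wt_sum_pos by (simp add: divide_le_eq)
qed

end

section \<open>The mass transport principle\<close>

lemma finite_index_prefix:
 assumes "countable (UNIV :: 'a set)" shows "finite {v :: 'a. to_nat_on UNIV v <= k}"
proof -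
 have "inj_on (to_nat_on (UNIV :: 'a set)) {v. to_nat_on UNIV v <= k}" using inj_on_to_nat_on[OF assms] by (rule inj_on_subset) auto
 moreover have "to_nat_on (UNIV :: 'a set) ` {v. to_nat_on UNIV v <= k} <= {..k}" by auto
 ultimately show ?thesis using finite_imageD finite_subset by blast
qed

lemma eventually_index_prefix:
 assumes "finite A" shows "\<forall>\<^sub>F k in sequentially. A <= {v. to_nat_on UNIV v <= k}"
proof -
 have "\<forall>\<^sub>F k in sequentially. \<forall>v\<in>A. to_nat_on UNIV v <= k" by (intro eventually_ball_finite assms ballI eventually_ge_at_top)
 then show ?thesis by eventually_elim auto
qed

locale wgraph =
 fixes ep :: "'e => 'v set" and J :: "'e => real"
 assumes wg: "weighted_graph ep J" and inf: "infinite (UNIV :: 'v set)"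
  and conn: "graph_connected ep" and transV: "vertex_transitive ep J"
begin

lemma card_ep: "card (ep e) = 2" using wg by (simp add: weighted_graph_def)
lemma J_pos: "J e > 0" using wg by (simp add: weighted_graph_def)
lemma J_summable: "J summable_on {e. v : ep e}" using wg by (simp add: weighted_graph_def)
lemma countable_V: "countable (UNIV :: 'v set)" using wg by (simp add: weighted_graph_def)
lemma countable_E: "countable (UNIV :: 'e set)" using wg by (simp add: weighted_graph_def)

lemma edgy_ep: "edgy ep" using card_ep unfolding edgy_def card_2_iff by blast

lemma finite_ep: "finite (ep e)" using card_ep[of e] card.infinite by fastforce

text \<open>The substitute for local finiteness: degrees may be infinite, but the couplings at a
  vertex are summable.\<close>

lemma finite_strong:
 assumes "eps > 0" shows "finite {e. v : ep e & eps <= J e}"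
proof (rule ccontr)
 assume "infinite {e. v : ep e & eps <= J e}"
 define s where "s = infsum J {e. v : ep e}"
 obtain n :: nat where n: "s / eps < n" using reals_Archimedean2 by blast
 obtain B where B: "B <= {e. v : ep e & eps <= J e}" "finite B" "card B = n" using \<open>infinite _\<close> infinite_arbitrarily_large by metis
 have "real n * eps <= sum J B" using B sum_bounded_below[of B eps J] by auto
 also have "... <= s" unfolding s_def by (rule finite_sum_le_infsum[OF J_summable]) (use B J_pos less_imp_le in auto)
 finally show False using n assms by (simp add: divide_less_eq)
qed

lemma aut_iff: "g : Aut ep J \<longleftrightarrow> bij (fst g) & bij (snd g) & (\<forall>e. ep (snd g e) = fst g ` ep e) & (\<forall>e. J (snd g e) = J e)"
 by (auto simp: Aut_def split: prod.splits)

lemma aut_id: "(id, id) : Aut ep J" by (simp add: aut_iff)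

lemma aut_mult_in: "g : Aut ep J ==> k : Aut ep J ==> aut_mult g k : Aut ep J" by (auto simp: aut_iff aut_mult_def bij_comp image_comp)

lemma aut_inv:
 assumes "g : Aut ep J" shows "(inv (fst g), inv (snd g)) : Aut ep J"
proof -
 have g: "bij (fst g)" "bij (snd g)" "!!e. ep (snd g e) = fst g ` ep e" "!!e. J (snd g e) = J e" using assms by (auto simp: aut_iff)
 have s: "snd g (inv (snd g) e) = e" for e using g(2) by (simp add: bij_is_surj surj_f_inv_f)
 have "ep (inv (snd g) e) = inv (fst g) ` ep e" for e
 proof -
  have "ep e = fst g ` ep (inv (snd g) e)" using g(3)[of "inv (snd g) e"] s by simp
  then show ?thesis using g(1) by (simp add: bij_is_inj image_inv_f_f)
 qed
 moreover have "J (inv (snd g) e) = J e" for e using g(4)[of "inv (snd g) e"] s by simp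
 ultimately show ?thesis using g by (simp add: aut_iff bij_imp_bij_inv)
qed

abbreviation "Tp \<equiv> aut_topology ep J"

lemma openin_vertex: "openin Tp {g : Aut ep J. fst g a = b}"
proof -
 let ?X = "prod_topology (product_topology (%_. discrete_topology (UNIV :: 'v set)) (UNIV :: 'v set))
  (product_topology (%_. discrete_topology (UNIV :: 'e set)) (UNIV :: 'e set))"
 have c: "continuous_map ?X (discrete_topology UNIV) (%g. fst g a)" using continuous_map_compose[OF continuous_map_fst continuous_map_product_projection[of a UNIV]]
  by (simp add: o_def)
 have "openin ?X {g : topspace ?X. fst g a : {b}}" using c by (rule openin_continuous_map_preimage) simp
 then have "openin Tp (Aut ep J Int {g. fst g a = b})" unfolding aut_topology_def openin_subtopology by auto
 then show ?thesis by (simp add: Collect_conj_eq Int_commute)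
qed

definition orbV :: "'v => 'v => 'v set" where
 "orbV a b = {fst g b | g. g : Aut ep J & fst g a = a}"
definition orbE :: "'v => 'e => 'e set" where
 "orbE a e = {snd g e | g. g : Aut ep J & fst g a = a}"

text \<open>Automorphisms preserve \<open>J\<close>. Along a path from \<open>a\<close>, an edge at
  a vertex of finite orbit can therefore only move among the finitely many edges at that orbit whose
  coupling is no smaller than its own.\<close>

lemma finite_orbits: "finite (orbV a b)" "finite (orbE a e)"
proof -
 have fin_step: "finite (orbE a e)" if "finite (orbV a v)" "v : ep e" for v e
 proof -
  have "orbE a e <= (\<Union>w\<in>orbV a v. {f. w : ep f & J e <= J f})"
  proof
   fix f assume "f : orbE a e"
   then obtain g where g: "g : Aut ep J" "fst g a = a" "f = snd g e" unfolding orbE_def by auto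
   then have "fst g v : orbV a v" "fst g v : ep f" "J e <= J f" using that(2) by (auto simp: orbV_def aut_iff)
   then show "f : (\<Union>w\<in>orbV a v. {f. w : ep f & J e <= J f})" by auto
  qed
  then show ?thesis using that(1) finite_strong[OF J_pos] by (meson finite_UN_I finite_subset)
 qed
 have V: "finite (orbV a b)" for b
 proof -
  have "(a, b) : (graph_adj ep)\<^sup>*" using conn by (simp add: graph_connected_def)
  then show ?thesis
  proof induction
   case base
   have "orbV a a <= {a}" by (auto simp: orbV_def)
   then show ?case using finite_subset by blast
  next
   case (step y z)
   then obtain e where e: "ep e = {y, z}" by (auto simp: graph_adj_def)
   then have "finite (orbE a e)" using fin_step[of y e] step.IH by simp
   have "orbV a z <= (\<Union>f\<in>orbE a e. ep f)"
   proof
   fix b assume "b : orbV a z"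
   then obtain g where g: "g : Aut ep J" "fst g a = a" "b = fst g z" by (auto simp: orbV_def)
   then have "b : ep (snd g e)" using e by (auto simp: aut_iff)
   moreover have "snd g e : orbE a e" using g unfolding orbE_def by blast
   ultimately show "b : (\<Union>f\<in>orbE a e. ep f)" by blast
   qed
   moreover have "finite (\<Union>f\<in>orbE a e. ep f)" using \<open>finite (orbE a e)\<close> finite_ep by blast
   ultimately show ?case by (rule finite_subset)
  qed
 qed
 show "finite (orbV a b)" by (rule V)
 obtain v where "v : ep e" using card_ep[of e] by (metis card_2_iff insertI1)
 then show "finite (orbE a e)" using fin_step V by blast
qed

text \<open>The stabiliser is cut out of a compact product of finite orbits by closed conditions,
  each on finitely many coordinates. Surjectivity is not such a condition; it is recovered because
  an injection of a finite orbit into itself is onto.\<close>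

lemma compact_stabilizer: "compactin Tp {g : Aut ep J. fst g a = a}"
proof -
 let ?XV = "product_topology (%_. discrete_topology (UNIV :: 'v set)) (UNIV :: 'v set)"
 let ?XE = "product_topology (%_. discrete_topology (UNIV :: 'e set)) (UNIV :: 'e set)"
 let ?X = "prod_topology ?XV ?XE"
 let ?S = "{g : Aut ep J. fst g a = a}"
 let ?P = "(\<Pi>\<^sub>E b\<in>UNIV. orbV a b) \<times> (\<Pi>\<^sub>E e\<in>UNIV. orbE a e)"
 have comp: "compactin ?X ?P" unfolding compactin_Times by (intro disjI2 conjI) (auto simp: compactin_PiE finite_orbits compactin_discrete_topology)
 have cV: "continuous_map ?X (discrete_topology UNIV) (%g. fst g b)" for b
  using continuous_map_compose[OF continuous_map_fst continuous_map_product_projection[of b UNIV]] by (simp add: o_def)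
 have cE: "continuous_map ?X (discrete_topology UNIV) (%g. snd g e)" for e
  using continuous_map_compose[OF continuous_map_snd continuous_map_product_projection[of e UNIV]] by (simp add: o_def)
 have clV: "closedin ?X {g. fst g b : B}" for b B using closedin_continuous_map_preimage[OF cV, of B b] by simp
 have clE: "closedin ?X {g. snd g e : B}" for e B using closedin_continuous_map_preimage[OF cE, of B e] by simp
 have cl2V: "closedin ?X {g. R (fst g b) (fst g c)}" for b c and R :: "'v => 'v => bool"
 proof -
  have "continuous_map ?X (prod_topology (discrete_topology UNIV) (discrete_topology UNIV)) (%g. (fst g b, fst g c))" using cV by (simp add: continuous_map_pairedI)
  then have "continuous_map ?X (discrete_topology UNIV) (%g. (fst g b, fst g c))" by (simp add: prod_topology_discrete_topology[symmetric])
  from closedin_continuous_map_preimage[OF this, of "{(y, z). R y z}"] show ?thesis by simp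
 qed
 have cl2E: "closedin ?X {g. R (snd g b) (snd g c)}" for b c and R :: "'e => 'e => bool"
 proof -
  have "continuous_map ?X (prod_topology (discrete_topology UNIV) (discrete_topology UNIV)) (%g. (snd g b, snd g c))" using cE by (simp add: continuous_map_pairedI)
  then have "continuous_map ?X (discrete_topology UNIV) (%g. (snd g b, snd g c))" by (simp add: prod_topology_discrete_topology[symmetric])
  from closedin_continuous_map_preimage[OF this, of "{(y, z). R y z}"] show ?thesis by simp
 qed
 have cl3: "closedin ?X {g. ep (snd g e) = {fst g b, fst g c}}" for e b c
 proof -
  have "continuous_map ?X (prod_topology (discrete_topology UNIV) (prod_topology (discrete_topology UNIV) (discrete_topology UNIV)))
   (%g. (snd g e, fst g b, fst g c))" using cV cE by (simp add: continuous_map_pairedI)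
  then have "continuous_map ?X (discrete_topology UNIV) (%g. (snd g e, fst g b, fst g c))" by (simp add: prod_topology_discrete_topology[symmetric])
  from closedin_continuous_map_preimage[OF this, of "{(x, y, z). ep x = {y, z}}"] show ?thesis by simp
 qed
 let ?C = "\<Inter> ({{g. fst g b = fst g c --> b = c} | b c. True} Un {{g. snd g b = snd g c --> b = c} | b c. True} \<union>
  {{g. ep (snd g e) = {fst g b, fst g c}} | e b c. ep e = {b, c}} Un {{g. snd g e : {f. J f = J e}} | e. True} \<union>
  {{g. fst g a : {a}}})"
 have "closedin ?X ?C" by (rule closedin_Inter) (use clV clE cl2V cl2E cl3 in \<open>auto intro: clV[of a "{a}", simplified]\<close>)
 then have "compactin ?X (?P Int ?C)" using comp compact_Int_closedin by blast
 moreover have "?P Int ?C = ?S"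
 proof
  show "?S \<subseteq> ?P Int ?C"
  proof
   fix g assume g: "g : ?S"
   then have "fst g b : orbV a b" "snd g e : orbE a e" for b e unfolding orbV_def orbE_def by blast+
   then have "g : ?P" by (cases g) (auto simp: PiE_def)
   moreover have "g : ?C" using g by (auto simp: aut_iff bij_def inj_def)
   ultimately show "g : ?P Int ?C" by blast
  qed
  show "?P Int ?C \<subseteq> ?S"
  proof
   fix g assume g: "g : ?P Int ?C"
   then have gC: "g : ?C" by (rule IntD2)
   have P: "fst g b : orbV a b" "snd g e : orbE a e" for b e using g by (cases g, auto simp: PiE_def)+
   have "g : {g. fst g b = fst g c --> b = c}" for b c by (rule InterD[OF gC]) blast
   then have injV: "inj (fst g)" by (auto simp: inj_def)
   have "g : {g. snd g b = snd g c --> b = c}" for b c by (rule InterD[OF gC]) blast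
   then have injE: "inj (snd g)" by (auto simp: inj_def)
   have e3: "ep (snd g e) = {fst g b, fst g c}" if "ep e = {b, c}" for e b c
   proof -
   have "g : {g. ep (snd g e) = {fst g b, fst g c}}" by (rule InterD[OF gC]) (use that in blast)
   then show ?thesis by simp
   qed
   have ep: "ep (snd g e) = fst g ` ep e" for e
   proof -
   obtain b c where "ep e = {b, c}" using edgy_ep unfolding edgy_def by blast
   then show ?thesis using e3 by simp
   qed
   have J: "J (snd g e) = J e" for e
   proof -
   have "g : {g. snd g e : {f. J f = J e}}" by (rule InterD[OF gC]) blast
   then show ?thesis by simp
   qed
   have a: "fst g a = a"
   proof -
   have "g : {g. fst g a : {a}}" by (rule InterD[OF gC]) blast
   then show ?thesis by simp
   qed
   have orb1: "orbV a c \<subseteq> orbV a b" if "c : orbV a b" for b c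
   proof -
   obtain k where k: "k : Aut ep J" "fst k a = a" "c = fst k b" using \<open>c : orbV a b\<close> by (auto simp: orbV_def)
   show ?thesis
   proof
   fix d assume "d : orbV a c"
   then obtain l where l: "l : Aut ep J" "fst l a = a" "d = fst l c" by (auto simp: orbV_def)
   have "d = fst (aut_mult l k) b" "fst (aut_mult l k) a = a" using k l by (auto simp: aut_mult_def)
   then show "d : orbV a b" using aut_mult_in[OF l(1) k(1)] unfolding orbV_def by blast
   qed
   qed
   have orb2: "orbE a c \<subseteq> orbE a b" if "c : orbE a b" for b c
   proof -
   obtain k where k: "k : Aut ep J" "fst k a = a" "c = snd k b" using \<open>c : orbE a b\<close> by (auto simp: orbE_def)
   show ?thesis
   proof
   fix d assume "d : orbE a c"
   then obtain l where l: "l : Aut ep J" "fst l a = a" "d = snd l c" by (auto simp: orbE_def)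
   have "d = snd (aut_mult l k) b" "fst (aut_mult l k) a = a" using k l by (auto simp: aut_mult_def)
   then show "d : orbE a b" using aut_mult_in[OF l(1) k(1)] unfolding orbE_def by blast
   qed
   qed
   have "b = fst (id, id) b" "e = snd (id, id) e" for b :: 'v and e :: 'e by auto
   then have refl: "b : orbV a b" "e : orbE a e" for b e using aut_id unfolding orbV_def orbE_def by (metis (mono_tags, lifting) CollectI fst_conv id_apply)+
   have "b : range (fst g)" for b
   proof -
   have "fst g ` orbV a b \<subseteq> orbV a b" using P(1) orb1 by blast
   then have "fst g ` orbV a b = orbV a b" using finite_orbits(1) injV by (meson endo_inj_surj inj_on_subset subset_UNIV)
   then show ?thesis using refl by blast
   qed
   moreover have "e : range (snd g)" for e
   proof -
   have "snd g ` orbE a e \<subseteq> orbE a e" using P(2) orb2 by blast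
   then have "snd g ` orbE a e = orbE a e" using finite_orbits(2) injE by (meson endo_inj_surj inj_on_subset subset_UNIV)
   then show ?thesis using refl by blast
   qed
   ultimately show "g : ?S" using injV injE ep J a by (auto simp: aut_iff bij_def)
  qed
 qed
 ultimately show ?thesis unfolding aut_topology_def compactin_subtopology by auto
qed

end

locale ugraph = wgraph ep J for ep :: "'e => 'v set" and J +
 assumes uni: "unimodular ep J"
begin

text \<open>Let \<open>S b c\<close> be the set of automorphisms sending \<open>b\<close> to
  \<open>c\<close>. Left translations give every \<open>S a b\<close> the same Haar measure and
  right translations every \<open>S b a\<close>; unimodularity lets one measure do both. Cut the
  group according to the image \<open>y\<close> of \<open>a\<close> and the preimage
  \<open>z\<close> of \<open>a\<close>: on a nonempty piece \<open>f a y = f z a\<close>, and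
  summing in the two orders gives the two sides. Compactness of stabilisers makes the common measure
  finite, so that it can be cancelled.\<close>

theorem mass_transport:
 fixes f :: "'v => 'v => ennreal"
 assumes inv: "!!g x y. g : Aut ep J ==> f (fst g x) (fst g y) = f x y"
 shows "(\<integral>\<^sup>+ y. f a y \<partial>count_space UNIV) = (\<integral>\<^sup>+ y. f y a \<partial>count_space UNIV)"
proof -
 from uni obtain \<mu> where \<mu>: "space \<mu> = Aut ep J" "sets \<mu> = sigma_sets (Aut ep J) {U. openin Tp U}"
  "!!K. compactin Tp K ==> emeasure \<mu> K < \<infinity>" "emeasure \<mu> (Aut ep J) ~= 0"
  "!!g A. g : Aut ep J ==> A : sets \<mu> ==> emeasure \<mu> (aut_mult g ` A) = emeasure \<mu> A"
  "!!g A. g : Aut ep J ==> A : sets \<mu> ==> emeasure \<mu> ((%k. aut_mult k g) ` A) = emeasure \<mu> A" unfolding unimodular_def by metis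
 define S where "S b c = {g : Aut ep J. fst g b = c}" for b c
 have Sm: "S b c : sets \<mu>" for b c unfolding \<mu>(2) S_def using openin_vertex by (auto intro!: sigma_sets.Basic)
 define m where "m = emeasure \<mu> (S a a)"
 have left: "emeasure \<mu> (S a b) = m" for b
 proof -
  obtain k where k: "k : Aut ep J" "fst k a = b" using transV unfolding vertex_transitive_def by blast
  have "aut_mult k ` S a a = S a b"
  proof
   show "aut_mult k ` S a a \<subseteq> S a b" using k aut_mult_in by (auto simp: S_def aut_mult_def)
   show "S a b \<subseteq> aut_mult k ` S a a"
   proof
   fix g assume g: "g : S a b"
   let ?k' = "(inv (fst k), inv (snd k))"
   have bk: "bij (fst k)" "bij (snd k)" using k by (auto simp: aut_iff)
   have "aut_mult ?k' g : Aut ep J" using g k aut_inv aut_mult_in by (auto simp: S_def)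
   moreover have "fst (aut_mult ?k' g) a = a" using g k bk by (auto simp: S_def aut_mult_def bij_is_inj)
   moreover have "aut_mult k (aut_mult ?k' g) = g" using bk by (simp add: aut_mult_def o_assoc surj_iff[THEN iffD1] bij_is_surj)
   ultimately show "g : aut_mult k ` S a a" unfolding S_def by force
   qed
  qed
  then show ?thesis using \<mu>(5)[OF k(1) Sm[of a a]] by (simp add: m_def)
 qed
 have right: "emeasure \<mu> (S b a) = m" for b
 proof -
  obtain k where k: "k : Aut ep J" "fst k b = a" using transV unfolding vertex_transitive_def by blast
  have "(%g. aut_mult g k) ` S a a = S b a"
  proof
   show "(%g. aut_mult g k) ` S a a \<subseteq> S b a" using k aut_mult_in by (auto simp: S_def aut_mult_def)
   show "S b a \<subseteq> (%g. aut_mult g k) ` S a a"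
   proof
   fix g assume g: "g : S b a"
   let ?k' = "(inv (fst k), inv (snd k))"
   have bk: "bij (fst k)" "bij (snd k)" using k by (auto simp: aut_iff)
   have "aut_mult g ?k' : Aut ep J" using g k aut_inv aut_mult_in by (auto simp: S_def)
   moreover have "fst (aut_mult g ?k') a = a"
   proof -
   have "inv (fst k) a = b" using k(2) bk(1) by (metis bij_is_inj inv_f_f)
   then show ?thesis using g by (auto simp: S_def aut_mult_def)
   qed
   moreover have "aut_mult (aut_mult g ?k') k = g" using bk by (simp add: aut_mult_def o_assoc[symmetric] inj_iff[THEN iffD1] bij_is_inj)
   ultimately show "g : (%g. aut_mult g k) ` S a a" unfolding S_def by force
   qed
  qed
  then show ?thesis using \<mu>(6)[OF k(1) Sm[of a a]] by (simp add: m_def)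
 qed
 have fin: "m ~= \<infinity>" using \<mu>(3)[OF compact_stabilizer[of a]] by (simp add: m_def S_def)
 \<comment> \<open>Otherwise countably many null sets would cover the group.\<close>
 have pos: "m ~= 0"
 proof
  assume "m = 0"
  have "Aut ep J = (\<Union>b. S a b)" by (auto simp: S_def)
  moreover have "(\<Union>b. S a b) : null_sets \<mu>"
   by (rule null_sets_UN'[OF countable_V]) (use left \<open>m = 0\<close> Sm in \<open>auto simp: null_sets_def\<close>)
  ultimately show False using \<mu>(4) by (auto simp: null_sets_def)
 qed
 have sum_em: "(\<integral>\<^sup>+ z. emeasure \<mu> (B Int R z) \<partial>count_space UNIV) = emeasure \<mu> B"
  if "!!z. R z : sets \<mu>" "disjoint_family R" "B : sets \<mu>" "B <= (\<Union>z. R z)" for R :: "'v => _" and B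
 proof -
  have "B = (\<Union>z. B Int R z)" using that(4) by auto
  moreover have "emeasure \<mu> (\<Union>z\<in>UNIV. B Int R z) = (\<integral>\<^sup>+ z. emeasure \<mu> (B Int R z) \<partial>count_space UNIV)"
   by (rule emeasure_UN_countable) (use that countable_V in \<open>auto simp: disjoint_family_on_def\<close>)
  ultimately show ?thesis by simp
 qed
 have disj: "disjoint_family (S b)" "disjoint_family (%z. S z c)" for b c by (auto simp: disjoint_family_on_def S_def aut_iff bij_def dest: injD)
 have cov: "S a b <= (\<Union>z. S z a)" "S b a <= (\<Union>z. S a z)" for b by (auto simp: S_def aut_iff bij_def surj_def) metis
 let ?C = "count_space (UNIV :: 'v set)"
 have key: "f a y * emeasure \<mu> (S a y Int S z a) = f z a * emeasure \<mu> (S a y Int S z a)" for y z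
 proof (cases "S a y Int S z a = {}")
  case False
  then obtain g where g: "g : Aut ep J" "fst g a = y" "fst g z = a" by (auto simp: S_def)
  have "f a y = f z a" using inv[OF g(1), of z a] g by simp
  then show ?thesis by simp
 qed simp
 have "m * (\<integral>\<^sup>+ y. f a y \<partial>?C) = (\<integral>\<^sup>+ y. f a y * emeasure \<mu> (S a y) \<partial>?C)"
  by (simp add: left nn_integral_cmult[symmetric] mult.commute)
 also have "... = (\<integral>\<^sup>+ y. f a y * (\<integral>\<^sup>+ z. emeasure \<mu> (S a y Int S z a) \<partial>?C) \<partial>?C)"
  using sum_em[of "%z. S z a"] Sm disj cov by simp
 also have "... = (\<integral>\<^sup>+ y. (\<integral>\<^sup>+ z. f a y * emeasure \<mu> (S a y Int S z a) \<partial>?C) \<partial>?C)" by (simp add: nn_integral_cmult)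
 also have "... = (\<integral>\<^sup>+ y. (\<integral>\<^sup>+ z. f z a * emeasure \<mu> (S a y Int S z a) \<partial>?C) \<partial>?C)" by (simp only: key)
 also have "... = (\<integral>\<^sup>+ z. (\<integral>\<^sup>+ y. f z a * emeasure \<mu> (S a y Int S z a) \<partial>?C) \<partial>?C)"
  by (rule nn_integral_count_space_nn_integral[OF countable_V]) simp
 also have "... = (\<integral>\<^sup>+ z. f z a * (\<integral>\<^sup>+ y. emeasure \<mu> (S z a Int S a y) \<partial>?C) \<partial>?C)"
  by (simp add: nn_integral_cmult Int_commute)
 also have "... = (\<integral>\<^sup>+ z. f z a * emeasure \<mu> (S z a) \<partial>?C)" using sum_em[of "S a"] Sm disj cov by simp
 also have "... = m * (\<integral>\<^sup>+ y. f y a \<partial>?C)" by (simp add: right nn_integral_cmult[symmetric] mult.commute)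
 finally show ?thesis using fin pos by (simp add: ennreal_mult_cancel_left)
qed

end

section \<open>Expansion and the spectral radius of the strong edges\<close>

context wgraph
begin

lemma J_nonneg: "0 <= J e" by (rule less_imp_le[OF J_pos])

lemma infsum_UN_le:
 assumes "finite K" and S: "!!v. v : K ==> J summable_on A v"
 shows "J summable_on (\<Union>v\<in>K. A v) & infsum J (\<Union>v\<in>K. A v) <= (\<Sum>v\<in>K. infsum J (A v))" using assms
proof (induction K rule: finite_induct)
 case empty then show ?case by simp
next
 case (insert v K)
 let ?U = "\<Union>v\<in>K. A v"
 have U: "J summable_on ?U" "infsum J ?U <= (\<Sum>v\<in>K. infsum J (A v))" using insert by auto
 have D: "J summable_on (A v - ?U)" using insert.prems[of v] by (rule summable_on_subset_banach) auto
 have eq: "(\<Union>v\<in>insert v K. A v) = ?U Un (A v - ?U)" by auto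
 have "J summable_on (?U Un (A v - ?U))" using U(1) D by (rule summable_on_Un_disjoint) auto
 moreover have "infsum J (?U Un (A v - ?U)) = infsum J ?U + infsum J (A v - ?U)" using U(1) D by (rule infsum_Un_disjoint) auto
 moreover have "infsum J (A v - ?U) <= infsum J (A v)" by (rule infsum_mono2[OF D]) (use insert.prems J_nonneg in auto)
 ultimately show ?case unfolding eq using U(2) insert.hyps by simp
qed

lemma infsum_aut:
 assumes "g : Aut ep J" "!!e. P (snd g e) \<longleftrightarrow> P e"
 shows "infsum J {e. fst g v : ep e & P e} = infsum J {e. v : ep e & P e}"
proof -
 have g: "bij (fst g)" "bij (snd g)" "!!e. ep (snd g e) = fst g ` ep e" "!!e. J (snd g e) = J e" using assms by (auto simp: aut_iff)
 have "{e. fst g v : ep e & P e} = snd g ` {e. v : ep e & P e}"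
 proof
  show "{e. fst g v : ep e & P e} \<subseteq> snd g ` {e. v : ep e & P e}"
  proof
   fix e assume e: "e : {e. fst g v : ep e & P e}"
   obtain f where f: "e = snd g f" using g(2) by (metis bij_pointE)
   then have "v : ep f" "P f" using e g assms(2) by (auto simp: bij_def dest: injD)
   then show "e : snd g ` {e. v : ep e & P e}" using f by auto
  qed
 qed (use g assms(2) in auto)
 moreover have "inj_on (snd g) {e. v : ep e & P e}" using g(2) by (meson bij_is_inj inj_on_subset subset_UNIV)
 ultimately show ?thesis using infsum_reindex[of "snd g" "{e. v : ep e & P e}" J] g(4) by (simp add: o_def)
qed

lemma infsum_const_v:
 assumes "!!g e. g : Aut ep J ==> P (snd g e) \<longleftrightarrow> P e"
 shows "infsum J {e. v : ep e & P e} = infsum J {e. w : ep e & P e}"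
proof -
 obtain g where "g : Aut ep J" "fst g w = v" using transV unfolding vertex_transitive_def by blast
 then show ?thesis using infsum_aut[of g P w] assms by simp
qed

lemma exists_edge: "\<exists>e. v : ep e"
proof -
 have "\<not> UNIV <= {v}" using inf finite_subset by blast
 then obtain w where w: "w ~= v" by auto
 have "(v, w) : (graph_adj ep)\<^sup>*" using conn by (simp add: graph_connected_def)
 then obtain z where "(v, z) : graph_adj ep" using w by (metis converse_rtranclE)
 then show ?thesis by (auto simp: graph_adj_def)
qed

lemma summable_P: "J summable_on {e. v : ep e & P e}" using J_summable[of v] by (rule summable_on_subset_banach) auto

text \<open>The tail of a convergent series at one vertex, carried to all vertices by
  transitivity.\<close>

lemma small_tail:
 assumes "dl > 0"
 shows "\<exists>eps>0. \<forall>v. infsum J {e. v : ep e & J e < eps} <= dl"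
proof -
 fix v0
 let ?s = "infsum J {e. v0 : ep e}"
 have "(J has_sum ?s) {e. v0 : ep e}" using J_summable by (simp add: has_sum_infsum)
 then have "(sum J \<longlongrightarrow> ?s) (finite_subsets_at_top {e. v0 : ep e})" by (simp add: has_sum_def)
 then have "\<forall>\<^sub>F B in finite_subsets_at_top {e. v0 : ep e}. dist (sum J B) ?s < dl" using assms tendstoD by blast
 then obtain B where B: "finite B" "B <= {e. v0 : ep e}" "dist (sum J B) ?s < dl" unfolding eventually_finite_subsets_at_top by (metis order_refl)
 define eps where "eps = Min (insert 1 (J ` B))"
 have eps: "eps > 0" unfolding eps_def using B J_pos by (subst Min_gr_iff) auto
 have epsB: "eps <= J e" if "e : B" for e unfolding eps_def using that B by (intro Min_le) auto
 have "infsum J {e. v0 : ep e & J e < eps} <= infsum J ({e. v0 : ep e} - B)"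
 proof (rule infsum_mono2[OF summable_P])
  show "J summable_on ({e. v0 : ep e} - B)" using J_summable[of v0] by (rule summable_on_subset_banach) auto
  show "{e. v0 : ep e & J e < eps} <= {e. v0 : ep e} - B" using epsB by fastforce
  show "0 <= J x" for x by (rule less_imp_le[OF J_pos])
 qed
 also have "... = ?s - sum J B" using infsum_Diff[OF J_summable[of v0], of B] B by simp
 also have "... <= dl" using B(3) by (auto simp: dist_real_def)
 finally have "infsum J {e. v0 : ep e & J e < eps} <= dl" .
 then have "infsum J {e. v : ep e & J e < eps} <= dl" for v using infsum_const_v[of "%e. J e < eps" v v0] by (auto simp: aut_iff)
 then show ?thesis using eps by blast
qed

lemma edge_boundary_subset: "edge_boundary ep K \<subseteq> edges_meeting ep K" unfolding edge_boundary_def edges_meeting_def using card_eq_0_iff by fastforce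

lemma edges_meeting_UN: "edges_meeting ep K = (\<Union>v\<in>K. {e. v : ep e})" unfolding edges_meeting_def by auto

text \<open>Nonamenability gives the boundary of \<open>K\<close> a weight at least proportional to
  \<open>card K\<close>. Edges below a suitable \<open>eps\<close> account for at most half of that
  bound, and every other edge weighs at most \<open>D\<close>, so strong boundary edges must be
  numerous.\<close>

theorem strong_expansion:
 assumes "nonamenable ep J"
 shows "\<exists>eps>0. \<exists>c::real. c > 0 & (\<forall>K. finite K --> c * real (card K) <= real (card {e. eps <= J e & card (ep e Int K) = 1}))"
proof -
 define h where "h = (INF K\<in>{K. finite K & K ~= {}}. infsum J (edge_boundary ep K) / infsum J (edges_meeting ep K))"
 have h0: "h > 0" using assms by (simp add: nonamenable_def h_def)
 have nn: "0 <= infsum J A" for A by (intro infsum_nonneg J_nonneg)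
 have h: "h <= infsum J (edge_boundary ep K) / infsum J (edges_meeting ep K)" if "finite K" "K ~= {}" for K
  unfolding h_def by (rule cINF_lower) (use that nn in \<open>auto intro!: bdd_belowI2[of _ 0]\<close>)
 fix v0
 obtain e0 where e0: "v0 : ep e0" using exists_edge by blast
 define eps1 where "eps1 = J e0"
 have eps1: "eps1 > 0" using J_pos by (simp add: eps1_def)
 have ex: "\<exists>e. v : ep e & J e = eps1" for v
 proof -
  obtain g where "g : Aut ep J" "fst g v0 = v" using transV unfolding vertex_transitive_def by blast
  then have "v : ep (snd g e0)" "J (snd g e0) = eps1" using e0 by (auto simp: aut_iff eps1_def)
  then show ?thesis by blast
 qed
 define D where "D = infsum J {e. v0 : ep e}"
 have D: "infsum J {e. v : ep e} = D" for v using infsum_const_v[of "%_. True" v v0] by (simp add: D_def)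
 have JD: "J e <= D" for e
 proof -
  obtain v where v: "v : ep e" using card_ep[of e] by (metis card_2_iff insertI1)
  have "sum J {e} <= infsum J {e. v : ep e}" by (rule finite_sum_le_infsum[OF J_summable]) (use v J_nonneg in auto)
  then show ?thesis by (simp add: D)
 qed
 have D0: "D > 0" using JD[of e0] J_pos[of e0] by linarith
 \<comment> \<open>The guaranteed boundary weight is \<open>h * eps1 / 2\<close> per vertex of
   \<open>K\<close>; this is half of it.\<close>
 define dl where "dl = h * eps1 / 4"
 have dl: "dl > 0" using h0 eps1 by (simp add: dl_def)
 obtain eps where eps: "eps > 0" "!!v. infsum J {e. v : ep e & J e < eps} <= dl" using small_tail[OF dl] by blast
 have main: "dl / D * card K <= card {e. eps <= J e & card (ep e Int K) = 1}" if K: "finite K" for K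
 proof (cases "K = {}")
  case False
  let ?M = "edges_meeting ep K" and ?B = "edge_boundary ep K"
  have sM: "J summable_on ?M" unfolding edges_meeting_UN using infsum_UN_le[OF K, of "%v. {e. v : ep e}"] J_summable by blast
  have UNw: "J summable_on (\<Union>v\<in>K. {e. v : ep e & J e < eps}) \<and>
   infsum J (\<Union>v\<in>K. {e. v : ep e & J e < eps}) <= (\<Sum>v\<in>K. infsum J {e. v : ep e & J e < eps})" by (rule infsum_UN_le[OF K]) (rule summable_P)
  have sub: "J summable_on A" if "A \<subseteq> ?M" for A using sM that by (rule summable_on_subset_banach)
  \<comment> \<open>Every vertex selects an edge of coupling \<open>eps1\<close> at it. An edge is
    selected by at most its two endpoints, whence the lower bound on the weight of the edges meeting
    \<open>K\<close>.\<close>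
  obtain pick where pick: "!!v. v : ep (pick v)" "!!v. J (pick v) = eps1" using ex by metis
  have "K <= (\<Union>e\<in>pick ` K. ep e)" using pick by auto
  then have "card K <= card (\<Union>e\<in>pick ` K. ep e)" by (rule card_mono[rotated]) (use K finite_ep in auto)
  also have "... <= (\<Sum>e\<in>pick ` K. card (ep e))" by (rule card_UN_le) (use K in auto)
  finally have cK: "card K <= 2 * card (pick ` K)" by (simp add: card_ep)
  have "sum J (pick ` K) = (\<Sum>e\<in>pick ` K. eps1)" using pick by (intro sum.cong) auto
  then have "eps1 * card (pick ` K) = sum J (pick ` K)" by simp
  also have "... <= infsum J ?M"
  proof (rule finite_sum_le_infsum[OF sM])
   show "pick ` K \<subseteq> ?M" unfolding edges_meeting_def using pick(1) by blast
  qed (use K J_nonneg in auto)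
  finally have "eps1 * card (pick ` K) <= infsum J ?M" .
  moreover have "eps1 * (real (card K) / 2) <= eps1 * card (pick ` K)" using cK eps1 by (intro mult_left_mono) linarith+
  ultimately have M: "eps1 / 2 * card K <= infsum J ?M" by (simp add: mult.commute)
  have M0: "infsum J ?M > 0"
  proof -
   have "0 < eps1 / 2 * card K" using eps1 K False by (simp add: card_gt_0_iff)
   then show ?thesis using M by linarith
  qed
  have "h * (eps1 / 2 * card K) <= h * infsum J ?M" using M h0 by (intro mult_left_mono) auto
  also have "... <= infsum J ?B" using h[OF K False] M0 by (simp add: le_divide_eq)
  also have "... = infsum J {e : ?B. eps <= J e} + infsum J {e : ?B. J e < eps}"
  proof -
   have "?B = {e : ?B. eps <= J e} Un {e : ?B. J e < eps}" by auto
   moreover have "infsum J ({e : ?B. eps <= J e} Un {e : ?B. J e < eps}) = infsum J {e : ?B. eps <= J e} + infsum J {e : ?B. J e < eps}"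
   by (rule infsum_Un_disjoint; (rule sub)?) (use edge_boundary_subset[of K] in auto)
   ultimately show ?thesis by simp
  qed
  also have "infsum J {e : ?B. J e < eps} <= infsum J (\<Union>v\<in>K. {e. v : ep e & J e < eps})"
  proof (rule infsum_mono2)
   show "J summable_on {e : ?B. J e < eps}" by (rule sub) (use edge_boundary_subset in auto)
   show "J summable_on (\<Union>v\<in>K. {e. v : ep e & J e < eps})" using UNw by blast
   show "{e : ?B. J e < eps} <= (\<Union>v\<in>K. {e. v : ep e & J e < eps})" using edge_boundary_subset[of K] by (auto simp: edges_meeting_def)
  qed (rule J_nonneg)
  also have "... <= (\<Sum>v\<in>K. infsum J {e. v : ep e & J e < eps})" using UNw by blast
  also have "... <= (\<Sum>v\<in>K. dl)" using eps(2) by (intro sum_mono) auto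
  also have "infsum J {e : ?B. eps <= J e} <= D * card {e : ?B. eps <= J e}"
  proof -
   have "{e : ?B. eps <= J e} <= (\<Union>v\<in>K. {e. v : ep e & eps <= J e})" using edge_boundary_subset[of K] by (auto simp: edges_meeting_def)
   moreover have "finite (\<Union>v\<in>K. {e. v : ep e & eps <= J e})" using K finite_strong[OF eps(1)] by blast
   ultimately have "finite {e : ?B. eps <= J e}" by (rule finite_subset)
   then show ?thesis using sum_bounded_above[of "{e : ?B. eps <= J e}" J D] JD by (simp add: mult.commute)
  qed
  finally have "h * (eps1 / 2 * card K) <= D * card {e : ?B. eps <= J e} + card K * dl" by simp
  moreover have "h * (eps1 / 2 * card K) = 2 * (card K * dl)" by (simp add: dl_def)
  ultimately have "dl * card K <= D * card {e : ?B. eps <= J e}" unfolding mult.commute[of dl] by linarith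
  moreover have "{e : ?B. eps <= J e} = {e. eps <= J e & card (ep e Int K) = 1}" by (auto simp: edge_boundary_def)
  ultimately show ?thesis using D0 by (simp add: divide_le_eq mult.commute)
 qed simp
 have dD: "dl / D > 0" using dl D0 by simp
 show ?thesis
 proof (rule exI[of _ eps], rule conjI)
  show "\<exists>c::real. c > 0 & (\<forall>K. finite K --> c * real (card K) <= real (card {e. eps <= J e & card (ep e Int K) = 1}))"

  proof (rule exI[of _ "dl / D"], rule conjI[OF dD], rule allI, rule impI)
   fix K :: "'v set" assume "finite K"
   then show "dl / D * card K <= card {e. eps <= J e & card (ep e Int K) = 1}" by (rule main)
  qed
 qed (rule eps(1))
qed

end

section \<open>Simple random walk on the strong edges and its spectral gap\<close>

locale strong = wgraph ep J for ep :: "'e => 'v set" and J +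
 fixes eps c :: real
 assumes eps: "eps > 0" and c: "c > 0"
  and expand: "!!K. finite K ==> c * card K <= card {e. eps <= J e & card (ep e Int K) = 1}"
begin

definition St :: "'v => 'e set" where "St v = {e. v : ep e & eps <= J e}"
definition oth :: "'e => 'v => 'v" where "oth e v = (THE w. ep e = {v, w} & w ~= v)"
definition deg :: real where "deg = card (St (SOME v. True))"

lemma finite_St: "finite (St v)" unfolding St_def by (rule finite_strong[OF eps])

lemma oth: assumes "v : ep e" shows "ep e = {v, oth e v}" "oth e v ~= v"
proof -
 obtain a b where ab: "ep e = {a, b}" "a ~= b" using card_ep[of e] by (metis card_2_iff)
 then obtain w where w: "ep e = {v, w}" "w ~= v" using assms by auto
 then have "oth e v = w" unfolding oth_def by (intro the_equality) (auto simp: doubleton_eq_iff)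
 then show "ep e = {v, oth e v}" "oth e v ~= v" using w by auto
qed

lemma oth_eq: "ep e = {v, w} ==> v ~= w ==> oth e v = w" using oth[of v e] by (auto simp: doubleton_eq_iff)

lemma card_St_aut: assumes g: "g : Aut ep J" shows "St (fst g v) = snd g ` St v"
proof
 have g': "bij (fst g)" "bij (snd g)" "!!e. ep (snd g e) = fst g ` ep e" "!!e. J (snd g e) = J e" using g by (auto simp: aut_iff)
 show "snd g ` St v \<subseteq> St (fst g v)" using g' by (auto simp: St_def)
 show "St (fst g v) \<subseteq> snd g ` St v"
 proof
  fix e assume e: "e : St (fst g v)"
  obtain f where f: "e = snd g f" using g'(2) by (metis bij_pointE)
  then have "f : St v" using e g' by (auto simp: St_def bij_def dest: injD)
  then show "e : snd g ` St v" using f by auto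
 qed
qed

lemma oth_aut: assumes g: "g : Aut ep J" and v: "v : ep e" shows "oth (snd g e) (fst g v) = fst g (oth e v)"
proof -
 have g': "inj (fst g)" "ep (snd g e) = fst g ` ep e" using g by (auto simp: aut_iff bij_def)
 show ?thesis
 proof (rule oth_eq)
  have "ep (snd g e) = fst g ` {v, oth e v}" using g'(2) oth(1)[OF v] by metis
  then show "ep (snd g e) = {fst g v, fst g (oth e v)}" by simp
  show "fst g v ~= fst g (oth e v)" using oth(2)[OF v] g'(1) by (metis injD)
 qed
qed

lemma card_St: "real (card (St v)) = deg"
proof -
 obtain g where g: "g : Aut ep J" "fst g (SOME v. True) = v" using transV unfolding vertex_transitive_def by blast
 have "inj (snd g)" using g by (auto simp: aut_iff bij_def)
 then show ?thesis using card_St_aut[OF g(1), of "SOME v. True"] g(2) by (simp add: deg_def card_image inj_on_subset)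
qed

lemma c_le_deg: "c <= deg"
proof -
 fix v :: 'v
 have "c * card {v} <= card {e. eps <= J e & card (ep e Int {v}) = 1}" by (rule expand) simp
 also have "real (card {e. eps <= J e & card (ep e Int {v}) = 1}) <= card (St v)"
 proof (intro of_nat_mono card_mono finite_St subsetI)
  fix e assume e: "e : {e. eps <= J e & card (ep e Int {v}) = 1}"
  then have "ep e Int {v} ~= {}" by force
  then show "e : St v" using e by (simp add: St_def)
 qed
 finally show ?thesis by (simp add: card_St)
qed

lemma deg_pos: "deg > 0" using c c_le_deg by linarith

text \<open>An arbitrary orientation, so that edge sums need no ordered pairs.\<close>

definition src :: "'e => 'v" where "src e = (SOME v. v : ep e)"
definition tgt :: "'e => 'v" where "tgt e = oth e (src e)"

lemma src_tgt: "ep e = {src e, tgt e}" "src e ~= tgt e"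
proof -
 have "src e : ep e" unfolding src_def using card_ep[of e] by (metis card_2_iff insertI1 someI)
 from oth[OF this] show "ep e = {src e, tgt e}" "src e ~= tgt e" unfolding tgt_def by auto
qed

definition near :: "'v set => 'e set" where "near K = {e. eps <= J e & ep e Int K ~= {}}"

lemma near_UN: "near K = (\<Union>v\<in>K. St v)" by (auto simp: near_def St_def)
lemma finite_near: "finite K ==> finite (near K)" unfolding near_UN using finite_St by auto

text \<open>Layer-cake argument: subtract the least positive value \<open>m\<close> on the whole
  support. The left side drops by \<open>c * m\<close> times the size of the support, the right side
  by \<open>m\<close> times the number of its strong boundary edges, and \<open>expand\<close>
  compares the two. The support shrinks, so the induction ends.\<close>

lemma coarea:
 fixes ph :: "'v => real"
 assumes "finite K" "!!x. 0 <= ph x" "!!x. x ~: K ==> ph x = 0"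
 shows "c * (\<Sum>x\<in>K. ph x) <= (\<Sum>e\<in>near K. \<bar>ph (src e) - ph (tgt e)\<bar>)" using assms
proof (induction "card {x. ph x ~= 0}" arbitrary: ph rule: less_induct)
 case less
 let ?K = "{x. ph x ~= 0}"
 have KK: "?K \<subseteq> K" using less.prems(3) by auto
 have fin: "finite ?K" using KK less.prems(1) finite_subset by blast
 show ?case
 proof (cases "?K = {}")
  case True
  then have "ph x = 0" for x by auto
  then show ?thesis by (simp add: sum_nonneg)
 next
  case False
  define m where "m = Min (ph ` ?K)"
  have "m : ph ` ?K" unfolding m_def using fin False by (intro Min_in) auto
  then obtain x0 where x0: "ph x0 = m" "ph x0 ~= 0" by auto
  have m: "m > 0" using x0 less.prems(2)[of x0] by linarith
  have mle: "m <= ph x" if "ph x ~= 0" for x unfolding m_def using fin that by (intro Min_le) auto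
  define ps where "ps x = (if ph x ~= 0 then ph x - m else 0)" for x
  have "{x. ps x ~= 0} \<subset> ?K" using x0 by (auto simp: ps_def)
  then have "card {x. ps x ~= 0} < card ?K" using fin psubset_card_mono by blast
  then have IH: "c * (\<Sum>x\<in>K. ps x) <= (\<Sum>e\<in>near K. \<bar>ps (src e) - ps (tgt e)\<bar>)"
   by (rule less.hyps) (use less.prems mle in \<open>auto simp: ps_def\<close>)
  have dec: "ph x = ps x + m * of_bool (x : ?K)" for x by (auto simp: ps_def)
  have "c * (\<Sum>x\<in>K. ph x) = c * (\<Sum>x\<in>K. ps x) + m * (c * card ?K)"
  proof -
   have "(\<Sum>x\<in>K. of_bool (x : ?K)) = real (card ?K)" using sum_of_bool_eq[of K "%x. x : ?K"] less.prems(1) KK by (simp add: Int_absorb2 inf.absorb_iff2)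
   moreover have "(\<Sum>x\<in>K. ph x) = (\<Sum>x\<in>K. ps x) + m * (\<Sum>x\<in>K. of_bool (x : ?K))"
   unfolding sum_distrib_left sum.distrib[symmetric] using dec by (intro sum.cong) auto
   ultimately show ?thesis by (simp add: algebra_simps)
  qed
  also have "... <= (\<Sum>e\<in>near K. \<bar>ps (src e) - ps (tgt e)\<bar>) + m * (\<Sum>e\<in>near K. of_bool (card (ep e Int ?K) = 1))"
  proof -
   have "{e. eps <= J e & card (ep e Int ?K) = 1} = near K Int {e. card (ep e Int ?K) = 1}"
   proof (intro equalityI subsetI)
   fix e assume e: "e : {e. eps <= J e & card (ep e Int ?K) = 1}"
   then have "ep e Int ?K ~= {}" by force
   then have "ep e Int K ~= {}" using KK by blast
   then show "e : near K Int {e. card (ep e Int ?K) = 1}" using e by (simp add: near_def)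
   qed (simp add: near_def)
   then have "c * card ?K <= (\<Sum>e\<in>near K. of_bool (card (ep e Int ?K) = 1))" using expand[OF fin] finite_near[OF less.prems(1)] by (simp add: sum_of_bool_eq)
   then show ?thesis using IH m by (intro add_mono mult_left_mono) auto
  qed
  also have "... = (\<Sum>e\<in>near K. \<bar>ps (src e) - ps (tgt e)\<bar> + m * of_bool (card (ep e Int ?K) = 1))" by (simp only: sum.distrib sum_distrib_left)
  also have "... = (\<Sum>e\<in>near K. \<bar>ph (src e) - ph (tgt e)\<bar>)"
  proof (rule sum.cong)
   fix e
   have "card (ep e Int ?K) = 1 \<longleftrightarrow> (src e : ?K) ~= (tgt e : ?K)"
   using src_tgt(2)[of e] by (subst src_tgt(1)) (cases "src e : ?K"; cases "tgt e : ?K"; auto simp: Int_insert_left)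
   then show "\<bar>ps (src e) - ps (tgt e)\<bar> + m * of_bool (card (ep e Int ?K) = 1) = \<bar>ph (src e) - ph (tgt e)\<bar>"
   using mle[of "src e"] mle[of "tgt e"] m by (auto simp: ps_def)
  qed simp
  finally show ?thesis .
 qed
qed

end

context strong
begin

lemma sum_near_bilinear:
 fixes f g :: "'v => real"
 assumes K: "finite K" and g: "!!x. x ~: K ==> g x = 0"
 shows "(\<Sum>x\<in>K. g x * (\<Sum>e\<in>St x. f (oth e x))) = (\<Sum>e\<in>near K. g (src e) * f (tgt e) + g (tgt e) * f (src e))"
proof -
 have "(\<Sum>x\<in>K. g x * (\<Sum>e\<in>St x. f (oth e x))) = (\<Sum>x\<in>K. \<Sum>e\<in>near K. if x : ep e then g x * f (oth e x) else 0)"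
 proof (rule sum.cong)
  fix x assume "x : K"
  then have "St x = {e : near K. x : ep e}" by (auto simp: near_def St_def)
  then show "g x * (\<Sum>e\<in>St x. f (oth e x)) = (\<Sum>e\<in>near K. if x : ep e then g x * f (oth e x) else 0)"
   using sum.inter_filter[OF finite_near[OF K], of "%e. g x * f (oth e x)" "%e. x : ep e"] by (simp add: sum_distrib_left)
 qed simp
 also have "... = (\<Sum>e\<in>near K. \<Sum>x\<in>K. if x : ep e then g x * f (oth e x) else 0)" by (rule sum.swap)
 also have "... = (\<Sum>e\<in>near K. g (src e) * f (tgt e) + g (tgt e) * f (src e))"
 proof (rule sum.cong)
  fix e
  have "(\<Sum>x\<in>K. if x : ep e then g x * f (oth e x) else 0) = (\<Sum>x\<in>{x : K. x : ep e}. g x * f (oth e x))" using K by (rule sum.inter_filter[symmetric])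
  also have "... = (\<Sum>x\<in>ep e. g x * f (oth e x))" by (rule sum.mono_neutral_left) (use finite_ep g in auto)
  also have "... = g (src e) * f (tgt e) + g (tgt e) * f (src e)"
  proof -
   have "oth e (tgt e) = src e" by (rule oth_eq) (use src_tgt[of e] in auto)
   then show ?thesis using src_tgt(2)[of e] by (subst src_tgt(1)) (simp add: tgt_def[symmetric])
  qed
  finally show "(\<Sum>x\<in>K. if x : ep e then g x * f (oth e x) else 0) = g (src e) * f (tgt e) + g (tgt e) * f (src e)" .
 qed simp
 finally show ?thesis .
qed

text \<open>Cheeger's inequality allows \<open>1 - (c / deg)\<^sup>2\<close> under the root. Halving
  the subtracted term keeps \<open>rho\<close> positive even if \<open>c = deg\<close>, so that
  division by it is possible.\<close>

definition rho :: real where "rho = sqrt (1 - (c / deg)\<^sup>2 / 2)"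

lemma rho: "0 < rho" "rho < 1"
proof -
 have "0 < c / deg" "c / deg <= 1" using c deg_pos c_le_deg by auto
 then have "0 < (c / deg)\<^sup>2" "(c / deg)\<^sup>2 <= 1" by (auto intro: power_le_one)
 then show "0 < rho" "rho < 1" by (auto simp: rho_def)
qed

definition Bf :: "'v set => ('v => real) => ('v => real) => real" where
 "Bf K f g = (\<Sum>e\<in>near K. g (src e) * f (tgt e) + g (tgt e) * f (src e))"

text \<open>Cheeger's inequality: \<open>coarea\<close> is applied to the square of
  \<open>f\<close>, the differences of squares are factored, and Cauchy-Schwarz turns the result
  into a bound for the quadratic form of the adjacency operator.\<close>

lemma Bf_bound:
 fixes f :: "'v => real"
 assumes K: "finite K" and f: "!!x. x ~: K ==> f x = 0"
 shows "\<bar>Bf K f f\<bar> <= rho * deg * (\<Sum>x\<in>K. (f x)\<^sup>2)"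
proof -
 let ?N = "\<Sum>x\<in>K. (f x)\<^sup>2" and ?P = "\<Sum>e\<in>near K. f (src e) * f (tgt e)"
 have N0: "0 <= ?N" by (intro sum_nonneg) auto
 have Bf: "Bf K f f = 2 * ?P" unfolding Bf_def by (simp add: mult.commute sum_distrib_left)
 have sq: "(\<Sum>e\<in>near K. (f (src e))\<^sup>2 + (f (tgt e))\<^sup>2) = deg * ?N"
 proof -
  have "(\<Sum>x\<in>K. (f x)\<^sup>2 * (\<Sum>e\<in>St x. 1)) = (\<Sum>e\<in>near K. (f (src e))\<^sup>2 * 1 + (f (tgt e))\<^sup>2 * 1)"
   by (rule sum_near_bilinear[OF K, of "%x. (f x)\<^sup>2" "%_. 1"]) (simp add: f)
  then show ?thesis by (simp add: card_St sum_distrib_left mult.commute)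
 qed
 have m: "(\<Sum>e\<in>near K. \<bar>f (src e) - f (tgt e)\<bar>\<^sup>2) = deg * ?N - 2 * ?P"
  unfolding sq[symmetric] by (simp add: power2_diff sum.distrib sum_subtractf sum_distrib_left mult.assoc)
 have p: "(\<Sum>e\<in>near K. \<bar>f (src e) + f (tgt e)\<bar>\<^sup>2) = deg * ?N + 2 * ?P"
  unfolding sq[symmetric] by (simp add: power2_sum sum.distrib sum_distrib_left mult.assoc)
 have "c * ?N <= (\<Sum>e\<in>near K. \<bar>(f (src e))\<^sup>2 - (f (tgt e))\<^sup>2\<bar>)" by (rule coarea[OF K]) (auto simp: f)
 also have "... = (\<Sum>e\<in>near K. \<bar>f (src e) - f (tgt e)\<bar> * \<bar>f (src e) + f (tgt e)\<bar>)"
  by (simp add: abs_mult[symmetric] power2_eq_square algebra_simps)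
 finally have "(c * ?N)\<^sup>2 <= (\<Sum>e\<in>near K. \<bar>f (src e) - f (tgt e)\<bar> * \<bar>f (src e) + f (tgt e)\<bar>)\<^sup>2"
  by (rule power_mono) (use c N0 in simp)
 also have "... <= (\<Sum>e\<in>near K. \<bar>f (src e) - f (tgt e)\<bar>\<^sup>2) * (\<Sum>e\<in>near K. \<bar>f (src e) + f (tgt e)\<bar>\<^sup>2)"
  by (rule Cauchy_Schwarz_ineq_sum)
 also have "... = (deg * ?N)\<^sup>2 - (2 * ?P)\<^sup>2" unfolding m p by (simp add: power2_eq_square algebra_simps)
 finally have "(Bf K f f)\<^sup>2 <= (deg * ?N)\<^sup>2 - (c * ?N)\<^sup>2" unfolding Bf by simp
 also have "... = (1 - (c / deg)\<^sup>2) * (deg * ?N)\<^sup>2" using deg_pos by (simp add: power_divide power_mult_distrib field_simps)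
 also have "... <= rho\<^sup>2 * (deg * ?N)\<^sup>2"
 proof (rule mult_right_mono)
  have "(c / deg)\<^sup>2 <= 1" using c deg_pos c_le_deg by (intro power_le_one) auto
  then show "1 - (c / deg)\<^sup>2 <= rho\<^sup>2" by (simp add: rho_def)
 qed simp
 finally have "\<bar>Bf K f f\<bar>\<^sup>2 <= (rho * deg * ?N)\<^sup>2" by (simp add: power_mult_distrib mult.assoc)
 then show ?thesis by (rule power2_le_imp_le) (use rho deg_pos N0 in \<open>auto intro!: mult_nonneg_nonneg less_imp_le\<close>)
qed

definition Pop :: "('v => real) => 'v => real" where
 "Pop f x = (\<Sum>e\<in>St x. f (oth e x)) / deg"

text \<open>From the quadratic form to the operator norm by polarisation. With
  \<open>g = Pop f\<close>, the form at \<open>f + l * g\<close> minus the form at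
  \<open>f - l * g\<close> is \<open>4 * l * deg\<close> times the squared norm of \<open>g\<close>,
  while both are controlled by \<open>Bf_bound\<close>. The choice \<open>l = 1 / rho\<close> yields
  exactly the factor \<open>rho\<close> squared.\<close>

lemma Pop_contract:
 fixes f :: "'v => real"
 assumes K: "finite K" and f: "!!x. x ~: K ==> f x = 0" and g: "!!x. x ~: K ==> Pop f x = 0"
 shows "(\<Sum>x\<in>K. (Pop f x)\<^sup>2) <= rho\<^sup>2 * (\<Sum>x\<in>K. (f x)\<^sup>2)"
proof -
 let ?g = "Pop f" and ?N = "\<Sum>x\<in>K. (f x)\<^sup>2" and ?G = "\<Sum>x\<in>K. (Pop f x)\<^sup>2"
 define l where "l = 1 / rho"
 have BfG: "Bf K f ?g = deg * ?G"
 proof -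
  have "(\<Sum>e\<in>St x. f (oth e x)) = deg * ?g x" for x using deg_pos by (simp add: Pop_def)
  moreover have "Bf K f ?g = (\<Sum>x\<in>K. ?g x * (\<Sum>e\<in>St x. f (oth e x)))" unfolding Bf_def by (rule sum_near_bilinear[OF K g, symmetric])
  ultimately have "Bf K f ?g = (\<Sum>x\<in>K. ?g x * (deg * ?g x))" by simp
  then show ?thesis by (simp add: sum_distrib_left power2_eq_square mult_ac)
 qed
 have sym: "Bf K ?g f = Bf K f ?g" unfolding Bf_def by (simp add: algebra_simps)
 have bil: "Bf K (%x. f x + t * ?g x) (%x. f x + t * ?g x) = Bf K f f + 2 * t * Bf K f ?g + t\<^sup>2 * Bf K ?g ?g" for t
 proof -
  have "Bf K (%x. f x + t * ?g x) (%x. f x + t * ?g x) = Bf K f f + t * Bf K ?g f + t * Bf K f ?g + t\<^sup>2 * Bf K ?g ?g"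
   unfolding Bf_def sum_distrib_left sum.distrib[symmetric] by (intro sum.cong) (auto simp: algebra_simps power2_eq_square)
  then show ?thesis using sym by simp
 qed
 have nrm: "(\<Sum>x\<in>K. (f x + t * ?g x)\<^sup>2) + (\<Sum>x\<in>K. (f x + - t * ?g x)\<^sup>2) = 2 * (?N + t\<^sup>2 * ?G)" for t
  unfolding sum_distrib_left sum.distrib[symmetric] by (intro sum.cong) (auto simp: power2_eq_square algebra_simps)
 have supp: "f x + t * ?g x = 0" if "x ~: K" for x t using f[OF that] g[OF that] by simp
 have "4 * l * Bf K f ?g = Bf K (%x. f x + l * ?g x) (%x. f x + l * ?g x) - Bf K (%x. f x + - l * ?g x) (%x. f x + - l * ?g x)" unfolding bil by simp
 also have "... <= rho * deg * (\<Sum>x\<in>K. (f x + l * ?g x)\<^sup>2) + rho * deg * (\<Sum>x\<in>K. (f x + - l * ?g x)\<^sup>2)"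
  using Bf_bound[OF K, of "%x. f x + l * ?g x", OF supp] Bf_bound[OF K, of "%x. f x + - l * ?g x", OF supp] by (auto simp: abs_le_iff)
 also have "... = rho * deg * (2 * (?N + l\<^sup>2 * ?G))" unfolding distrib_left[symmetric] nrm ..
 finally have "deg * (4 * l * ?G) <= deg * (rho * (2 * (?N + l\<^sup>2 * ?G)))" unfolding BfG by (simp add: mult_ac)
 then have "4 * l * ?G <= rho * (2 * (?N + l\<^sup>2 * ?G))" using deg_pos by simp
 then have "rho * (4 * l * ?G) <= rho * (rho * (2 * (?N + l\<^sup>2 * ?G)))" using rho(1) by (intro mult_left_mono) auto
 moreover have "rho * (4 * l * ?G) = 4 * ?G" using rho(1) by (simp add: l_def)
 moreover have "rho * (rho * (2 * (?N + l\<^sup>2 * ?G))) = 2 * rho\<^sup>2 * ?N + 2 * ?G" using rho(1) by (simp add: l_def power2_eq_square field_simps)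
 ultimately show ?thesis by linarith
qed

text \<open>Transition probabilities of the walk, unfolded at the first step so that
  \<open>Pop\<close> acts on the starting point.\<close>

fun pk :: "nat => 'v => 'v => real" where
 "pk 0 x y = of_bool (x = y)"
| "pk (Suc k) x y = (\<Sum>e\<in>St x. pk k (oth e x) y) / deg"

definition reach :: "('v \<times> 'v) set" where
 "reach = {(x, y). \<exists>e. eps <= J e & ep e = {x, y}}"

lemma sym_reach: "sym reach" by (auto simp: sym_def reach_def insert_commute)

lemma St_reach: "e : St x ==> (x, oth e x) : reach" using oth(1)[of x e] by (auto simp: St_def reach_def)

lemma pk_nonneg: "0 <= pk k x y" using deg_pos by (induction k arbitrary: x) (auto intro!: divide_nonneg_pos sum_nonneg)

lemma pk_reach: "pk k x y ~= 0 ==> (x, y) : reach ^^ k"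
proof (induction k arbitrary: x)
 case 0 then show ?case by (simp split: if_splits)
next
 case (Suc k)
 then obtain e where "e : St x" "pk k (oth e x) y ~= 0" by (auto intro: ccontr sum.neutral)
 then show ?case using Suc.IH St_reach by (meson relpow_Suc_I2)
qed

lemma finite_reach_step: "finite K ==> finite (reach `` K)"
proof -
 assume "finite K"
 have "reach `` K <= (\<Union>e\<in>near K. ep e)" by (auto simp: reach_def near_def)
 then show ?thesis using finite_near[OF \<open>finite K\<close>] finite_ep by (meson finite_UN_I finite_subset)
qed

lemma finite_reach: "finite {y. (x, y) : reach ^^ k}"
proof (induction k)
 case (Suc k)
 have "{y. (x, y) : reach ^^ Suc k} = reach `` {y. (x, y) : reach ^^ k}" by auto
 then show ?case using finite_reach_step[OF Suc] by simp
qed simp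

lemma reach_sym: "(x, y) : reach ^^ k \<longleftrightarrow> (y, x) : reach ^^ k"
proof -
 have "(y, x) : reach ^^ k" if "(x, y) : reach ^^ k" for x y using that
 proof (induction k arbitrary: y)
  case (Suc k)
  then obtain z where z: "(x, z) : reach ^^ k" "(z, y) : reach" by auto
  have "(y, z) : reach" using z(2) sym_reach by (simp add: sym_def)
  then show ?case using Suc.IH[OF z(1)] by (rule relpow_Suc_I2)
 qed simp
 then show ?thesis by blast
qed

lemma finite_pk: "finite {y. pk k x y ~= 0}" "finite {x. pk k x y ~= 0}"
proof -
 show "finite {y. pk k x y ~= 0}" by (rule finite_subset[OF _ finite_reach[of x k]]) (auto dest: pk_reach)
 show "finite {x. pk k x y ~= 0}" by (rule finite_subset[OF _ finite_reach[of y k]]) (auto dest: pk_reach simp: reach_sym)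
qed

lemma pk_sum: "finite Y ==> {y. (x, y) : reach ^^ k} \<subseteq> Y ==> (\<Sum>y\<in>Y. pk k x y) = 1"
proof (induction k arbitrary: x)
 case 0
 then have "x : Y" by auto
 then show ?case using 0 by (simp add: of_bool_def)
next
 case (Suc k)
 have "(\<Sum>y\<in>Y. pk (Suc k) x y) = (\<Sum>e\<in>St x. \<Sum>y\<in>Y. pk k (oth e x) y) / deg" by (simp add: sum_divide_distrib[symmetric] sum.swap[of _ Y])
 also have "... = (\<Sum>e\<in>St x. 1) / deg"
 proof (intro arg_cong2[where f="(/)"] sum.cong refl Suc.IH)
  fix e assume "e : St x"
  then show "{y. (oth e x, y) : reach ^^ k} \<subseteq> Y" using Suc.prems(2) relpow_Suc_I2[OF St_reach[OF \<open>e : St x\<close>]] by blast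
 qed (rule Suc.prems)
 also have "... = 1" using card_St[of x] deg_pos by simp
 finally show ?case .
qed

lemma pk_aut: "g : Aut ep J ==> pk k (fst g x) (fst g y) = pk k x y"
proof (induction k arbitrary: x)
 case 0
 have "inj (fst g)" using 0 by (auto simp: aut_iff bij_def)
 then show ?case by (simp add: inj_eq)
next
 case (Suc k)
 have inj: "inj (snd g)" using Suc.prems by (auto simp: aut_iff bij_def)
 have "(\<Sum>e\<in>St (fst g x). pk k (oth e (fst g x)) (fst g y)) = (\<Sum>e\<in>St x. pk k (oth (snd g e) (fst g x)) (fst g y))"
  unfolding card_St_aut[OF Suc.prems] by (rule sum.reindex_cong[of "snd g"]) (use inj in \<open>auto intro: inj_on_subset\<close>)
 also have "... = (\<Sum>e\<in>St x. pk k (oth e x) y)"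
 proof (rule sum.cong)
  fix e assume "e : St x"
  then have "x : ep e" by (auto simp: St_def)
  then show "pk k (oth (snd g e) (fst g x)) (fst g y) = pk k (oth e x) y" using oth_aut[OF Suc.prems] Suc.IH[OF Suc.prems] by simp
 qed simp
 finally show ?case by simp
qed

text \<open>The inner sum, as a function of \<open>x\<close>, is the \<open>k\<close>-th iterate of
  \<open>Pop\<close> on the indicator of \<open>K\<close>, whose squared norm is
  \<open>card K\<close>.\<close>

theorem pk_decay:
 assumes K: "finite K" and X: "finite X"
 shows "(\<Sum>x\<in>X. (\<Sum>y\<in>K. pk k x y)\<^sup>2) <= rho ^ (2 * k) * card K" using X
proof (induction k arbitrary: X)
 case 0
 have "(\<Sum>x\<in>X. (\<Sum>y\<in>K. pk 0 x y)\<^sup>2) = (\<Sum>x\<in>X. of_bool (x : K))" using K by (intro sum.cong) (auto simp: of_bool_def)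
 also have "... = card (X Int K)" using 0 by (simp add: sum_of_bool_eq)
 also have "... <= card K" using K by (intro of_nat_mono card_mono) auto
 finally show ?case by simp
next
 case (Suc k)
 let ?f = "%x. \<Sum>y\<in>K. pk k x y"
 \<comment> \<open>\<open>Pop_contract\<close> needs a finite set carrying both the function and its
   image; enlarging \<open>X\<close> to such a set only increases the sum.\<close>
 let ?S = "\<Union>y\<in>K. {x. pk k x y ~= 0} Un {x. pk (Suc k) x y ~= 0}"
 have P: "(\<Sum>y\<in>K. pk (Suc k) x y) = Pop ?f x" for x by (simp add: Pop_def sum_divide_distrib[symmetric] sum.swap[of _ K])
 have finS: "finite (X Un ?S)" using Suc.prems K finite_pk(2)[of k] finite_pk(2)[of "Suc k"] by blast
 have "(\<Sum>x\<in>X. (\<Sum>y\<in>K. pk (Suc k) x y)\<^sup>2) <= (\<Sum>x\<in>X Un ?S. (Pop ?f x)\<^sup>2)" unfolding P by (rule sum_mono2[OF finS]) auto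
 also have "... <= rho\<^sup>2 * (\<Sum>x\<in>X Un ?S. (?f x)\<^sup>2)"
 proof (rule Pop_contract[OF finS])
  fix x assume x: "x ~: X Un ?S"
  show "?f x = 0" using x by (intro sum.neutral) auto
  have "(\<Sum>y\<in>K. pk (Suc k) x y) = 0" using x by (intro sum.neutral) blast
  then show "Pop ?f x = 0" using P by simp
 qed
 also have "... <= rho\<^sup>2 * (rho ^ (2 * k) * card K)" using Suc.IH[OF finS] by (intro mult_left_mono) auto
 also have "... = rho ^ (2 * Suc k) * card K" by (simp add: power2_eq_square)
 finally show ?case .
qed

end

section \<open>From the finite-volume measures to finite models\<close>

lemma sum_Pow_partition:
 fixes f :: "'w set => 'w set => real"
 assumes "finite \<C>" "!!C. C : \<C> ==> finite C" "!!C D. C : \<C> ==> D : \<C> ==> C ~= D ==> C Int D = {}"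
 shows "(\<Sum>G\<in>Pow (\<Union>\<C>). \<Prod>C\<in>\<C>. f C (G Int C)) = (\<Prod>C\<in>\<C>. \<Sum>G\<in>Pow C. f C G)" using assms
proof (induction \<C> rule: finite_induct)
 case empty then show ?case by simp
next
 case (insert D \<C>)
 let ?U = "\<Union>\<C>"
 have dis: "D Int ?U = {}"
 proof -
  have "D Int C = {}" if "C : \<C>" for C by (rule insert.prems(2)) (use that insert.hyps(2) in auto)
  then show ?thesis by auto
 qed
 have fin: "finite D" "finite ?U" using insert by auto
 have "(\<Sum>G\<in>Pow (\<Union>(insert D \<C>)). \<Prod>C\<in>insert D \<C>. f C (G Int C)) =
  (\<Sum>G2\<in>Pow ?U. \<Sum>G1\<in>Pow D. \<Prod>C\<in>insert D \<C>. f C ((G1 Un G2) Int C))" unfolding Union_insert by (rule sum_Pow_Un[OF fin dis])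
 also have "... = (\<Sum>G2\<in>Pow ?U. \<Sum>G1\<in>Pow D. f D G1 * (\<Prod>C\<in>\<C>. f C (G2 Int C)))"
 proof (intro sum.cong refl)
  fix G2 G1 assume G: "G2 : Pow ?U" "G1 : Pow D"
  have "(G1 Un G2) Int D = G1" using G dis by auto
  moreover have "(\<Prod>C\<in>\<C>. f C ((G1 Un G2) Int C)) = (\<Prod>C\<in>\<C>. f C (G2 Int C))"
  proof (rule prod.cong)
   fix C assume C: "C : \<C>"
   have "(G1 Un G2) Int C = G2 Int C" using G dis C by auto
   then show "f C ((G1 Un G2) Int C) = f C (G2 Int C)" by simp
  qed simp
  ultimately show "(\<Prod>C\<in>insert D \<C>. f C ((G1 Un G2) Int C)) = f D G1 * (\<Prod>C\<in>\<C>. f C (G2 Int C))" using insert.hyps by simp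
 qed
 also have "... = (\<Sum>G1\<in>Pow D. f D G1) * (\<Sum>G2\<in>Pow ?U. \<Prod>C\<in>\<C>. f C (G2 Int C))"
  by (simp add: sum_distrib_right[symmetric] sum_distrib_left[symmetric])
 also have "... = (\<Prod>C\<in>insert D \<C>. \<Sum>G\<in>Pow C. f C G)" using insert by simp
 finally show ?case .
qed

lemma sum_Pow_card: "finite C ==> (\<Sum>G\<in>Pow C. s ^ card G) = (1 + s) ^ card C" for s :: real using sum_Pow_prod1[of C "%_. s"] by simp

context fk_model
begin

text \<open>The sum over ghost sets factors over the clusters. Within a cluster the empty ghost set
  counts \<open>1 + Q\<close> and the others 1, so the factor is
  \<open>(1 + s) ^ card C + Q\<close>.\<close>

lemma kap_ghost:
 assumes s: "0 <= s" and A: "!!e. e : A ==> en e \<subseteq> W"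
 shows "(\<Sum>G\<in>Pow W. (1 + Q) ^ card {C : cl en A ` W. C Int G = {}} * s ^ card G) =
  (1 + s) ^ card W * kap en W Q (%_. 1 / (1 + s)) A"
proof -
 let ?C = "cl en A ` W"
 have fC: "finite ?C" using fin_W by simp
 have sub: "C \<subseteq> W" if "C : ?C" for C using that cl_subset[of _ W A en] A by blast
 have fin: "finite C" if "C : ?C" for C using sub[OF that] fin_W finite_subset by blast
 have dis: "C Int D = {}" if CD: "C : ?C" "D : ?C" "C ~= D" for C D
 proof -
  obtain c d where "C = cl en A c" "D = cl en A d" using CD by blast
  then show ?thesis using cl_disjoint[of en A c d] CD(3) by simp
 qed
 have U: "\<Union>?C = W"
 proof
  show "\<Union>?C \<subseteq> W" using sub by (rule Union_least)
  show "W \<subseteq> \<Union>?C" using cl_refl[of _ en A] by blast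
 qed
 define f where "f C G = (if G = {} then 1 + Q else 1) * s ^ card G" for C G :: "'w set"
 have "(\<Sum>G\<in>Pow W. (1 + Q) ^ card {C : ?C. C Int G = {}} * s ^ card G) = (\<Sum>G\<in>Pow (\<Union>?C). \<Prod>C\<in>?C. f C (G Int C))" unfolding U
 proof (rule sum.cong)
  fix G assume G: "G : Pow W"
  have "(\<Prod>C\<in>?C. (if G Int C = {} then 1 + Q else 1)) = (1 + Q) ^ card {C : ?C. C Int G = {}}"
   using prod.inter_filter[OF fC, of "%_. 1 + Q" "%C. C Int G = {}"] by (simp add: Int_commute)
  moreover have "(\<Prod>C\<in>?C. s ^ card (G Int C)) = s ^ card G"
  proof -
   have "(\<Prod>C\<in>?C. s ^ card (G Int C)) = s ^ (\<Sum>C\<in>?C. card (G Int C))" by (simp add: power_sum)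
   also have "(\<Sum>C\<in>?C. card (G Int C)) = card (\<Union>C\<in>?C. G Int C)" by (rule card_UN_disjoint[symmetric]) (use fC fin dis in auto)
   also have "(\<Union>C\<in>?C. G Int C) = G" using U G by blast
   finally show ?thesis .
  qed
  ultimately show "(1 + Q) ^ card {C : ?C. C Int G = {}} * s ^ card G = (\<Prod>C\<in>?C. f C (G Int C))" unfolding f_def prod.distrib by simp
 qed simp
 also have "... = (\<Prod>C\<in>?C. \<Sum>G\<in>Pow C. f C G)" by (rule sum_Pow_partition[OF fC fin dis])
 also have "... = (\<Prod>C\<in>?C. (1 + s) ^ card C * (1 + Q * ucl (%_. 1 / (1 + s)) C))"
 proof (rule prod.cong)
  fix C assume C: "C : ?C"
  have "(\<Sum>G\<in>Pow C. f C G) = (\<Sum>G\<in>Pow C. s ^ card G + (if G = {} then Q else 0))" by (intro sum.cong) (auto simp: f_def)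
  also have "... = (1 + s) ^ card C + Q" using fin[OF C] by (simp add: sum.distrib sum_Pow_card)
  also have "... = (1 + s) ^ card C * (1 + Q * ucl (%_. 1 / (1 + s)) C)" using s by (simp add: ucl_def power_divide field_simps)
  finally show "(\<Sum>G\<in>Pow C. f C G) = (1 + s) ^ card C * (1 + Q * ucl (%_. 1 / (1 + s)) C)" .
 qed simp
 also have "... = (1 + s) ^ card W * kap en W Q (%_. 1 / (1 + s)) A"
 proof -
  have "(\<Sum>C\<in>?C. card C) = card W" using card_UN_disjoint[OF fC, of "%C. C"] fin dis U by auto
  then show ?thesis unfolding kap_def prod.distrib by (simp add: power_sum[symmetric])
 qed
 finally show ?thesis .
qed

end

section \<open>The discrete measure of a finite volume with infinitely many edges\<close>

locale rc_setup =
 fixes q bt h :: real and J :: "'e => real" and en :: "'e => 'w set" and F :: "'e set" and W :: "'w set"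
 assumes q: "q \<ge> 1" and bt: "bt \<ge> 0" and h: "h \<ge> 0" and J: "!!e. J e > 0" and edgy: "edgy en"
  and finW: "finite W" and FW: "!!e. e : F ==> en e \<subseteq> W"
  and sumF: "(%e. exp (2 * bt * J e) - 1) summable_on F" and cE: "countable (UNIV :: 'e set)"
begin

definition "xx e = exp (2 * bt * J e) - 1"
definition "ss = exp (2 * bt * h) - 1"
definition "u0 = exp (- (2 * bt * h))"

lemma xx: "0 <= xx e" using bt J[of e] by (simp add: xx_def)
lemma ss: "0 <= ss" using bt h by (simp add: ss_def)
lemma sumxx: "xx summable_on F"
proof -
 have "xx = (%e. exp (2 * bt * J e) - 1)" by (simp add: fun_eq_iff xx_def)
 then show ?thesis using sumF by simp
qed
lemma u0: "u0 = 1 / (1 + ss)" by (simp add: u0_def ss_def exp_minus divide_inverse)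
lemma u0_bounds: "0 < u0" "u0 <= 1" using bt h by (auto simp: u0_def)

sublocale fk_model en W "q - 1" "%_. u0" using q u0_bounds finW edgy by unfold_locales auto

definition cnf :: "'e set => 'w set => ('e => bool) \<times> ('w => bool)" where
 "cnf A G = ((%e. e : A), (%w. w : G))"

lemma conf_cnf: "rc_conf F W = (%(A, G). cnf A G) ` ({A. finite A & A \<subseteq> F} \<times> Pow W)"
proof
 show "rc_conf F W \<subseteq> (%(A, G). cnf A G) ` ({A. finite A & A \<subseteq> F} \<times> Pow W)"
 proof
  fix om assume "om : rc_conf F W"
  then have "om = (%(A, G). cnf A G) ({e. fst om e}, {w. snd om w})"
   "({e. fst om e}, {w. snd om w}) : {A. finite A & A \<subseteq> F} \<times> Pow W" by (auto simp: cnf_def rc_conf_def)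
  then show "om : (%(A, G). cnf A G) ` ({A. finite A & A \<subseteq> F} \<times> Pow W)" by (rule image_eqI)
 qed
qed (auto simp: cnf_def rc_conf_def)

lemma inj_cnf: "inj (%(A, G). cnf A G)" by (auto simp: inj_def cnf_def fun_eq_iff)

abbreviation "RW \<equiv> rc_weight q bt h J en F W"

lemma RW_cnf:
 assumes A: "A \<subseteq> F"
 shows "RW (cnf A G) = (\<Prod>e\<in>A. xx e) * (q ^ card {C : cl en A ` W. C Int G = {}} * ss ^ card G)"
proof -
 have "rc_adj en F (fst (cnf A G)) = adj en A" using A by (auto simp: rc_adj_def adj_def cnf_def)
 then have conn: "rc_conn en F W (fst (cnf A G)) = {(a, b). a : W & b : W & b : cl en A a}" by (simp add: rc_conn_def cl_def)
 have "W // rc_conn en F W (fst (cnf A G)) = cl en A ` W"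
 proof -
  have "rc_conn en F W (fst (cnf A G)) `` {a} = cl en A a" if "a : W" for a using that cl_subset[of a W A en] A FW unfolding conn by auto
  then show ?thesis by (auto simp: quotient_def)
 qed
 moreover have "(\<forall>w\<in>C. \<not> snd (cnf A G) w) \<longleftrightarrow> C Int G = {}" for C by (auto simp: cnf_def)
 ultimately have "rc_k en F W (cnf A G) = card {C : cl en A ` W. C Int G = {}}" by (simp add: rc_k_def)
 then show ?thesis unfolding rc_weight_def by (simp add: cnf_def xx_def ss_def mult_ac)
qed

lemma RW_nonneg: "om : rc_conf F W ==> 0 <= RW om" unfolding conf_cnf using q ss by (auto simp: RW_cnf intro!: mult_nonneg_nonneg prod_nonneg xx)

lemma sum_RW:
 assumes "finite F'" "F' \<subseteq> F"
 shows "(\<Sum>om\<in>(%(A, G). cnf A G) ` ({A : Pow F'. \<Psi> A} \<times> Pow W). RW om) =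
  (1 + ss) ^ card W * (\<Sum>A\<in>Pow F'. of_bool (\<Psi> A) * wt en W (q - 1) (%_. u0) xx A)"
proof -
 have "(\<Sum>om\<in>(%(A, G). cnf A G) ` ({A : Pow F'. \<Psi> A} \<times> Pow W). RW om) = (\<Sum>(A, G)\<in>{A : Pow F'. \<Psi> A} \<times> Pow W. RW (cnf A G))"
  by (rule sum.reindex_cong[of "%(A, G). cnf A G"]) (use inj_cnf inj_on_subset in auto)
 also have "... = (\<Sum>A\<in>{A : Pow F'. \<Psi> A}. \<Sum>G\<in>Pow W. RW (cnf A G))" by (rule sum.cartesian_product[symmetric])
 also have "... = (\<Sum>A\<in>{A : Pow F'. \<Psi> A}. (1 + ss) ^ card W * wt en W (q - 1) (%_. u0) xx A)"
 proof (rule sum.cong)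
  fix A assume "A : {A : Pow F'. \<Psi> A}"
  then have A: "A \<subseteq> F" using assms by auto
  have "(\<Sum>G\<in>Pow W. RW (cnf A G)) = (\<Prod>e\<in>A. xx e) * (\<Sum>G\<in>Pow W. (1 + (q - 1)) ^ card {C : cl en A ` W. C Int G = {}} * ss ^ card G)"
   by (simp add: RW_cnf[OF A] sum_distrib_left)
  also have "... = (1 + ss) ^ card W * wt en W (q - 1) (%_. u0) xx A" using kap_ghost[OF ss, of A] A FW unfolding wt_def u0 by auto
  finally show "(\<Sum>G\<in>Pow W. RW (cnf A G)) = (1 + ss) ^ card W * wt en W (q - 1) (%_. u0) xx A" .
 qed simp
 also have "... = (1 + ss) ^ card W * (\<Sum>A\<in>{A : Pow F'. \<Psi> A}. wt en W (q - 1) (%_. u0) xx A)" by (simp add: sum_distrib_left)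
 also have "(\<Sum>A\<in>{A : Pow F'. \<Psi> A}. wt en W (q - 1) (%_. u0) xx A) = (\<Sum>A\<in>Pow F'. of_bool (\<Psi> A) * wt en W (q - 1) (%_. u0) xx A)"
 proof -
  have "(\<Sum>A\<in>{A : Pow F'. \<Psi> A}. wt en W (q - 1) (%_. u0) xx A) =
   (\<Sum>A\<in>Pow F'. if \<Psi> A then wt en W (q - 1) (%_. u0) xx A else 0)" by (rule sum.inter_filter) (use assms(1) in simp)
  also have "... = (\<Sum>A\<in>Pow F'. of_bool (\<Psi> A) * wt en W (q - 1) (%_. u0) xx A)" by (intro sum.cong) auto
  finally show ?thesis .
 qed
 finally show ?thesis .
qed

text \<open>Up to constants in the number of vertices, a finite partial sum is at most the product
  of \<open>1 + xx e\<close>, hence at most the exponential of the summable total of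
  \<open>xx\<close>.\<close>

lemma RW_summable: "RW summable_on rc_conf F W"
proof (rule nonneg_bdd_above_summable_on)
 define S where "S = infsum xx F"
 let ?B = "(1 + ss) ^ card W * (exp S * q ^ card W)"
 show "bdd_above (sum RW ` {\<Omega>. \<Omega> \<subseteq> rc_conf F W & finite \<Omega>})"
 proof (rule bdd_aboveI2)
  fix \<Omega> assume \<Omega>: "\<Omega> : {\<Omega>. \<Omega> \<subseteq> rc_conf F W & finite \<Omega>}"
  define F' where "F' = (\<Union>om\<in>\<Omega>. {e. fst om e})"
  have F': "finite F'" "F' \<subseteq> F" using \<Omega> by (auto simp: F'_def rc_conf_def)
  interpret m: fk_finite en W "q - 1" "%_. u0" xx F' using xx F' FW by unfold_locales auto
  have "\<Omega> \<subseteq> (%(A, G). cnf A G) ` ({A : Pow F'. True} \<times> Pow W)"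
  proof
   fix om assume o: "om : \<Omega>"
   then have "om : rc_conf F W" using \<Omega> by auto
   then have "om = (%(A, G). cnf A G) ({e. fst om e}, {w. snd om w})"
   "({e. fst om e}, {w. snd om w}) : {A : Pow F'. True} \<times> Pow W" using o by (auto simp: cnf_def rc_conf_def F'_def)
   then show "om : (%(A, G). cnf A G) ` ({A : Pow F'. True} \<times> Pow W)" by (rule image_eqI)
  qed
  then have "sum RW \<Omega> <= (\<Sum>om\<in>(%(A, G). cnf A G) ` ({A : Pow F'. True} \<times> Pow W). RW om)"
  proof (rule sum_mono2[rotated])
   fix om assume "om : (%(A, G). cnf A G) ` ({A : Pow F'. True} \<times> Pow W) - \<Omega>"
   then have "om : rc_conf F W" unfolding conf_cnf using F' finite_subset by fastforce
   then show "0 <= RW om" by (rule RW_nonneg)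
  qed (use F' finW in auto)
  also have "... = (1 + ss) ^ card W * (\<Sum>A\<in>Pow F'. of_bool True * wt en W (q - 1) (%_. u0) xx A)" by (rule sum_RW[OF F'])
  also have "... <= (1 + ss) ^ card W * (\<Sum>A\<in>Pow F'. (\<Prod>e\<in>A. xx e) * q ^ card W)"
  proof (intro mult_left_mono sum_mono)
   fix A
   have "kap en W (q - 1) (%_. u0) A <= (\<Prod>C\<in>cl en A ` W. q)" unfolding kap_def
   proof (rule prod_mono)
   fix C :: "'w set" show "0 <= 1 + (q - 1) * ucl (%_. u0) C & 1 + (q - 1) * ucl (%_. u0) C <= q" using one_le[of C] by linarith
   qed
   also have "... = q ^ card (cl en A ` W)" by simp
   also have "... <= q ^ card W" using q finW by (intro power_increasing card_image_le) auto
   finally show "of_bool True * wt en W (q - 1) (%_. u0) xx A <= (\<Prod>e\<in>A. xx e) * q ^ card W" unfolding wt_def by (auto intro!: mult_left_mono prod_nonneg xx)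
  qed (use ss in auto)
  also have "... = (1 + ss) ^ card W * ((\<Prod>e\<in>F'. 1 + xx e) * q ^ card W)" using F'(1) by (simp add: sum_distrib_right[symmetric] sum_Pow_prod1)
  also have "... <= ?B"
  proof (intro mult_left_mono mult_right_mono)
   have "(\<Prod>e\<in>F'. 1 + xx e) <= (\<Prod>e\<in>F'. exp (xx e))" by (rule prod_mono) (use xx exp_ge_add_one_self in \<open>auto intro: add_nonneg_nonneg\<close>)
   also have "... = exp (sum xx F')" using F'(1) by (simp add: exp_sum)
   also have "sum xx F' <= S" unfolding S_def by (rule finite_sum_le_infsum) (use F' xx sumxx in auto)
   finally show "(\<Prod>e\<in>F'. 1 + xx e) <= exp S" by simp
  qed (use q ss in auto)
  finally show "sum RW \<Omega> <= ?B" .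
 qed
qed (rule RW_nonneg)

definition "Z = infsum RW (rc_conf F W)"
abbreviation "MU \<equiv> rc_pmf q bt h J en F W"

lemma Z_pos: "Z > 0"
proof -
 have c: "cnf {} {} : rc_conf F W" unfolding conf_cnf by force
 have "sum RW {cnf {} {}} <= Z" unfolding Z_def by (rule finite_sum_le_infsum[OF RW_summable]) (use c RW_nonneg in auto)
 moreover have "RW (cnf {} {}) > 0" using q by (simp add: RW_cnf)
 ultimately show ?thesis by simp
qed

lemma pmf_MU: "pmf MU om = (if om : rc_conf F W then RW om / Z else 0)" unfolding rc_pmf_def Z_def[symmetric]
proof (rule pmf_embed_pmf)
 let ?p = "%om. if om : rc_conf F W then RW om / Z else 0"
 show nn: "0 <= ?p om" for om using RW_nonneg Z_pos by simp
 have "(RW has_sum Z) (rc_conf F W)" unfolding Z_def using RW_summable by (rule has_sum_infsum)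
 then have "((%om. RW om * (1 / Z)) has_sum (Z * (1 / Z))) (rc_conf F W)" by (rule has_sum_cmult_left)
 then have hs: "(?p has_sum 1) (rc_conf F W)" using Z_pos by (subst has_sum_cong[where g = "%om. RW om * (1 / Z)"]) auto
 then have "(?p has_sum 1) UNIV" by (subst has_sum_cong_neutral[where S = UNIV and g = ?p and T = "rc_conf F W"]) auto
 then have sU: "?p summable_on UNIV" "infsum ?p UNIV = 1" by (auto dest: has_sum_imp_summable infsumI)
 have "norm (?p om) = ?p om" for om unfolding real_norm_def by (rule abs_of_nonneg) (rule nn)
 then have "(%om. norm (?p om)) summable_on UNIV" using sU(1) by presburger
 then have a: "Infinite_Set_Sum.abs_summable_on ?p UNIV" using abs_summable_equivalent by blast
 have "(\<integral>\<^sup>+ om. ennreal (?p om) \<partial>count_space UNIV) = ennreal (infsetsum ?p UNIV)" by (rule nn_integral_conv_infsetsum[OF a nn])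
 also have "infsetsum ?p UNIV = infsum ?p UNIV" by (rule infsetsum_infsum) (use a abs_summable_equivalent in blast)
 also have "... = 1" by (rule sU(2))
 finally have "(\<integral>\<^sup>+ om. ennreal (?p om) \<partial>count_space UNIV) = ennreal 1" .
 then show "(\<integral>\<^sup>+ om. ennreal (?p om) \<partial>count_space UNIV) = 1" by simp
qed

lemma prob_sub:
 assumes "finite F'" "F' \<subseteq> F"
 shows "measure MU {om. {e. fst om e} \<subseteq> F' & \<Psi> {e. fst om e}} =
  (1 + ss) ^ card W / Z * (\<Sum>A\<in>Pow F'. of_bool (\<Psi> A) * wt en W (q - 1) (%_. u0) xx A)"
proof -
 let ?\<Omega> = "(%(A, G). cnf A G) ` ({A : Pow F'. \<Psi> A} \<times> Pow W)"
 have sub: "?\<Omega> \<subseteq> rc_conf F W" unfolding conf_cnf using assms finite_subset by fastforce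
 have "measure MU {om. {e. fst om e} \<subseteq> F' & \<Psi> {e. fst om e}} = measure MU ?\<Omega>"
 proof -
  have eq: "{om. {e. fst om e} \<subseteq> F' & \<Psi> {e. fst om e}} Int set_pmf MU = ?\<Omega> Int set_pmf MU"
  proof (intro equalityI subsetI)
   fix om assume o: "om : {om. {e. fst om e} \<subseteq> F' & \<Psi> {e. fst om e}} Int set_pmf MU"
   then have "om : rc_conf F W" by (auto simp: set_pmf_iff pmf_MU split: if_splits)
   then have "om = (%(A, G). cnf A G) ({e. fst om e}, {w. snd om w})"
   "({e. fst om e}, {w. snd om w}) : {A : Pow F'. \<Psi> A} \<times> Pow W" using o by (auto simp: cnf_def rc_conf_def)
   then have "om : ?\<Omega>" by (rule image_eqI)
   then show "om : ?\<Omega> Int set_pmf MU" using o by blast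
  qed (auto simp: cnf_def)
  have "measure MU {om. {e. fst om e} \<subseteq> F' & \<Psi> {e. fst om e}} =
   measure MU ({om. {e. fst om e} \<subseteq> F' & \<Psi> {e. fst om e}} Int set_pmf MU)" by (rule measure_Int_set_pmf[symmetric])
  also have "... = measure MU ?\<Omega>" unfolding eq by (rule measure_Int_set_pmf)
  finally show ?thesis .
 qed
 also have "... = (\<Sum>om\<in>?\<Omega>. pmf MU om)" by (rule measure_measure_pmf_finite) (use assms finW in auto)
 also have "... = (\<Sum>om\<in>?\<Omega>. RW om / Z)"
 proof (rule sum.cong)
  fix om assume "om : ?\<Omega>"
  then have "om : rc_conf F W" using sub by (rule subsetD[rotated])
  then show "pmf MU om = RW om / Z" by (simp only: pmf_MU if_True)
 qed simp
 also have "... = (\<Sum>om\<in>?\<Omega>. RW om) / Z" by (rule sum_divide_distrib[symmetric])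
 finally show ?thesis unfolding sum_RW[OF assms] by simp
qed

text \<open>With probability close to 1 all open edges lie in a given large finite set, and
  conditioning on that event yields exactly a finite model. One \<open>F0\<close> serves all events,
  and every larger finite \<open>F'\<close> is admissible; this freedom is used to choose convenient
  edge sets later.\<close>

lemma prob_approx:
 assumes "dl > 0"
 shows "\<exists>F0. finite F0 & F0 \<subseteq> F & (\<forall>F'. finite F' --> F0 \<subseteq> F' --> F' \<subseteq> F --> (\<forall>\<Psi>.
  \<bar>measure MU {om. \<Psi> {e. fst om e}} - EE en W (q - 1) (%_. u0) xx F' (%A. of_bool (\<Psi> A))\<bar> <= dl))"
proof -
 define FF where "FF k = {e : F. to_nat_on (UNIV :: 'e set) e <= k}" for k
 have finFF: "finite (FF k)" for k
 proof -
  have "inj_on (to_nat_on (UNIV :: 'e set)) (FF k)" using inj_on_to_nat_on[OF cE] by (rule inj_on_subset) auto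
  moreover have "to_nat_on (UNIV :: 'e set) ` FF k <= {..k}" by (auto simp: FF_def)
  ultimately show ?thesis using finite_imageD finite_subset by blast
 qed
 let ?B = "%k. {om :: ('e => bool) \<times> ('w => bool). {e. fst om e} \<subseteq> FF k}"
 have "(%k. measure MU (?B k)) \<longlonglongrightarrow> measure MU (\<Union>k. ?B k)"
  by (rule measure_pmf.finite_Lim_measure_incseq) (auto simp: incseq_def FF_def intro: order_trans)
 moreover have "measure MU (\<Union>k. ?B k) = 1"
 proof -
  have "set_pmf MU <= (\<Union>k. ?B k)"
  proof
   fix om assume "om : set_pmf MU"
   then have "om : rc_conf F W" by (auto simp: set_pmf_iff pmf_MU split: if_splits)
   then have o: "finite {e. fst om e}" "{e. fst om e} \<subseteq> F" by (auto simp: rc_conf_def)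
   define k where "k = Max (insert 0 (to_nat_on (UNIV :: 'e set) ` {e. fst om e}))"
   have "{e. fst om e} \<subseteq> FF k" using o by (auto simp: FF_def k_def intro!: Max_ge)
   then show "om : (\<Union>k. ?B k)" by blast
  qed
  then show ?thesis by (subst measure_pmf.prob_eq_1, simp, simp only: AE_measure_pmf_iff, blast)
 qed
 \<comment> \<open>The bound 1/2 keeps the conditioning event from having probability 0.\<close>
 ultimately have "\<forall>\<^sub>F k in sequentially. 1 - min (dl / 2) (1 / 2) < measure MU (?B k)" using assms by (intro order_tendstoD(1)) auto
 then obtain k where k: "1 - min (dl / 2) (1 / 2) < measure MU (?B k)" by (auto simp: eventually_sequentially)
 show ?thesis
 proof (intro exI[of _ "FF k"] conjI allI impI finFF)
  show "FF k \<subseteq> F" by (auto simp: FF_def)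
  fix F' \<Psi> assume F': "finite F'" "FF k \<subseteq> F'" "F' \<subseteq> F"
  interpret m: fk_finite en W "q - 1" "%_. u0" xx F'
  proof
   show "en e \<subseteq> W" if "e : F'" for e using FW F'(3) that by blast
  qed (use xx F' in auto)
  let ?K = "(1 + ss) ^ card W / Z"
  have K: "?K > 0" using ss Z_pos by simp
  define S where "S = (\<Sum>A\<in>Pow F'. wt en W (q - 1) (%_. u0) xx A)"
  define T where "T = (\<Sum>A\<in>Pow F'. of_bool (\<Psi> A) * wt en W (q - 1) (%_. u0) xx A)"
  let ?a = "measure MU {om. \<Psi> {e. fst om e}}"
  let ?b = "measure MU {om. {e. fst om e} \<subseteq> F' & \<Psi> {e. fst om e}}"
  let ?m = "measure MU {om. {e. fst om e} \<subseteq> F'}"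
  have b: "?b = ?K * T" unfolding T_def by (rule prob_sub[OF F'(1,3)])
  have m: "?m = ?K * S" using prob_sub[OF F'(1,3), of "%_. True"] by (simp add: S_def)
  have EE: "EE en W (q - 1) (%_. u0) xx F' (%A. of_bool (\<Psi> A)) = ?b / ?m" unfolding EE_def b m S_def[symmetric] T_def[symmetric]
   by (rule mult_divide_mult_cancel_left[symmetric]) (use K in linarith)
  have "measure MU (?B k) <= ?m" by (rule measure_pmf.finite_measure_mono) (use F' in auto)
  then have m1: "1 - min (dl / 2) (1 / 2) < ?m" using k by linarith
  have m0: "0 < ?m" "?m <= 1" using m1 by auto
  have bm: "?b <= ?m" "?b <= ?a" by (auto intro: measure_pmf.finite_measure_mono)
  have "?a <= measure MU ({om. {e. fst om e} \<subseteq> F' & \<Psi> {e. fst om e}} Un {om. \<not> {e. fst om e} \<subseteq> F'})"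
   by (rule measure_pmf.finite_measure_mono) auto
  also have "... <= ?b + measure MU {om. \<not> {e. fst om e} \<subseteq> F'}" by (rule measure_Un_le) auto
  also have "measure MU {om. \<not> {e. fst om e} \<subseteq> F'} = 1 - ?m"
   using measure_pmf.prob_compl[of "{om. {e. fst om e} \<subseteq> F'}" MU] by (simp add: Collect_neg_eq Compl_eq_Diff_UNIV)
  finally have ab: "?a - ?b <= 1 - ?m" by simp
  have "?b / ?m - ?b = ?b / ?m * (1 - ?m)" using m0 by (simp add: field_simps)
  also have "... <= 1 * (1 - ?m)" using bm m0 by (intro mult_right_mono) auto
  finally have c: "?b / ?m - ?b <= 1 - ?m" by simp
  have d: "?b <= ?b / ?m" using m0 by (simp add: le_divide_eq mult_left_le)
  show "\<bar>?a - EE en W (q - 1) (%_. u0) xx F' (%A. of_bool (\<Psi> A))\<bar> <= dl" unfolding EE using ab bm c d m1 by linarith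
 qed
qed

end

section \<open>One contracted model for free and wired volumes\<close>

definition prj :: "'v set => 'v => 'v option" where
 "prj S v = (if v : S then Some v else None)"

definition WW :: "'v set => 'v option set" where "WW S = insert None (Some ` S)"

lemma prj_in [simp]: "v : S ==> prj S v = Some v" and prj_out [simp]: "v ~: S ==> prj S v = None" by (auto simp: prj_def)

lemma prj_WW [simp]: "prj S v : WW S" by (auto simp: prj_def WW_def)

context wgraph
begin

text \<open>Edges without an endpoint in \<open>S\<close> become loops at \<open>None\<close>. Free
  volumes use the same vertices but only edges inside \<open>S\<close>, which leaves
  \<open>None\<close> isolated; both boundary conditions are thus models that differ in the edge set
  alone.\<close>

definition epS :: "'v set => 'e => 'v option set" where "epS S e = prj S ` ep e"

lemma edgy_epS: "edgy (epS S)" unfolding epS_def by (rule edgy_image[OF edgy_ep])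

lemma epS_WW: "epS S e <= WW S" by (auto simp: epS_def)

lemma finite_WW: "finite S ==> finite (WW S)" by (simp add: WW_def)

lemma summable_xx:
 assumes "finite S" "bt \<ge> 0"
 shows "(%e. exp (2 * bt * J e) - 1) summable_on {e. ep e Int S ~= {}}"
proof -
 let ?M = "{e. ep e Int S ~= {}}"
 have M: "?M = (\<Union>v\<in>S. {e. v : ep e})" by auto
 have sJ: "J summable_on ?M" unfolding M using infsum_UN_le[OF assms(1), of "%v. {e. v : ep e}"] J_summable by blast
 define D where "D = infsum J ?M"
 have JD: "J e <= D" if "e : ?M" for e
 proof -
  have "sum J {e} <= D" unfolding D_def by (rule finite_sum_le_infsum[OF sJ]) (use that J_nonneg in auto)
  then show ?thesis by simp
 qed
 have "(%e. 2 * bt * exp (2 * bt * D) * J e) summable_on ?M" using sJ by (rule summable_on_cmult_right)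
 then show ?thesis
 proof (rule summable_on_comparison_test)
  fix e assume e: "e : ?M"
  let ?t = "2 * bt * J e"
  have t: "0 <= ?t" using assms(2) J_nonneg by simp
  have "1 - ?t <= exp (- ?t)" using exp_ge_add_one_self[of "- ?t"] by simp
  then have "exp ?t * (1 - ?t) <= exp ?t * exp (- ?t)" by (intro mult_left_mono) auto
  then have "exp ?t - 1 <= ?t * exp ?t" by (simp add: exp_minus algebra_simps)
  also have "... <= ?t * exp (2 * bt * D)" using t JD[OF e] assms(2) by (intro mult_left_mono) (auto intro!: mult_left_mono)
  finally show "exp ?t - 1 <= 2 * bt * exp (2 * bt * D) * J e" by (simp add: mult_ac)
  show "0 <= exp ?t - 1" using t by simp
 qed
qed

lemma approx_wired:
 assumes S: "finite S" and q: "q \<ge> 1" and bt: "bt \<ge> 0" and h: "h \<ge> 0" and dl: "dl > 0"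
 shows "\<exists>F0. finite F0 & F0 <= {e. ep e Int S ~= {}} & (\<forall>F'. finite F' --> F0 \<subseteq> F' --> F' <= {e. ep e Int S ~= {}} -->
  (\<forall>\<Psi>. \<bar>measure (rc_wired_fin q bt h J ep S) {om. \<Psi> {e. fst om e}} -
   EE (epS S) (WW S) (q - 1) (%_. exp (- (2 * bt * h))) (%e. exp (2 * bt * J e) - 1) F' (%A. of_bool (\<Psi> A))\<bar> <= dl))"
proof -
 interpret rc_setup q bt h J "epS S" "{e. ep e Int S ~= {}}" "WW S" using assms J_pos edgy_epS epS_WW finite_WW[OF S] summable_xx[OF S bt] countable_E
  by unfold_locales auto
 have eq: "epS S = (%e. (%v. if v : S then Some v else None) ` ep e)" by (simp add: fun_eq_iff epS_def prj_def[abs_def])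
 have x: "xx = (%e. exp (2 * bt * J e) - 1)" by (simp add: fun_eq_iff xx_def)
 have m: "measure (rc_wired_fin q bt h J ep S) {om. \<Psi> {e. fst om e}} = measure MU {om. \<Psi> {e. fst om e}}" for \<Psi>
 proof -
  have "rc_wired_fin q bt h J ep S = map_pmf (%(omE, omW). (omE, %v. omW (Some v))) MU" unfolding rc_wired_fin_def eq WW_def ..
  then have "measure (rc_wired_fin q bt h J ep S) {om. \<Psi> {e. fst om e}} =
   measure MU ((%(omE, omW). (omE, %v. omW (Some v))) -` {om. \<Psi> {e. fst om e}})" by (simp add: measure_map_pmf)
  also have "(%(omE, omW). (omE, %v. omW (Some v))) -` {om. \<Psi> {e. fst om e}} = {om. \<Psi> {e. fst om e}}" by auto
  finally show ?thesis .
 qed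
 show ?thesis using prob_approx[OF dl] unfolding m x u0_def .
qed

text \<open>The isolated vertex \<open>None\<close> contributes the constant factor
  \<open>1 + Q * t\<close>, which cancels in expectations.\<close>

lemma kap_free:
 assumes S: "finite S" and A: "!!e. e : A ==> ep e \<subseteq> S"
 shows "kap (epS S) (WW S) Q (%_. t) A = (1 + Q * t) * kap ep S Q (%_. t) A"
proof -
 have cN: "cl (epS S) A None = {None}"
 proof
  show "cl (epS S) A None <= {None}"
  proof (rule cl_least)
   fix e assume "e : A" "epS S e Int {None} ~= {}"
   moreover have "None ~: epS S e" using A[OF \<open>e : A\<close>] by (auto simp: epS_def prj_def)
   ultimately show "epS S e <= {None}" by blast
  qed simp
 qed simp
 have cS: "cl (epS S) A (Some v) = Some ` cl ep A v" for v
 proof -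
  have "cl (epS S) (id ` A) (Some v) = Some ` cl ep A v"
  proof (rule cl_image_inj[OF edgy_ep])
   fix e assume "e : A"
   then have "ep e \<subseteq> S" by (rule A)
   then show "epS S (id e) = Some ` ep e" unfolding epS_def by (auto intro!: image_cong)
  qed simp
  then show ?thesis by simp
 qed
 have "cl (epS S) A ` WW S = insert {None} ((%C. Some ` C) ` cl ep A ` S)" unfolding WW_def by (simp add: cN cS image_image)
 moreover have "{None} ~: (%C. Some ` C) ` cl ep A ` S" by auto
 moreover have "ucl (%_. t) (Some ` C) = ucl (%_. t) C" for C :: "'v set" by (simp add: ucl_def card_image)
 moreover have "inj_on (%C. Some ` C) (cl ep A ` S)" by (auto intro: inj_onI)
 ultimately show ?thesis unfolding kap_def using S by (simp add: prod.reindex o_def) (simp add: ucl_def)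
qed

lemma approx_free:
 assumes S: "finite S" and q: "q \<ge> 1" and bt: "bt \<ge> 0" and h: "h \<ge> 0" and dl: "dl > 0"
 shows "\<exists>F0. finite F0 & F0 <= {e. ep e \<subseteq> S} & (\<forall>F'. finite F' --> F0 \<subseteq> F' --> F' <= {e. ep e \<subseteq> S} -->
  (\<forall>\<Psi>. \<bar>measure (rc_free_fin q bt h J ep S) {om. \<Psi> {e. fst om e}} -
   EE (epS S) (WW S) (q - 1) (%_. exp (- (2 * bt * h))) (%e. exp (2 * bt * J e) - 1) F' (%A. of_bool (\<Psi> A))\<bar> <= dl))"
proof -
 have sub: "{e. ep e \<subseteq> S} <= {e. ep e Int S ~= {}}"
 proof
  fix e assume e: "e : {e. ep e \<subseteq> S}"
  have "ep e ~= {}" using card_ep[of e] by auto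
  then show "e : {e. ep e Int S ~= {}}" using e by auto
 qed
 interpret rc_setup q bt h J ep "{e. ep e \<subseteq> S}" S using assms J_pos edgy_ep summable_on_subset_banach[OF summable_xx[OF S bt] sub] countable_E
  by unfold_locales auto
 have x: "xx = (%e. exp (2 * bt * J e) - 1)" by (simp add: fun_eq_iff xx_def)
 have "EE ep S (q - 1) (%_. u0) xx F' f = EE (epS S) (WW S) (q - 1) (%_. u0) xx F' f"
  if F': "F' <= {e. ep e \<subseteq> S}" for F' f
 proof -
  have c: "1 + (q - 1) * u0 ~= 0"
  proof -
   have "0 <= (q - 1) * u0" using q u0_bounds by simp
   then show ?thesis by linarith
  qed
  have w: "wt (epS S) (WW S) (q - 1) (%_. u0) xx A = (1 + (q - 1) * u0) * wt ep S (q - 1) (%_. u0) xx A"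
   if "A : Pow F'" for A
  proof -
   have "kap (epS S) (WW S) (q - 1) (%_. u0) A = (1 + (q - 1) * u0) * kap ep S (q - 1) (%_. u0) A" by (rule kap_free[OF S]) (use that F' in auto)
   then show ?thesis by (simp add: wt_def)
  qed
  have 1: "(\<Sum>A\<in>Pow F'. f A * wt (epS S) (WW S) (q - 1) (%_. u0) xx A) =
   (1 + (q - 1) * u0) * (\<Sum>A\<in>Pow F'. f A * wt ep S (q - 1) (%_. u0) xx A)" unfolding sum_distrib_left by (intro sum.cong) (auto simp: w)
  have 2: "(\<Sum>A\<in>Pow F'. wt (epS S) (WW S) (q - 1) (%_. u0) xx A) =
   (1 + (q - 1) * u0) * (\<Sum>A\<in>Pow F'. wt ep S (q - 1) (%_. u0) xx A)" unfolding sum_distrib_left by (intro sum.cong) (auto simp: w)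
  show ?thesis unfolding EE_def 1 2 using c by simp
 qed
 note eq = this
 show ?thesis
 proof (rule exE[OF prob_approx[OF dl]])
  fix F0 assume a: "finite F0 & F0 <= {e. ep e \<subseteq> S} & (\<forall>F'. finite F' --> F0 \<subseteq> F' --> F' <= {e. ep e \<subseteq> S} --> (\<forall>\<Psi>.
   \<bar>measure MU {om. \<Psi> {e. fst om e}} - EE ep S (q - 1) (%_. u0) xx F' (%A. of_bool (\<Psi> A))\<bar> <= dl))"
  show ?thesis
  proof (intro exI[of _ F0] conjI allI impI)
   fix F' \<Psi> assume F': "finite F'" "F0 \<subseteq> F'" "F' <= {e. ep e \<subseteq> S}"
   have "\<bar>measure MU {om. \<Psi> {e. fst om e}} - EE ep S (q - 1) (%_. u0) xx F' (%A. of_bool (\<Psi> A))\<bar> <= dl" using a F' by simp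
   then show "\<bar>measure (rc_free_fin q bt h J ep S) {om. \<Psi> {e. fst om e}} - EE (epS S) (WW S) (q - 1)
   (%_. exp (- (2 * bt * h))) (%e. exp (2 * bt * J e) - 1) F' (%A. of_bool (\<Psi> A))\<bar> <= dl" unfolding rc_free_fin_def eq[OF F'(3)] unfolding x u0_def .
  qed (use a in auto)
 qed
qed

end

section \<open>Open paths and quasi-locality\<close>

lemma p_of_x: "(exp t - 1) / (1 + (exp t - 1)) <= t" if "0 <= t" for t :: real
proof -
 have "1 - exp (- t) <= t" using exp_ge_add_one_self[of "- t"] by simp
 then show ?thesis by (simp add: exp_minus field_simps)
qed

context strong
begin

text \<open>Walks are lists of edges because parallel edges make vertex lists ambiguous.\<close>

fun wk :: "'v => 'e list => bool" where
 "wk v [] = True"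
| "wk v (e # l) = (v : ep e & wk (oth e v) l)"

fun vs :: "'v => 'e list => 'v list" where
 "vs v [] = [v]"
| "vs v (e # l) = v # vs (oth e v) l"

lemma vs_ne [simp]: "vs v l ~= []" by (cases l) auto

lemma length_vs [simp]: "length (vs v l) = Suc (length l)" by (induction l arbitrary: v) auto

lemma wk_append: "wk v (l @ [e]) \<longleftrightarrow> wk v l & last (vs v l) : ep e" by (induction l arbitrary: v) auto

lemma vs_append: "vs v (l @ [e]) = vs v l @ [oth e (last (vs v l))]" by (induction l arbitrary: v) auto

lemma vs_take: "k <= length l ==> vs v (take k l) = take (Suc k) (vs v l)"
proof (induction l arbitrary: v k)
 case (Cons e l)
 then show ?case by (cases k) auto
qed simp

lemma wk_take: "wk v l ==> wk v (take k l)"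
proof (induction l arbitrary: v k)
 case (Cons e l)
 then show ?case by (cases k) auto
qed simp

lemma wk_edge_vs: "wk v l ==> e : set l ==> ep e \<subseteq> set (vs v l)"
proof (induction l arbitrary: v)
 case (Cons f l)
 show ?case
 proof (cases "e = f")
  case True
  have "oth f v : set (vs (oth f v) l)" by (cases l) auto
  then show ?thesis using Cons.prems True oth(1)[of v f] by auto
 next
  case False
  then show ?thesis using Cons by auto
 qed
qed simp

lemma wk_distinct: "wk v l ==> distinct (vs v l) ==> distinct l"
proof (induction l arbitrary: v)
 case (Cons e l)
 have "e ~: set l"
 proof
  assume "e : set l"
  then have "ep e \<subseteq> set (vs (oth e v) l)" using wk_edge_vs[of "oth e v" l e] Cons.prems by auto
  then show False using Cons.prems by auto
 qed
 then show ?case using Cons by auto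
qed simp

lemma wk_cl: "wk v l ==> set l \<subseteq> A ==> set (vs v l) <= cl ep A v"
proof (induction l arbitrary: v)
 case (Cons e l)
 have "oth e v : cl ep A v" using Cons.prems oth(1)[of v e] cl_edge[OF edgy_ep, of e A v v] by auto
 then have "cl ep A (oth e v) = cl ep A v" by (rule cl_eq)
 then show ?case using Cons by auto
qed simp

lemma cl_path:
 assumes "y : cl ep A v"
 shows "\<exists>l. wk v l & distinct (vs v l) & set l \<subseteq> A & last (vs v l) = y"
proof -
 have "(v, y) : (adj ep A)\<^sup>*" using assms by (simp add: cl_def)
 then show ?thesis
 proof induction
  case base
  show ?case by (rule exI[of _ "[]"]) simp
 next
  case (step y z)
  then obtain l where l: "wk v l" "distinct (vs v l)" "set l \<subseteq> A" "last (vs v l) = y" by auto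
  obtain e where e: "e : A" "ep e = {y, z}" using step by (auto simp: adj_def)
  have "y ~= z" using card_ep[of e] e by auto
  then have oz: "oth e y = z" using oth_eq e by blast
  show ?case
  proof (cases "z : set (vs v l)")
   case True
   then obtain k where k: "k < length (vs v l)" "vs v l ! k = z" by (auto simp: in_set_conv_nth)
   then have k': "k <= length l" by simp
   have "last (vs v (take k l)) = z" unfolding vs_take[OF k'] using k by (subst last_conv_nth) auto
   moreover have "wk v (take k l)" by (rule wk_take) fact
   moreover have "distinct (vs v (take k l))" unfolding vs_take[OF k'] using l by simp
   moreover have "set (take k l) \<subseteq> A" using l(3) set_take_subset by fastforce
   ultimately show ?thesis by blast
  next
   case False
   then show ?thesis using l e oz by (intro exI[of _ "l @ [e]"]) (auto simp: wk_append vs_append)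
  qed
 qed
qed

text \<open>The event that a short open simple path from \<open>v\<close> leaves the window
  \<open>I\<close>. Infinitely many edges outside \<open>I\<close> may touch a cluster, so asking
  that none of them be open would be hopeless to control directly; restricting to paths of bounded
  length gives an event of small probability.\<close>

definition bad :: "'v => nat => 'e set => 'e set => bool" where
 "bad v m I A \<longleftrightarrow> (\<exists>l. wk v l & distinct (vs v l) & length l <= m & set l \<subseteq> A & \<not> set l \<subseteq> I)"

lemma finite_cl_I: "finite I ==> finite (cl ep (A Int I) v)"
proof -
 assume "finite I"
 have "cl ep (A Int I) v \<subseteq> insert v (\<Union>e\<in>I. ep e)" by (rule cl_least) auto
 then show ?thesis using \<open>finite I\<close> finite_ep finite_subset by (metis finite_UN finite_insert)
qed

text \<open>Follow a simple path inside the visible cluster to an endpoint of \<open>e\<close> and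
  append \<open>e\<close>. The path has no more vertices than the cluster, so the extended path has
  at most \<open>m\<close> edges; if \<open>e\<close> left the cluster, this path would be
  bad.\<close>

lemma good_closed:
 assumes "\<not> bad v m I A" "finite I" "card (cl ep (A Int I) v) <= m" "e : A" "ep e Int cl ep (A Int I) v ~= {}"
 shows "ep e <= cl ep (A Int I) v"
proof (rule ccontr)
 assume n: "\<not> ep e <= cl ep (A Int I) v"
 let ?K = "cl ep (A Int I) v"
 obtain z where z: "z : ep e" "z : ?K" using assms(5) by auto
 have w: "oth e z ~: ?K" using n z oth(1)[OF z(1)] by auto
 have eI: "e ~: I" using n z assms(4) cl_edge[OF edgy_ep, of e "A Int I" z v] by auto
 obtain l where l: "wk v l" "distinct (vs v l)" "set l \<subseteq> A Int I" "last (vs v l) = z" using cl_path[OF z(2)] by blast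
 have sub: "set (vs v l) <= ?K" using wk_cl l by blast
 have "Suc (length l) = card (set (vs v l))" using l(2) distinct_card by fastforce
 also have "... <= card ?K" using sub finite_cl_I[OF assms(2)] by (intro card_mono) auto
 finally have "length (l @ [e]) <= m" using assms(3) by simp
 moreover have "wk v (l @ [e])" "distinct (vs v (l @ [e]))" using l z w sub by (auto simp: wk_append vs_append)
 moreover have "set (l @ [e]) \<subseteq> A" "\<not> set (l @ [e]) \<subseteq> I" using l assms(4) eI by auto
 ultimately show False using assms(1) unfolding bad_def by blast
qed

text \<open>Outside the bad event the cluster is either resolved within \<open>I\<close> or visibly
  larger than \<open>m\<close>. In the second case a power of its size is negligible, so the exact
  cluster is irrelevant.\<close>

lemma good_cl:
 assumes "\<not> bad v m I A" "finite I"
 shows "cl ep A v = cl ep (A Int I) v | m < card (cl ep (A Int I) v) & cl ep (A Int I) v <= cl ep A v"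
proof (cases "m < card (cl ep (A Int I) v)")
 case True
 then show ?thesis using cl_mono[of "A Int I" A ep v] by blast
next
 case False
 have "cl ep A v <= cl ep (A Int I) v" by (rule cl_least) (use good_closed[OF assms] False in auto)
 then show ?thesis using cl_mono[of "A Int I" A ep v] by blast
qed

lemma good_cl_model:
 assumes "\<not> bad v m I A" "finite I" "insert v (\<Union>e\<in>I. ep e) \<subseteq> S"
 shows "cl (epS S) A (Some v) = Some ` cl ep (A Int I) v \<or>
  m < card (cl ep (A Int I) v) & Some ` cl ep (A Int I) v <= cl (epS S) A (Some v)"
proof -
 let ?K = "cl ep (A Int I) v"
 have KS: "?K \<subseteq> S"
 proof -
  have "?K \<subseteq> insert v (\<Union>e\<in>I. ep e)" by (rule cl_least) auto
  then show ?thesis using assms(3) by blast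
 qed
 have "Some ` ?K <= cl (epS S) (id ` (A Int I)) (Some v)"
 proof (rule cl_image[OF edgy_ep])
  fix e assume "e : A Int I"
  then have "ep e \<subseteq> S" using assms(3) by auto
  then show "epS S (id e) = Some ` ep e" unfolding epS_def by (auto intro!: image_cong)
 qed
 also have "... <= cl (epS S) A (Some v)" by (rule cl_mono) auto
 finally have 1: "Some ` ?K <= cl (epS S) A (Some v)" .
 show ?thesis
 proof (cases "m < card ?K")
  case False
  have "cl (epS S) A (Some v) \<subseteq> Some ` ?K"
  proof (rule cl_least)
   fix e assume e: "e : A" "epS S e Int Some ` ?K ~= {}"
   then have "ep e Int ?K ~= {}" by (auto simp: epS_def prj_def split: if_splits)
   then have "ep e <= ?K" using good_closed[OF assms(1,2) _ e(1)] False by auto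
   then show "epS S e \<subseteq> Some ` ?K" using KS by (auto simp: epS_def prj_def)
  qed simp
  then show ?thesis using 1 by blast
 qed (use 1 in blast)
qed

lemma walk_sum:
 fixes p :: "'e => real"
 assumes p: "!!e. 0 <= p e" and B: "!!v E. finite E ==> (!!e. e : E ==> v : ep e) ==> sum p E <= B"
  and L: "finite L" "!!l. l : L ==> wk v l & length l = j"
 shows "(\<Sum>l\<in>L. prod_list (map p l)) <= B ^ j" using L
proof (induction j arbitrary: v L)
 case 0
 then have "L <= {[]}" by auto
 then show ?case by (auto simp: subset_singleton_iff)
next
 case (Suc j)
 have B0: "0 <= B" using B[of "{}"] by simp
 have L: "L = (\<Union>e\<in>hd ` L. (#) e ` {l. e # l : L})"
 proof
  show "L <= (\<Union>e\<in>hd ` L. (#) e ` {l. e # l : L})"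
  proof
   fix l assume l: "l : L"
   then obtain e l' where "l = e # l'" using Suc.prems(2)[OF l] by (cases l) auto
   then show "l : (\<Union>e\<in>hd ` L. (#) e ` {l. e # l : L})" using l by force
  qed
 qed auto
 have fin: "finite {l. e # l : L}" for e using finite_vimageI[OF Suc.prems(1), of "(#) e"] by (simp add: vimage_def)
 have "(\<Sum>l\<in>L. prod_list (map p l)) = (\<Sum>e\<in>hd ` L. \<Sum>l\<in>(#) e ` {l. e # l : L}. prod_list (map p l))"
  by (subst L, rule sum.UNION_disjoint) (use Suc.prems(1) fin in auto)
 also have "... = (\<Sum>e\<in>hd ` L. p e * (\<Sum>l\<in>{l. e # l : L}. prod_list (map p l)))" by (intro sum.cong refl) (simp add: sum.reindex sum_distrib_left)
 also have "... <= (\<Sum>e\<in>hd ` L. p e * B ^ j)"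
 proof (intro sum_mono mult_left_mono p)
  fix e assume "e : hd ` L"
  show "(\<Sum>l\<in>{l. e # l : L}. prod_list (map p l)) <= B ^ j" by (rule Suc.IH[OF fin, of e "oth e v"]) (use Suc.prems(2) in force)
 qed
 also have "... = sum p (hd ` L) * B ^ j" by (simp add: sum_distrib_right)
 also have "... <= B * B ^ j"
 proof (intro mult_right_mono B[of _ v])
  fix e assume "e : hd ` L"
  then obtain l where l: "l : L" "e = hd l" by auto
  then show "v : ep e" using Suc.prems(2)[OF l(1)] by (cases l) auto
 qed (use Suc.prems(1) B0 in auto)
 finally show ?case by simp
qed

text \<open>The weights at each vertex sum to at most \<open>B\<close>, so walks of length at most
  \<open>m\<close> have finite total weight. Finitely many of them carry all but \<open>dl\<close>,
  and \<open>I0\<close> collects their edges.\<close>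

lemma walk_tail:
 fixes p :: "'e => real"
 assumes p: "!!e. 0 <= p e" and B: "!!v E. finite E ==> (!!e. e : E ==> v : ep e) ==> sum p E <= B"
  and dl: "dl > 0"
 shows "\<exists>I0. finite I0 & (\<forall>L. finite L --> (\<forall>l\<in>L. wk v l & length l <= m & \<not> set l \<subseteq> I0) -->
  (\<Sum>l\<in>L. prod_list (map p l)) <= dl)"
proof -
 let ?X = "{l. wk v l & length l <= m}" and ?f = "%l. prod_list (map p l)"
 have nn: "0 <= ?f l" for l by (induction l) (auto simp: p)
 have "?f summable_on ?X"
 proof (rule nonneg_bdd_above_summable_on)
  show "bdd_above (sum ?f ` {L. L \<subseteq> ?X & finite L})"
  proof (rule bdd_aboveI2)
   fix L assume L: "L : {L. L \<subseteq> ?X & finite L}"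
   have "sum ?f L = (\<Sum>j\<le>m. sum ?f {l : L. length l = j})" by (rule sum.group[symmetric]) (use L in auto)
   also have "... <= (\<Sum>j\<le>m. B ^ j)" by (intro sum_mono walk_sum[OF p B]) (use L in auto)
   finally show "sum ?f L <= (\<Sum>j\<le>m. B ^ j)" .
  qed
 qed (rule nn)
 then have "(?f has_sum infsum ?f ?X) ?X" by (rule has_sum_infsum)
 then have "\<forall>\<^sub>F L in finite_subsets_at_top ?X. dist (sum ?f L) (infsum ?f ?X) < dl" unfolding has_sum_def by (rule tendstoD) (rule dl)
 then have "\<exists>L0. finite L0 & L0 \<subseteq> ?X & (\<forall>L. finite L & L0 \<subseteq> L & L \<subseteq> ?X --> dist (sum ?f L) (infsum ?f ?X) < dl)"
  by (simp only: eventually_finite_subsets_at_top)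
 then obtain L0 where L0': "finite L0 & L0 \<subseteq> ?X & (\<forall>L. finite L & L0 \<subseteq> L & L \<subseteq> ?X --> dist (sum ?f L) (infsum ?f ?X) < dl)"
  by (rule exE)
 have L0: "finite L0" "L0 \<subseteq> ?X" using L0' by (simp_all only:)
 have "dist (sum ?f L0) (infsum ?f ?X) < dl" using conjunct2[OF conjunct2[OF L0'], THEN spec[of _ L0]] L0 by (simp only: simp_thms subset_refl)
 then have i: "infsum ?f ?X < sum ?f L0 + dl" unfolding dist_real_def by linarith
 have "(\<Sum>l\<in>L. ?f l) <= dl" if "finite L" "\<forall>l\<in>L. wk v l & length l <= m & \<not> set l \<subseteq> \<Union>(set ` L0)" for L
 proof -
  have dis: "L Int L0 = {}" using that(2) by blast
  have "sum ?f L + sum ?f L0 = sum ?f (L Un L0)" by (rule sum.union_disjoint[symmetric]) (use that(1) L0 dis in auto)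
  also have "... <= infsum ?f ?X" by (rule finite_sum_le_infsum) (use \<open>?f summable_on ?X\<close> that L0 nn in auto)
  finally show ?thesis using i by linarith
 qed
 then show ?thesis using L0(1) by (intro exI[of _ "\<Union>(set ` L0)"]) auto
qed

end

section \<open>Infinite-volume measures as limits of finite models\<close>

lemma (in prob_space) countable_union_bound:
 assumes "countable X" "!!l. l : X ==> B l : sets M" "0 <= dl"
  and fin: "!!L. finite L ==> L \<subseteq> X ==> (\<Sum>l\<in>L. measure M (B l)) <= dl"
 shows "measure M (\<Union>l\<in>X. B l) <= dl"
proof (cases "X = {}")
 case False
 define f where "f = from_nat_into X"
 have r: "range f = X" unfolding f_def using False assms(1) by (rule range_from_nat_into)
 let ?U = "%n. \<Union>l\<in>f ` {..n}. B l"
 have conv: "(%n. measure M (?U n)) \<longlonglongrightarrow> measure M (\<Union>n. ?U n)"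
 proof (rule finite_Lim_measure_incseq)
  show "range ?U \<subseteq> sets M" using assms(2) r by (auto intro!: sets.finite_UN)
  show "incseq ?U" by (auto simp: incseq_def intro: order_trans)
 qed
 have eq: "(\<Union>n. ?U n) = (\<Union>l\<in>X. B l)" unfolding r[symmetric] by auto
 have "measure M (?U n) <= dl" for n
 proof -
  have "measure M (?U n) <= (\<Sum>l\<in>f ` {..n}. measure M (B l))" by (rule finite_measure_subadditive_finite) (use assms(2) r in auto)
  also have "... <= dl" by (rule fin) (use r in auto)
  finally show ?thesis .
 qed
 then show ?thesis using LIMSEQ_le_const2[OF conv[unfolded eq]] by blast
qed (use assms(3) in simp)

lemma (in fk_finite) EE_sum: "finite L ==> E (%A. \<Sum>l\<in>L. f l A) = (\<Sum>l\<in>L. E (f l))"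
proof (induction L rule: finite_induct)
 case empty
 show ?case using EE_const[of 0] by simp
next
 case (insert l L)
 then show ?case using EE_add[of "f l" "%A. \<Sum>l\<in>L. f l A"] by (simp del: sum_of_bool_eq)
qed

text \<open>The infinite-volume measure enters the analysis only through these facts: convergence of
  cylinder expectations from finite models, and invariance of the probabilities that finitely many
  given edges are open. Free and wired limits are both instances.\<close>

locale fk_limit = strong ep J eps c for ep :: "'e => 'v set" and J eps c +
 fixes Q t bt :: real and nu :: "('e => bool) measure" and S :: "nat => 'v set" and F :: "nat => 'e set"
 assumes Q: "0 <= Q" and t: "0 < t" "t <= 1" and bt: "0 <= bt"
  and finS: "!!n. finite (S n)" and finF: "!!n. finite (F n)"
  and evS: "!!B. finite B ==> \<forall>\<^sub>F n in sequentially. B \<subseteq> S n"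
  and evF: "!!I. finite I ==> \<forall>\<^sub>F n in sequentially. I \<subseteq> F n"
  and prob_nu: "prob_space nu" and sets_nu: "sets nu = sets (PiM UNIV (%_. count_space UNIV))"
  and lim: "!!I f. finite I ==>
   (%n. EE (epS (S n)) (WW (S n)) Q (%_. t) (%e. exp (2 * bt * J e) - 1) (F n) (%A. f (A Int I)))
   \<longlonglongrightarrow> (\<integral>om. f (Collect om Int I) \<partial>nu)"
  and inv: "!!g P. g : Aut ep J ==> finite P ==>
   measure nu {om. snd g ` P <= Collect om} = measure nu {om. P <= Collect om}"
begin

sublocale nu: prob_space nu by (rule prob_nu)

lemma space_nu [simp]: "space nu = UNIV" using sets_eq_imp_space_eq[OF sets_nu] by (simp add: space_PiM)

definition x :: "'e => real" where "x e = exp (2 * bt * J e) - 1"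
definition p :: "'e => real" where "p e = x e / (1 + x e)"

lemma x_nonneg: "0 <= x e" using bt J_nonneg by (simp add: x_def)
lemma p_bounds: "0 <= p e" "p e <= 1" using x_nonneg[of e] by (auto simp: p_def)
lemma p_le: "p e <= 2 * bt * J e" unfolding p_def x_def by (rule p_of_x) (use bt J_nonneg in simp)

abbreviation "En n \<equiv> EE (epS (S n)) (WW (S n)) Q (%_. t) x (F n)"

lemma model: "fk_const (epS (S n)) (WW (S n)) Q t x (F n)" using edgy_epS epS_WW finite_WW[OF finS] Q t x_nonneg finF by unfold_locales auto

lemma lim': "finite I ==> (%n. En n (%A. f (A Int I))) \<longlonglongrightarrow> (\<integral>om. f (Collect om Int I) \<partial>nu)"
proof -
 assume "finite I"
 have "x = (%e. exp (2 * bt * J e) - 1)" by (simp add: fun_eq_iff x_def)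
 then show ?thesis using lim[OF \<open>finite I\<close>, of f] by simp
qed

lemma meas_coord [measurable]: "(%om. om e) : measurable nu (count_space UNIV)"
proof -
 have "(%om. om e) : measurable (PiM UNIV (%_. count_space (UNIV :: bool set))) (count_space UNIV)" by (rule measurable_component_singleton) simp
 then show ?thesis by (simp only: measurable_cong_sets[OF sets_nu refl])
qed

lemma sets_open: "finite P ==> {om. P <= Collect om} : sets nu"
proof -
 assume "finite P"
 then have "{om : space nu. \<forall>e\<in>P. om e} : sets nu" by measurable
 then show ?thesis by (simp add: subset_iff Ball_def)
qed

lemma sets_cyl: "finite I ==> {om. Collect om Int I = A} : sets nu"
proof -
 assume I: "finite I"
 show ?thesis
 proof (cases "A \<subseteq> I")
  case True
  have "{om : space nu. \<forall>e\<in>I. om e = (e : A)} : sets nu" using I by measurable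
  moreover have "{om : space nu. \<forall>e\<in>I. om e = (e : A)} = {om. Collect om Int I = A}" using True by auto
  ultimately show ?thesis by simp
 next
  case False
  then have "{om. Collect om Int I = A} = {}" by auto
  then show ?thesis by simp
 qed
qed

lemma meas_cyl: "finite I ==> (%om. f (Collect om Int I) :: real) : borel_measurable nu"
proof -
 assume I: "finite I"
 have "(%om. f (Collect om Int I)) = (%om. \<Sum>A\<in>Pow I. f A * indicator {om. Collect om Int I = A} om)"
 proof
  fix om
  have "(\<Sum>A\<in>Pow I. f A * indicator {om. Collect om Int I = A} om) = (\<Sum>A\<in>{Collect om Int I}. f A)"
   by (rule sum.mono_neutral_cong_right) (use I in \<open>auto simp: indicator_def\<close>)
  then show "f (Collect om Int I) = (\<Sum>A\<in>Pow I. f A * indicator {om. Collect om Int I = A} om)" by simp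
 qed
 moreover have "(%om. \<Sum>A\<in>Pow I. f A * indicator {om. Collect om Int I = A} om) : borel_measurable nu"
  using sets_cyl[OF I] by (intro borel_measurable_sum borel_measurable_times borel_measurable_indicator) auto
 ultimately show ?thesis by simp
qed

lemma sets_cyl_pred: "finite I ==> {om. P (Collect om Int I)} : sets nu"
proof -
 assume "finite I"
 then have "(%om. of_bool (P (Collect om Int I)) :: real) : borel_measurable nu" by (rule meas_cyl)
 then have "(%om. of_bool (P (Collect om Int I)) :: real) -` {1} Int space nu : sets nu" by (rule measurable_sets) auto
 moreover have "(%om. of_bool (P (Collect om Int I)) :: real) -` {1} = {om. P (Collect om Int I)}" by auto
 ultimately show ?thesis by simp
qed

lemma int_cyl: "finite I ==> (\<integral>om. of_bool (P (Collect om Int I)) \<partial>nu) = measure nu {om. P (Collect om Int I)}"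
proof -
 assume "finite I"
 have "(%om. of_bool (P (Collect om Int I)) :: real) = indicator {om. P (Collect om Int I)}" by (auto simp: fun_eq_iff indicator_def)
 then show ?thesis using sets_cyl_pred[OF \<open>finite I\<close>, of P] by simp
qed

lemma dom_n: "finite P ==> En n (%A. of_bool (P \<subseteq> A)) <= (\<Prod>e\<in>P. p e)"
proof -
 assume "finite P"
 interpret m: fk_const "epS (S n)" "WW (S n)" Q t x "F n" by (rule model)
 show ?thesis
 proof (cases "P \<subseteq> F n")
  case True then show ?thesis using m.EE_dominated[OF True] by (simp add: p_def)
 next
  case False
  have "En n (%A. of_bool (P \<subseteq> A)) <= En n (%A. 0)" by (rule m.EE_mono) (use False in auto)
  also have "... = 0" by (rule m.EE_const)
  also have "0 <= (\<Prod>e\<in>P. p e)" by (intro prod_nonneg p_bounds)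
  finally show ?thesis .
 qed
qed

lemma dom: "finite P ==> measure nu {om. P <= Collect om} <= (\<Prod>e\<in>P. p e)"
proof -
 assume P: "finite P"
 have eq: "P \<subseteq> A Int P \<longleftrightarrow> P \<subseteq> A" for A by auto
 have "(%n. En n (%A. of_bool (P \<subseteq> A))) \<longlonglongrightarrow> measure nu {om. P <= Collect om}"
  using lim'[OF P, of "%A. of_bool (P \<subseteq> A)"] int_cyl[OF P, of "%A. P \<subseteq> A"] unfolding eq by simp
 then show ?thesis by (rule LIMSEQ_le_const2) (use dom_n[OF P] in auto)
qed

definition DJ :: real where "DJ = infsum J {e. (SOME v. True) : ep e}"

lemma DJ: "infsum J {e. v : ep e} = DJ" using infsum_const_v[of "%_. True" v "SOME v. True"] by (simp add: DJ_def)

lemma DJ_pos: "0 < DJ"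
proof -
 fix v obtain e where e: "v : ep e" using exists_edge by blast
 have "sum J {e} <= infsum J {e. v : ep e}" by (rule finite_sum_le_infsum[OF J_summable]) (use e J_nonneg in auto)
 then show ?thesis using J_pos[of e] by (simp add: DJ)
qed

lemma sum_p_le:
 assumes "finite E" "!!e. e : E ==> v : ep e"
 shows "sum p E <= 2 * bt * DJ"
proof -
 have "sum p E <= (\<Sum>e\<in>E. 2 * bt * J e)" by (intro sum_mono p_le)
 also have "... = 2 * bt * sum J E" by (simp add: sum_distrib_left)
 also have "sum J E <= infsum J {e. v : ep e}" by (rule finite_sum_le_infsum[OF J_summable]) (use assms J_nonneg in auto)
 finally show ?thesis using bt by (simp add: DJ mult_left_mono)
qed

lemma prod_walk: "wk v l ==> distinct (vs v l) ==> (\<Prod>e\<in>set l. p e) = prod_list (map p l)" using wk_distinct[of v l] by (simp add: prod.distinct_set_conv_list)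

text \<open>Stated for finite families of walks, so that one condition controls both the finite
  models and, through countable unions, the limit.\<close>

definition tail_ok :: "'v => nat => real => 'e set => bool" where
 "tail_ok v m dl I \<longleftrightarrow> (\<forall>L. finite L --> (\<forall>l\<in>L. wk v l & length l <= m & \<not> set l \<subseteq> I) -->
  (\<Sum>l\<in>L. prod_list (map p l)) <= dl)"

lemma tail_ok_ex: "dl > 0 ==> \<exists>I0. finite I0 & (\<forall>I. I0 \<subseteq> I --> tail_ok v m dl I)"
proof -
 assume d: "dl > 0"
 have "\<exists>I0. finite I0 & (\<forall>L. finite L --> (\<forall>l\<in>L. wk v l & length l <= m & \<not> set l \<subseteq> I0) -->
  (\<Sum>l\<in>L. prod_list (map p l)) <= dl)"
 proof (rule walk_tail)
  show "0 <= p e" for e by (rule p_bounds)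
  fix v E assume "finite E" "!!e. e : E ==> v : ep e"
  then show "sum p E <= 2 * bt * DJ" by (rule sum_p_le)
 qed (rule d)
 then obtain I0 where I0: "finite I0" "\<forall>L. finite L --> (\<forall>l\<in>L. wk v l & length l <= m & \<not> set l \<subseteq> I0) -->
  (\<Sum>l\<in>L. prod_list (map p l)) <= dl" by (elim exE conjE) (rule that)
 have "tail_ok v m dl I" if "I0 \<subseteq> I" for I unfolding tail_ok_def
 proof (intro allI impI)
  fix L assume L: "finite L" "\<forall>l\<in>L. wk v l & length l <= m & \<not> set l \<subseteq> I"
  have "\<forall>l\<in>L. wk v l & length l <= m & \<not> set l \<subseteq> I0" using L(2) that by blast
  then show "(\<Sum>l\<in>L. prod_list (map p l)) <= dl" using I0(2) L(1) by simp
 qed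
 then show ?thesis using I0(1) by blast
qed

lemma bad_n:
 assumes "tail_ok v m dl I"
 shows "En n (%A. of_bool (bad v m I A)) <= dl"
proof -
 interpret m: fk_const "epS (S n)" "WW (S n)" Q t x "F n" by (rule model)
 define L where "L = {l. wk v l & distinct (vs v l) & length l <= m & set l \<subseteq> F n & \<not> set l \<subseteq> I}"
 have finL: "finite L" by (rule finite_subset[OF _ finite_lists_length_le[OF finF[of n], of m]]) (auto simp: L_def)
 have "En n (%A. of_bool (bad v m I A)) <= En n (%A. \<Sum>l\<in>L. of_bool (set l \<subseteq> A))"
 proof (rule m.EE_mono)
  fix A assume A: "A \<subseteq> F n"
  show "of_bool (bad v m I A) <= (\<Sum>l\<in>L. of_bool (set l \<subseteq> A) :: real)"
  proof (cases "bad v m I A")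
   case True
   then obtain l where l: "l : L" "set l \<subseteq> A" unfolding bad_def L_def using A by blast
   have "of_bool (set l \<subseteq> A) <= (\<Sum>l\<in>L. of_bool (set l \<subseteq> A) :: real)" by (rule member_le_sum[OF l(1) _ finL]) auto
   then show ?thesis using l True by simp
  qed (simp add: sum_nonneg)
 qed
 also have "... = (\<Sum>l\<in>L. En n (%A. of_bool (set l \<subseteq> A)))" by (rule m.EE_sum[OF finL])
 also have "... <= (\<Sum>l\<in>L. prod_list (map p l))"
 proof (rule sum_mono)
  fix l assume "l : L"
  then show "En n (%A. of_bool (set l \<subseteq> A)) <= prod_list (map p l)" using dom_n[of "set l" n] prod_walk[of v l] by (auto simp: L_def)
 qed
 also have "... <= dl" using assms finL unfolding tail_ok_def by (auto simp: L_def)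
 finally show ?thesis .
qed

lemma countable_lists_E: "countable (X :: 'e list set)" using countable_lists[OF countable_E] by (rule countable_subset[rotated]) auto

lemma sets_ex_list: "{om. \<exists>l. P l & set l <= Collect om} : sets nu"
proof -
 have "{om. \<exists>l. P l & set l <= Collect om} = (\<Union>l\<in>Collect P. {om. set l <= Collect om})" by auto
 then show ?thesis using countable_lists_E sets_open by (auto intro!: sets.countable_UN')
qed

lemma bad_alt: "{om. bad v m I (Collect om)} =
  {om. \<exists>l. (wk v l & distinct (vs v l) & length l <= m & \<not> set l \<subseteq> I) & set l <= Collect om}" unfolding bad_def by auto

lemma sets_bad: "{om. bad v m I (Collect om)} : sets nu" unfolding bad_alt by (rule sets_ex_list)

lemma bad_nu:
 assumes "tail_ok v m dl I" "0 <= dl"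
 shows "measure nu {om. bad v m I (Collect om)} <= dl"
proof -
 let ?X = "{l. wk v l & distinct (vs v l) & length l <= m & \<not> set l \<subseteq> I}"
 have "{om. bad v m I (Collect om)} = (\<Union>l\<in>?X. {om. set l <= Collect om})" unfolding bad_def by auto
 moreover have "measure nu (\<Union>l\<in>?X. {om. set l <= Collect om}) <= dl"
 proof (rule nu.countable_union_bound[OF countable_lists_E _ assms(2)])
  fix L assume L: "finite L" "L \<subseteq> ?X"
  have "(\<Sum>l\<in>L. measure nu {om. set l <= Collect om}) <= (\<Sum>l\<in>L. prod_list (map p l))"
  proof (rule sum_mono)
   fix l assume "l : L"
   then show "measure nu {om. set l <= Collect om} <= prod_list (map p l)" using L(2) dom[of "set l"] prod_walk[of v l] by auto
  qed
  also have "... <= dl" using assms(1) L unfolding tail_ok_def by blast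
  finally show "(\<Sum>l\<in>L. measure nu {om. set l <= Collect om}) <= dl" .
 qed (rule sets_open, simp)
 ultimately show ?thesis by simp
qed

definition loc_approx :: "(nat => 'e set => real) => ('e set => real) => real => 'v set => nat => 'e set => bool" where
 "loc_approx Yn Y dl B m I \<longleftrightarrow>
  (\<forall>A. (\<forall>v\<in>B. \<not> bad v m I A) --> \<bar>Y A - Y (A Int I)\<bar> <= dl) \<and>
   (\<forall>\<^sub>F n in sequentially. \<forall>A\<subseteq>F n. (\<forall>v\<in>B. \<not> bad v m I A) --> \<bar>Yn n A - Y (A Int I)\<bar> <= dl)"

text \<open>Both functionals are replaced by the cylinder functional \<open>Y (A Int I)\<close>. The
  error is at most \<open>dl\<close> off the bad events and at most \<open>2 * M\<close> on them,
  and the bad events are unlikely uniformly in the volume.\<close>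

theorem converge:
 fixes Yn :: "nat => 'e set => real" and Y :: "'e set => real"
 assumes meas: "(%om. Y (Collect om)) : borel_measurable nu"
  and bnd: "!!A. \<bar>Y A\<bar> <= M" "!!n A. A \<subseteq> F n ==> \<bar>Yn n A\<bar> <= M"
  and loc: "!!dl. dl > 0 ==> \<exists>B m I1. finite B & finite I1 & (\<forall>I. finite I --> I1 \<subseteq> I -->
   loc_approx Yn Y dl B m I)"
 shows "(%n. En n (Yn n)) \<longlonglongrightarrow> (\<integral>om. Y (Collect om) \<partial>nu)"
proof (rule LIMSEQ_I)
 fix r :: real assume r: "0 < r"
 have M0: "0 <= M" using bnd(1)[of "{}"] by linarith
 \<comment> \<open>Three errors are added at the end: twice \<open>dl + 2 * M * dl\<close>, and once
   \<open>dl\<close> from the convergence of the cylinder expectation.\<close>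
 define dl where "dl = r / (4 * (1 + 2 * M))"
 have dl: "dl > 0" using r M0 by (simp add: dl_def)
 obtain B m I1 where L: "finite B" "finite I1" and L2: "!!I. finite I ==> I1 \<subseteq> I ==>
   loc_approx Yn Y dl B m I" using loc[OF dl] by blast
 define d where "d = dl / (1 + card B)"
 have d: "d > 0" "card B * d <= dl" using dl by (auto simp: d_def field_simps)
 have "\<forall>v. \<exists>I0. finite I0 & (\<forall>I. I0 \<subseteq> I --> tail_ok v m d I)" by (rule allI) (rule tail_ok_ex[OF d(1)])
 then have "\<exists>I0. \<forall>v. finite (I0 v) & (\<forall>I. I0 v \<subseteq> I --> tail_ok v m d I)" by (rule choice)
 then obtain I0 where I0': "\<forall>v. finite (I0 v) & (\<forall>I. I0 v \<subseteq> I --> tail_ok v m d I)" by (rule exE)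
 have I0: "!!v. finite (I0 v)" "!!v I. I0 v \<subseteq> I ==> tail_ok v m d I" using I0' by simp_all
 define I where "I = I1 Un (\<Union>v\<in>B. I0 v)"
 have I: "finite I" "I1 \<subseteq> I" using L I0 by (auto simp: I_def)
 have ok: "tail_ok v m d I" if "v : B" for v by (rule I0(2)) (use that in \<open>auto simp: I_def\<close>)
 have Ynu: "\<bar>Y A - Y (A Int I)\<bar> <= dl" if "\<forall>v\<in>B. \<not> bad v m I A" for A using L2[OF I] that unfolding loc_approx_def by blast
 have evY: "\<forall>\<^sub>F n in sequentially. \<forall>A\<subseteq>F n. (\<forall>v\<in>B. \<not> bad v m I A) --> \<bar>Yn n A - Y (A Int I)\<bar> <= dl"
  using L2[OF I] unfolding loc_approx_def by (rule conjunct2)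
 have badsum: "of_bool (\<exists>v\<in>B. bad v m I A) <= (\<Sum>v\<in>B. of_bool (bad v m I A) :: real)" for A
 proof (cases "\<exists>v\<in>B. bad v m I A")
  case True
  then obtain v where v: "v : B" "bad v m I A" by blast
  have "of_bool (bad v m I A) <= (\<Sum>v\<in>B. of_bool (bad v m I A) :: real)" by (rule member_le_sum[OF v(1) _ L(1)]) auto
  then show ?thesis using v by auto
 qed (simp add: sum_nonneg)
 have dec: "\<bar>a - b\<bar> <= dl + 2 * M * (\<Sum>v\<in>B. of_bool (bad v m I A))"
  if "\<bar>a\<bar> <= M" "\<bar>b\<bar> <= M" "(\<forall>v\<in>B. \<not> bad v m I A) --> \<bar>a - b\<bar> <= dl" for a b A
 proof (cases "\<forall>v\<in>B. \<not> bad v m I A")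
  case True
  then have "\<bar>a - b\<bar> <= dl" using that(3) by blast
  moreover have "0 <= 2 * M * (\<Sum>v\<in>B. of_bool (bad v m I A) :: real)" using M0 by (intro mult_nonneg_nonneg sum_nonneg) auto
  ultimately show ?thesis by linarith
 next
  case False
  then have "1 <= (\<Sum>v\<in>B. of_bool (bad v m I A) :: real)" using badsum[of A] by simp
  then have "2 * M * 1 <= 2 * M * (\<Sum>v\<in>B. of_bool (bad v m I A) :: real)" using M0 by (intro mult_left_mono) auto
  then show ?thesis using that(1,2) dl by linarith
 qed
 have n1: "\<bar>En n (Yn n) - En n (%A. Y (A Int I))\<bar> <= dl + 2 * M * dl"
  if "\<forall>A\<subseteq>F n. (\<forall>v\<in>B. \<not> bad v m I A) --> \<bar>Yn n A - Y (A Int I)\<bar> <= dl" for n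
 proof -
  interpret m: fk_const "epS (S n)" "WW (S n)" Q t x "F n" by (rule model)
  have "\<bar>En n (Yn n) - En n (%A. Y (A Int I))\<bar> <= En n (%A. dl + 2 * M * (\<Sum>v\<in>B. of_bool (bad v m I A)))"
  proof (rule m.EE_abs_diff)
   fix A assume A: "A \<subseteq> F n"
   have h: "(\<forall>v\<in>B. \<not> bad v m I A) --> \<bar>Yn n A - Y (A Int I)\<bar> <= dl" using that A by simp
   show "\<bar>Yn n A - Y (A Int I)\<bar> <= dl + 2 * M * (\<Sum>v\<in>B. of_bool (bad v m I A))" by (rule dec[OF bnd(2)[OF A] bnd(1) h])
  qed
  also have "... = dl + 2 * M * (\<Sum>v\<in>B. En n (%A. of_bool (bad v m I A)))"
  proof -
   have "En n (%A. \<Sum>v\<in>B. of_bool (bad v m I A)) = (\<Sum>v\<in>B. En n (%A. of_bool (bad v m I A)))" by (rule m.EE_sum[OF L(1)])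
   then show ?thesis unfolding m.EE_add m.EE_const m.EE_cmult by (simp only:)
  qed
  also have "... <= dl + 2 * M * dl"
  proof -
   have "(\<Sum>v\<in>B. En n (%A. of_bool (bad v m I A))) <= (\<Sum>v\<in>B. d)" by (intro sum_mono bad_n ok)
   also have "... <= dl" using d by simp
   finally show ?thesis using M0 by (intro add_left_mono mult_left_mono) auto
  qed
  finally show ?thesis .
 qed
 have n2: "\<bar>(\<integral>om. Y (Collect om) \<partial>nu) - (\<integral>om. Y (Collect om Int I) \<partial>nu)\<bar> <= dl + 2 * M * dl"
 proof -
  have i1: "integrable nu (%om. Y (Collect om))" by (rule nu.integrable_const_bound[of _ M]) (use bnd(1) meas in simp_all)
  have i2: "integrable nu (%om. Y (Collect om Int I))" by (rule nu.integrable_const_bound[of _ M]) (use bnd(1) meas_cyl[OF I(1)] in simp_all)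
  have ib: "integrable nu (%om. of_bool (bad v m I (Collect om)) :: real)"
   "(\<integral>om. of_bool (bad v m I (Collect om)) \<partial>nu) = measure nu {om. bad v m I (Collect om)}" for v
  proof -
   have e: "(%om. of_bool (bad v m I (Collect om)) :: real) = indicator {om. bad v m I (Collect om)}" by (auto simp: indicator_def fun_eq_iff)
   show "integrable nu (%om. of_bool (bad v m I (Collect om)) :: real)" unfolding e using sets_bad by (simp add: nu.emeasure_finite less_top[symmetric])
   show "(\<integral>om. of_bool (bad v m I (Collect om)) \<partial>nu) = measure nu {om. bad v m I (Collect om)}" unfolding e using sets_bad by simp
  qed
  have "\<bar>(\<integral>om. Y (Collect om) \<partial>nu) - (\<integral>om. Y (Collect om Int I) \<partial>nu)\<bar> = \<bar>\<integral>om. Y (Collect om) - Y (Collect om Int I) \<partial>nu\<bar>"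
   using i1 i2 by simp
  also have "... <= (\<integral>om. \<bar>Y (Collect om) - Y (Collect om Int I)\<bar> \<partial>nu)" by (rule integral_abs_bound)
  also have "... <= (\<integral>om. dl + 2 * M * (\<Sum>v\<in>B. of_bool (bad v m I (Collect om))) \<partial>nu)"
  proof (rule integral_mono)
   show "integrable nu (%om. \<bar>Y (Collect om) - Y (Collect om Int I)\<bar>)" by (rule integrable_abs, rule Bochner_Integration.integrable_diff[OF i1 i2])
   show "integrable nu (%om. dl + 2 * M * (\<Sum>v\<in>B. of_bool (bad v m I (Collect om))))"
   by (intro Bochner_Integration.integrable_add integrable_mult_right Bochner_Integration.integrable_sum ib(1)) simp
   fix om
   have h: "(\<forall>v\<in>B. \<not> bad v m I (Collect om)) --> \<bar>Y (Collect om) - Y (Collect om Int I)\<bar> <= dl" by (rule impI) (rule Ynu)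
   show "\<bar>Y (Collect om) - Y (Collect om Int I)\<bar> <= dl + 2 * M * (\<Sum>v\<in>B. of_bool (bad v m I (Collect om)))" by (rule dec[OF bnd(1) bnd(1) h])
  qed
  also have "... = dl + 2 * M * (\<Sum>v\<in>B. measure nu {om. bad v m I (Collect om)})"
  proof -
   have "(\<integral>om. dl + 2 * M * (\<Sum>v\<in>B. of_bool (bad v m I (Collect om))) \<partial>nu) =
   (\<integral>om. dl \<partial>nu) + (\<integral>om. 2 * M * (\<Sum>v\<in>B. of_bool (bad v m I (Collect om))) \<partial>nu)"
   by (intro Bochner_Integration.integral_add integrable_mult_right Bochner_Integration.integrable_sum ib(1)) simp
   also have "(\<integral>om. dl \<partial>nu) = dl" using nu.prob_space by simp
   also have "(\<integral>om. 2 * M * (\<Sum>v\<in>B. of_bool (bad v m I (Collect om))) \<partial>nu) =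
   2 * M * (\<integral>om. (\<Sum>v\<in>B. of_bool (bad v m I (Collect om))) \<partial>nu)" by (rule integral_mult_right_zero)
   also have "(\<integral>om. (\<Sum>v\<in>B. of_bool (bad v m I (Collect om)) :: real) \<partial>nu) =
   (\<Sum>v\<in>B. \<integral>om. of_bool (bad v m I (Collect om)) \<partial>nu)" by (rule Bochner_Integration.integral_sum) (rule ib(1))
   finally show ?thesis unfolding ib(2) .
  qed
  also have "... <= dl + 2 * M * dl"
  proof -
   have "(\<Sum>v\<in>B. measure nu {om. bad v m I (Collect om)}) <= (\<Sum>v\<in>B. d)" by (intro sum_mono bad_nu ok) (use d in auto)
   also have "... <= dl" using d by simp
   finally show ?thesis using M0 by (intro add_left_mono mult_left_mono) auto
  qed
  finally show ?thesis .
 qed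
 have "(%n. En n (%A. Y (A Int I))) \<longlonglongrightarrow> (\<integral>om. Y (Collect om Int I) \<partial>nu)" by (rule lim'[OF I(1)])
 then have "\<forall>\<^sub>F n in sequentially. dist (En n (%A. Y (A Int I))) (\<integral>om. Y (Collect om Int I) \<partial>nu) < dl" using dl by (rule tendstoD)
 with evY have "\<forall>\<^sub>F n in sequentially. norm (En n (Yn n) - (\<integral>om. Y (Collect om) \<partial>nu)) < r"
 proof eventually_elim
  case (elim n)
  have "0 < 4 * (1 + 2 * M)" using M0 by simp
  then have nz: "4 * (1 + 2 * M) ~= 0" by (rule less_imp_neq[THEN not_sym])
  have "dl * (4 * (1 + 2 * M)) = r" unfolding dl_def times_divide_eq_left by (rule nonzero_mult_div_cancel_right[OF nz])
  then have eq: "4 * (dl + 2 * M * dl) = r" by (simp add: algebra_simps)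
  have "0 <= 2 * M * dl" using M0 dl by simp
  then show ?case using n1[OF elim(1)] n2 elim(2) eq dl by (auto simp: dist_real_def)
 qed
 then show "\<exists>no. \<forall>n\<ge>no. norm (En n (Yn n) - (\<integral>om. Y (Collect om) \<partial>nu)) < r" by (simp add: eventually_sequentially)
qed

end

section \<open>Invariance, insertion tolerance and measurability\<close>

text \<open>Two measures are treated at once because insertion compares a law with its image under
  opening an edge, and one approximating set must be good for both.\<close>

lemma approximate_by_algebra:
 assumes m: "finite_measure M1" "finite_measure M2" "sets M1 = sigma_sets UNIV G" "sets M2 = sigma_sets UNIV G"
  and G: "!!A. A : G ==> UNIV - A : G" "!!A B. A : G ==> B : G ==> A Un B : G" "{} : G"
  and A: "A : sigma_sets UNIV G" and dl: "(dl::real) > 0"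
 shows "\<exists>B\<in>G. measure M1 (A - B Un (B - A)) <= dl & measure M2 (A - B Un (B - A)) <= dl" using A dl
proof (induction arbitrary: dl rule: sigma_sets.induct)
 case (Basic a)
 then show ?case by (intro bexI[of _ a]) auto
next
 case Empty
 then show ?case using G(3) by (intro bexI[of _ "{}"]) auto
next
 case (Compl a)
 then obtain B where B: "B : G" "measure M1 (a - B Un (B - a)) <= dl" "measure M2 (a - B Un (B - a)) <= dl" by blast
 have "(UNIV - a) - (UNIV - B) Un ((UNIV - B) - (UNIV - a)) = a - B Un (B - a)" by auto
 then show ?case using B G(1) by (intro bexI[of _ "UNIV - B"]) auto
next
 case (Union a)
 interpret M1: finite_measure M1 by (rule m)
 interpret M2: finite_measure M2 by (rule m)
 have GM: "B : sets M1" "B : sets M2" if "B : G" for B using that m by auto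
 have aM: "a i : sets M1" "a i : sets M2" for i using Union.hyps m by auto
 let ?U = "%n. \<Union>i<n. a i"
 have UU: "(\<Union>n. ?U n) = (\<Union>i. a i)" by auto
 have inc: "incseq ?U" by (auto simp: incseq_def intro: order_less_le_trans)
 have c1: "(%n. measure M1 (?U n)) \<longlonglongrightarrow> measure M1 (\<Union>i. a i)" using M1.finite_Lim_measure_incseq[OF _ inc] aM UU by auto
 have c2: "(%n. measure M2 (?U n)) \<longlonglongrightarrow> measure M2 (\<Union>i. a i)" using M2.finite_Lim_measure_incseq[OF _ inc] aM UU by auto
 have "\<forall>\<^sub>F n in sequentially. measure M1 (\<Union>i. a i) - dl / 2 < measure M1 (?U n)" by (rule order_tendstoD(1)[OF c1]) (use Union.prems in simp)
 moreover have "\<forall>\<^sub>F n in sequentially. measure M2 (\<Union>i. a i) - dl / 2 < measure M2 (?U n)"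
  by (rule order_tendstoD(1)[OF c2]) (use Union.prems in simp)
 ultimately have "\<forall>\<^sub>F n in sequentially. measure M1 (\<Union>i. a i) - dl / 2 < measure M1 (?U n) \<and>
   measure M2 (\<Union>i. a i) - dl / 2 < measure M2 (?U n)" by (rule eventually_conj)
 then obtain n where n: "measure M1 (\<Union>i. a i) - dl / 2 < measure M1 (?U n)" "measure M2 (\<Union>i. a i) - dl / 2 < measure M2 (?U n)"
  by (auto simp: eventually_sequentially)
 define d where "d = dl / (2 * (1 + n))"
 have d: "d > 0" "n * d <= dl / 2" using Union.prems by (auto simp: d_def field_simps)
 have "\<forall>i. \<exists>B\<in>G. measure M1 (a i - B Un (B - a i)) <= d & measure M2 (a i - B Un (B - a i)) <= d" using Union.IH d(1) by blast
 then obtain B where B: "!!i. B i : G" "!!i. measure M1 (a i - B i Un (B i - a i)) <= d" "!!i. measure M2 (a i - B i Un (B i - a i)) <= d"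
  unfolding bchoice_iff choice_iff by (auto simp: Bex_def choice_iff)
 define C where "C = (\<Union>i<n. B i)"
 have CG: "(\<Union>i<k. B i) : G" for k by (induction k) (use G B(1) in \<open>auto simp: lessThan_Suc\<close>)
 have sub: "(\<Union>i. a i) - C Un (C - (\<Union>i. a i)) \<subseteq> ((\<Union>i. a i) - ?U n) Un (\<Union>i<n. a i - B i Un (B i - a i))" unfolding C_def by auto
 have est: "measure M ((\<Union>i. a i) - C Un (C - (\<Union>i. a i))) <= dl"
  if "finite_measure M" "!!i. a i : sets M" "!!i. B i : sets M" "measure M (\<Union>i. a i) - dl / 2 < measure M (?U n)"
   "!!i. measure M (a i - B i Un (B i - a i)) <= d" for M
 proof -
  interpret finite_measure M by (rule that)
  have "measure M ((\<Union>i. a i) - C Un (C - (\<Union>i. a i))) <= measure M (((\<Union>i. a i) - ?U n) Un (\<Union>i<n. a i - B i Un (B i - a i)))"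
   by (rule finite_measure_mono[OF sub]) (use that in auto)
  also have "... <= measure M ((\<Union>i. a i) - ?U n) + measure M (\<Union>i<n. a i - B i Un (B i - a i))" by (rule measure_Un_le) (use that in auto)
  also have "measure M ((\<Union>i. a i) - ?U n) = measure M (\<Union>i. a i) - measure M (?U n)" by (rule finite_measure_Diff) (use that in auto)
  also have "measure M (\<Union>i<n. a i - B i Un (B i - a i)) <= (\<Sum>i<n. measure M (a i - B i Un (B i - a i)))"
   by (rule finite_measure_subadditive_finite) (use that in auto)
  also have "... <= (\<Sum>i<n. d)" by (intro sum_mono that)
  finally show ?thesis using that(4) d(2) by simp
 qed
 show ?case by (rule bexI[of _ C], rule conjI; (rule est)?) (use m aM GM B n CG C_def in auto)
qed

context fk_limit
begin

definition Gen :: "('e => bool) set set" where "Gen = {{om. P <= Collect om} | P. finite P}"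

lemma sets_nu_sigma: "sets nu = sigma_sets UNIV {{om. om i : A} | i A. True}" unfolding sets_nu sets_PiM_single by (simp add: PiE_UNIV_domain)

lemma sets_nu_Gen: "sets nu = sigma_sets UNIV Gen"
proof
 show "sigma_sets UNIV Gen \<subseteq> sets nu"
 proof -
  have "Gen \<subseteq> sets nu" using sets_open by (auto simp: Gen_def)
  then show ?thesis using sets.sigma_sets_subset[of Gen nu] by simp
 qed
 show "sets nu \<subseteq> sigma_sets UNIV Gen" unfolding sets_nu_sigma
 proof (rule sigma_sets_mono, safe)
  fix i and A :: "bool set"
  have e: "{om. {i} <= Collect om} : Gen" unfolding Gen_def by (intro CollectI exI[of _ "{i}"]) simp
  have T: "{om. om i} : sigma_sets UNIV Gen" using sigma_sets.Basic[OF e] by simp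
  have F: "{om. \<not> om i} : sigma_sets UNIV Gen" using sigma_sets.Compl[OF T] by (simp add: Collect_neg_eq Compl_eq_Diff_UNIV)
  have "{om. om i : A} = (if True : A then {om. om i} else {}) Un (if False : A then {om. \<not> om i} else {})"
  proof (rule set_eqI)
   fix om show "om : {om. om i : A} \<longleftrightarrow> om : (if True : A then {om. om i} else {}) Un (if False : A then {om. \<not> om i} else {})"
   by (cases "om i") auto
  qed
  also have "... : sigma_sets UNIV Gen" by (intro sigma_sets_Un) (use T F sigma_sets.Empty in auto)
  finally show "{om. om i : A} : sigma_sets UNIV Gen" .
 qed
qed

lemma meas_shift: "(%om. om \<circ> ta) : measurable nu nu"
proof -
 have "(%om. om \<circ> ta) : measurable nu (PiM UNIV (%_. count_space UNIV))" by (rule measurable_PiM_single') (auto simp: o_def PiE_UNIV_domain)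
 then show ?thesis by (simp only: measurable_cong_sets[OF refl sets_nu])
qed

text \<open>The events that a finite set of edges is open are stable under intersection and generate
  the sigma-algebra, so invariance on them is invariance of the law.\<close>

lemma distr_inv:
 assumes g: "g : Aut ep J"
 shows "distr nu nu (%om. om \<circ> snd g) = nu"
proof (rule measure_eqI_generator_eq[where E = Gen and \<Omega> = UNIV and A = "%_. UNIV"])
 show "Int_stable Gen"
 proof (rule Int_stableI)
  fix a b assume "a : Gen" "b : Gen"
  then obtain P R where "finite P" "a = {om. P <= Collect om}" "finite R" "b = {om. R <= Collect om}" by (auto simp: Gen_def)
  then have "finite (P Un R)" "a Int b = {om. P Un R <= Collect om}" by auto
  then show "a Int b : Gen" unfolding Gen_def by blast
 qed
 show "Gen <= Pow UNIV" by simp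
 show "sets (distr nu nu (%om. om \<circ> snd g)) = sigma_sets UNIV Gen" by (simp add: sets_nu_Gen)
 show "sets nu = sigma_sets UNIV Gen" by (rule sets_nu_Gen)
 show "range (%_ :: nat. UNIV) \<subseteq> Gen" unfolding Gen_def by (auto intro!: exI[of _ "{}"])
 show "(\<Union>i :: nat. UNIV) = (UNIV :: ('e => bool) set)" by simp
 fix X assume "X : Gen"
 then obtain P where P: "finite P" "X = {om. P <= Collect om}" by (auto simp: Gen_def)
 have pre: "(%om. om \<circ> snd g) -` X Int space nu = {om. snd g ` P <= Collect om}" unfolding P(2) by (simp add: set_eq_iff subset_iff image_iff) blast
 have X: "X : sets nu" unfolding P(2) by (rule sets_open) (rule P(1))
 have "emeasure (distr nu nu (%om. om \<circ> snd g)) X = emeasure nu ((%om. om \<circ> snd g) -` X Int space nu)" by (rule emeasure_distr[OF meas_shift[of "snd g"] X])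
 also have "... = emeasure nu {om. snd g ` P <= Collect om}" by (simp only: pre)
 also have "... = emeasure nu {om. P <= Collect om}" by (simp only: nu.emeasure_eq_measure inv[OF g P(1)])
 also have "... = emeasure nu X" by (simp only: P(2))
 finally show "emeasure (distr nu nu (%om. om \<circ> snd g)) X = emeasure nu X" .
next
 interpret d: prob_space "distr nu nu (%om. om \<circ> snd g)" by (rule nu.prob_space_distr[OF meas_shift[of "snd g"]])
 show "emeasure (distr nu nu (%om. om \<circ> snd g)) UNIV ~= \<infinity>" for i :: nat by (simp add: d.emeasure_finite)
qed

lemma Collect_shift:
 assumes "g : Aut ep J" shows "Collect (om \<circ> inv (snd g)) = snd g ` Collect om"
proof -
 have b: "bij (snd g)" using assms by (simp add: aut_iff)
 show ?thesis
 proof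
  show "Collect (om \<circ> inv (snd g)) \<subseteq> snd g ` Collect om"
  proof
   fix e assume "e : Collect (om \<circ> inv (snd g))"
   moreover have "e = snd g (inv (snd g) e)" using b by (simp add: bij_is_surj surj_f_inv_f)
   ultimately show "e : snd g ` Collect om" by auto
  qed
 qed (use b in \<open>auto simp: bij_is_inj\<close>)
qed

lemma inv_int:
 assumes g: "g : Aut ep J" and f: "(%om. f (Collect om)) : borel_measurable nu"
 shows "(\<integral>om. f (snd g ` Collect om) \<partial>nu) = (\<integral>om. (f (Collect om) :: real) \<partial>nu)"
proof -
 let ?g = "(inv (fst g), inv (snd g))"
 have g': "?g : Aut ep J" by (rule aut_inv[OF g])
 have "(\<integral>om. f (Collect om) \<partial>nu) = (\<integral>om. f (Collect om) \<partial>(distr nu nu (%om. om \<circ> snd ?g)))" unfolding distr_inv[OF g'] ..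
 also have "... = (\<integral>om. f (Collect (om \<circ> snd ?g)) \<partial>nu)" by (rule integral_distr[OF meas_shift[of "snd ?g"] f])
 finally show ?thesis using Collect_shift[OF g] by simp
qed

lemma meas_upd: "(%om. fun_upd om e True) : measurable nu nu"
proof -
 have "(%om. fun_upd om e True i) : measurable nu (count_space UNIV)" for i by (cases "i = e") auto
 then have "(%om. fun_upd om e True) : measurable nu (PiM UNIV (%_. count_space UNIV))" by (intro measurable_PiM_single') (auto simp: PiE_UNIV_domain)
 then show ?thesis by (simp only: measurable_cong_sets[OF refl sets_nu])
qed

lemma insert_cyl:
 assumes x: "x e > 0" and I: "finite I"
 shows "measure nu {om. P (Collect (fun_upd om e True) Int I)} <= (1 + (1 + Q) / x e) * measure nu {om. P (Collect om Int I)}"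
proof -
 let ?I = "insert e I"
 have I': "finite ?I" using I by simp
 have C: "Collect (fun_upd om e True) Int I = insert e (Collect om Int ?I) Int I" for om by auto
 have l1: "(%n. En n (%A. of_bool (P (insert e (A Int ?I) Int I)))) \<longlonglongrightarrow> measure nu {om. P (insert e (Collect om Int ?I) Int I)}"
  using lim'[OF I', of "%A. of_bool (P (insert e A Int I))"] int_cyl[OF I', of "%A. P (insert e A Int I)"] by simp
 have l2: "(%n. En n (%A. of_bool (P (A Int I)))) \<longlonglongrightarrow> measure nu {om. P (Collect om Int I)}"
  using lim'[OF I, of "%A. of_bool (P A)"] int_cyl[OF I, of P] by simp
 have ev: "\<forall>\<^sub>F n in sequentially. En n (%A. of_bool (P (insert e (A Int ?I) Int I))) <= (1 + (1 + Q) / x e) * En n (%A. of_bool (P (A Int I)))"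
  using evF[OF I']
 proof eventually_elim
  case (elim n)
  interpret m: fk_const "epS (S n)" "WW (S n)" Q t x "F n" by (rule model)
  have eq: "insert e (A Int ?I) Int I = insert e A Int I" for A by auto
  show ?case unfolding eq by (rule m.EE_insert[of e "%A. P (A Int I)"]) (use elim x in auto)
 qed
 show ?thesis unfolding C by (rule tendsto_le[OF _ tendsto_mult_left[OF l2] l1 ev]) simp
qed

text \<open>Cluster events depend on infinitely many edges. The bound for cylinder events extends by
  approximating \<open>A\<close> simultaneously for \<open>nu\<close> and for the law of the
  configuration with \<open>e\<close> opened.\<close>

lemma insertion:
 assumes x: "x e > 0" and A: "A : sets nu"
 shows "measure nu {om. fun_upd om e True : A} <= (1 + (1 + Q) / x e) * measure nu A"
proof -
 let ?N = "distr nu nu (%om. fun_upd om e True)" and ?C = "1 + (1 + Q) / x e"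
 define G where "G = {{om :: 'e => bool. P (Collect om Int I)} | P I. finite I}"
 have N: "measure ?N B = measure nu {om. fun_upd om e True : B}" if "B : sets nu" for B using measure_distr[OF meas_upd[of e] that] by (simp add: vimage_def)
 interpret N: prob_space ?N by (rule nu.prob_space_distr[OF meas_upd[of e]])
 have C: "0 <= ?C" using Q x by simp
 have sG: "sets nu = sigma_sets UNIV G"
 proof
  have "G \<subseteq> sets nu"
  proof
   fix B assume "B : G"
   then obtain P I where P: "B = {om. P (Collect om Int I)}" "finite I" unfolding G_def by (elim CollectE exE conjE) (rule that)
   show "B : sets nu" unfolding P(1) by (rule sets_cyl_pred) (rule P(2))
  qed
  then show "sigma_sets UNIV G \<subseteq> sets nu" using sets.sigma_sets_subset[of G nu] by simp
  have "Gen \<subseteq> G"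
  proof
   fix X assume "X : Gen"
   then obtain P where P: "finite P" "X = {om. P <= Collect om}" by (auto simp: Gen_def)
   have "X = {om. (%A. P \<subseteq> A) (Collect om Int P)}" unfolding P(2) by simp
   then show "X : G" using P(1) unfolding G_def by (intro CollectI exI conjI)
  qed
  then show "sets nu \<subseteq> sigma_sets UNIV G" unfolding sets_nu_Gen by (rule sigma_sets_mono')
 qed
 have G1: "UNIV - B : G" if "B : G" for B
 proof -
  obtain P I where P: "B = {om. P (Collect om Int I)}" "finite I" using \<open>B : G\<close> unfolding G_def by (elim CollectE exE conjE) (rule that)
  have "UNIV - B = {om. (%A. \<not> P A) (Collect om Int I)}" unfolding P(1) by (simp add: set_eq_iff)
  then show ?thesis using P(2) unfolding G_def by (intro CollectI exI conjI)
 qed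
 have G2: "B Un B' : G" if "B : G" "B' : G" for B B'
 proof -
  obtain P I where 1: "B = {om. P (Collect om Int I)}" "finite I" using \<open>B : G\<close> unfolding G_def by (elim CollectE exE conjE) (rule that)
  obtain P' I' where 2: "B' = {om. P' (Collect om Int I')}" "finite I'" using \<open>B' : G\<close> unfolding G_def by (elim CollectE exE conjE) (rule that)
  have eqs: "X Int (I Un I') Int I = X Int I" "X Int (I Un I') Int I' = X Int I'" for X by auto
  have "B Un B' = {om. (%A. P (A Int I) | P' (A Int I')) (Collect om Int (I Un I'))}" unfolding 1 2 eqs Collect_disj_eq ..
  moreover have "finite (I Un I')" using 1 2 by simp
  ultimately show ?thesis unfolding G_def by (intro CollectI exI conjI)
 qed
 have G3: "{} : G" unfolding G_def by (intro CollectI exI[of _ "%_. False"] exI[of _ "{}"]) simp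
 show ?thesis
 proof (rule field_le_epsilon)
  fix r :: real assume r: "0 < r"
  define d where "d = r / (1 + ?C)"
  have nz: "1 + ?C > 0" using C by linarith
  have aux: "r / y + (y - 1) * (r / y) = r" if "y > 0" for y using that by (simp add: field_simps)
  have d: "d > 0" "d + ?C * d = r" using divide_pos_pos[OF r nz] aux[OF nz] unfolding d_def[symmetric] by (simp_all only: add_diff_cancel_left')
  obtain B where B: "B : G" "measure nu (A - B Un (B - A)) <= d" "measure ?N (A - B Un (B - A)) <= d"
   using approximate_by_algebra[of nu ?N G A d] G1 G2 G3 sG A d(1) nu.finite_measure_axioms N.finite_measure_axioms by auto
  have Bs: "B : sets nu" using B(1) sG by auto
  have a1: "measure ?N A <= measure ?N (B Un (A - B Un (B - A)))" by (rule N.finite_measure_mono) (use A Bs in auto)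
  have a2: "measure ?N (B Un (A - B Un (B - A))) <= measure ?N B + measure ?N (A - B Un (B - A))" by (rule measure_Un_le) (use A Bs in auto)
  have a3: "measure ?N B <= ?C * measure nu B"
  proof -
   obtain P I where P: "B = {om. P (Collect om Int I)}" "finite I" using B(1) unfolding G_def by (elim CollectE exE conjE) (rule that)
   show ?thesis using insert_cyl[OF x P(2), of P] unfolding N[OF Bs] unfolding P(1) by simp
  qed
  have a4: "measure nu B <= measure nu A + d"
  proof -
   have "measure nu B <= measure nu (A Un (A - B Un (B - A)))" by (rule nu.finite_measure_mono) (use A Bs in auto)
   also have "... <= measure nu A + measure nu (A - B Un (B - A))" by (rule measure_Un_le) (use A Bs in auto)
   finally show ?thesis using B(2) by linarith
  qed
  have "measure ?N A <= ?C * measure nu B + d" by (rule order.trans[OF order.trans[OF a1 a2] add_mono[OF a3 B(3)]])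
  also have "... <= ?C * (measure nu A + d) + d" by (rule add_right_mono[OF mult_left_mono[OF a4 C]])
  also have "... = ?C * measure nu A + r" using d(2) by (simp add: distrib_left)
  finally show "measure nu {om. fun_upd om e True : A} <= ?C * measure nu A + r" unfolding N[OF A] .
 qed
qed

section \<open>Measurability of cluster functionals\<close>

abbreviation "Kl om v \<equiv> cl ep (Collect om) v"

lemma meas_cl [measurable]: "Measurable.pred nu (%om. y : Kl om v)"
proof -
 have "{om. y : Kl om v} = {om. \<exists>l. (wk v l & last (vs v l) = y) & set l <= Collect om}"
 proof (intro Collect_cong iffI)
  fix om assume "y : Kl om v"
  then show "\<exists>l. (wk v l & last (vs v l) = y) & set l <= Collect om" using cl_path by blast
 next
  fix om assume "\<exists>l. (wk v l & last (vs v l) = y) & set l <= Collect om"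
  then obtain l where l: "wk v l" "last (vs v l) = y" "set l <= Collect om" by blast
  have "y : set (vs v l)" using l(2) last_in_set[OF vs_ne] by blast
  then show "y : Kl om v" using wk_cl[OF l(1,3)] by blast
 qed
 then have "{om. y : Kl om v} : sets nu" using sets_ex_list[of "%l. wk v l & last (vs v l) = y"] by simp
 then show ?thesis by (simp add: pred_def)
qed

definition BV :: "nat => 'v set" where "BV k = {v. to_nat_on (UNIV :: 'v set) v <= k}"

lemma finite_BV: "finite (BV k)" unfolding BV_def by (rule finite_index_prefix[OF countable_V])

lemma BV_fin: "finite A ==> \<forall>\<^sub>F k in sequentially. A <= BV k" unfolding BV_def by (rule eventually_index_prefix)

lemma card_BV_lim:
 assumes "infinite A" shows "filterlim (%k. card (A Int BV k)) at_top sequentially" unfolding filterlim_at_top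
proof
 fix n
 obtain B where B: "B \<subseteq> A" "finite B" "card B = n" using assms infinite_arbitrarily_large by blast
 have "\<forall>\<^sub>F k in sequentially. B <= BV k" by (rule BV_fin) fact
 then show "\<forall>\<^sub>F k in sequentially. n <= card (A Int BV k)"
 proof eventually_elim
  case (elim k)
  then show ?case using B card_mono[of "A Int BV k" B] finite_BV by auto
 qed
qed

lemma card_BV_fin:
 assumes "finite A" shows "\<forall>\<^sub>F k in sequentially. f (card (A Int BV k)) = f (card A)" using BV_fin[OF assms] by eventually_elim (simp add: Int_absorb2)

text \<open>This is the origin of the value of \<open>pw\<close> on infinite sets: it is the limit
  over finite windows, and hence depends measurably on the configuration.\<close>

lemma pw_lim: "0 <= s ==> s <= 1 ==> (%k. s ^ card (A Int BV k)) \<longlonglongrightarrow> pw s A"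
proof -
 assume s: "0 <= s" "s <= 1"
 show ?thesis
 proof (cases "finite A")
  case True
  then show ?thesis using tendsto_eventually[OF card_BV_fin[OF True, of "%n. s ^ n"]] by (simp add: pw_def)
 next
  case False
  show ?thesis
  proof (cases "s = 1")
   case True then show ?thesis using False by (simp add: pw_def)
  next
   case s1: False
   then have "(%n. s ^ n) \<longlonglongrightarrow> 0" using s by (intro LIMSEQ_realpow_zero) auto
   then have "(%k. s ^ card (A Int BV k)) \<longlonglongrightarrow> 0" by (rule filterlim_compose[OF _ card_BV_lim[OF False]])
   then show ?thesis using False s1 by (simp add: pw_def)
  qed
 qed
qed

text \<open>Sizes are approached through their inverses: for an infinite cluster these tend to 0,
  which agrees with the inverse of the conventional cardinality 0.\<close>

lemma inv_card_lim: "(%k. inverse (real (card (A Int BV k)))) \<longlonglongrightarrow> inverse (real (card A))"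
proof (cases "finite A")
 case True
 then show ?thesis using tendsto_eventually[OF card_BV_fin[OF True, of "%n. inverse (real n)"]] by simp
next
 case False
 have "(%k. inverse (real (card (A Int BV k)))) \<longlonglongrightarrow> 0" by (rule tendsto_inverse_0_at_top)
   (rule filterlim_compose[OF filterlim_real_sequentially card_BV_lim[OF False]])
 then show ?thesis using False by simp
qed

lemma meas_card_BV: "(%om. real (card (Kl om v Int BV k))) : borel_measurable nu"
proof -
 have "real (card (Kl om v Int BV k)) = (\<Sum>y\<in>BV k. if y : Kl om v then 1 else 0)" for om using finite_BV[of k] by (simp add: sum.If_cases Int_commute)
 moreover have "(%om. \<Sum>y\<in>BV k. if y : Kl om v then 1 else (0 :: real)) : borel_measurable nu" by measurable
 ultimately show ?thesis by simp
qed

lemma meas_pw [measurable]: "0 <= s ==> s <= 1 ==> (%om. pw s (Kl om v)) : borel_measurable nu"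
proof -
 assume s: "0 <= s" "s <= 1"
 have "(%om. s ^ card (Kl om v Int BV k)) : borel_measurable nu" for k
 proof -
  have "s ^ card (Kl om v Int BV k) = (\<Prod>y\<in>BV k. if y : Kl om v then s else 1)" for om using finite_BV[of k] by (simp add: prod.If_cases Int_commute)
  moreover have "(%om. \<Prod>y\<in>BV k. if y : Kl om v then s else 1) : borel_measurable nu" by measurable
  ultimately show ?thesis by simp
 qed
 then show ?thesis by (rule borel_measurable_LIMSEQ_real[rotated]) (rule pw_lim[OF s])
qed

lemma meas_card [measurable]: "(%om. real (card (Kl om v))) : borel_measurable nu"
proof -
 have "(%om. inverse (real (card (Kl om v)))) : borel_measurable nu" by (rule borel_measurable_LIMSEQ_real[OF inv_card_lim])
   (use meas_card_BV in measurable)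
 then have "(%om. inverse (inverse (real (card (Kl om v))))) : borel_measurable nu" by measurable
 then show ?thesis by simp
qed

lemma meas_fin [measurable]: "Measurable.pred nu (%om. finite (Kl om v))"
proof -
 have "finite (Kl om v) \<longleftrightarrow> pw (1 / 2) (Kl om v) > 0" for om by (simp add: pw_def)
 moreover have "Measurable.pred nu (%om. pw (1 / 2) (Kl om v) > 0)" by measurable
 ultimately show ?thesis by simp
qed

end

section \<open>Passing the finite-volume inequalities to the limit\<close>

context fk_limit
begin

text \<open>If the cluster is not resolved, it and its visible part both exceed \<open>m\<close>,
  and both powers are at most \<open>d\<close>. For \<open>s = 1\<close> the power is constantly
  1.\<close>

lemma pw_agree:
 assumes s: "0 <= s" "s <= 1" "s = 1 | s ^ m <= d" and f: "inj f" and fin: "finite KI" and d: "0 <= d"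
  and ag: "K = f ` KI | m < card KI & f ` KI \<subseteq> K"
 shows "\<bar>pw s K - pw s KI\<bar> <= d"
proof (cases "K = f ` KI")
 case True
 then show ?thesis using f fin d by (simp add: pw_def card_image inj_on_subset finite_image_iff)
next
 case False
 then have a: "m < card KI" "f ` KI \<subseteq> K" using ag by auto
 have b: "pw s KI <= d & pw s K <= d" if s1: "s ~= 1"
 proof
  have sm: "s ^ m <= d" using s(3) s1 by simp
  have "pw s KI <= s ^ m" using fin a s by (simp add: pw_def power_decreasing)
  then show "pw s KI <= d" using sm by linarith
  show "pw s K <= d"
  proof (cases "finite K")
   case True
   have "card KI = card (f ` KI)" using f by (simp add: card_image inj_on_subset)
   also have "... <= card K" by (rule card_mono[OF True a(2)])
   finally have "pw s K <= s ^ m" using True a s by (simp add: pw_def power_decreasing)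
   then show ?thesis using sm by linarith
  qed (use s1 d in \<open>simp add: pw_def\<close>)
 qed
 show ?thesis
 proof (cases "s = 1")
  case True then show ?thesis using d by (simp add: pw_def)
 next
  case s1: False
  then show ?thesis using b[OF s1] pw_bounds[OF s(1,2), of K] pw_bounds[OF s(1,2), of KI] by linarith
 qed
qed

lemma pw_small:
 assumes "0 <= s" "s < 1" "s ^ m <= d" "finite KI" "m < card KI" "inj f" "f ` KI \<subseteq> K" "0 <= d"
 shows "pw s K <= d" "pw s KI <= d"
proof -
 have "pw s KI <= s ^ m" using assms by (simp add: pw_def power_decreasing)
 then show "pw s KI <= d" using assms(3) by linarith
 show "pw s K <= d"
 proof (cases "finite K")
  case True
  have "card KI = card (f ` KI)" using assms(6) by (simp add: card_image inj_on_subset)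
  also have "... <= card K" by (rule card_mono[OF True assms(7)])
  finally have "pw s K <= s ^ m" using True assms by (simp add: pw_def power_decreasing)
  then show ?thesis using assms(3) by linarith
 qed (use assms in \<open>simp add: pw_def\<close>)
qed

text \<open>A bounded functional of two clusters that is Lipschitz in their size profiles and small when
 both clusters are large converges, because large clusters need not be resolved.\<close>

lemma pair_local:
 fixes \<Phi> :: "bool => bool => (real => real) => (real => real) => real" and KI LI :: "'v set" and K L :: "'z set"
 assumes al: "0 <= al'" "al' <= al" "al < 1"
  and lip: "!!b o' P L P' L' d. 0 <= d ==> (!!s. s : {t, al, al'} ==> 0 <= P s & P s <= 1 & 0 <= L s & L s <= 1 \<and>
   0 <= P' s & P' s <= 1 & 0 <= L' s & L' s <= 1 & \<bar>P s - P' s\<bar> <= d & \<bar>L s - L' s\<bar> <= d) ==>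
   \<bar>\<Phi> b o' P L - \<Phi> b o' P' L'\<bar> <= C * d"
  and small: "!!b o' P L d. 0 <= d ==> d <= 1 ==> (!!s. s : {t, al, al'} ==> 0 <= P s & P s <= 1 & 0 <= L s & L s <= 1) ==>
   (!!s. s : {al, al'} ==> P s <= d & L s <= d) ==> \<bar>\<Phi> b o' P L\<bar> <= C * d"
  and C: "0 <= C" and sm: "!!s. s : {t, al, al'} ==> s = 1 | s ^ m <= d" and d: "0 <= d" "d <= 1"
  and f: "inj f" and fin: "finite KI" "finite LI"
  and ag: "K = f ` KI | m < card KI & f ` KI \<subseteq> K" "L = f ` LI | m < card LI & f ` LI \<subseteq> L"
  and fl: "b \<longleftrightarrow> f y : K" "b \<longleftrightarrow> f x' : L" "bI \<longleftrightarrow> y : KI" "bI \<longleftrightarrow> x' : LI"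
 shows "\<bar>\<Phi> b o' (%s. pw s K) (%s. pw s L) - \<Phi> bI o' (%s. pw s KI) (%s. pw s LI)\<bar> <= 2 * C * d"
proof -
 have s01: "0 <= s & s <= 1" if "s : {t, al, al'}" for s using that t al by auto
 have pwb: "0 <= pw s X & pw s X <= 1" if "s : {t, al, al'}" for s and X :: "'z set" using pw_bounds s01[OF that] by auto
 have pwb': "0 <= pw s X & pw s X <= 1" if "s : {t, al, al'}" for s and X :: "'v set" using pw_bounds s01[OF that] by auto
 have pwb'': "0 <= pw s K & pw s K <= 1 & 0 <= pw s L & pw s L <= 1" if "s : {t, al, al'}" for s using pw_bounds s01[OF that] by auto
 have Cd: "0 <= C * d" using C d by simp
 show ?thesis
 proof (cases "b = bI")
  case True
  have "\<bar>\<Phi> b o' (%s. pw s K) (%s. pw s L) - \<Phi> b o' (%s. pw s KI) (%s. pw s LI)\<bar> <= C * d"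
  proof (rule lip[OF d(1)])
   fix s assume s: "s : {t, al, al'}"
   have "\<bar>pw s K - pw s KI\<bar> <= d" "\<bar>pw s L - pw s LI\<bar> <= d" by (rule pw_agree[OF _ _ sm[OF s] f _ d(1)]; use s01[OF s] fin ag in simp)+
   then show "0 <= pw s K & pw s K <= 1 & 0 <= pw s L & pw s L <= 1 & 0 <= pw s KI & pw s KI <= 1 \<and>
   0 <= pw s LI & pw s LI <= 1 & \<bar>pw s K - pw s KI\<bar> <= d & \<bar>pw s L - pw s LI\<bar> <= d" using pwb'[OF s, of KI] pwb'[OF s, of LI] pwb''[OF s] by simp
  qed
  then show ?thesis using True Cd by simp
 next
  case False
  \<comment> \<open>If the window misjudges whether the two vertices are joined, neither cluster is
    resolved; both are then large, and the functional is small on either side.\<close>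
  have "K ~= f ` KI" using False fl(1,3) inj_image_mem_iff[OF f, of y KI] by metis
  moreover have "L ~= f ` LI" using False fl(2,4) inj_image_mem_iff[OF f, of x' LI] by metis
  ultimately have big: "m < card KI" "f ` KI \<subseteq> K" "m < card LI" "f ` LI \<subseteq> L" using ag by auto
  have sml: "s ^ m <= d" if "s : {al, al'}" for s using sm[of s] that al by auto
  have sal: "0 <= s" "s < 1" if "s : {al, al'}" for s using that al by auto
  have "\<bar>\<Phi> b o' (%s. pw s K) (%s. pw s L)\<bar> <= C * d"
  proof (rule small[OF d])
   show "0 <= pw s K & pw s K <= 1 & 0 <= pw s L & pw s L <= 1" if "s : {t, al, al'}" for s using pwb''[OF that] .
   show "pw s K <= d & pw s L <= d" if s: "s : {al, al'}" for s using pw_small(1)[OF sal[OF s] sml[OF s] fin(1) big(1) f big(2) d(1)]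
   pw_small(1)[OF sal[OF s] sml[OF s] fin(2) big(3) f big(4) d(1)] by simp
  qed
  moreover have "\<bar>\<Phi> bI o' (%s. pw s KI) (%s. pw s LI)\<bar> <= C * d"
  proof (rule small[OF d])
   show "0 <= pw s KI & pw s KI <= 1 & 0 <= pw s LI & pw s LI <= 1" if "s : {t, al, al'}" for s using pwb'[OF that] by simp
   show "pw s KI <= d & pw s LI <= d" if s: "s : {al, al'}" for s using pw_small(2)[OF sal[OF s] sml[OF s] fin(1) big(1) f big(2) d(1)]
   pw_small(2)[OF sal[OF s] sml[OF s] fin(2) big(3) f big(4) d(1)] by simp
  qed
  ultimately show ?thesis by linarith
 qed
qed

lemma ex_power_small:
 assumes "0 < d" "finite R" "!!s. s : R ==> 0 <= s & s <= (1 :: real)"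
 shows "\<exists>m. \<forall>s\<in>R. s = 1 | s ^ m <= d" using assms(2,3)
proof (induction R rule: finite_induct)
 case (insert s R)
 then obtain m where m: "\<forall>s\<in>R. s = 1 | s ^ m <= d" by auto
 have s: "0 <= s" "s <= 1" using insert.prems[of s] by auto
 have "\<exists>k. s = 1 | s ^ k <= d"
 proof (cases "s = 1")
  case False
  then obtain k where "s ^ k < d" using real_arch_pow_inv[OF assms(1), of s] s by auto
  then show ?thesis by (intro exI[of _ k]) simp
 qed simp
 then obtain k where k: "s = 1 | s ^ k <= d" by blast
 have mono: "r ^ (m + k) <= r ^ m" "r ^ (m + k) <= r ^ k" if "0 <= r" "r <= 1" for r :: real using that by (auto intro: power_decreasing)
 show ?case
 proof (intro exI[of _ "m + k"] ballI)
  fix r assume r: "r : insert s R"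
  then have r01: "0 <= r" "r <= 1" using insert.prems by auto
  show "r = 1 | r ^ (m + k) <= d" using r k m mono[OF r01] by force
 qed
qed simp

theorem pair_converge:
 fixes \<Phi> :: "bool => bool => (real => real) => (real => real) => real"
 assumes al: "0 <= al'" "al' <= al" "al < 1"
  and lip: "!!b o' P L P' L' d. 0 <= d ==> (!!s. s : {t, al, al'} ==> 0 <= P s & P s <= 1 & 0 <= L s & L s <= 1 \<and>
   0 <= P' s & P' s <= 1 & 0 <= L' s & L' s <= 1 & \<bar>P s - P' s\<bar> <= d & \<bar>L s - L' s\<bar> <= d) ==>
   \<bar>\<Phi> b o' P L - \<Phi> b o' P' L'\<bar> <= C * d"
  and small: "!!b o' P L d. 0 <= d ==> d <= 1 ==> (!!s. s : {t, al, al'} ==> 0 <= P s & P s <= 1 & 0 <= L s & L s <= 1) ==>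
   (!!s. s : {al, al'} ==> P s <= d & L s <= d) ==> \<bar>\<Phi> b o' P L\<bar> <= C * d"
  and C: "0 <= C"
  and meas: "(%om. \<Phi> (b : Kl om a) (e : Collect om) (%s. pw s (Kl om a)) (%s. pw s (Kl om b))) : borel_measurable nu"
 shows "(%n. En n (%A. \<Phi> (Some b : cl (epS (S n)) A (Some a)) (e : A) (%s. pw s (cl (epS (S n)) A (Some a))) (%s. pw s (cl (epS (S n)) A (Some b)))))
  \<longlonglongrightarrow> (\<integral>om. \<Phi> (b : Kl om a) (e : Collect om) (%s. pw s (Kl om a)) (%s. pw s (Kl om b)) \<partial>nu)"
proof -
 define Y where "Y A = \<Phi> (b : cl ep A a) (e : A) (%s. pw s (cl ep A a)) (%s. pw s (cl ep A b))" for A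
 define Yn where "Yn n A = \<Phi> (Some b : cl (epS (S n)) A (Some a)) (e : A) (%s. pw s (cl (epS (S n)) A (Some a)))
   (%s. pw s (cl (epS (S n)) A (Some b)))" for n A
 have s01: "0 <= s & s <= 1" if "s : {t, al, al'}" for s using that t al by auto
 have bnd: "\<bar>\<Phi> u v P L\<bar> <= C" if "!!s. s : {t, al, al'} ==> 0 <= P s & P s <= 1 & 0 <= L s & L s <= 1" for u v P L using small[of 1 P L u v] that by simp
 have "(%n. En n (Yn n)) \<longlonglongrightarrow> (\<integral>om. Y (Collect om) \<partial>nu)"
 proof (rule converge)
  show "(%om. Y (Collect om)) : borel_measurable nu" using meas by (simp add: Y_def)
  show "\<bar>Y A\<bar> <= C" for A unfolding Y_def by (rule bnd) (use pw_bounds s01 in blast)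
  show "\<bar>Yn n A\<bar> <= C" for n A unfolding Yn_def by (rule bnd) (use pw_bounds s01 in blast)
  fix dl :: real assume dl: "dl > 0"
  define d where "d = min 1 (dl / (2 * C + 1))"
  have d: "0 < d" "d <= 1" using dl C by (auto simp: d_def)
  have Cd: "2 * C * d <= dl"
  proof -
   have "(2 * C + 1) * d <= (2 * C + 1) * (dl / (2 * C + 1))" using C by (intro mult_left_mono) (auto simp: d_def)
   also have "... = dl" using C by simp
   finally show ?thesis using d by (simp add: distrib_right)
  qed
  obtain m where m: "\<forall>s\<in>{t, al, al'}. s = 1 | s ^ m <= d" using ex_power_small[OF d(1), of "{t, al, al'}"] s01 by blast
  have "loc_approx Yn Y dl {a, b} m I" if I: "finite I" "{e} \<subseteq> I" for I
  proof -
   have eI: "(e : A Int I) = (e : A)" for A using I by auto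
   show ?thesis unfolding loc_approx_def
  proof (intro conjI allI impI)
   fix A assume g: "\<forall>v\<in>{a, b}. \<not> bad v m I A"
   have fin: "finite (cl ep (A Int I) v)" for v by (rule finite_cl_I[OF I(1)])
   have "\<bar>Y A - Y (A Int I)\<bar> <= 2 * C * d" unfolding Y_def
   proof (simp only: eI, rule pair_local[OF al lip small C _ _ _ _ fin fin, where f = id and m = m and y = b and x' = a])
   show "s = 1 | s ^ m <= d" if "s : {t, al, al'}" for s using m that by blast
   show "cl ep A a = id ` cl ep (A Int I) a | m < card (cl ep (A Int I) a) & id ` cl ep (A Int I) a <= cl ep A a" using good_cl[of a m I A] g I(1) by simp
   show "cl ep A b = id ` cl ep (A Int I) b | m < card (cl ep (A Int I) b) & id ` cl ep (A Int I) b <= cl ep A b" using good_cl[of b m I A] g I(1) by simp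
   show "b : cl ep A a \<longleftrightarrow> id a : cl ep A b" "b : cl ep (A Int I) a \<longleftrightarrow> a : cl ep (A Int I) b"
   using cl_sym[of b ep A a] cl_sym[of a ep A b] cl_sym[of b ep "A Int I" a] cl_sym[of a ep "A Int I" b] by auto
   qed (use d in auto)
   then show "\<bar>Y A - Y (A Int I)\<bar> <= dl" using Cd by linarith
  next
   have "finite (\<Union>e\<in>I. ep e)" using I(1) finite_ep by blast
   then have "finite ({a, b} Un (\<Union>e\<in>I. ep e))" by simp
   from evS[OF this] show "\<forall>\<^sub>F n in sequentially. \<forall>A\<subseteq>F n. (\<forall>v\<in>{a, b}. \<not> bad v m I A) --> \<bar>Yn n A - Y (A Int I)\<bar> <= dl"
   proof eventually_elim
   case (elim n)
   show ?case
   proof (intro allI impI)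
   fix A assume A: "A \<subseteq> F n" "\<forall>v\<in>{a, b}. \<not> bad v m I A"
   have fin: "finite (cl ep (A Int I) v)" for v by (rule finite_cl_I[OF I(1)])
   let ?E = "epS (S n)"
   have "\<bar>Yn n A - Y (A Int I)\<bar> <= 2 * C * d" unfolding Y_def Yn_def
   proof (simp only: eI, rule pair_local[OF al lip small C _ _ _ _ fin fin, where f = Some and m = m and y = b and x' = a])
   show "s = 1 | s ^ m <= d" if "s : {t, al, al'}" for s using m that by blast
   show "cl ?E A (Some a) = Some ` cl ep (A Int I) a | m < card (cl ep (A Int I) a) & Some ` cl ep (A Int I) a <= cl ?E A (Some a)"
   by (rule good_cl_model) (use A I elim in auto)
   show "cl ?E A (Some b) = Some ` cl ep (A Int I) b | m < card (cl ep (A Int I) b) & Some ` cl ep (A Int I) b <= cl ?E A (Some b)"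
   by (rule good_cl_model) (use A I elim in auto)
   show "Some b : cl ?E A (Some a) \<longleftrightarrow> Some a : cl ?E A (Some b)" "b : cl ep (A Int I) a \<longleftrightarrow> a : cl ep (A Int I) b"
   using cl_sym[of "Some b" ?E A "Some a"] cl_sym[of "Some a" ?E A "Some b"] cl_sym[of b ep "A Int I" a] cl_sym[of a ep "A Int I" b] by auto
   qed (use d in auto)
   then show "\<bar>Yn n A - Y (A Int I)\<bar> <= dl" using Cd by linarith
   qed
   qed
  qed
  qed
  then show "\<exists>B m I1. finite B & finite I1 & (\<forall>I. finite I --> I1 \<subseteq> I --> loc_approx Yn Y dl B m I)"
   by (intro exI[of _ "{a, b}"] exI[of _ m] exI[of _ "{e}"]) auto
 qed
 then show ?thesis unfolding Y_def Yn_def[abs_def] .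
qed

lemma rr_01: "0 <= z ==> 0 <= 1 / (1 + Q * z) & 1 / (1 + Q * z) <= 1"
proof -
 assume "0 <= z"
 then have "1 <= 1 + Q * z" using Q by simp
 then show ?thesis by (simp add: divide_le_eq_1)
qed

lemma rr_lip: "0 <= x ==> 0 <= y ==> \<bar>1 / (1 + Q * x) - 1 / (1 + Q * y)\<bar> <= Q * \<bar>x - y\<bar>" for x y :: real
proof -
 assume xy: "0 <= x" "0 <= y"
 have p: "1 <= 1 + Q * x" "1 <= 1 + Q * y" using xy Q by auto
 have "1 / (1 + Q * x) - 1 / (1 + Q * y) = Q * (y - x) / ((1 + Q * x) * (1 + Q * y))" using p by (simp add: divide_simps algebra_simps)
 then have "\<bar>1 / (1 + Q * x) - 1 / (1 + Q * y)\<bar> = Q * \<bar>x - y\<bar> / ((1 + Q * x) * (1 + Q * y))"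
  using p Q by (simp add: abs_mult abs_divide abs_minus_commute)
 also have "... <= Q * \<bar>x - y\<bar> / 1" using p Q mult_mono[OF p] by (intro divide_left_mono) auto
 finally show ?thesis by simp
qed

lemma prod_lip:
 fixes a b a' b' x y :: real
 assumes "\<bar>a\<bar> <= A" "\<bar>b'\<bar> <= B" "\<bar>a - a'\<bar> <= x" "\<bar>b - b'\<bar> <= y"
 shows "\<bar>a * b - a' * b'\<bar> <= A * y + x * B"
proof -
 have "a * b - a' * b' = a * (b - b') + (a - a') * b'" by (simp add: algebra_simps)
 then have "\<bar>a * b - a' * b'\<bar> <= \<bar>a\<bar> * \<bar>b - b'\<bar> + \<bar>a - a'\<bar> * \<bar>b'\<bar>" by (simp add: abs_mult[symmetric])
 also have "... <= A * y + x * B" using assms by (intro add_mono mult_mono) auto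
 finally show ?thesis .
qed

text \<open>\<open>Zf\<close> seen as a function of whether the endpoints are joined, whether the
  edge is open, and the two size profiles \<open>%s. pw s K\<close>; this is the form to which
  \<open>pair_converge\<close> applies. \<open>PhiY\<close> does the same for
  \<open>Yf\<close>.\<close>

definition PhiZ :: "real => real => real => bool => bool => (real => real) => (real => real) => real" where
 "PhiZ p' al al' b o' P L = (if b then (p' - of_bool o') * (1 / (1 + Q * P t) * (P al - P al'))
  else p' * (1 / (1 + Q * P t) * (1 / (1 + Q * L t)) * ((P al - P al') + (L al - L al'))))"

definition PhiY :: "real => real => bool => bool => (real => real) => (real => real) => real" where
 "PhiY al al' b o' P L = (if b then 0 else (1 - P al') * (1 - L al') - (1 - P al) * (1 - L al))"

lemma Zf_Phi: "Zf en Q t p' al al' e a b A = PhiZ p' al al' (b : cl en A a) (e : A) (%s. pw s (cl en A a)) (%s. pw s (cl en A b))"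
 by (simp add: Zf_def PhiZ_def rr_def gg_def Let_def)

lemma Yf_Phi: "Yf en al al' a b A = PhiY al al' (b : cl en A a) (e : A) (%s. pw s (cl en A a)) (%s. pw s (cl en A b))" by (simp add: Yf_def PhiY_def GG_def)

lemma meas_Zf: "0 <= al' ==> al' <= al ==> al < 1 ==> (%om. Zf ep Q t p' al al' e a b (Collect om)) : borel_measurable nu"
proof -
 assume al: "0 <= al'" "al' <= al" "al < 1"
 have [measurable]: "(%om. pw al (Kl om v)) : borel_measurable nu" "(%om. pw al' (Kl om v)) : borel_measurable nu"
  "(%om. pw t (Kl om v)) : borel_measurable nu" for v using al t by (auto intro!: meas_pw)
 show ?thesis unfolding Zf_Phi PhiZ_def of_bool_def mem_Collect_eq by measurable
qed

lemma meas_Yf: "0 <= al' ==> al' <= al ==> al < 1 ==> (%om. Yf ep al al' a b (Collect om)) : borel_measurable nu"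
proof -
 assume al: "0 <= al'" "al' <= al" "al < 1"
 have [measurable]: "(%om. pw al (Kl om v)) : borel_measurable nu" "(%om. pw al' (Kl om v)) : borel_measurable nu"
  for v using al by (auto intro!: meas_pw)
 show ?thesis unfolding Yf_def GG_def by measurable
qed

theorem edge_fluctuation_nu:
 assumes e: "ep e = {a, b}" and al: "0 <= al'" "al' <= al" "al < 1"
 shows "p e / (1 + Q)\<^sup>2 * (\<integral>om. Yf ep al al' a b (Collect om) \<partial>nu) <= (\<integral>om. Zf ep Q t (p e) al al' e a b (Collect om) \<partial>nu)"
proof -
 \<comment> \<open>Covers the Lipschitz constants \<open>2 + Q\<close> and \<open>4 + 4 * Q\<close>
   of the two branches of \<open>PhiZ\<close>, and the constant 4 of \<open>PhiY\<close>.\<close>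
 define C where "C = 4 * Q + 8"
 have C: "0 <= C" using Q by (simp add: C_def)
 have pb: "0 <= p e" "p e <= 1" by (rule p_bounds)+
 have lZ: "(%n. En n (Zf (epS (S n)) Q t (p e) al al' e (Some a) (Some b))) \<longlonglongrightarrow> (\<integral>om. Zf ep Q t (p e) al al' e a b (Collect om) \<partial>nu)"
  unfolding Zf_Phi
 proof (rule pair_converge[OF al _ _ C])
  fix b o' P L P' L' and d :: real
  assume d: "0 <= d" and H: "!!s. s : {t, al, al'} ==> 0 <= P s & P s <= 1 & 0 <= L s & L s <= 1 \<and>
   0 <= P' s & P' s <= 1 & 0 <= L' s & L' s <= 1 & \<bar>P s - P' s\<bar> <= d & \<bar>L s - L' s\<bar> <= d"
  have T: "0 <= P t" "0 <= L t" "0 <= P' t" "0 <= L' t" "\<bar>P t - P' t\<bar> <= d" "\<bar>L t - L' t\<bar> <= d" using H[of t] by auto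
  have A: "0 <= P al" "P al <= 1" "0 <= L al" "L al <= 1" "0 <= P' al" "P' al <= 1" "0 <= L' al" "L' al <= 1"
   "\<bar>P al - P' al\<bar> <= d" "\<bar>L al - L' al\<bar> <= d" using H[of al] by auto
  have A': "0 <= P al'" "P al' <= 1" "0 <= L al'" "L al' <= 1" "0 <= P' al'" "P' al' <= 1" "0 <= L' al'" "L' al' <= 1"
   "\<bar>P al' - P' al'\<bar> <= d" "\<bar>L al' - L' al'\<bar> <= d" using H[of al'] by auto
  have r: "\<bar>1 / (1 + Q * P t) - 1 / (1 + Q * P' t)\<bar> <= Q * d" "\<bar>1 / (1 + Q * L t) - 1 / (1 + Q * L' t)\<bar> <= Q * d"
   using rr_lip[OF T(1,3)] rr_lip[OF T(2,4)] mult_left_mono[OF T(5) Q] mult_left_mono[OF T(6) Q] by linarith+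
  have r1: "\<bar>1 / (1 + Q * z)\<bar> <= 1" if "0 <= z" for z using rr_01[OF that] by simp
  have g1: "\<bar>(P al - P al') - (P' al - P' al')\<bar> <= 2 * d" "\<bar>P' al - P' al'\<bar> <= 1" "\<bar>(P' al - P' al') + (L' al - L' al')\<bar> <= 2"
   "\<bar>((P al - P al') + (L al - L al')) - ((P' al - P' al') + (L' al - L' al'))\<bar> <= 4 * d" using A A' by (auto simp: abs_le_iff)
  have Qd: "0 <= Q * d" using Q d by simp
  show "\<bar>PhiZ (p e) al al' b o' P L - PhiZ (p e) al al' b o' P' L'\<bar> <= C * d"
  proof (cases b)
   case True
   have "\<bar>1 / (1 + Q * P t) * (P al - P al') - 1 / (1 + Q * P' t) * (P' al - P' al')\<bar> <= 1 * (2 * d) + Q * d * 1"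
   by (rule prod_lip[OF r1[OF T(1)] g1(2) r(1) g1(1)])
   moreover have "\<bar>p e - of_bool o'\<bar> <= 1" using pb by (cases o') auto
   ultimately have "\<bar>p e - of_bool o'\<bar> * \<bar>1 / (1 + Q * P t) * (P al - P al') - 1 / (1 + Q * P' t) * (P' al - P' al')\<bar> <= 1 * (1 * (2 * d) + Q * d * 1)"
   by (intro mult_mono) auto
   moreover have "1 * (1 * (2 * d) + Q * d * 1) <= C * d" using Qd d by (simp add: C_def algebra_simps)
   ultimately have "\<bar>(p e - of_bool o') * (1 / (1 + Q * P t) * (P al - P al') - 1 / (1 + Q * P' t) * (P' al - P' al'))\<bar> <= C * d"
   unfolding abs_mult[of "p e - of_bool o'"] by linarith
   then show ?thesis using True unfolding PhiZ_def by (simp only: if_True right_diff_distrib[of "p e - of_bool o'", symmetric])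
  next
   case False
   have h1: "\<bar>1 / (1 + Q * P t) * (1 / (1 + Q * L t)) - 1 / (1 + Q * P' t) * (1 / (1 + Q * L' t))\<bar> <= 1 * (Q * d) + Q * d * 1"
   by (rule prod_lip[OF r1[OF T(1)] r1[OF T(4)] r(1) r(2)])
   have h2: "\<bar>1 / (1 + Q * P t) * (1 / (1 + Q * L t))\<bar> <= 1" using r1[OF T(1)] r1[OF T(2)] by (simp only: abs_mult) (intro mult_le_one, auto)
   have "\<bar>1 / (1 + Q * P t) * (1 / (1 + Q * L t)) * ((P al - P al') + (L al - L al')) -
   1 / (1 + Q * P' t) * (1 / (1 + Q * L' t)) * ((P' al - P' al') + (L' al - L' al'))\<bar> <= 1 * (4 * d) + (1 * (Q * d) + Q * d * 1) * 2"
   by (rule prod_lip[OF h2 g1(3) h1 g1(4)])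
   then have "p e * \<bar>1 / (1 + Q * P t) * (1 / (1 + Q * L t)) * ((P al - P al') + (L al - L al')) -
   1 / (1 + Q * P' t) * (1 / (1 + Q * L' t)) * ((P' al - P' al') + (L' al - L' al'))\<bar> <= 1 * (1 * (4 * d) + (1 * (Q * d) + Q * d * 1) * 2)"
   using pb by (intro mult_mono) auto
   moreover have "1 * (1 * (4 * d) + (1 * (Q * d) + Q * d * 1) * 2) <= C * d" using d by (simp add: C_def algebra_simps)
   ultimately show ?thesis using False pb unfolding PhiZ_def by (simp only: if_False right_diff_distrib[symmetric] abs_mult abs_of_nonneg)
  qed
 next
  fix b o' P L and d :: real
  assume d: "0 <= d" "d <= 1" and H: "!!s. s : {t, al, al'} ==> 0 <= P s & P s <= 1 & 0 <= L s & L s <= 1"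
   and sm: "!!s. s : {al, al'} ==> P s <= d & L s <= d"
  have h: "0 <= P t" "0 <= L t" "0 <= P al" "0 <= L al" "0 <= P al'" "0 <= L al'" using H by auto
  have h': "P al <= d" "L al <= d" "P al' <= d" "L al' <= d" using sm by auto
  have r1: "0 <= 1 / (1 + Q * z)" "1 / (1 + Q * z) <= 1" if "0 <= z" for z using rr_01[OF that] by auto
  have g: "\<bar>P al - P al'\<bar> <= d" "\<bar>(P al - P al') + (L al - L al')\<bar> <= 2 * d" using h h' by (auto simp: abs_le_iff)
  have "0 <= Q * d" using Q d by simp
  then have C2: "2 * d <= C * d" using d by (simp add: C_def algebra_simps)
  show "\<bar>PhiZ (p e) al al' b o' P L\<bar> <= C * d"
  proof (cases b)
   case True
   have "\<bar>p e - of_bool o'\<bar> * (\<bar>1 / (1 + Q * P t)\<bar> * \<bar>P al - P al'\<bar>) <= 1 * (1 * d)"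
   using pb r1[OF h(1)] g(1) d by (intro mult_mono) (auto simp: abs_le_iff split: if_splits)
   then show ?thesis using True C2 d unfolding PhiZ_def by (simp only: if_True abs_mult, (linarith)?)
  next
   case False
   have "\<bar>p e\<bar> * (\<bar>1 / (1 + Q * P t)\<bar> * \<bar>1 / (1 + Q * L t)\<bar> * \<bar>(P al - P al') + (L al - L al')\<bar>) <= 1 * (1 * 1 * (2 * d))"
   using pb r1[OF h(1)] r1[OF h(2)] g(2) d by (intro mult_mono mult_nonneg_nonneg) auto
   then show ?thesis using False C2 unfolding PhiZ_def by (simp only: if_False abs_mult, (linarith)?)
  qed
 next
  show "(%om. PhiZ (p e) al al' (b : Kl om a) (e : Collect om) (%s. pw s (Kl om a)) (%s. pw s (Kl om b))) : borel_measurable nu"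
   using meas_Zf[OF al, of "p e" e a b] unfolding Zf_Phi .
 qed
 have lY: "(%n. En n (Yf (epS (S n)) al al' (Some a) (Some b))) \<longlonglongrightarrow> (\<integral>om. Yf ep al al' a b (Collect om) \<partial>nu)"
  unfolding Yf_Phi[where e = e]
 proof (rule pair_converge[OF al _ _ C])
  fix b o' P L P' L' and d :: real
  assume d: "0 <= d" and H: "!!s. s : {t, al, al'} ==> 0 <= P s & P s <= 1 & 0 <= L s & L s <= 1 \<and>
   0 <= P' s & P' s <= 1 & 0 <= L' s & L' s <= 1 & \<bar>P s - P' s\<bar> <= d & \<bar>L s - L' s\<bar> <= d"
  have pr: "\<bar>(1 - P s) * (1 - L s) - (1 - P' s) * (1 - L' s)\<bar> <= 1 * d + d * 1" if "s : {t, al, al'}" for s by (rule prod_lip) (use H[OF that] in auto)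
  have "0 <= Q * d" using Q d by simp
  then have "4 * d <= C * d" using d by (simp add: C_def algebra_simps)
  then show "\<bar>PhiY al al' b o' P L - PhiY al al' b o' P' L'\<bar> <= C * d" using pr[of al] pr[of al'] d unfolding PhiY_def by (cases b) (auto simp: abs_le_iff)
 next
  fix b o' P L and d :: real
  assume d: "0 <= d" "d <= 1" and H: "!!s. s : {t, al, al'} ==> 0 <= P s & P s <= 1 & 0 <= L s & L s <= 1"
   and sm: "!!s. s : {al, al'} ==> P s <= d & L s <= d"
  have pr: "\<bar>(1 - P s) * (1 - L s) - 1 * 1\<bar> <= 1 * d + d * 1" if "s : {al, al'}" for s by (rule prod_lip) (use H[of s] sm[OF that] that in auto)
  have "0 <= Q * d" using Q d by simp
  then have "4 * d <= C * d" using d by (simp add: C_def algebra_simps)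
  then show "\<bar>PhiY al al' b o' P L\<bar> <= C * d" using pr[of al] pr[of al'] d unfolding PhiY_def by (cases b) (auto simp: abs_le_iff)
 next
  show "(%om. PhiY al al' (b : Kl om a) (e : Collect om) (%s. pw s (Kl om a)) (%s. pw s (Kl om b))) : borel_measurable nu"
   using meas_Yf[OF al, of a b] unfolding Yf_Phi[where e = e] .
 qed
 have fin: "finite {e}" "finite {a, b}" by auto
 have ev: "\<forall>\<^sub>F n in sequentially. p e / (1 + Q)\<^sup>2 * En n (Yf (epS (S n)) al al' (Some a) (Some b)) \<le>
  En n (Zf (epS (S n)) Q t (p e) al al' e (Some a) (Some b))" using evF[OF fin(1)] evS[OF fin(2)]
 proof eventually_elim
  case (elim n)
  interpret m: fk_const "epS (S n)" "WW (S n)" Q t x "F n" by (rule model)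
  show ?case unfolding p_def by (rule m.edge_fluctuation) (use elim e al in \<open>auto simp: epS_def\<close>)
 qed
 show ?thesis by (rule tendsto_le[OF _ lZ tendsto_mult_left[OF lY] ev]) simp
qed

end

section \<open>Bounding the fluctuation of a cluster\<close>

lemma touching_term_bound:
 fixes r :: "'w => real"
 assumes "finite X" "card X <= 2" "X Int K ~= {}" "0 <= p" "p <= 1" "!!w. w : X ==> 0 <= r w & r w <= 1"
 shows "0 <= p * (\<Sum>w\<in>X - K. r w)" "p * (\<Sum>w\<in>X - K. r w) <= 1" "card (X - K) <= 1"
proof -
 show c: "card (X - K) <= 1"
 proof -
  have "card (X - K) = card X - card (X Int K)" by (rule card_Diff_subset_Int) (use assms(1) in simp)
  moreover have "card (X Int K) ~= 0" using assms(1,3) by simp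
  ultimately show ?thesis using assms(2) by linarith
 qed
 have s0: "0 <= (\<Sum>w\<in>X - K. r w)" by (intro sum_nonneg) (use assms(6) in blast)
 have "(\<Sum>w\<in>X - K. r w) <= (\<Sum>w\<in>X - K. 1)" by (intro sum_mono) (use assms(6) in blast)
 then have s1: "(\<Sum>w\<in>X - K. r w) <= 1" using c by simp
 show "0 <= p * (\<Sum>w\<in>X - K. r w)" using s0 assms(4) by simp
 show "p * (\<Sum>w\<in>X - K. r w) <= 1" using mult_mono[OF assms(5) s1] s0 assms(4) by simp
qed

context fk_limit
begin

text \<open>One vertex's share in the weight \<open>rr * gg\<close> of its cluster: summing over the
  vertices of the cluster restores the weight, as mass transport requires. An infinite set has
  \<open>card\<close> 0 and receives share 0.\<close>

definition gam :: "real => real => 'w set => real" where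
 "gam al al' K = rr Q t K * gg al al' K / card K"

lemma gam_bounds:
 assumes "0 <= al'" "al' <= al" "al < 1"
 shows "0 <= gam al al' K" "gam al al' K * card K <= 1" "gam al al' K <= 1"
proof -
 have t0: "0 <= t" using t by simp
 note g = gg_bounds[OF assms, of K]
 have r: "0 <= rr Q t K" "rr Q t K <= 1" using rr_nonneg[OF Q t0 t(2), of K] rr_bounds[OF Q t0 t(2), of K] by auto
 have rg: "0 <= rr Q t K * gg al al' K" "rr Q t K * gg al al' K <= 1" using r g by (auto intro: mult_le_one)
 show a: "0 <= gam al al' K" using rg by (simp add: gam_def)
 show b: "gam al al' K * card K <= 1" using rg by (cases "card K = 0") (auto simp: gam_def)
 show "gam al al' K <= 1"
 proof (cases "card K = 0")
  case False
  then have "gam al al' K * 1 <= gam al al' K * card K" using a by (intro mult_left_mono) auto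
  then show ?thesis using b by linarith
 qed (simp add: gam_def)
qed

lemma gam_card: "al < 1 ==> al' <= al ==> K ~= {} ==> card K * gam al al' K = rr Q t K * gg al al' K" by (cases "finite K") (auto simp: gam_def gg_def pw_def)

lemma gam_image: "inj f ==> gam al al' (f ` K) = gam al al' K"
proof -
 assume "inj f"
 then have f: "inj_on f K" by (rule inj_on_subset) simp
 show ?thesis by (simp add: gam_def rr_def gg_def pw_def card_image[OF f] finite_image_iff[OF f])
qed

lemma gam_infinite: "infinite K ==> gam al al' K = 0" by (simp add: gam_def)

text \<open>The counterpart of \<open>HH\<close> in the infinite graph, over strong edges only, of
  which finitely many touch a finite cluster.\<close>

definition HK :: "'e set => 'v => real" where
 "HK A v = (\<Sum>e\<in>near (cl ep A v). if ep e <= cl ep A v then p e - of_bool (e : A)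
  else p e * (\<Sum>w\<in>ep e - cl ep A v. rr Q t (cl ep A w)))"

lemma card_near: "finite K ==> card (near K) <= deg * card K"
proof -
 assume K: "finite K"
 have "card (near K) <= (\<Sum>v\<in>K. card (St v))" unfolding near_UN by (rule card_UN_le[OF K])
 then have "real (card (near K)) <= real (\<Sum>v\<in>K. card (St v))" by (simp only: of_nat_le_iff)
 also have "... = deg * card K" by (simp add: card_St)
 finally show ?thesis .
qed

lemma deg_ge_1: "1 <= deg"
proof -
 have "0 < real (card (St undefined))" using deg_pos card_St[of undefined] by simp
 then have "1 <= card (St undefined)" by (simp only: of_nat_0_less_iff, (linarith)?)
 then have "real 1 <= real (card (St undefined))" by (simp only: of_nat_le_iff)
 then show ?thesis unfolding card_St by simp
qed

lemma rr01: "0 <= rr Q t K & rr Q t K <= 1" using rr_nonneg[OF Q _ t(2), of K] rr_bounds[OF Q _ t(2), of K] t by auto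

lemma abs_term:
 assumes "finite X" "card X <= 2" "X Int K ~= {}"
 shows "\<bar>if X \<subseteq> K then p e - of_bool b else p e * (\<Sum>w\<in>X - K. rr Q t (f w))\<bar> <= 1"
proof -
 have b: "0 <= p e * (\<Sum>w\<in>X - K. rr Q t (f w))" "p e * (\<Sum>w\<in>X - K. rr Q t (f w)) <= 1"
  by (rule touching_term_bound[OF assms p_bounds(1)[of e] p_bounds(2)[of e]]; rule rr01)+
 show ?thesis
 proof (cases "X \<subseteq> K")
  case True
  then show ?thesis using p_bounds[of e] by (cases b) auto
 qed (use b in simp)
qed

lemma gam_H_bound:
 fixes h :: "'e => real" and K :: "'w set"
 assumes al: "0 <= al'" "al' <= al" "al < 1" and c: "real (card N) <= deg * card K" and h: "!!e. e : N ==> \<bar>h e\<bar> <= 1"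
 shows "\<bar>gam al al' K * (\<Sum>e\<in>N. h e)\<bar> <= deg"
proof -
 note g = gam_bounds[OF al, of K]
 have "\<bar>\<Sum>e\<in>N. h e\<bar> <= (\<Sum>e\<in>N. \<bar>h e\<bar>)" by (rule sum_abs)
 also have "... <= (\<Sum>e\<in>N. 1)" by (rule sum_mono) (rule h)
 finally have "\<bar>\<Sum>e\<in>N. h e\<bar> <= deg * card K" using c by simp
 then have "gam al al' K * \<bar>\<Sum>e\<in>N. h e\<bar> <= gam al al' K * (deg * card K)" using g by (intro mult_left_mono)
 also have "... = deg * (gam al al' K * card K)" by (simp add: ac_simps)
 also have "... <= deg * 1" using g deg_pos by (intro mult_left_mono) auto
 finally show ?thesis using g by (simp add: abs_mult)
qed

lemma gam_HK_bound:
 assumes al: "0 <= al'" "al' <= al" "al < 1"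
 shows "\<bar>gam al al' (cl ep A v) * HK A v\<bar> <= deg"
proof (cases "finite (cl ep A v)")
 case True
 show ?thesis unfolding HK_def by (rule gam_H_bound[OF al card_near[OF True] abs_term])
   (use finite_ep card_ep in \<open>auto simp: near_def\<close>)
qed (use deg_pos in \<open>simp add: gam_infinite\<close>)

abbreviation "HM n v A \<equiv> HH (epS (S n)) (rr Q t) p {e : F n. eps <= J e} (Some v) A"

lemma touch_near:
 assumes "K \<subseteq> S n" shows "touch (epS (S n)) {e : F n. eps <= J e} (Some ` K) = near K Int F n"
proof -
 have "epS (S n) e Int Some ` K ~= {} \<longleftrightarrow> ep e Int K ~= {}" for e using assms by (auto simp: epS_def prj_def split: if_splits)
 then show ?thesis by (auto simp: touch_def near_def)
qed

lemma HM_bound: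
 assumes al: "0 <= al'" "al' <= al" "al < 1" and K: "cl (epS (S n)) A (Some v) = Some ` C" "C \<subseteq> S n"
 shows "\<bar>gam al al' (cl (epS (S n)) A (Some v)) * HM n v A\<bar> <= deg"
proof -
 have fC: "finite C" using K(2) finS finite_subset by blast
 have c: "real (card (touch (epS (S n)) {e : F n. eps <= J e} (Some ` C))) <= deg * card (Some ` C)"
 proof -
  have "card (near C Int F n) <= card (near C)" by (rule card_mono[OF finite_near[OF fC]]) auto
  then show ?thesis unfolding touch_near[OF K(2)] using card_near[OF fC] by (simp add: card_image)
 qed
 have "card (epS (S n) e) <= 2" for e unfolding epS_def using card_image_le[OF finite_ep, of "prj (S n)" e] card_ep[of e] by simp
 then show ?thesis unfolding HH_def by (intro gam_H_bound[OF al _ abs_term]) (use c K finite_ep in \<open>auto simp: touch_def epS_def\<close>)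
qed

text \<open>The exponential moment of \<open>HM\<close> turns into a first moment because \<open>gam\<close> is at most
 \<open>1 / N\<close> for \<open>al' = 1 - 1 / N\<close>.\<close>

lemma model_fluctuation:
 assumes al: "al' = 1 - 1 / real N" "1 <= N" "al' <= al" "al < 1" and B: "B \<subseteq> S n" "v : S n"
 shows "En n (%A. of_bool (cl (epS (S n)) A (Some v) \<subseteq> Some ` B) * (gam al al' (cl (epS (S n)) A (Some v)) * HM n v A))
  <= 2 * sqrt (deg / N)"
proof -
 interpret m: fk_const "epS (S n)" "WW (S n)" Q t x "F n" by (rule model)
 let ?en = "epS (S n)" and ?T = "{e : F n. eps <= J e}"
 \<comment> \<open>This value balances the two final terms \<open>th * deg\<close> and
   \<open>1 / (th * N)\<close>.\<close>
 define th where "th = 1 / sqrt (deg * N)"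
 have N: "1 <= real N" using al(2) by simp
 have dN: "1 <= deg * N" using mult_mono[OF deg_ge_1 N] deg_pos by simp
 have th: "0 < th" "th <= 1" using dN by (auto simp: th_def)
 have a0: "0 <= al'" using N al(1) by simp
 have uc: "1 / (1 + Q * ucl (%_. t) C) = rr Q t C" if "finite C" for C :: "'v option set" using ucl_const[OF that, of t] by (simp add: rr_def)
 have vW: "Some v : WW (S n)" using B by (simp add: WW_def)
 have fincl: "finite (cl ?en A z)" if "z : WW (S n)" for A z by (rule finite_subset[OF cl_subset[OF that epS_WW] finite_WW[OF finS]])
 have HHeq: "HH ?en (%C. 1 / (1 + Q * ucl (%_. t) C)) p ?T (Some v) A = HM n v A" for A
  unfolding HH_def using uc fincl subsetD[OF epS_WW] by (intro sum.cong refl if_cong arg_cong2[where f = "(*)"]) auto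
 let ?X = "%A. rr Q t (cl ?en A (Some v)) * exp (th * HM n v A - th\<^sup>2 * card (touch ?en ?T (cl ?en A (Some v))))"
 have X: "En n ?X <= 1"
 proof -
  have "p = (%e. x e / (1 + x e))" by (simp add: fun_eq_iff p_def)
  then have "En n (%A. 1 / (1 + Q * ucl (%_. t) (cl ?en A (Some v))) *
   exp (th * HH ?en (%C. 1 / (1 + Q * ucl (%_. t) C)) p ?T (Some v) A - th\<^sup>2 * card (touch ?en ?T (cl ?en A (Some v))))) <= 1"
   using m.tilt[OF vW, of ?T th] th by (simp only:) auto
  then show ?thesis unfolding HHeq uc[OF fincl[OF vW]] .
 qed
 have "En n (%A. of_bool (cl ?en A (Some v) \<subseteq> Some ` B) * (gam al al' (cl ?en A (Some v)) * HM n v A)) \<le>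
  En n (%A. th * deg + (1 / (th * N)) * ?X A)"
 proof (rule m.EE_mono)
  fix A assume A: "A \<subseteq> F n"
  let ?K = "cl ?en A (Some v)" and ?c = "real (card (touch ?en ?T (cl ?en A (Some v))))"
  have rhs: "0 <= (1 / (th * N)) * ?X A" by (intro mult_nonneg_nonneg) (use rr01 th in auto)
  show "of_bool (?K \<subseteq> Some ` B) * (gam al al' ?K * HM n v A) <= th * deg + (1 / (th * N)) * ?X A"
  proof (cases "?K \<subseteq> Some ` B")
   case True
   define C where "C = the ` ?K"
   have KC: "?K = Some ` C" unfolding C_def image_image using True by force
   have CS: "C \<subseteq> S n" using True B(1) KC by auto
   have fC: "finite C" using CS finS finite_subset by blast
   have c: "?c <= deg * card ?K"
   proof -
   have "card (near C Int F n) <= card (near C)" by (rule card_mono[OF finite_near[OF fC]]) auto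
   then show ?thesis unfolding KC touch_near[OF CS] using card_near[OF fC] by (simp add: card_image)
   qed
   define k where "k = card ?K"
   have k: "1 <= k" unfolding k_def using fincl[OF vW, of A] cl_refl[of "Some v" ?en A] by (metis One_nat_def Suc_leI card_gt_0_iff empty_iff)
   \<comment> \<open>Bernoulli's inequality: the truncated size grows at most linearly, with slope
     \<open>1 / N\<close>.\<close>
   have gb: "gg al al' ?K <= k / N"
   proof -
   have "gg al al' ?K = al ^ k - al' ^ k" using fincl[OF vW, of A] by (simp add: gg_def pw_def k_def)
   also have "al ^ k <= 1" by (rule power_le_one) (use order.trans[OF a0 al(3)] al(4) in auto)
   also have "1 + real k * (- (1 / N)) <= (1 + - (1 / N)) ^ k" by (rule Bernoulli_inequality) (use N in simp)
   then have "1 - al' ^ k <= k / N" unfolding al(1) by simp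
   finally show ?thesis by simp
   qed
   note gm = gam_bounds[OF a0 al(3,4), of ?K]
   have g1: "gam al al' ?K <= rr Q t ?K / N"
   proof -
   have "gam al al' ?K = rr Q t ?K * (gg al al' ?K / k)" by (simp add: gam_def k_def)
   also have "gg al al' ?K / k <= 1 / N" using gb k by (simp add: field_simps)
   finally show ?thesis using rr01[of ?K] by (simp add: mult_left_mono)
   qed
   have g2: "gam al al' ?K * ?c <= deg"
   proof -
   have "gam al al' ?K * ?c <= gam al al' ?K * (deg * card ?K)" by (rule mult_left_mono[OF c gm(1)])
   also have "... = deg * (gam al al' ?K * card ?K)" by (simp add: ac_simps)
   also have "... <= deg * 1" using gm(2) deg_pos by (intro mult_left_mono) auto
   finally show ?thesis by simp
   qed
   let ?e = "exp (th * HM n v A - th\<^sup>2 * ?c)"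
   \<comment> \<open>From \<open>z <= exp z\<close>: after division by \<open>th\<close>, the
     fluctuation is at most \<open>th * ?c\<close> plus the exponential over \<open>th\<close>. The
     first part is tamed by \<open>gam * ?c <= deg\<close>, the second by the exponential
     moment.\<close>
   have "th * HM n v A - th\<^sup>2 * ?c <= ?e" using exp_ge_add_one_self[of "th * HM n v A - th\<^sup>2 * ?c"] by linarith
   then have "th * HM n v A <= th * (th * ?c + ?e / th)" using th(1) by (simp add: power2_eq_square distrib_left)
   then have H: "HM n v A <= th * ?c + ?e / th" using th(1) by (simp only: mult_le_cancel_left_pos)
   have "gam al al' ?K * HM n v A <= gam al al' ?K * (th * ?c + ?e / th)" by (rule mult_left_mono[OF H gm(1)])
   also have "... = th * (gam al al' ?K * ?c) + gam al al' ?K * (?e / th)" by (simp add: distrib_left ac_simps)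
   also have "... <= th * deg + (rr Q t ?K / N) * (?e / th)" by (intro add_mono mult_left_mono mult_right_mono g1 g2) (use th in auto)
   also have "(rr Q t ?K / N) * (?e / th) = (1 / (th * N)) * ?X A" by simp
   finally show ?thesis using True by simp
  qed (use rhs th deg_pos in simp)
 qed
 also have "... = th * deg + (1 / (th * N)) * En n ?X" unfolding m.EE_add[of "%_. th * deg"] m.EE_const m.EE_cmult ..
 also have "... <= th * deg + (1 / (th * N)) * 1" using X th by (intro add_left_mono mult_left_mono) auto
 also have "... = 2 * sqrt (deg / N)"
 proof -
  define a b where "a = sqrt deg" and "b = sqrt N"
  have ab: "0 < a" "0 < b" "deg = a * a" "real N = b * b" using deg_pos N by (auto simp: a_def b_def)
  have th: "th = 1 / (a * b)" and sq: "sqrt (deg / N) = a / b" by (simp_all add: th_def a_def b_def real_sqrt_mult real_sqrt_divide)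
  show ?thesis unfolding sq th unfolding ab(3,4) using ab(1,2) by (simp add: field_simps)
 qed
 finally show ?thesis .
qed

lemma rr_diff:
 assumes "\<bar>pw t K - pw t L\<bar> <= d" shows "\<bar>rr Q t K - rr Q t L\<bar> <= Q * d"
proof -
 have "0 <= pw t K" "0 <= pw t L" using pw_bounds[of t K] pw_bounds[of t L] t by simp_all
 from rr_lip[OF this] have "\<bar>rr Q t K - rr Q t L\<bar> <= Q * \<bar>pw t K - pw t L\<bar>" by (simp add: rr_def)
 also have "... <= Q * d" using assms Q by (rule mult_left_mono)
 finally show ?thesis .
qed

lemma H_diff:
 fixes y :: real and R1 R2 :: "'v => real"
 assumes B: "finite B" "K \<subseteq> B" and y: "0 <= y" and b: "!!e. e : near K ==> b1 e = b2 e"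
  and R: "!!e w. e : near K ==> w : ep e ==> \<bar>R1 w - R2 w\<bar> <= y"
 shows "\<bar>(\<Sum>e\<in>near K. if ep e \<subseteq> K then p e - of_bool (b1 e) else p e * (\<Sum>w\<in>ep e - K. R1 w)) -
  (\<Sum>e\<in>near K. if ep e \<subseteq> K then p e - of_bool (b2 e) else p e * (\<Sum>w\<in>ep e - K. R2 w))\<bar> <= card (near B) * y"
proof -
 let ?f = "%b R e. if ep e \<subseteq> K then p e - of_bool (b e) else p e * (\<Sum>w\<in>ep e - K. R w)"
 have "\<bar>(\<Sum>e\<in>near K. ?f b1 R1 e) - (\<Sum>e\<in>near K. ?f b2 R2 e)\<bar> = \<bar>\<Sum>e\<in>near K. ?f b1 R1 e - ?f b2 R2 e\<bar>"
  by (simp only: sum_subtractf)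
 also have "... <= (\<Sum>e\<in>near K. \<bar>?f b1 R1 e - ?f b2 R2 e\<bar>)" by (rule sum_abs)
 also have "... <= (\<Sum>e\<in>near K. y)"
 proof (rule sum_mono)
  fix e assume e: "e : near K"
  have "card (ep e - K) <= 1" by (rule touching_term_bound(3)[where p = 0 and r = "%_. 0"]) (use e finite_ep card_ep in \<open>auto simp: near_def\<close>)
  then have "real (card (ep e - K)) * y <= 1 * y" using y by (intro mult_right_mono) auto
  moreover have "\<bar>\<Sum>w\<in>ep e - K. R1 w - R2 w\<bar> <= (\<Sum>w\<in>ep e - K. y)" by (rule order.trans[OF sum_abs sum_mono]) (use R e in auto)
  ultimately have s: "\<bar>\<Sum>w\<in>ep e - K. R1 w - R2 w\<bar> <= y" by simp
  have "p e * \<bar>\<Sum>w\<in>ep e - K. R1 w - R2 w\<bar> <= 1 * y" by (rule mult_mono) (use s p_bounds in auto)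
  then have "\<bar>p e * (\<Sum>w\<in>ep e - K. R1 w) - p e * (\<Sum>w\<in>ep e - K. R2 w)\<bar> <= y"
   by (simp add: right_diff_distrib[symmetric] sum_subtractf[symmetric] abs_mult p_bounds)
  then show "\<bar>?f b1 R1 e - ?f b2 R2 e\<bar> <= y" using b[OF e] y by simp
 qed
 also have "... <= card (near B) * y"
 proof -
  have "card (near K) <= card (near B)" by (rule card_mono[OF finite_near[OF B(1)]]) (use B(2) in \<open>auto simp: near_def\<close>)
  then show ?thesis using y by (simp add: mult_right_mono)
 qed
 finally show ?thesis .
qed

lemma pred_subset: "Measurable.pred nu (%om. Kl om v \<subseteq> B)"
proof -
 have 1: "{om. y : Kl om v} : sets nu" for y using meas_cl[of y v] by (simp add: pred_def)
 have "(\<Union>y\<in>- B. {om. y : Kl om v}) : sets nu" by (rule sets.countable_UN'[OF countable_subset[OF subset_UNIV countable_V]]) (use 1 in auto)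
 then have "space nu - (\<Union>y\<in>- B. {om. y : Kl om v}) : sets nu" by (rule sets.compl_sets)
 moreover have "space nu - (\<Union>y\<in>- B. {om. y : Kl om v}) = {om. Kl om v \<subseteq> B}" by auto
 ultimately show ?thesis by (simp add: pred_def)
qed

lemma meas_rr [measurable]: "(%om. rr Q t (Kl om v)) : borel_measurable nu"
proof -
 have [measurable]: "(%om. pw t (Kl om v)) : borel_measurable nu" using t by (intro meas_pw) auto
 show ?thesis unfolding rr_def by measurable
qed

lemma meas_gam:
 assumes al: "0 <= al'" "al' <= al" "al < 1"
 shows "(%om. gam al al' (Kl om v)) : borel_measurable nu"
proof -
 have [measurable]: "(%om. pw al (Kl om v)) : borel_measurable nu" "(%om. pw al' (Kl om v)) : borel_measurable nu" using al by (intro meas_pw; simp)+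
 show ?thesis unfolding gam_def gg_def by measurable
qed

lemma pred_ep: "Measurable.pred nu (%om. ep e \<subseteq> Kl om v)" "Measurable.pred nu (%om. ep e Int Kl om v ~= {})"
proof -
 have "ep e \<subseteq> Kl om v \<longleftrightarrow> src e : Kl om v & tgt e : Kl om v" "ep e Int Kl om v ~= {} \<longleftrightarrow> src e : Kl om v | tgt e : Kl om v" for om
  using src_tgt(1)[of e] by auto
 then show "Measurable.pred nu (%om. ep e \<subseteq> Kl om v)" "Measurable.pred nu (%om. ep e Int Kl om v ~= {})" by simp_all
qed

lemma outer_sum: "(\<Sum>w\<in>ep e - K. f w) = (if src e : K then 0 else f (src e)) + (if tgt e : K then 0 else (f (tgt e) :: real))"
proof -
 have "ep e - K = (if src e : K then {} else {src e}) Un (if tgt e : K then {} else {tgt e})" using src_tgt(1)[of e] by auto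
 then show ?thesis using src_tgt(2)[of e] by auto
qed

lemma meas_outer [measurable]: "(%om. \<Sum>w\<in>ep e - Kl om v. rr Q t (Kl om w)) : borel_measurable nu" unfolding outer_sum by measurable

lemma meas_HKB:
 assumes al: "0 <= al'" "al' <= al" "al < 1" and B: "finite B"
 shows "(%om. of_bool (Kl om v \<subseteq> B) * (gam al al' (Kl om v) * HK (Collect om) v)) : borel_measurable nu"
proof -
 note [measurable] = pred_subset pred_ep meas_gam[OF al]
 have "(%om. of_bool (Kl om v \<subseteq> B) * (gam al al' (Kl om v) * HK (Collect om) v)) =
  (%om. if Kl om v \<subseteq> B then gam al al' (Kl om v) * (\<Sum>e\<in>near B. if ep e Int Kl om v ~= {} then
   (if ep e \<subseteq> Kl om v then p e - (if om e then 1 else 0) else p e * (\<Sum>w\<in>ep e - Kl om v. rr Q t (Kl om w))) else 0) else 0)"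
 proof
  fix om
  show "of_bool (Kl om v \<subseteq> B) * (gam al al' (Kl om v) * HK (Collect om) v) =
  (if Kl om v \<subseteq> B then gam al al' (Kl om v) * (\<Sum>e\<in>near B. if ep e Int Kl om v ~= {} then
   (if ep e \<subseteq> Kl om v then p e - (if om e then 1 else 0) else p e * (\<Sum>w\<in>ep e - Kl om v. rr Q t (Kl om w))) else 0) else 0)"
  proof (cases "Kl om v \<subseteq> B")
   case True
   have "HK (Collect om) v = (\<Sum>e\<in>near B. if ep e Int Kl om v ~= {} then
   (if ep e \<subseteq> Kl om v then p e - (if om e then 1 else 0) else p e * (\<Sum>w\<in>ep e - Kl om v. rr Q t (Kl om w))) else 0)" unfolding HK_def
   by (rule sum.mono_neutral_cong_left) (use True finite_near[OF B] in \<open>auto simp: near_def\<close>)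
   then show ?thesis using True by simp
  qed simp
 qed
 moreover have "(%om. if Kl om v \<subseteq> B then gam al al' (Kl om v) * (\<Sum>e\<in>near B. if ep e Int Kl om v ~= {} then
   (if ep e \<subseteq> Kl om v then p e - (if om e then 1 else 0) else p e * (\<Sum>w\<in>ep e - Kl om v. rr Q t (Kl om w))) else 0) else 0) : borel_measurable nu"
  by measurable
 ultimately show ?thesis by simp
qed

text \<open>Restricting to clusters inside a finite \<open>B\<close> makes the functional
  quasi-local. The cluster of \<open>v\<close> is then resolved exactly, as \<open>m\<close> is at
  least \<open>card B\<close>; only the sizes of neighbouring clusters, which enter through
  \<open>rr\<close>, are approximated.\<close>

lemma fluctuation_in:
 assumes al: "al' = 1 - 1 / real N" "1 <= N" "al' <= al" "al < 1" and B: "finite B"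
 shows "(\<integral>om. of_bool (Kl om v \<subseteq> B) * (gam al al' (Kl om v) * HK (Collect om) v) \<partial>nu) <= 2 * sqrt (deg / N)"
proof -
 have a0: "0 <= al'" using al(1,2) by simp
 define Y where "Y A = of_bool (cl ep A v \<subseteq> B) * (gam al al' (cl ep A v) * HK A v)" for A
 define Yn where "Yn n A = of_bool (B \<subseteq> S n & cl (epS (S n)) A (Some v) \<subseteq> Some ` B) * (gam al al' (cl (epS (S n)) A (Some v)) * HM n v A)" for n A
 have l: "(%n. En n (Yn n)) \<longlonglongrightarrow> (\<integral>om. Y (Collect om) \<partial>nu)"
 proof (rule converge)
  show "(%om. Y (Collect om)) : borel_measurable nu" unfolding Y_def by (rule meas_HKB[OF a0 al(3,4) B])
  show "\<bar>Y A\<bar> <= deg" for A unfolding Y_def using gam_HK_bound[OF a0 al(3,4), of A v] deg_pos by (simp add: of_bool_def)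
  show "\<bar>Yn n A\<bar> <= deg" for n A
  proof (cases "B \<subseteq> S n & cl (epS (S n)) A (Some v) \<subseteq> Some ` B")
   case True
   have k1: "cl (epS (S n)) A (Some v) = Some ` the ` cl (epS (S n)) A (Some v)" unfolding image_image using True by force
   have k2: "the ` cl (epS (S n)) A (Some v) \<subseteq> S n" using image_mono[of "cl (epS (S n)) A (Some v)" "Some ` B" the] True
   by (simp add: image_image) (blast intro: order.trans)
   show ?thesis using HM_bound[OF a0 al(3,4) k1 k2] True by (simp add: Yn_def)
  qed (use deg_pos in \<open>auto simp: Yn_def\<close>)
  fix dl :: real assume dl: "dl > 0"
  define d where "d = dl / (1 + real (card (near B)) * Q)"
  have dd: "0 < 1 + real (card (near B)) * Q" using Q by (simp add: add_pos_nonneg)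
  have d: "0 < d" "0 <= d" using dl dd by (auto simp: d_def)
  have Md: "real (card (near B)) * (Q * d) <= dl"
  proof -
   have "(1 + real (card (near B)) * Q) * d = dl" unfolding d_def using dd by simp
   then show ?thesis using d by (simp add: distrib_right mult.assoc)
  qed
  have Qd: "0 <= Q * d" using Q d by simp
  have "\<exists>m. \<forall>s\<in>{t}. s = 1 | s ^ m <= d" by (rule ex_power_small[OF d(1)]) (use t in auto)
  then obtain m0 where m0: "t = 1 | t ^ m0 <= d" by auto
  define m where "m = max m0 (card B)"
  have m: "t = 1 | t ^ m <= d" "card B <= m"
  proof -
   have "t ^ m <= t ^ m0" using t by (intro power_decreasing) (auto simp: m_def)
   then show "t = 1 | t ^ m <= d" using m0 by auto
  qed (simp add: m_def)
  define V where "V = insert v (\<Union>e\<in>near B. ep e)"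
  have V: "finite V" unfolding V_def using finite_near[OF B] finite_ep by auto
  have pwd: "\<bar>pw t K - pw t L\<bar> <= d" if "inj f" "finite L" "K = f ` L | m < card L & f ` L \<subseteq> K"
   for f :: "'v => 'w" and K L by (rule pw_agree[OF _ t(2) m(1) that(1,2) d(2) that(3)]) (use t in simp)
  have "loc_approx Yn Y dl V m I" if I: "finite I" "near B \<subseteq> I" for I unfolding loc_approx_def
  proof (intro conjI allI impI)
   fix A assume g: "\<forall>v\<in>V. \<not> bad v m I A"
   have gc: "cl ep A w = cl ep (A Int I) w | m < card (cl ep (A Int I) w) & cl ep (A Int I) w <= cl ep A w" if "w : V" for w
   using good_cl[of w m I A] g I(1) that by simp
   show "\<bar>Y A - Y (A Int I)\<bar> <= dl"
   proof (cases "cl ep (A Int I) v \<subseteq> B")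
   case False
   then have "\<not> cl ep A v \<subseteq> B" using gc[of v] by (auto simp: V_def)
   then show ?thesis using False dl by (simp add: Y_def)
   next
   case True
   have "card (cl ep (A Int I) v) <= m" using card_mono[OF B True] m(2) by linarith
   then have eq: "cl ep A v = cl ep (A Int I) v" using gc[of v] by (auto simp: V_def)
   have nI: "near (cl ep A v) <= near B" using True unfolding eq by (auto simp: near_def)
   have hd: "\<bar>HK A v - HK (A Int I) v\<bar> <= card (near B) * (Q * d)" unfolding HK_def eq[symmetric]
   proof (rule H_diff[OF B _ Qd])
   show "cl ep A v \<subseteq> B" using True eq by simp
   show "(e : A) = (e : A Int I)" if "e : near (cl ep A v)" for e using that nI I(2) by auto
   fix e w assume "e : near (cl ep A v)" "w : ep e"
   then have "w : V" using nI by (auto simp: V_def)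
   then show "\<bar>rr Q t (cl ep A w) - rr Q t (cl ep (A Int I) w)\<bar> <= Q * d" using gc[of w] by (intro rr_diff pwd[of id]) (auto intro: finite_cl_I[OF I(1)])
   qed
   have "\<bar>Y A - Y (A Int I)\<bar> = gam al al' (cl ep A v) * \<bar>HK A v - HK (A Int I) v\<bar>"
   unfolding Y_def eq using True gam_bounds(1)[OF a0 al(3,4), of "cl ep (A Int I) v"] by (simp add: right_diff_distrib[symmetric] abs_mult)
   also have "... <= 1 * (card (near B) * (Q * d))" using gam_bounds[OF a0 al(3,4)] hd by (intro mult_mono) auto
   finally show ?thesis using Md by simp
   qed
  next
   have "finite (\<Union>e\<in>I. ep e)" using I(1) finite_ep by blast
   then have f1: "finite (B Un V Un (\<Union>e\<in>I. ep e))" using B V by simp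
   show "\<forall>\<^sub>F n in sequentially. \<forall>A\<subseteq>F n. (\<forall>v\<in>V. \<not> bad v m I A) --> \<bar>Yn n A - Y (A Int I)\<bar> <= dl"
   using evS[OF f1] evF[OF finite_near[OF B]]
   proof eventually_elim
   case (elim n)
   let ?E = "epS (S n)"
   show ?case
   proof (intro allI impI)
   fix A assume A: "A \<subseteq> F n" "\<forall>v\<in>V. \<not> bad v m I A"
   have gc: "cl ?E A (Some w) = Some ` cl ep (A Int I) w | m < card (cl ep (A Int I) w) & Some ` cl ep (A Int I) w <= cl ?E A (Some w)"
   if "w : V" for w by (rule good_cl_model) (use A I elim that in auto)
   have vV: "v : V" by (simp add: V_def)
   have BS: "B \<subseteq> S n" using elim by auto
   let ?K = "cl ep (A Int I) v"
   show "\<bar>Yn n A - Y (A Int I)\<bar> <= dl"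
   proof (cases "?K \<subseteq> B")
   case False
   then have "\<not> cl ?E A (Some v) \<subseteq> Some ` B" using gc[OF vV] by auto
   then show ?thesis using False dl by (simp add: Y_def Yn_def)
   next
   case True
   have "card ?K <= m" using card_mono[OF B True] m(2) by linarith
   then have eq: "cl ?E A (Some v) = Some ` ?K" using gc[OF vV] by auto
   have nI: "near ?K <= near B" using True by (auto simp: near_def)
   have KS: "?K \<subseteq> S n" using True BS by auto
   have tn: "touch ?E {e : F n. eps <= J e} (Some ` ?K) = near ?K" unfolding touch_near[OF KS] using nI elim by auto
   have eE: "?E e = Some ` ep e" if "e : near ?K" for e
   proof -
   have "e : near B" using that nI by blast
   then have "ep e \<subseteq> V" by (auto simp: V_def)
   then have "ep e \<subseteq> S n" using elim by blast
   then show ?thesis unfolding epS_def by (intro image_cong) auto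
   qed
   have H2: "HM n v A = (\<Sum>e\<in>near ?K. if ep e <= ?K then p e - of_bool (e : A) else p e * (\<Sum>w\<in>ep e - ?K. rr Q t (cl ?E A (Some w))))"
   unfolding HH_def eq tn
   proof (rule sum.cong[OF refl])
   fix e assume e: "e : near ?K"
   have "?E e \<subseteq> Some ` ?K \<longleftrightarrow> ep e <= ?K" unfolding eE[OF e] by auto
   moreover have "?E e - Some ` ?K = Some ` (ep e - ?K)" unfolding eE[OF e] by auto
   ultimately show "(if ?E e \<subseteq> Some ` ?K then p e - of_bool (e : A) else p e * (\<Sum>w\<in>?E e - Some ` ?K. rr Q t (cl ?E A w))) =
   (if ep e <= ?K then p e - of_bool (e : A) else p e * (\<Sum>w\<in>ep e - ?K. rr Q t (cl ?E A (Some w))))" by (simp add: sum.reindex)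
   qed
   have hd: "\<bar>HM n v A - HK (A Int I) v\<bar> <= card (near B) * (Q * d)" unfolding H2 unfolding HK_def
   proof (rule H_diff[OF B True Qd])
   show "(e : A) = (e : A Int I)" if "e : near ?K" for e using that nI I(2) by auto
   fix e w assume "e : near ?K" "w : ep e"
   then have "w : V" using nI by (auto simp: V_def)
   then show "\<bar>rr Q t (cl ?E A (Some w)) - rr Q t (cl ep (A Int I) w)\<bar> <= Q * d"
   using gc[of w] by (intro rr_diff pwd[of Some]) (auto intro: finite_cl_I[OF I(1)])
   qed
   have gi: "gam al al' (Some ` ?K) = gam al al' ?K" by (rule gam_image) simp
   have "Some ` ?K \<subseteq> Some ` B" using True by auto
   then have "Yn n A - Y (A Int I) = gam al al' ?K * HM n v A - gam al al' ?K * HK (A Int I) v" unfolding Yn_def Y_def eq gi using True BS by simp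
   then have "\<bar>Yn n A - Y (A Int I)\<bar> = gam al al' ?K * \<bar>HM n v A - HK (A Int I) v\<bar>"
   using gam_bounds(1)[OF a0 al(3,4), of ?K] by (simp only: right_diff_distrib[symmetric] abs_mult abs_of_nonneg)
   also have "... <= 1 * (card (near B) * (Q * d))" using gam_bounds[OF a0 al(3,4), of ?K] hd by (intro mult_mono) auto
   finally show ?thesis using Md by simp
   qed
   qed
   qed
  qed
  then show "\<exists>B m I1. finite B & finite I1 & (\<forall>I. finite I --> I1 \<subseteq> I --> loc_approx Yn Y dl B m I)"
   using V finite_near[OF B] by (intro exI[of _ V] exI[of _ m] exI[of _ "near B"]) auto
 qed
 have "finite (insert v B)" using B by simp
 from evS[OF this] have "\<forall>\<^sub>F n in sequentially. En n (Yn n) <= 2 * sqrt (deg / N)"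
 proof eventually_elim
  case (elim n)
  then have BS: "B \<subseteq> S n" "v : S n" by auto
  show ?case using model_fluctuation[OF al BS] BS unfolding Yn_def[abs_def] by simp
 qed
 then have "(\<integral>om. Y (Collect om) \<partial>nu) <= 2 * sqrt (deg / N)" by (rule tendsto_upperbound[OF l]) simp
 then show ?thesis unfolding Y_def .
qed

lemma meas_HK:
 assumes al: "0 <= al'" "al' <= al" "al < 1"
 shows "(%om. gam al al' (Kl om v) * HK (Collect om) v) : borel_measurable nu"
  and lim_HK: "(%k. of_bool (Kl om v <= BV k) * (gam al al' (Kl om v) * HK (Collect om) v)) \<longlonglongrightarrow> gam al al' (Kl om v) * HK (Collect om) v"
proof -
 show l: "(%k. of_bool (Kl om v <= BV k) * (gam al al' (Kl om v) * HK (Collect om) v)) \<longlonglongrightarrow> gam al al' (Kl om v) * HK (Collect om) v" for om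
 proof (cases "finite (Kl om v)")
  case True
  show ?thesis by (rule tendsto_eventually) (use BV_fin[OF True] in eventually_elim, simp)
 qed (simp add: gam_infinite)
 show "(%om. gam al al' (Kl om v) * HK (Collect om) v) : borel_measurable nu" by (rule borel_measurable_LIMSEQ_real[OF l meas_HKB[OF al finite_BV]])
qed

theorem fluctuation_bound:
 assumes al: "al' = 1 - 1 / real N" "1 <= N" "al' <= al" "al < 1"
 shows "(\<integral>om. gam al al' (Kl om v) * HK (Collect om) v \<partial>nu) <= 2 * sqrt (deg / N)"
proof -
 have a0: "0 <= al'" using al(1,2) by simp
 have "(%k. \<integral>om. of_bool (Kl om v <= BV k) * (gam al al' (Kl om v) * HK (Collect om) v) \<partial>nu) \<longlonglongrightarrow>
  (\<integral>om. gam al al' (Kl om v) * HK (Collect om) v \<partial>nu)"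
 proof (rule integral_dominated_convergence[where w = "%_. deg"])
  show "AE om in nu. norm (of_bool (Kl om v <= BV k) * (gam al al' (Kl om v) * HK (Collect om) v)) <= deg" for k
   using gam_HK_bound[OF a0 al(3,4)] deg_pos by (simp add: of_bool_def)
 qed (use lim_HK[OF a0 al(3,4)] meas_HK[OF a0 al(3,4)] meas_HKB[OF a0 al(3,4) finite_BV] in auto)
 then show ?thesis by (rule LIMSEQ_le_const2) (use fluctuation_in[OF al finite_BV] in auto)
qed

end

section \<open>Mass transport between clusters and edges\<close>

lemma
 fixes f :: "'a => 'b => ennreal"
 assumes a: "countable (UNIV :: 'a set)" and M: "sigma_finite_measure M" and f: "!!a. f a : borel_measurable M"
 shows nn_swap: "(\<integral>\<^sup>+ a. (\<integral>\<^sup>+ om. f a om \<partial>M) \<partial>count_space UNIV) = (\<integral>\<^sup>+ om. (\<integral>\<^sup>+ a. f a om \<partial>count_space UNIV) \<partial>M)"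
  and nn_meas: "(%om. \<integral>\<^sup>+ a. f a om \<partial>count_space UNIV) : borel_measurable M"
proof -
 interpret c: sigma_finite_measure "count_space (UNIV :: 'a set)" by (rule sigma_finite_measure_count_space_countable[OF a])
 interpret M: sigma_finite_measure M by (rule M)
 interpret pair_sigma_finite M "count_space (UNIV :: 'a set)" ..
 have "(%(a, om). f a om) : borel_measurable (count_space UNIV \<Otimes>\<^sub>M M)" by (rule measurable_pair_measure_countable1[OF a]) (use f in simp)
 from measurable_pair_swap[OF this]
 have m: "(%(om, a). f a om) : borel_measurable (M \<Otimes>\<^sub>M count_space UNIV)" by simp
 show "(\<integral>\<^sup>+ a. (\<integral>\<^sup>+ om. f a om \<partial>M) \<partial>count_space UNIV) = (\<integral>\<^sup>+ om. (\<integral>\<^sup>+ a. f a om \<partial>count_space UNIV) \<partial>M)"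
  by (rule Fubini'[OF m])
 show "(%om. \<integral>\<^sup>+ a. f a om \<partial>count_space UNIV) : borel_measurable M" by (rule c.borel_measurable_nn_integral[OF m])
qed

locale fk_uni = fk_limit ep J eps c Q t bt nu S F + ugraph ep J
 for ep :: "'e => 'v set" and J eps c Q t bt nu S F
begin

lemma cl_aut: "g : Aut ep J ==> cl ep (snd g ` A) (fst g v) = fst g ` cl ep A v" by (rule cl_image_inj[OF edgy_ep]) (auto simp: aut_iff bij_def)

lemma nn_inv:
 assumes g: "g : Aut ep J" and f: "(%om. f (Collect om)) : borel_measurable nu"
 shows "(\<integral>\<^sup>+ om. f (snd g ` Collect om) \<partial>nu) = (\<integral>\<^sup>+ om. f (Collect om) \<partial>nu)"
proof -
 let ?g = "(inv (fst g), inv (snd g))"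
 have g': "?g : Aut ep J" by (rule aut_inv[OF g])
 have "(\<integral>\<^sup>+ om. f (Collect om) \<partial>nu) = (\<integral>\<^sup>+ om. f (Collect om) \<partial>(distr nu nu (%om. om \<circ> snd ?g)))"
  unfolding distr_inv[OF g'] ..
 also have "... = (\<integral>\<^sup>+ om. f (Collect (om \<circ> snd ?g)) \<partial>nu)" by (rule nn_integral_distr[OF meas_shift[of "snd ?g"]]) (use f in simp)
 finally show ?thesis using Collect_shift[OF g] by simp
qed

lemma sf_nu: "sigma_finite_measure nu" by unfold_locales

text \<open>Each vertex \<open>v\<close> sends the mass \<open>G v e\<close> to both endpoints of
  every strong edge \<open>e\<close>, whence the factor 2. The mass received by \<open>r\<close> is
  what all vertices send through the strong edges at \<open>r\<close>.\<close>

lemma edge_transport: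
 fixes G :: "'v => 'e => 'e set => ennreal"
 assumes m: "!!v e. (%om. G v e (Collect om)) : borel_measurable nu"
  and inv: "!!g v e A. g : Aut ep J ==> G (fst g v) (snd g e) (snd g ` A) = G v e A"
 shows "(\<integral>\<^sup>+ om. 2 * (\<integral>\<^sup>+ e. indicator {e. eps <= J e} e * G r e (Collect om) \<partial>count_space UNIV) \<partial>nu) =
  (\<Sum>e\<in>St r. \<integral>\<^sup>+ om. (\<integral>\<^sup>+ v. G v e (Collect om) \<partial>count_space UNIV) \<partial>nu)"
proof -
 define I where "I v e = (\<integral>\<^sup>+ om. G v e (Collect om) \<partial>nu)" for v e
 have Iinv: "I (fst g v) (snd g e) = I v e" if g: "g : Aut ep J" for g v e unfolding I_def using nn_inv[OF g m, of "fst g v" "snd g e"] inv[OF g] by simp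
 let ?f = "%v y. \<integral>\<^sup>+ e. indicator (St y) e * I v e \<partial>count_space UNIV"
 have sfV: "sigma_finite_measure (count_space (UNIV :: 'v set))" and sfE: "sigma_finite_measure (count_space (UNIV :: 'e set))"
  using sigma_finite_measure_count_space_countable countable_V countable_E by blast+
 have "?f (fst g v) (fst g y) = ?f v y" if g: "g : Aut ep J" for g v y
 proof -
  have b: "bij_betw (snd g) UNIV UNIV" using g by (simp add: aut_iff)
  have "?f (fst g v) (fst g y) = (\<integral>\<^sup>+ e. indicator (St (fst g y)) (snd g e) * I (fst g v) (snd g e) \<partial>count_space UNIV)"
   by (rule nn_integral_bij_count_space[OF b, symmetric])
  also have "... = ?f v y"
  proof (rule nn_integral_cong)
   fix e
   have "snd g e : St (fst g y) \<longleftrightarrow> e : St y" unfolding card_St_aut[OF g] using b by (simp add: inj_image_mem_iff bij_is_inj)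
   then show "indicator (St (fst g y)) (snd g e) * I (fst g v) (snd g e) = indicator (St y) e * I v e" by (simp add: Iinv[OF g] indicator_def)
  qed
  finally show ?thesis .
 qed
 then have mt: "(\<integral>\<^sup>+ y. ?f r y \<partial>count_space UNIV) = (\<integral>\<^sup>+ y. ?f y r \<partial>count_space UNIV)" by (rule mass_transport)
 have "(\<integral>\<^sup>+ y. ?f r y \<partial>count_space UNIV) = (\<integral>\<^sup>+ e. (\<integral>\<^sup>+ y. indicator (St y) e * I r e \<partial>count_space UNIV) \<partial>count_space UNIV)"
  by (rule nn_swap[OF countable_V sfE]) simp
 also have "... = (\<integral>\<^sup>+ e. 2 * (indicator {e. eps <= J e} e * I r e) \<partial>count_space UNIV)"
 proof (rule nn_integral_cong)
  fix e
  have "(\<integral>\<^sup>+ y. indicator (St y) e * I r e \<partial>count_space UNIV) = (\<Sum>y\<in>ep e. indicator (St y) e * I r e)"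
   by (rule nn_integral_count_space') (use finite_ep in \<open>auto simp: St_def\<close>)
  also have "... = (\<Sum>y\<in>ep e. indicator {e. eps <= J e} e * I r e)" by (rule sum.cong) (auto simp: St_def indicator_def)
  also have "... = 2 * (indicator {e. eps <= J e} e * I r e)" by (simp add: card_ep)
  finally show "(\<integral>\<^sup>+ y. indicator (St y) e * I r e \<partial>count_space UNIV) = 2 * (indicator {e. eps <= J e} e * I r e)" .
 qed
 also have "... = (\<integral>\<^sup>+ e. (\<integral>\<^sup>+ om. 2 * (indicator {e. eps <= J e} e * G r e (Collect om)) \<partial>nu) \<partial>count_space UNIV)"
  unfolding I_def using m by (simp add: nn_integral_cmult)
 also have "... = (\<integral>\<^sup>+ om. (\<integral>\<^sup>+ e. 2 * (indicator {e. eps <= J e} e * G r e (Collect om)) \<partial>count_space UNIV) \<partial>nu)"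
  by (rule nn_swap[OF countable_E sf_nu]) (use m in measurable)
 also have "... = (\<integral>\<^sup>+ om. 2 * (\<integral>\<^sup>+ e. indicator {e. eps <= J e} e * G r e (Collect om) \<partial>count_space UNIV) \<partial>nu)"
  by (simp add: nn_integral_cmult)
 finally have L: "(\<integral>\<^sup>+ y. ?f r y \<partial>count_space UNIV) = ..." .
 have "(\<integral>\<^sup>+ y. ?f y r \<partial>count_space UNIV) = (\<integral>\<^sup>+ e. (\<integral>\<^sup>+ y. indicator (St r) e * I y e \<partial>count_space UNIV) \<partial>count_space UNIV)"
  by (rule nn_swap[OF countable_V sfE]) simp
 also have "... = (\<Sum>e\<in>St r. \<integral>\<^sup>+ y. indicator (St r) e * I y e \<partial>count_space UNIV)"
  by (rule nn_integral_count_space') (use finite_St in auto)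
 also have "... = (\<Sum>e\<in>St r. \<integral>\<^sup>+ y. I y e \<partial>count_space UNIV)" by (rule sum.cong) auto
 also have "... = (\<Sum>e\<in>St r. \<integral>\<^sup>+ om. (\<integral>\<^sup>+ v. G v e (Collect om) \<partial>count_space UNIV) \<partial>nu)"
  unfolding I_def by (rule sum.cong[OF refl]) (rule nn_swap[OF countable_V sf_nu m])
 finally show ?thesis using mt L by simp
qed

text \<open>The total mass sent through \<open>e\<close> by the vertices whose cluster touches it:
  those of one cluster if the endpoints are joined, those of two otherwise.\<close>

definition zed :: "real => real => ('e => 'e set => 'v => real) => 'e => 'e set => real" where
 "zed al al' ta e A = (let K = cl ep A (src e); L = cl ep A (tgt e) in
  if tgt e : K then card K * gam al al' K * ta e A (src e)
  else card K * gam al al' K * ta e A (src e) + card L * gam al al' L * ta e A (tgt e))"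

lemma nn_const:
 "0 <= y ==> 0 <= gam al al' K ==> (\<integral>\<^sup>+ v. indicator K v * ennreal (gam al al' K * y) \<partial>count_space UNIV) = ennreal (card K * gam al al' K * y)"
proof (cases "finite K")
 case True
 assume "0 <= y" "0 <= gam al al' K"
 have "(\<integral>\<^sup>+ v. indicator K v * ennreal (gam al al' K * y) \<partial>count_space UNIV) = (\<Sum>v\<in>K. indicator K v * ennreal (gam al al' K * y))"
  by (rule nn_integral_count_space') (use True in auto)
 also have "... = of_nat (card K) * ennreal (gam al al' K * y)" by simp
 also have "... = ennreal (card K * (gam al al' K * y))" by (simp add: ennreal_mult' ennreal_of_nat_eq_real_of_nat)
 finally show ?thesis by (simp add: mult.assoc)
qed (simp add: gam_infinite)

lemma edge_transport_real:
 fixes ta :: "'e => 'e set => 'v => real"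
 assumes al: "0 <= al'" "al' <= al" "al < 1"
  and b: "!!e A v. 0 <= ta e A v & ta e A v <= 2"
  and m: "!!v e. (%om. ta e (Collect om) v) : borel_measurable nu"
  and inv: "!!g v e A. g : Aut ep J ==> ta (snd g e) (snd g ` A) (fst g v) = ta e A v"
  and dep: "!!e A v w. w : cl ep A v ==> ta e A w = ta e A v"
 shows "2 * (\<integral>om. gam al al' (Kl om r) * (\<Sum>e\<in>near (Kl om r). ta e (Collect om) r) \<partial>nu) = (\<Sum>e\<in>St r. \<integral>om. zed al al' ta e (Collect om) \<partial>nu)"
  and "integrable nu (%om. gam al al' (Kl om r) * (\<Sum>e\<in>near (Kl om r). ta e (Collect om) r))"
  and "!!e. integrable nu (%om. zed al al' ta e (Collect om))"
proof -
 define G where "G v e A = ennreal (if ep e Int cl ep A v ~= {} then gam al al' (cl ep A v) * ta e A v else 0)" for v e A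
 note g0 = gam_bounds[OF al]
 have b0: "0 <= ta e A v" "ta e A v <= 2" for e A v using b by auto
 have mG: "(%om. G v e (Collect om)) : borel_measurable nu" for v e
 proof -
  note [measurable] = pred_ep(2)[of e v] meas_gam[OF al, of v] m[of e v]
  show ?thesis unfolding G_def by measurable
 qed
 have iG: "G (fst g v) (snd g e) (snd g ` A) = G v e A" if g: "g : Aut ep J" for g v e A
 proof -
  have i: "inj (fst g)" "ep (snd g e) = fst g ` ep e" using g by (auto simp: aut_iff bij_def)
  have "fst g ` ep e Int fst g ` cl ep A v = fst g ` (ep e Int cl ep A v)" using i(1) by (simp add: image_Int)
  then show ?thesis unfolding G_def cl_aut[OF g] i(2) inv[OF g] gam_image[OF i(1)] by simp
 qed
 let ?A = "%A. gam al al' (cl ep A r) * (\<Sum>e\<in>near (cl ep A r). ta e A r)"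
 let ?a = "%A. \<integral>\<^sup>+ e. indicator {e. eps <= J e} e * G r e A \<partial>count_space UNIV"
 have A0: "0 <= ?A A" for A using g0 b0 by (auto intro!: mult_nonneg_nonneg sum_nonneg)
 have A1: "?A A <= 2 * deg" for A
 proof (cases "finite (cl ep A r)")
  case True
  have "\<bar>gam al al' (cl ep A r) * (\<Sum>e\<in>near (cl ep A r). ta e A r / 2)\<bar> <= deg" by (rule gam_H_bound[OF al card_near[OF True]]) (use b0 in simp)
  then show ?thesis by (simp add: sum_divide_distrib[symmetric])
 qed (use deg_pos in \<open>simp add: gam_infinite\<close>)
 have pA: "?a A = ennreal (?A A)" for A
 proof (cases "finite (cl ep A r)")
  case True
  have "?a A = (\<Sum>e\<in>near (cl ep A r). indicator {e. eps <= J e} e * G r e A)"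
   by (rule nn_integral_count_space') (use finite_near[OF True] in \<open>auto simp: near_def G_def\<close>)
  also have "... = (\<Sum>e\<in>near (cl ep A r). ennreal (gam al al' (cl ep A r) * ta e A r))" by (rule sum.cong) (auto simp: near_def G_def)
  also have "... = ennreal (\<Sum>e\<in>near (cl ep A r). gam al al' (cl ep A r) * ta e A r)" by (rule sum_ennreal) (rule mult_nonneg_nonneg[OF g0(1) b0(1)])
  finally show ?thesis by (simp add: sum_distrib_left)
 next
  case False
  have "G r e A = 0" for e by (cases "ep e Int cl ep A r = {}") (simp_all add: G_def gam_infinite[OF False])
  then show ?thesis by (simp add: gam_infinite[OF False])
 qed
 have pZ: "(\<integral>\<^sup>+ v. G v e A \<partial>count_space UNIV) = ennreal (zed al al' ta e A)" for e A
 proof -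
  let ?K = "cl ep A (src e)" and ?L = "cl ep A (tgt e)"
  have touch: "ep e Int cl ep A v ~= {} \<longleftrightarrow> v : ?K | v : ?L" for v
   using src_tgt(1)[of e] cl_sym[of v ep A "src e"] cl_sym[of v ep A "tgt e"] cl_sym[of "src e" ep A v] cl_sym[of "tgt e" ep A v] by auto
  show ?thesis
  proof (cases "tgt e : ?K")
   case True
   then have LK: "?L = ?K" by (rule cl_eq)
   have "G v e A = indicator ?K v * ennreal (gam al al' ?K * ta e A (src e))" for v
   unfolding G_def touch LK using dep[of v A "src e"] cl_eq[of v ep A "src e"] by (auto simp: indicator_def)
   then show ?thesis using True nn_const[OF b0(1) g0(1)] by (simp add: zed_def Let_def)
  next
   case False
   have dj: "?K Int ?L = {}" using False cl_disjoint[of ep A "src e" "tgt e"] cl_eq_iff[of ep A "src e" "tgt e"] by auto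
   have "G v e A = indicator ?K v * ennreal (gam al al' ?K * ta e A (src e)) + indicator ?L v * ennreal (gam al al' ?L * ta e A (tgt e))" for v
   unfolding G_def touch using dj dep[of v A "src e" e] cl_eq[of v ep A "src e"] dep[of v A "tgt e" e] cl_eq[of v ep A "tgt e"] by (auto simp: indicator_def)
   then have "(\<integral>\<^sup>+ v. G v e A \<partial>count_space UNIV) = (\<integral>\<^sup>+ v. indicator ?K v * ennreal (gam al al' ?K * ta e A (src e)) + indicator ?L v * ennreal (gam al al' ?L * ta e A (tgt e)) \<partial>count_space UNIV)"
   by (simp only:)
   also have "... = (\<integral>\<^sup>+ v. indicator ?K v * ennreal (gam al al' ?K * ta e A (src e)) \<partial>count_space UNIV) + (\<integral>\<^sup>+ v. indicator ?L v * ennreal (gam al al' ?L * ta e A (tgt e)) \<partial>count_space UNIV)"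
   by (rule nn_integral_add) auto
   also have "... = ennreal (card ?K * gam al al' ?K * ta e A (src e)) + ennreal (card ?L * gam al al' ?L * ta e A (tgt e))" by (simp only: nn_const[OF b0(1) g0(1)])
   finally have eq: "(\<integral>\<^sup>+ v. G v e A \<partial>count_space UNIV) = ennreal (card ?K * gam al al' ?K * ta e A (src e)) + ennreal (card ?L * gam al al' ?L * ta e A (tgt e))" .
   have n: "0 <= card ?K * gam al al' ?K * ta e A (src e)" "0 <= card ?L * gam al al' ?L * ta e A (tgt e)" by (intro mult_nonneg_nonneg of_nat_0_le_iff g0(1) b0(1))+
   show ?thesis unfolding eq ennreal_plus[OF n, symmetric] using False by (simp add: zed_def Let_def)
  qed
 qed
 have Z0: "0 <= zed al al' ta e A" for e A unfolding zed_def Let_def by (auto intro!: add_nonneg_nonneg mult_nonneg_nonneg g0(1) b0(1))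
 have Z1: "zed al al' ta e A <= 4" for e A
 proof -
  have "card K * gam al al' K * ta e A v <= 1 * 2" for K :: "'v set" and v using g0[of K] b0[of e A v] by (intro mult_mono) (auto simp: mult.commute)
  then have z: "card K * gam al al' K * ta e A v <= 2" for K :: "'v set" and v by simp
  show ?thesis using z[of "cl ep A (src e)" "src e"] z[of "cl ep A (tgt e)" "tgt e"] by (simp add: zed_def Let_def)
 qed
 have mA: "(%om. ?A (Collect om)) : borel_measurable nu"
 proof -
  have "(%om. ?a (Collect om)) : borel_measurable nu" by (rule nn_meas[OF countable_E sf_nu]) (use mG in measurable)
  then have "(%om. enn2real (?a (Collect om))) : borel_measurable nu" by measurable
  then show ?thesis by (simp only: pA enn2real_ennreal[OF A0])
 qed
 have mZ: "(%om. zed al al' ta e (Collect om)) : borel_measurable nu" for e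
 proof -
  have "(%om. \<integral>\<^sup>+ v. G v e (Collect om) \<partial>count_space UNIV) : borel_measurable nu" by (rule nn_meas[OF countable_V sf_nu mG])
  then have "(%om. enn2real (\<integral>\<^sup>+ v. G v e (Collect om) \<partial>count_space UNIV)) : borel_measurable nu" by measurable
  then show ?thesis unfolding pZ using Z0 by simp
 qed
 show intA: "integrable nu (%om. ?A (Collect om))"
 proof (rule nu.integrable_const_bound[where B = "2 * deg"])
  show "AE om in nu. norm (?A (Collect om)) <= 2 * deg" by (rule AE_I2) (simp only: real_norm_def abs_of_nonneg[OF A0] A1)
 qed (rule mA)
 show intZ: "integrable nu (%om. zed al al' ta e (Collect om))" for e by (rule nu.integrable_const_bound[where B = 4]) (use Z0 Z1 mZ in auto)
 have "(\<integral>\<^sup>+ om. 2 * ennreal (?A (Collect om)) \<partial>nu) = (\<Sum>e\<in>St r. \<integral>\<^sup>+ om. ennreal (zed al al' ta e (Collect om)) \<partial>nu)"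
  using edge_transport[OF mG iG, of r] unfolding pA pZ .
 moreover have "(\<integral>\<^sup>+ om. 2 * ennreal (?A (Collect om)) \<partial>nu) = ennreal (2 * (\<integral>om. ?A (Collect om) \<partial>nu))"
 proof -
  have "(\<integral>\<^sup>+ om. 2 * ennreal (?A (Collect om)) \<partial>nu) = 2 * (\<integral>\<^sup>+ om. ennreal (?A (Collect om)) \<partial>nu)"
   by (rule nn_integral_cmult) (rule measurable_compose[OF mA measurable_ennreal])
  also have "(\<integral>\<^sup>+ om. ennreal (?A (Collect om)) \<partial>nu) = ennreal (\<integral>om. ?A (Collect om) \<partial>nu)"
   by (rule nn_integral_eq_integral[OF intA]) (use A0 in simp)
  finally show ?thesis using A0 by (simp add: ennreal_mult')
 qed
 moreover have "(\<Sum>e\<in>St r. \<integral>\<^sup>+ om. ennreal (zed al al' ta e (Collect om)) \<partial>nu) = ennreal (\<Sum>e\<in>St r. \<integral>om. zed al al' ta e (Collect om) \<partial>nu)"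
 proof -
  have "(\<integral>\<^sup>+ om. ennreal (zed al al' ta e (Collect om)) \<partial>nu) = ennreal (\<integral>om. zed al al' ta e (Collect om) \<partial>nu)" for e
   by (rule nn_integral_eq_integral[OF intZ]) (use Z0 in simp)
  then show ?thesis using Z0 by (simp add: sum_ennreal integral_nonneg_AE)
 qed
 ultimately have "ennreal (2 * (\<integral>om. ?A (Collect om) \<partial>nu)) = ennreal (\<Sum>e\<in>St r. \<integral>om. zed al al' ta e (Collect om) \<partial>nu)" by simp
 moreover have "0 <= 2 * (\<integral>om. ?A (Collect om) \<partial>nu)" using A0 by (simp add: integral_nonneg_AE)
 moreover have "0 <= (\<Sum>e\<in>St r. \<integral>om. zed al al' ta e (Collect om) \<partial>nu)" using Z0 by (intro sum_nonneg integral_nonneg_AE) auto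
 ultimately show "2 * (\<integral>om. ?A (Collect om) \<partial>nu) = (\<Sum>e\<in>St r. \<integral>om. zed al al' ta e (Collect om) \<partial>nu)"
  by (simp only: ennreal_inj)
qed

text \<open>The summand of \<open>HK\<close> has no fixed sign, while mass transport needs
  nonnegative masses, so it is written as the difference of \<open>tp\<close> and
  \<open>tm\<close>.\<close>

definition tp :: "'e => 'e set => 'v => real" where
 "tp e A v = (if ep e <= cl ep A v then p e else p e * (\<Sum>w\<in>ep e - cl ep A v. rr Q t (cl ep A w)))"
definition tm :: "'e => 'e set => 'v => real" where
 "tm e A v = (if ep e <= cl ep A v then of_bool (e : A) else 0)"

lemma HK_split: "HK A v = (\<Sum>e\<in>near (cl ep A v). tp e A v) - (\<Sum>e\<in>near (cl ep A v). tm e A v)"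
 unfolding HK_def sum_subtractf[symmetric] by (rule sum.cong) (auto simp: tp_def tm_def)

lemma p_aut: "g : Aut ep J ==> p (snd g e) = p e" by (simp add: p_def x_def aut_iff)

lemma cl_ne: "cl en A a ~= {}" using cl_refl[of a en A] by (metis empty_iff)

lemma Zf_split:
 assumes al: "al' <= al" "al < 1"
 shows "Zf ep Q t (p e) al al' e (src e) (tgt e) A = zed al al' tp e A - zed al al' tm e A"
proof -
 let ?K = "cl ep A (src e)" and ?L = "cl ep A (tgt e)"
 have kg: "card ?K * gam al al' ?K = rr Q t ?K * gg al al' ?K" "card ?L * gam al al' ?L = rr Q t ?L * gg al al' ?L" by (rule gam_card[OF al(2,1) cl_ne])+
 have e: "ep e = {src e, tgt e}" "src e ~= tgt e" by (rule src_tgt)+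
 show ?thesis
 proof (cases "tgt e : ?K")
  case True
  then have "ep e <= ?K" using e by auto
  then show ?thesis using True unfolding zed_def Zf_def Let_def kg tp_def tm_def by (simp add: algebra_simps)
 next
  case False
  then have f: "src e ~: ?L" using cl_sym by metis
  have 1: "\<not> ep e <= ?K" "ep e - ?K = {tgt e}" using e False by auto
  have 2: "\<not> ep e \<subseteq> ?L" "ep e - ?L = {src e}" using e f by auto
  show ?thesis using False 1(1) 2(1) unfolding zed_def Zf_def Let_def kg tp_def tm_def 1(2) 2(2) by (simp add: algebra_simps)
 qed
qed

lemma rr_image: "inj f ==> rr Q t (f ` K) = rr Q t K"
proof -
 assume "inj f"
 then have f: "inj_on f K" by (rule inj_on_subset) simp
 show ?thesis by (simp add: rr_def pw_def card_image[OF f] finite_image_iff[OF f])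
qed

text \<open>What \<open>r\<close> sends out is its share of the fluctuation of its own cluster; what
  passes through an edge at \<open>r\<close> is \<open>Zf\<close>, the fluctuation that the clusters
  adjacent to this edge owe to it. Transport equates the two, with each edge counted at both
  ends.\<close>

lemma sum_Zf:
 assumes al: "0 <= al'" "al' <= al" "al < 1"
 shows "(\<Sum>e\<in>St r. \<integral>om. Zf ep Q t (p e) al al' e (src e) (tgt e) (Collect om) \<partial>nu) =
  2 * (\<integral>om. gam al al' (Kl om r) * HK (Collect om) r \<partial>nu)"
proof -
 have tpb: "0 <= tp e A v & tp e A v <= 2" for e A v
 proof -
  have s: "0 <= (\<Sum>w\<in>ep e - cl ep A v. rr Q t (cl ep A w))" "(\<Sum>w\<in>ep e - cl ep A v. rr Q t (cl ep A w)) <= 2"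
   unfolding outer_sum using rr01[of "cl ep A (src e)"] rr01[of "cl ep A (tgt e)"] by auto
  have "p e * (\<Sum>w\<in>ep e - cl ep A v. rr Q t (cl ep A w)) <= 1 * 2" by (rule mult_mono) (use s p_bounds in auto)
  then show ?thesis using s p_bounds[of e] by (auto simp: tp_def)
 qed
 have tmb: "0 <= tm e A v & tm e A v <= 2" for e A v by (simp add: tm_def)
 note [measurable] = pred_ep
 have tpm: "(%om. tp e (Collect om) v) : borel_measurable nu" for e v unfolding tp_def by measurable
 have tmm: "(%om. tm e (Collect om) v) : borel_measurable nu" for e v unfolding tm_def of_bool_def mem_Collect_eq by measurable
 have sub: "ep (snd g e) <= cl ep (snd g ` A) (fst g v) \<longleftrightarrow> ep e <= cl ep A v"
  "snd g e : snd g ` A \<longleftrightarrow> e : A"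
  "ep (snd g e) - cl ep (snd g ` A) (fst g v) = fst g ` (ep e - cl ep A v)" if g: "g : Aut ep J" for g e A v
 proof -
  have i: "inj (fst g)" "inj (snd g)" "ep (snd g e) = fst g ` ep e" using g by (auto simp: aut_iff bij_def)
  show "ep (snd g e) <= cl ep (snd g ` A) (fst g v) \<longleftrightarrow> ep e <= cl ep A v" unfolding i(3) cl_aut[OF g] by (rule inj_image_subset_iff[OF i(1)])
  show "snd g e : snd g ` A \<longleftrightarrow> e : A" by (rule inj_image_mem_iff[OF i(2)])
  show "ep (snd g e) - cl ep (snd g ` A) (fst g v) = fst g ` (ep e - cl ep A v)" unfolding i(3) cl_aut[OF g] by (rule image_set_diff[OF i(1), symmetric])
 qed
 have tpi: "tp (snd g e) (snd g ` A) (fst g v) = tp e A v" if g: "g : Aut ep J" for g e A v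
 proof -
  have i: "inj (fst g)" using g by (auto simp: aut_iff bij_def)
  have "(\<Sum>w\<in>fst g ` (ep e - cl ep A v). rr Q t (cl ep (snd g ` A) w)) = (\<Sum>w\<in>ep e - cl ep A v. rr Q t (cl ep (snd g ` A) (fst g w)))"
   by (subst sum.reindex) (use i in \<open>auto intro: inj_on_subset\<close>)
  also have "... = (\<Sum>w\<in>ep e - cl ep A v. rr Q t (cl ep A w))" unfolding cl_aut[OF g] rr_image[OF i] ..
  finally show ?thesis unfolding tp_def sub[OF g] p_aut[OF g] by simp
 qed
 have tmi: "tm (snd g e) (snd g ` A) (fst g v) = tm e A v" if g: "g : Aut ep J" for g e A v unfolding tm_def sub[OF g] ..
 have tpd: "tp e A w = tp e A v" and tmd: "tm e A w = tm e A v" if "w : cl ep A v" for e A v w using cl_eq[OF that] by (simp_all add: tp_def tm_def)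
 note P = edge_transport_real[OF al tpb tpm tpi tpd] and M = edge_transport_real[OF al tmb tmm tmi tmd]
 have "(\<Sum>e\<in>St r. \<integral>om. Zf ep Q t (p e) al al' e (src e) (tgt e) (Collect om) \<partial>nu) =
  (\<Sum>e\<in>St r. (\<integral>om. zed al al' tp e (Collect om) \<partial>nu) - (\<integral>om. zed al al' tm e (Collect om) \<partial>nu))"
  unfolding Zf_split[OF al(2,3)] by (rule sum.cong[OF refl]) (rule Bochner_Integration.integral_diff[OF P(3) M(3)])
 also have "... = 2 * (\<integral>om. gam al al' (Kl om r) * (\<Sum>e\<in>near (Kl om r). tp e (Collect om) r) \<partial>nu) -
  2 * (\<integral>om. gam al al' (Kl om r) * (\<Sum>e\<in>near (Kl om r). tm e (Collect om) r) \<partial>nu)"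
  unfolding sum_subtractf using P(1)[of r] M(1)[of r] by linarith
 also have "... = 2 * (\<integral>om. gam al al' (Kl om r) * HK (Collect om) r \<partial>nu)"
  unfolding HK_split right_diff_distrib[of "gam _ _ _"] using Bochner_Integration.integral_diff[OF P(2) M(2), of r r] by linarith
 finally show ?thesis .
qed

text \<open>Each term of the sum over edges at a vertex dominates a nonnegative multiple of the mean
  of \<open>Yf\<close>. The bound on the total fluctuation therefore bounds each of these
  means.\<close>

lemma edge_Y_bound:
 assumes al: "al' = 1 - 1 / real N" "1 <= N" "al' <= al" "al < 1" and e: "eps <= J e"
 shows "p e * (\<integral>om. Yf ep al al' (src e) (tgt e) (Collect om) \<partial>nu) <= 4 * (1 + Q)\<^sup>2 * sqrt (deg / N)"
proof -
 have a0: "0 <= al'" using al(1,2) by simp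
 have Q2: "0 < (1 + Q)\<^sup>2" using Q by simp
 have Y0: "0 <= Yf ep al al' a b A" for a b A using GG_bounds[OF a0 al(3,4), of "cl ep A a" "cl ep A b"] by (simp add: Yf_def)
 let ?y = "%e. p e / (1 + Q)\<^sup>2 * (\<integral>om. Yf ep al al' (src e) (tgt e) (Collect om) \<partial>nu)"
 have y0: "0 <= ?y e" for e using Y0 p_bounds[of e] by (intro mult_nonneg_nonneg integral_nonneg_AE) auto
 have eS: "e : St (src e)" using e src_tgt(1)[of e] by (auto simp: St_def)
 have "?y e <= (\<Sum>e\<in>St (src e). ?y e)" by (rule member_le_sum[OF eS y0 finite_St])
 also have "... <= (\<Sum>f\<in>St (src e). \<integral>om. Zf ep Q t (p f) al al' f (src f) (tgt f) (Collect om) \<partial>nu)"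
  by (rule sum_mono) (rule edge_fluctuation_nu[OF src_tgt(1) a0 al(3,4)])
 also have "... <= 2 * (2 * sqrt (deg / N))" unfolding sum_Zf[OF a0 al(3,4)] using fluctuation_bound[OF al, of "src e"] by simp
 finally have "(1 + Q)\<^sup>2 * ?y e <= (1 + Q)\<^sup>2 * (2 * (2 * sqrt (deg / N)))" using Q2 by (simp only: mult_le_cancel_left_pos)
 then show ?thesis using Q2 by simp
qed

section \<open>Separated large clusters at the ends of a strong edge\<close>

definition big :: "nat => 'v set => bool" where "big N K \<longleftrightarrow> (finite K --> N <= card K)"

text \<open>Infinite clusters count as large, but one of the two clusters must be finite: on a
  nonamenable graph several infinite clusters may coexist.\<close>

definition Sev :: "nat => 'v => 'v => ('e => bool) set" where
 "Sev N a b = {om. b ~: Kl om a & big N (Kl om a) & big N (Kl om b) & (finite (Kl om a) | finite (Kl om b))}"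

lemma pred_big [measurable]: "Measurable.pred nu (%om. big N (Kl om v))"
proof -
 have "big N (Kl om v) \<longleftrightarrow> \<not> finite (Kl om v) | real N <= real (card (Kl om v))" for om by (auto simp: big_def)
 moreover have "Measurable.pred nu (%om. \<not> finite (Kl om v) | real N <= real (card (Kl om v)))" by measurable
 ultimately show ?thesis by simp
qed

lemma sets_Sev [measurable]: "Sev N a b : sets nu"
proof -
 have "Measurable.pred nu (%om. b ~: Kl om a & big N (Kl om a) & big N (Kl om b) & (finite (Kl om a) | finite (Kl om b)))" by measurable
 then show ?thesis unfolding Sev_def by (simp add: pred_def)
qed

lemma Sev_sym: "Sev N a b = Sev N b a"
proof -
 have "b : cl ep A a \<longleftrightarrow> a : cl ep A b" for A using cl_sym[of b ep A a] cl_sym[of a ep A b] by blast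
 then show ?thesis unfolding Sev_def by auto
qed

lemma pw_big:
 assumes "1 <= N" "big N K" shows "pw (1 - 1 / real N) K <= 1 / 2"
proof (cases "finite K")
 case True
 let ?a = "1 - 1 / real N"
 have a: "0 <= ?a" "?a <= 1" using assms(1) by auto
 have "?a ^ card K <= ?a ^ N" using assms(2) True a by (intro power_decreasing) (auto simp: big_def)
 also have "... <= exp (- (1 / real N)) ^ N" by (rule power_mono[OF _ a(1)]) (use exp_ge_add_one_self[of "- (1 / real N)"] in simp)
 also have "... = exp (- 1)" using assms(1) by (simp add: exp_of_nat_mult[symmetric])
 also have "exp (- 1) <= (1 / 2 :: real)" using exp_ge_add_one_self[of 1] by (simp add: exp_minus field_simps)
 finally show ?thesis using True by (simp add: pw_def)
qed (use assms in \<open>auto simp: pw_def\<close>)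

text \<open>Let \<open>al\<close> tend to 1 along \<open>a j\<close>. On this event one cluster is
  finite, so the second product in \<open>GG\<close> tends to 0, while the first is at least
  \<open>1/2 * 1/2\<close>. The constant 16 is 4 times the 4 of \<open>edge_Y_bound\<close>.\<close>

theorem Sev_edge:
 assumes N: "1 <= N" and e: "eps <= J e"
 shows "p e * measure nu (Sev N (src e) (tgt e)) <= 16 * (1 + Q)\<^sup>2 * sqrt (deg / N)"
proof -
 let ?x = "src e" and ?y = "tgt e" and ?b = "1 - 1 / real N"
 define a where "a j = 1 - 1 / (real N * real (Suc j))" for j
 have a: "?b <= a j" "a j < 1" "0 <= a j" for j
 proof -
  have "1 / (real N * real (Suc j)) <= 1 / real N" using N by (intro divide_left_mono) auto
  then show "?b <= a j" by (simp add: a_def)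
  moreover have "0 <= ?b" using N by simp
  ultimately show "0 <= a j" by linarith
  show "a j < 1" using N by (simp add: a_def)
 qed
 have b0: "0 <= ?b" "?b <= 1" using N by auto
 have a1: "a \<longlonglongrightarrow> 1"
 proof -
  have "(%j. 1 - (1 / real N) * inverse (real (Suc j))) \<longlonglongrightarrow> 1 - (1 / real N) * 0" by (intro tendsto_intros LIMSEQ_inverse_real_of_nat)
  moreover have "a = (%j. 1 - (1 / real N) * inverse (real (Suc j)))" by (simp add: fun_eq_iff a_def field_simps)
  ultimately show ?thesis by simp
 qed
 define R where "R j om = indicator (Sev N ?x ?y) om * ((1 - pw (a j) (Kl om ?x)) * (1 - pw (a j) (Kl om ?y)))" for j om
 have pwa: "0 <= 1 - pw (a j) K" "1 - pw (a j) K <= 1" for j and K :: "'v set" using pw_bounds[of "a j" K] a[of j] by auto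
 have R01: "0 <= R j om" "R j om <= 1" for j om unfolding R_def using pwa by (auto simp: indicator_def intro: mult_le_one)
 have mR: "R j : borel_measurable nu" for j
 proof -
  have [measurable]: "(%om. pw (a j) (Kl om v)) : borel_measurable nu" for v using a[of j] by (intro meas_pw) auto
  show ?thesis unfolding R_def by measurable
 qed
 have Rle: "R j om <= 1 - pw (a j) (Kl om ?x)" "R j om <= 1 - pw (a j) (Kl om ?y)" for j om using mult_left_mono[OF pwa(2)[of j "Kl om ?y"] pwa(1)[of j "Kl om ?x"]]
   mult_right_mono[OF pwa(2)[of j "Kl om ?x"] pwa(1)[of j "Kl om ?y"]]
   pwa(1)[of j "Kl om ?x"] pwa(1)[of j "Kl om ?y"] by (auto simp: R_def indicator_def)
 have Rlim: "(%j. R j om) \<longlonglongrightarrow> 0" for om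
 proof (cases "om : Sev N ?x ?y")
  case True
  have one: "(%j. 1 - pw (a j) K) \<longlonglongrightarrow> 0" if "finite K" for K :: "'v set"
  proof -
   have "(%j. 1 - a j ^ card K) \<longlonglongrightarrow> 1 - 1 ^ card K" by (intro tendsto_intros a1)
   then show ?thesis using that by (simp add: pw_def)
  qed
  have "finite (Kl om ?x) | finite (Kl om ?y)" using True by (simp add: Sev_def)
  then show ?thesis
  proof
   assume "finite (Kl om ?x)"
   from one[OF this] show ?thesis by (rule tendsto_sandwich[OF always_eventually always_eventually tendsto_const, rotated 2])
   (use R01 Rle in blast)+
  next
   assume "finite (Kl om ?y)"
   from one[OF this] show ?thesis by (rule tendsto_sandwich[OF always_eventually always_eventually tendsto_const, rotated 2])
   (use R01 Rle in blast)+
  qed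
 qed (simp add: R_def)
 have intR: "(%j. \<integral>om. R j om \<partial>nu) \<longlonglongrightarrow> (\<integral>om. 0 \<partial>nu)"
  by (rule integral_dominated_convergence[where w = "%_. 1"]) (use mR Rlim R01 in auto)
 have le: "p e * (measure nu (Sev N ?x ?y) / 4 - (\<integral>om. R j om \<partial>nu)) <= 4 * (1 + Q)\<^sup>2 * sqrt (deg / N)" for j
 proof -
  have "(\<integral>om. indicator (Sev N ?x ?y) om / 4 - R j om \<partial>nu) <= (\<integral>om. Yf ep (a j) ?b ?x ?y (Collect om) \<partial>nu)"
  proof (rule integral_mono)
   have Yb: "\<bar>Yf ep (a j) ?b ?x ?y A\<bar> <= 1" for A using GG_bounds[OF b0(1) a(1,2), of j "cl ep A ?x" "cl ep A ?y"] by (simp add: Yf_def)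
   show "integrable nu (%om. indicator (Sev N ?x ?y) om / 4 - R j om)"
   proof (rule Bochner_Integration.integrable_diff)
   show "integrable nu (%om. indicator (Sev N ?x ?y) om / (4 :: real))" by (rule nu.integrable_const_bound[where B = 1]) (auto simp: indicator_def)
   show "integrable nu (R j)" by (rule nu.integrable_const_bound[where B = 1]) (use R01 mR in auto)
   qed
   show "integrable nu (%om. Yf ep (a j) ?b ?x ?y (Collect om))" by (rule nu.integrable_const_bound[where B = 1])
   (use meas_Yf[OF b0(1) a(1,2)] Yb in \<open>auto intro!: AE_I2\<close>)
   fix om
   have "0 <= Yf ep (a j) ?b ?x ?y (Collect om)" using GG_bounds[OF b0(1) a(1,2), of j "Kl om ?x" "Kl om ?y"] by (simp add: Yf_def)
   moreover have "1 / 4 - R j om <= Yf ep (a j) ?b ?x ?y (Collect om)" if s: "om : Sev N ?x ?y"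
   proof -
   have "1 / 2 <= 1 - pw ?b (Kl om ?x)" "1 / 2 <= 1 - pw ?b (Kl om ?y)" using pw_big[OF N] s by (auto simp: Sev_def)
   then have "(1 / 2) * (1 / 2) <= (1 - pw ?b (Kl om ?x)) * (1 - pw ?b (Kl om ?y))" by (intro mult_mono) auto
   then show ?thesis using s by (simp add: Yf_def GG_def R_def Sev_def)
   qed
   ultimately show "indicator (Sev N ?x ?y) om / 4 - R j om <= Yf ep (a j) ?b ?x ?y (Collect om)" by (cases "om : Sev N ?x ?y") (auto simp: R_def)
  qed
  also have "(\<integral>om. indicator (Sev N ?x ?y) om / 4 - R j om \<partial>nu) = measure nu (Sev N ?x ?y) / 4 - (\<integral>om. R j om \<partial>nu)"
  proof -
   have "integrable nu (R j)" by (rule nu.integrable_const_bound[where B = 1]) (use R01 mR in auto)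
   then show ?thesis by (subst Bochner_Integration.integral_diff) (auto simp: nu.emeasure_eq_measure)
  qed
  finally have "p e * (measure nu (Sev N ?x ?y) / 4 - (\<integral>om. R j om \<partial>nu)) <= p e * (\<integral>om. Yf ep (a j) ?b ?x ?y (Collect om) \<partial>nu)"
   using p_bounds by (intro mult_left_mono) auto
  also have "... <= 4 * (1 + Q)\<^sup>2 * sqrt (deg / N)" by (rule edge_Y_bound[OF refl N a(1,2) e])
  finally show ?thesis .
 qed
 have "(%j. p e * (measure nu (Sev N ?x ?y) / 4 - (\<integral>om. R j om \<partial>nu))) \<longlonglongrightarrow> p e * (measure nu (Sev N ?x ?y) / 4 - 0)"
  using intR by (intro tendsto_intros) simp
 then have "p e * (measure nu (Sev N ?x ?y) / 4 - 0) <= 4 * (1 + Q)\<^sup>2 * sqrt (deg / N)" by (rule LIMSEQ_le_const2) (use le in auto)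
 then show ?thesis by simp
qed

end

section \<open>From adjacent clusters to the tail of one cluster\<close>

text \<open>Take the first \<open>k\<close> with \<open>r ^ (2 * k) <= p / 2\<close>. The first term
  on the right of the hypothesis is then absorbed, leaving half of \<open>p\<close> squared below
  \<open>s * B ^ (2 * k)\<close>. By minimality the previous power of \<open>r\<close> exceeds
  \<open>p / 2\<close>, and \<open>a\<close> is the exponent that converts powers of
  \<open>r\<close> into powers of \<open>B\<close>.\<close>

lemma power_tail_bound:
 fixes p r s B :: real
 assumes p: "0 <= p" "p <= 1" and r: "0 < r" "r < 1" and B: "1 <= B" and s: "0 < s"
  and H: "!!k. p\<^sup>2 <= r ^ (2 * k) * p + s * B ^ (2 * k)"
 defines "a \<equiv> ln B / (- ln r)"
 shows "p <= 2 * (s * B\<^sup>2) powr (1 / (2 + a))"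
proof (cases "p = 0")
 case False
 then have p0: "p > 0" using p by simp
 have a: "0 <= a" unfolding a_def by (rule divide_nonneg_pos) (use B r in auto)
 have "0 < r\<^sup>2" "r\<^sup>2 < 1" using r by (auto simp: power_less_one_iff)
 then obtain k0 where "(r\<^sup>2) ^ k0 < p / 2" using real_arch_pow_inv[of "p / 2" "r\<^sup>2"] p0 by auto
 then have ex: "\<exists>k. r ^ (2 * k) <= p / 2" by (auto simp: power_mult intro: less_imp_le)
 define k where "k = (LEAST k. r ^ (2 * k) <= p / 2)"
 have k: "r ^ (2 * k) <= p / 2" unfolding k_def by (rule LeastI_ex[OF ex])
 have "k ~= 0"
 proof
  assume "k = 0"
  then show False using k p by simp
 qed
 then obtain j where j: "k = Suc j" using not0_implies_Suc by blast
 have kj: "p / 2 < r ^ (2 * j)"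
 proof -
  have "j < (LEAST k. r ^ (2 * k) <= p / 2)" using j k_def by simp
  from not_less_Least[OF this] show ?thesis by simp
 qed
 have Br: "B ^ n = (r ^ n) powr (- a)" for n
 proof -
  have "(r ^ n) powr (- a) = exp (- a * ln (r ^ n))" using r by (simp add: powr_def)
  also have "- a * ln (r ^ n) = real n * ln B" using r by (simp add: ln_realpow a_def)
  also have "exp (real n * ln B) = B ^ n" using B by (simp add: exp_of_nat_mult)
  finally show ?thesis by simp
 qed
 have "r ^ (2 * k) * p <= (p / 2) * p" by (rule mult_right_mono[OF k p(1)])
 then have "p\<^sup>2 / 2 <= s * B ^ (2 * k)" using H[of k] by (simp add: power2_eq_square)
 also have "B ^ (2 * k) = B\<^sup>2 * B ^ (2 * j)" unfolding j by (simp add: power_add[symmetric])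
 also have "B ^ (2 * j) <= (p / 2) powr (- a)" unfolding Br by (rule powr_mono2') (use a kj p0 in auto)
 finally have m: "p\<^sup>2 / 2 <= s * B\<^sup>2 * (p / 2) powr (- a)" using s by (simp add: mult_left_mono mult.assoc)
 have "(p / 2) powr (2 + a) = (p / 2)\<^sup>2 * (p / 2) powr a" using p0 by (simp add: powr_add powr_numeral)
 also have "... <= (p\<^sup>2 / 2) * (p / 2) powr a" using p0 by (intro mult_right_mono) (auto simp: power2_eq_square)
 also have "... <= s * B\<^sup>2 * (p / 2) powr (- a) * (p / 2) powr a" by (rule mult_right_mono[OF m]) simp
 also have "... = s * B\<^sup>2" using p0 by (simp add: mult.assoc powr_add[symmetric])
 finally have "((p / 2) powr (2 + a)) powr (1 / (2 + a)) <= (s * B\<^sup>2) powr (1 / (2 + a))" using a by (intro powr_mono2) auto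
 then have "p / 2 <= (s * B\<^sup>2) powr (1 / (2 + a))" using a p0 by (simp add: powr_powr)
 then show ?thesis by simp
qed simp

context strong
begin

text \<open>These constants depend on the inverse temperature only through a lower bound
  \<open>b\<close>, and not on the field; this is the source of uniformity. \<open>xm\<close> bounds
  the odds of a strong edge from below, \<open>Bc\<close> is the loss per step when distant vertices
  are compared, \<open>sc\<close> is the constant of \<open>Sev_edge\<close> divided by the least
  edge probability, and \<open>ac\<close> fixes the exponent of the tail.\<close>

definition xm :: "real => real" where "xm b = exp (2 * b * eps) - 1"
definition Bc :: "real => real => real" where "Bc Q b = 3 + (1 + Q) / xm b"
definition sc :: "real => real => real" where "sc Q b = 16 * (1 + Q)\<^sup>2 * sqrt deg * ((1 + xm b) / xm b)"
definition ac :: "real => real => real" where "ac Q b = ln (Bc Q b) / (- ln rho)"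

end

context fk_uni
begin

text \<open>If \<open>v\<close> is joined to \<open>a\<close> or to \<open>b\<close>, it takes over
  that vertex's role. If it has a large cluster of its own, finiteness of one of the clusters
  separates it from \<open>a\<close> or from \<open>b\<close>. If its cluster is small, opening
  \<open>e\<close> lends it the large cluster of \<open>a\<close> while keeping it apart from
  \<open>b\<close>.\<close>

lemma Sev_step:
 assumes e: "ep e = {a, v}"
 shows "Sev N a b \<subseteq> Sev N a v Un Sev N v b Un {om. fun_upd om e True : Sev N v b}"
proof
 fix om assume w: "om : Sev N a b"
 let ?A = "Collect om" let ?Ka = "cl ep ?A a" and ?Kb = "cl ep ?A b" and ?Kv = "cl ep ?A v"
 have h: "b ~: ?Ka" "big N ?Ka" "big N ?Kb" "finite ?Ka | finite ?Kb" using w by (auto simp: Sev_def)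
 have "om : Sev N a v | om : Sev N v b | fun_upd om e True : Sev N v b"
 proof (cases "v : ?Ka")
  case True
  then have "?Kv = ?Ka" by (rule cl_eq)
  then show ?thesis using h by (simp add: Sev_def)
 next
  case va: False
  show ?thesis
  proof (cases "v : ?Kb")
   case True
   then have "?Kv = ?Kb" by (rule cl_eq)
   then show ?thesis using h va by (simp add: Sev_def)
  next
   case False
   then have bv: "b ~: ?Kv" using cl_sym[of b ep ?A v] by blast
   show ?thesis
   proof (cases "big N ?Kv")
   case True
   show ?thesis
   proof (cases "finite ?Ka | finite ?Kv")
   case True
   then show ?thesis using h va \<open>big N ?Kv\<close> by (simp add: Sev_def)
   next
   case False
   then show ?thesis using h bv \<open>big N ?Kv\<close> by (simp add: Sev_def)
   qed
   next
   case nb: False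
   then have fv: "finite ?Kv" by (simp add: big_def)
   have ins: "Collect (fun_upd om e True) = insert e ?A" by auto
   have c1: "cl ep (insert e ?A) v = ?Ka Un ?Kv" unfolding cl_insert[OF edgy_ep e] by simp
   have c2: "cl ep (insert e ?A) b = ?Kb" unfolding cl_insert[OF edgy_ep e] using bv h by simp
   have "big N (?Ka Un ?Kv)" unfolding big_def
   proof
   assume f: "finite (?Ka Un ?Kv)"
   then have "N <= card ?Ka" using h(2) by (simp add: big_def)
   also have "... <= card (?Ka Un ?Kv)" by (rule card_mono[OF f]) simp
   finally show "N <= card (?Ka Un ?Kv)" .
   qed
   then have "fun_upd om e True : Sev N v b" unfolding Sev_def mem_Collect_eq ins c1 c2 using h bv fv by simp
   then show ?thesis by simp
   qed
  qed
 qed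
 then show "om : Sev N a v Un Sev N v b Un {om. fun_upd om e True : Sev N v b}" by blast
qed

text \<open>One step costs \<open>s\<close> for the adjacent pair and a factor \<open>1 + D\<close>
  for the two events that end at \<open>b\<close>, one of them after an insertion. The base
  \<open>2 + D\<close> absorbs the added \<open>s\<close>.\<close>

lemma Sev_reach:
 assumes D: "0 <= D" "!!e. eps <= J e ==> 0 < x e & 1 + (1 + Q) / x e <= D"
  and s: "0 <= s" "!!a b. (a, b) : reach ==> measure nu (Sev N a b) <= s"
 shows "(a, b) : reach ^^ m ==> measure nu (Sev N a b) <= s * (2 + D) ^ m"
proof (induction m arbitrary: a)
 case 0
 then have "Sev N a b = {}" by (auto simp: Sev_def)
 then show ?case using s by simp
next
 case (Suc m)
 then obtain v where v: "(a, v) : reach" "(v, b) : reach ^^ m" by (meson relpow_Suc_D2)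
 then obtain e where e: "eps <= J e" "ep e = {a, v}" by (auto simp: reach_def)
 have IH: "measure nu (Sev N v b) <= s * (2 + D) ^ m" by (rule Suc.IH[OF v(2)])
 let ?U = "{om. fun_upd om e True : Sev N v b}"
 have U: "?U : sets nu" using measurable_sets[OF meas_upd[of e] sets_Sev[of N v b]] by (simp add: vimage_def)
 have "measure nu (Sev N a b) <= measure nu (Sev N a v Un Sev N v b Un ?U)" by (rule nu.finite_measure_mono[OF Sev_step[OF e(2)]]) (use U in auto)
 also have "... <= measure nu (Sev N a v Un Sev N v b) + measure nu ?U" by (rule measure_Un_le) (use U in auto)
 also have "... <= (measure nu (Sev N a v) + measure nu (Sev N v b)) + measure nu ?U" by (intro add_right_mono measure_Un_le) auto
 also have "measure nu ?U <= D * (s * (2 + D) ^ m)"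
 proof -
  have "measure nu ?U <= (1 + (1 + Q) / x e) * measure nu (Sev N v b)" by (rule insertion) (use D(2)[OF e(1)] in auto)
  also have "... <= D * (s * (2 + D) ^ m)" by (rule mult_mono) (use D(1) D(2)[OF e(1)] IH in auto)
  finally show ?thesis .
 qed
 finally have "measure nu (Sev N a b) <= s + s * (2 + D) ^ m + D * (s * (2 + D) ^ m)" using s(2)[OF v(1)] IH by linarith
 moreover have "s * 1 <= s * (2 + D) ^ m" using s(1) D(1) by (intro mult_left_mono one_le_power) auto
 ultimately show ?case by (simp add: algebra_simps)
qed

section \<open>Two walkers in large finite clusters\<close>

definition Av :: "nat => 'v => ('e => bool) set" where
 "Av N v = {om. finite (Kl om v) & N <= card (Kl om v)}"

lemma sets_Av [measurable]: "Av N v : sets nu"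
proof -
 have "Measurable.pred nu (%om. finite (Kl om v) & real N <= real (card (Kl om v)))" by measurable
 then show ?thesis unfolding Av_def by (simp add: pred_def)
qed

text \<open>The event as a property of edge sets, on which automorphisms act by images.\<close>

definition av :: "nat => 'v => 'e set => bool" where
 "av N v A \<longleftrightarrow> finite (cl ep A v) & N <= card (cl ep A v)"

lemma av_Av: "av N v (Collect om) \<longleftrightarrow> om : Av N v" by (simp add: av_def Av_def)

lemma av_aut: assumes g: "g : Aut ep J" shows "av N (fst g v) (snd g ` A) = av N v A"
proof -
 have "inj (fst g)" using g by (simp add: aut_iff bij_def)
 then have i: "inj_on (fst g) (cl ep A v)" by (rule inj_on_subset) simp
 show ?thesis unfolding av_def cl_aut[OF g] finite_image_iff[OF i] card_image[OF i] ..
qed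

lemma Av_const: "measure nu (Av N v) = measure nu (Av N r)"
proof -
 obtain g where g: "g : Aut ep J" "fst g r = v" using transV unfolding vertex_transitive_def by blast
 have e: "(%om. of_bool (av N w (Collect om)) :: real) = indicator (Av N w)" for w by (simp add: fun_eq_iff av_Av indicator_def of_bool_def)
 have m: "(%om. of_bool (av N w (Collect om)) :: real) : borel_measurable nu" for w unfolding e by (rule borel_measurable_indicator) (rule sets_Av)
 have "(\<integral>om. of_bool (av N (fst g r) (snd g ` Collect om)) \<partial>nu) = (\<integral>om. (of_bool (av N (fst g r) (Collect om)) :: real) \<partial>nu)"
  by (rule inv_int[OF g(1) m])
 then have "(\<integral>om. indicator (Av N r) om \<partial>nu) = (\<integral>om. (indicator (Av N v) om :: real) \<partial>nu)"
  unfolding av_aut[OF g(1)] e using g(2) by simp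
 then show ?thesis by simp
qed

text \<open>The inner sum \<open>?h\<close> is constant on each cluster, so \<open>f y\<close> may
  be averaged over the cluster of \<open>y\<close>. The double sum becomes a sum over single
  vertices, which is the form that mass transport can handle.\<close>

lemma same_cluster_sum:
 assumes fin: "!!y. y : Y ==> av N y A ==> finite (cl ep A y)" and Y: "finite Y" and f: "!!z. 0 <= f z"
 defines "W \<equiv> \<Union>y\<in>{y : Y. av N y A}. cl ep A y"
 shows "(\<Sum>y\<in>Y. \<Sum>z\<in>Y. f y * f z * of_bool (av N y A & z : cl ep A y)) \<le>
  (\<Sum>w\<in>W. inverse (card (cl ep A w)) * (\<Sum>z\<in>cl ep A w. f z)\<^sup>2)" and "finite W" and "!!w. w : W ==> av N w A"
proof -
 let ?K = "cl ep A" and ?h = "%w. \<Sum>z\<in>cl ep A w. f z" and ?Y = "{y : Y. av N y A}"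
 show fW: "finite W" unfolding W_def using Y fin by auto
 show WA: "av N w A" if w: "w : W" for w
 proof -
  obtain y where y: "y : Y" "av N y A" "w : ?K y" using w unfolding W_def by auto
  then show ?thesis using cl_eq[OF y(3)] by (simp add: av_def)
 qed
 have KW: "?K w \<subseteq> W" if w: "w : W" for w
 proof -
  obtain y where y: "y : Y" "av N y A" "w : ?K y" using w unfolding W_def by auto
  then show ?thesis unfolding cl_eq[OF y(3)] W_def by auto
 qed
 have h0: "0 <= ?h w" for w using f by (intro sum_nonneg)
 have "(\<Sum>y\<in>Y. \<Sum>z\<in>Y. f y * f z * of_bool (av N y A & z : ?K y)) <= (\<Sum>y\<in>?Y. f y * ?h y)"
 proof -
  have "(\<Sum>y\<in>Y. \<Sum>z\<in>Y. f y * f z * of_bool (av N y A & z : ?K y)) <= (\<Sum>y\<in>Y. if av N y A then f y * ?h y else 0)"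
  proof (rule sum_mono)
   fix y assume y: "y : Y"
   show "(\<Sum>z\<in>Y. f y * f z * of_bool (av N y A & z : ?K y)) <= (if av N y A then f y * ?h y else 0)"
   proof (cases "av N y A")
   case True
   have "(\<Sum>z\<in>Y. f y * f z * of_bool (av N y A & z : ?K y)) = (\<Sum>z\<in>Y Int ?K y. f y * f z)"
   using True Y by (simp add: of_bool_def sum.inter_restrict if_distrib cong: if_cong)
   also have "... <= (\<Sum>z\<in>?K y. f y * f z)" by (rule sum_mono2) (use fin[OF y True] f in auto)
   finally show ?thesis using True by (simp add: sum_distrib_left)
   qed simp
  qed
  then show ?thesis using Y by (simp add: sum.inter_filter)
 qed
 also have "... <= (\<Sum>y\<in>W. f y * ?h y)" by (rule sum_mono2[OF fW]) (use f h0 in \<open>auto simp: W_def intro: cl_refl\<close>)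
 also have "... = (\<Sum>z\<in>W. \<Sum>w\<in>W. if w : ?K z then f z * inverse (card (?K w)) * ?h w else 0)"
 proof (rule sum.cong[OF refl])
  fix z assume z: "z : W"
  have fK: "finite (?K z)" using WA[OF z] by (simp add: av_def)
  have "(\<Sum>w\<in>W. if w : ?K z then f z * inverse (card (?K w)) * ?h w else 0) = (\<Sum>w\<in>W. if w : ?K z then f z * inverse (card (?K z)) * ?h z else 0)"
  proof (rule sum.cong[OF refl])
   fix w show "(if w : ?K z then f z * inverse (card (?K w)) * ?h w else 0) = (if w : ?K z then f z * inverse (card (?K z)) * ?h z else 0)"
   using cl_eq[of w ep A z] by simp
  qed
  also have "... = (\<Sum>w\<in>W Int ?K z. f z * inverse (card (?K z)) * ?h z)" by (rule sum.inter_restrict[OF fW, symmetric])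
  also have "W Int ?K z = ?K z" using KW[OF z] by auto
  also have "(\<Sum>w\<in>?K z. f z * inverse (card (?K z)) * ?h z) = f z * ?h z"
  proof -
   have "card (?K z) ~= 0" using fK cl_ne[of ep A z] by simp
   then show ?thesis by simp
  qed
  finally show "f z * ?h z = (\<Sum>w\<in>W. if w : ?K z then f z * inverse (card (?K w)) * ?h w else 0)" by simp
 qed
 also have "... = (\<Sum>w\<in>W. \<Sum>z\<in>W. if w : ?K z then f z * inverse (card (?K w)) * ?h w else 0)" by (rule sum.swap)
 also have "... = (\<Sum>w\<in>W. inverse (card (?K w)) * (?h w)\<^sup>2)"
 proof (rule sum.cong[OF refl])
  fix w assume w: "w : W"
  have "w : ?K z \<longleftrightarrow> z : ?K w" for z using cl_sym[of w ep A z] cl_sym[of z ep A w] by blast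
  then have "(\<Sum>z\<in>W. if w : ?K z then f z * inverse (card (?K w)) * ?h w else 0) = (\<Sum>z\<in>W. if z : ?K w then f z * inverse (card (?K w)) * ?h w else 0)" by simp
  also have "... = (\<Sum>z\<in>W Int ?K w. f z * inverse (card (?K w)) * ?h w)" by (rule sum.inter_restrict[OF fW, symmetric])
  also have "W Int ?K w = ?K w" using KW[OF w] by auto
  also have "(\<Sum>z\<in>?K w. f z * inverse (card (?K w)) * ?h w) = inverse (card (?K w)) * (?h w)\<^sup>2"
   by (simp only: sum_distrib_right[symmetric] power2_eq_square) simp
  finally show "(\<Sum>z\<in>W. if w : ?K z then f z * inverse (card (?K w)) * ?h w else 0) = inverse (card (?K w)) * (?h w)\<^sup>2" .
 qed
 finally show "(\<Sum>y\<in>Y. \<Sum>z\<in>Y. f y * f z * of_bool (av N y A & z : cl ep A y)) \<le>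
  (\<Sum>w\<in>W. inverse (card (cl ep A w)) * (\<Sum>z\<in>cl ep A w. f z)\<^sup>2)" .
qed

text \<open>Averaging the quadratic form over the cluster turns the spectral gap of the walk into a
 bound on the probability that two walkers meet in one cluster.\<close>

lemma same_cluster_bound:
 assumes Y: "finite Y"
 shows "(\<integral>om. (\<Sum>y\<in>Y. \<Sum>z\<in>Y. pk k r y * pk k r z * of_bool (om : Av N y & z : Kl om y)) \<partial>nu) <= rho ^ (2 * k) * measure nu (Av N r)"
proof -
 \<comment> \<open>The mass sent from \<open>v\<close> to \<open>w\<close>. After transport the sum
   runs over the starting points \<open>v\<close> for a fixed cluster, where \<open>pk_decay\<close>
   gives \<open>rho ^ (2 * k)\<close> times its size and the inverse size cancels.\<close>
 define G where "G v w A = (if av N w A then inverse (card (cl ep A w)) * (\<Sum>z\<in>cl ep A w. pk k v z)\<^sup>2 else 0)" for v w A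
 have G0: "0 <= G v w A" for v w A by (simp add: G_def)
 have mG: "(%om. G v w (Collect om)) : borel_measurable nu" for v w
 proof -
  have T: "finite {z. pk k v z ~= 0}" by (rule finite_pk)
  have eq: "G v w (Collect om) = (if om : Av N w then inverse (real (card (Kl om w))) * (\<Sum>z\<in>{z. pk k v z ~= 0}. if z : Kl om w then pk k v z else 0)\<^sup>2 else 0)" for om
  proof (cases "om : Av N w")
   case True
   then have fK: "finite (Kl om w)" by (simp add: Av_def)
   have "(\<Sum>z\<in>Kl om w. pk k v z) = (\<Sum>z\<in>{z. pk k v z ~= 0} Int Kl om w. pk k v z)" by (rule sum.mono_neutral_right) (use fK in auto)
   also have "... = (\<Sum>z\<in>{z. pk k v z ~= 0}. if z : Kl om w then pk k v z else 0)" by (rule sum.inter_restrict[OF T])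
   finally show ?thesis using True by (simp add: G_def av_Av)
  qed (simp add: G_def av_Av)
  show ?thesis unfolding eq by measurable
 qed
 define f where "f v w = (\<integral>\<^sup>+ om. ennreal (G v w (Collect om)) \<partial>nu)" for v w
 have "f (fst g v) (fst g w) = f v w" if g: "g : Aut ep J" for g v w
 proof -
  have i: "inj_on (fst g) X" for X using g by (auto simp: aut_iff bij_def intro: inj_on_subset)
  have "G (fst g v) (fst g w) (snd g ` A) = G v w A" for A unfolding G_def av_aut[OF g] cl_aut[OF g] card_image[OF i] sum.reindex[OF i] o_def pk_aut[OF g] ..
  then show ?thesis unfolding f_def using nn_inv[OF g, of "%A. ennreal (G (fst g v) (fst g w) A)"] mG by simp
 qed
 then have mt: "(\<integral>\<^sup>+ w. f r w \<partial>count_space UNIV) = (\<integral>\<^sup>+ w. f w r \<partial>count_space UNIV)" by (rule mass_transport)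
 have "(\<integral>\<^sup>+ w. f w r \<partial>count_space UNIV) = (\<integral>\<^sup>+ om. (\<integral>\<^sup>+ w. ennreal (G w r (Collect om)) \<partial>count_space UNIV) \<partial>nu)"
  unfolding f_def by (rule nn_swap[OF countable_V sf_nu]) (use mG in measurable)
 also have "... <= (\<integral>\<^sup>+ om. ennreal (rho ^ (2 * k)) * indicator (Av N r) om \<partial>nu)"
 proof (rule nn_integral_mono)
  fix om
  show "(\<integral>\<^sup>+ w. ennreal (G w r (Collect om)) \<partial>count_space UNIV) <= ennreal (rho ^ (2 * k)) * indicator (Av N r) om"
  proof (cases "om : Av N r")
   case True
   then have fK: "finite (Kl om r)" by (simp add: Av_def)
   let ?X = "\<Union>z\<in>Kl om r. {w. pk k w z ~= 0}"
   have fX: "finite ?X" using fK finite_pk(2) by auto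
   have "(\<integral>\<^sup>+ w. ennreal (G w r (Collect om)) \<partial>count_space UNIV) = (\<Sum>w\<in>?X. ennreal (G w r (Collect om)))"
   proof (rule nn_integral_count_space'[OF fX])
   fix w assume "w ~: ?X"
   then have "(\<Sum>z\<in>Kl om r. pk k w z) = 0" by (intro sum.neutral) auto
   then show "ennreal (G w r (Collect om)) = 0" by (simp add: G_def)
   qed auto
   also have "... = ennreal (\<Sum>w\<in>?X. G w r (Collect om))" using G0 by (simp add: sum_ennreal)
   also have "(\<Sum>w\<in>?X. G w r (Collect om)) <= rho ^ (2 * k)"
   proof -
   have c: "card (Kl om r) ~= 0" using fK cl_ne[of ep "Collect om" r] by simp
   have "(\<Sum>w\<in>?X. G w r (Collect om)) = inverse (card (Kl om r)) * (\<Sum>w\<in>?X. (\<Sum>z\<in>Kl om r. pk k w z)\<^sup>2)"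
   using True by (simp add: G_def av_Av sum_distrib_left)
   also have "... <= inverse (card (Kl om r)) * (rho ^ (2 * k) * card (Kl om r))" by (intro mult_left_mono pk_decay fK fX) simp
   also have "... = rho ^ (2 * k)" using c by simp
   finally show ?thesis .
   qed
   finally show ?thesis using True by (simp add: ennreal_leI)
  qed (simp add: G_def av_Av)
 qed
 also have "... = ennreal (rho ^ (2 * k) * measure nu (Av N r))" using rho by (simp add: nn_integral_cmult_indicator nu.emeasure_eq_measure ennreal_mult')
 finally have up: "(\<integral>\<^sup>+ w. f r w \<partial>count_space UNIV) <= ennreal (rho ^ (2 * k) * measure nu (Av N r))" unfolding mt .
 let ?S = "%om. \<Sum>y\<in>Y. \<Sum>z\<in>Y. pk k r y * pk k r z * of_bool (om : Av N y & z : Kl om y)"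
 have S0: "0 <= ?S om" for om using pk_nonneg by (intro sum_nonneg) auto
 have "(\<integral>\<^sup>+ om. ennreal (?S om) \<partial>nu) <= (\<integral>\<^sup>+ om. (\<integral>\<^sup>+ w. ennreal (G r w (Collect om)) \<partial>count_space UNIV) \<partial>nu)"
 proof (rule nn_integral_mono)
  fix om :: "'e => bool"
  let ?A = "Collect om"
  define W where "W = (\<Union>y\<in>{y : Y. av N y ?A}. cl ep ?A y)"
  have fin: "finite (cl ep ?A y)" if "y : Y" "av N y ?A" for y using that by (simp add: av_def)
  note sc = same_cluster_sum[where f = "pk k r" and N = N and A = ?A and Y = Y, OF fin Y pk_nonneg, folded W_def]
  have "ennreal (?S om) <= ennreal (\<Sum>w\<in>W. G r w ?A)"
  proof (rule ennreal_leI)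
   have "?S om <= (\<Sum>w\<in>W. inverse (card (cl ep ?A w)) * (\<Sum>z\<in>cl ep ?A w. pk k r z)\<^sup>2)" using sc(1) by (simp only: av_Av)
   also have "... = (\<Sum>w\<in>W. G r w ?A)" using sc(3) by (intro sum.cong) (auto simp: G_def)
   finally show "?S om <= (\<Sum>w\<in>W. G r w ?A)" .
  qed
  also have "... = (\<Sum>w\<in>W. ennreal (G r w ?A))" using G0 by (simp add: sum_ennreal)
  also have "... = (\<Sum>w\<in>W. indicator W w * ennreal (G r w ?A))" by (rule sum.cong) auto
  also have "... = (\<integral>\<^sup>+ w. indicator W w * ennreal (G r w ?A) \<partial>count_space UNIV)"
   by (rule nn_integral_count_space'[symmetric]) (use sc(2) in auto)
  also have "... <= (\<integral>\<^sup>+ w. ennreal (G r w ?A) \<partial>count_space UNIV)" by (rule nn_integral_mono) (auto simp: indicator_def)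
  finally show "ennreal (?S om) <= (\<integral>\<^sup>+ w. ennreal (G r w ?A) \<partial>count_space UNIV)" .
 qed
 also have "... = (\<integral>\<^sup>+ w. f r w \<partial>count_space UNIV)" unfolding f_def by (rule nn_swap[OF countable_V sf_nu, symmetric]) (use mG in measurable)
 finally have le: "(\<integral>\<^sup>+ om. ennreal (?S om) \<partial>nu) <= ennreal (rho ^ (2 * k) * measure nu (Av N r))" using up by (rule order.trans)
 have mS: "?S : borel_measurable nu" unfolding of_bool_def by measurable
 have "(\<integral>om. ?S om \<partial>nu) = enn2real (\<integral>\<^sup>+ om. ennreal (?S om) \<partial>nu)" by (rule integral_eq_nn_integral[OF mS]) (use S0 in simp)
 also have "... <= rho ^ (2 * k) * measure nu (Av N r)" by (rule enn2real_leI[OF _ le]) (use rho in simp)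
 finally show ?thesis .
qed

text \<open>\<open>X\<close> is the probability, given the configuration, that a walk of
  \<open>k\<close> steps from \<open>r\<close> ends in a finite cluster of size at least
  \<open>N\<close>; by invariance its mean is \<open>?P\<close>. In its second moment two such
  walkers are either in one cluster or in separated large ones, and their positions are joined by
  \<open>2 * k\<close> strong steps.\<close>

lemma two_point:
 assumes s: "!!a b. (a, b) : reach ^^ (2 * k) ==> measure nu (Sev N a b) <= s"
 shows "(measure nu (Av N r))\<^sup>2 <= rho ^ (2 * k) * measure nu (Av N r) + s"
proof -
 define Y where "Y = {y. (r, y) : reach ^^ k}"
 have Y: "finite Y" unfolding Y_def by (rule finite_reach)
 have sumY: "(\<Sum>y\<in>Y. pk k r y) = 1" by (rule pk_sum[OF Y]) (simp add: Y_def)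
 let ?P = "measure nu (Av N r)"
 define X where "X om = (\<Sum>y\<in>Y. pk k r y * indicator (Av N y) om)" for om
 have mX: "X : borel_measurable nu" unfolding X_def by measurable
 have X01: "0 <= X om" "X om <= 1" for om
 proof -
  show "0 <= X om" unfolding X_def using pk_nonneg by (intro sum_nonneg) auto
  have "X om <= (\<Sum>y\<in>Y. pk k r y)" unfolding X_def using pk_nonneg by (intro sum_mono mult_left_le) (auto simp: indicator_def)
  then show "X om <= 1" by (simp add: sumY)
 qed
 have iX: "integrable nu X" by (rule nu.integrable_const_bound[where B = 1]) (use X01 mX in auto)
 have iX2: "integrable nu (%om. (X om)\<^sup>2)" by (rule nu.integrable_const_bound[where B = 1]) (use X01 mX in \<open>auto intro!: power_le_one\<close>)
 have EX: "(\<integral>om. X om \<partial>nu) = ?P"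
 proof -
  have "(\<integral>om. X om \<partial>nu) = (\<Sum>y\<in>Y. pk k r y * measure nu (Av N y))"
   unfolding X_def by (subst Bochner_Integration.integral_sum) (auto simp: nu.emeasure_eq_measure)
  also have "... = (\<Sum>y\<in>Y. pk k r y * ?P)" by (rule sum.cong[OF refl]) (use Av_const[of N] in metis)
  also have "... = ?P" by (simp add: sum_distrib_right[symmetric] sumY)
  finally show ?thesis .
 qed
 \<comment> \<open>Nonnegative variance: the squared mean is at most the second moment.\<close>
 have "0 <= (\<integral>om. (X om - ?P)\<^sup>2 \<partial>nu)" by (rule integral_nonneg_AE) simp
 also have "(\<integral>om. (X om - ?P)\<^sup>2 \<partial>nu) = (\<integral>om. ((X om)\<^sup>2 - 2 * ?P * X om) + ?P\<^sup>2 \<partial>nu)"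
  by (simp add: power2_diff algebra_simps)
 also have "... = ((\<integral>om. (X om)\<^sup>2 \<partial>nu) - 2 * ?P * (\<integral>om. X om \<partial>nu)) + ?P\<^sup>2" using iX iX2 nu.prob_space by simp
 finally have var: "?P\<^sup>2 <= (\<integral>om. (X om)\<^sup>2 \<partial>nu)" unfolding EX by (simp add: power2_eq_square)
 let ?S = "%om. \<Sum>y\<in>Y. \<Sum>z\<in>Y. pk k r y * pk k r z * of_bool (om : Av N y & z : Kl om y)"
 let ?D = "%om. \<Sum>y\<in>Y. \<Sum>z\<in>Y. pk k r y * pk k r z * indicator (Sev N y z) om"
 have pp: "0 <= pk k r y * pk k r z" for y z using pk_nonneg by simp
 have iS: "integrable nu ?S"
 proof (intro Bochner_Integration.integrable_sum)
  fix y z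
  show "integrable nu (%om. pk k r y * pk k r z * of_bool (om : Av N y & z : Kl om y))" by (rule nu.integrable_const_bound[where B = "pk k r y * pk k r z"])
   (use pp in \<open>auto simp: of_bool_def abs_mult pk_nonneg\<close>)
 qed
 have iD: "integrable nu ?D" by (intro Bochner_Integration.integrable_sum integrable_mult_right integrable_real_indicator) (auto simp: nu.emeasure_eq_measure)
 have "(\<integral>om. (X om)\<^sup>2 \<partial>nu) <= (\<integral>om. ?S om + ?D om \<partial>nu)"
 proof (rule integral_mono[OF iX2 Bochner_Integration.integrable_add[OF iS iD]])
  fix om
  have "(X om)\<^sup>2 = (\<Sum>y\<in>Y. \<Sum>z\<in>Y. (pk k r y * indicator (Av N y) om) * (pk k r z * indicator (Av N z) om))"
   unfolding X_def power2_eq_square sum_product ..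
  also have "... <= (\<Sum>y\<in>Y. \<Sum>z\<in>Y. pk k r y * pk k r z * of_bool (om : Av N y & z : Kl om y) + pk k r y * pk k r z * indicator (Sev N y z) om)"
  proof (intro sum_mono)
   fix y z
   have "(indicator (Av N y) om * indicator (Av N z) om :: real) <= of_bool (om : Av N y & z : Kl om y) + indicator (Sev N y z) om"
   by (auto simp: indicator_def Av_def Sev_def big_def)
   from mult_left_mono[OF this pp[of y z]]
   show "(pk k r y * indicator (Av N y) om) * (pk k r z * indicator (Av N z) om) \<le>
   pk k r y * pk k r z * of_bool (om : Av N y & z : Kl om y) + pk k r y * pk k r z * indicator (Sev N y z) om" by (simp only: distrib_left) (simp add: ac_simps)
  qed
  also have "... = ?S om + ?D om" by (simp only: sum.distrib)
  finally show "(X om)\<^sup>2 <= ?S om + ?D om" .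
 qed
 also have "... = (\<integral>om. ?S om \<partial>nu) + (\<integral>om. ?D om \<partial>nu)" by (rule Bochner_Integration.integral_add[OF iS iD])
 also have "(\<integral>om. ?S om \<partial>nu) <= rho ^ (2 * k) * ?P" by (rule same_cluster_bound[OF Y])
 also have "(\<integral>om. ?D om \<partial>nu) = (\<Sum>y\<in>Y. \<Sum>z\<in>Y. pk k r y * pk k r z * measure nu (Sev N y z))"
  by (simp add: Bochner_Integration.integral_sum nu.emeasure_eq_measure)
 also have "... <= (\<Sum>y\<in>Y. \<Sum>z\<in>Y. pk k r y * pk k r z * s)"
 proof (intro sum_mono mult_left_mono pp s)
  fix y z assume "y : Y" "z : Y"
  then have "(y, r) : reach ^^ k" "(r, z) : reach ^^ k" using reach_sym by (auto simp: Y_def)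
  then have "(y, z) : reach ^^ (k + k)" unfolding relpow_add by blast
  then show "(y, z) : reach ^^ (2 * k)" by (simp add: mult_2)
 qed
 also have "... = s" by (simp only: sum_distrib_right[symmetric] sum_distrib_left[symmetric] sumY, (simp add: sumY)?)
 finally show ?thesis using var by linarith
qed

theorem tail_large:
 assumes b: "0 < b" "b <= bt" and N: "1 <= N"
 shows "measure nu (Av N r) <= 2 * (sc Q b * (Bc Q b)\<^sup>2) powr (1 / (2 + ac Q b)) * real N powr (- (1 / (2 * (2 + ac Q b))))"
proof -
 have xm: "0 < xm b" using b eps by (simp add: xm_def)
 have xe: "xm b <= x e" if "eps <= J e" for e
 proof -
  have "b * eps <= bt * J e" using b eps that by (intro mult_mono) auto
  then show ?thesis by (simp add: xm_def x_def)
 qed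
 define D where "D = 1 + (1 + Q) / xm b"
 have D: "0 <= D" using Q xm by (simp add: D_def)
 have De: "0 < x e & 1 + (1 + Q) / x e <= D" if "eps <= J e" for e
 proof
  show x0: "0 < x e" using xe[OF that] xm by linarith
  have "(1 + Q) / x e <= (1 + Q) / xm b" using xe[OF that] xm x0 Q by (intro divide_left_mono) auto
  then show "1 + (1 + Q) / x e <= D" by (simp add: D_def)
 qed
 define s where "s = sc Q b / sqrt N"
 have N0: "0 < real N" using N by simp
 have sc0: "0 < sc Q b" using Q deg_pos xm by (auto simp: sc_def intro!: mult_pos_pos divide_pos_pos add_pos_pos)
 have s0: "0 < s" using sc0 N0 by (simp add: s_def)
 have se: "measure nu (Sev N a c') <= s" if ac: "(a, c') : reach" for a c'
 proof -
  obtain e where e: "eps <= J e" "ep e = {a, c'}" using ac by (auto simp: reach_def)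
  have "Sev N a c' = Sev N (src e) (tgt e)" using src_tgt(1)[of e] e(2) Sev_sym by (auto simp: doubleton_eq_iff)
  moreover have "measure nu (Sev N (src e) (tgt e)) <= s"
  proof -
   let ?m = "measure nu (Sev N (src e) (tgt e))"
   have pm: "xm b / (1 + xm b) <= p e" unfolding p_def using xm xe[OF e(1)] by (simp add: divide_simps algebra_simps)
   have "xm b / (1 + xm b) * ?m <= p e * ?m" by (rule mult_right_mono[OF pm]) simp
   also have "... <= 16 * (1 + Q)\<^sup>2 * sqrt (deg / N)" by (rule Sev_edge[OF N e(1)])
   finally have "((1 + xm b) / xm b) * (xm b / (1 + xm b) * ?m) <= ((1 + xm b) / xm b) * (16 * (1 + Q)\<^sup>2 * sqrt (deg / N))"
   using xm by (intro mult_left_mono) auto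
   moreover have "((1 + xm b) / xm b) * (xm b / (1 + xm b) * ?m) = ?m" using xm by simp
   moreover have "((1 + xm b) / xm b) * (16 * (1 + Q)\<^sup>2 * sqrt (deg / N)) = s" by (simp add: s_def sc_def real_sqrt_divide)
   ultimately show ?thesis by linarith
  qed
  ultimately show ?thesis by simp
 qed
 have B: "2 + D = Bc Q b" by (simp add: D_def Bc_def)
 have H: "(measure nu (Av N r))\<^sup>2 <= rho ^ (2 * k) * measure nu (Av N r) + s * Bc Q b ^ (2 * k)" for k
  unfolding B[symmetric] by (rule two_point) (rule Sev_reach[OF D De less_imp_le[OF s0] se])
 have a0: "0 < 2 + ac Q b"
 proof -
  have "1 <= Bc Q b" using D B by linarith
  then have "0 <= ac Q b" unfolding ac_def using rho by (intro divide_nonneg_pos) auto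
  then show ?thesis by simp
 qed
 have "measure nu (Av N r) <= 2 * (s * (Bc Q b)\<^sup>2) powr (1 / (2 + ac Q b))" unfolding ac_def by (rule power_tail_bound[OF _ _ rho _ s0 H]) (use D B in auto)
 also have "s * (Bc Q b)\<^sup>2 = (sc Q b * (Bc Q b)\<^sup>2) * real N powr (- (1 / 2))"
 proof -
  have "real N powr (- (1 / 2)) = 1 / sqrt N" using N0 by (simp add: powr_minus_divide powr_half_sqrt)
  then show ?thesis by (simp add: s_def)
 qed
 also have "((sc Q b * (Bc Q b)\<^sup>2) * real N powr (- (1 / 2))) powr (1 / (2 + ac Q b)) =
  (sc Q b * (Bc Q b)\<^sup>2) powr (1 / (2 + ac Q b)) * (real N powr (- (1 / 2))) powr (1 / (2 + ac Q b))" by (rule powr_mult)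
 also have "(real N powr (- (1 / 2))) powr (1 / (2 + ac Q b)) = real N powr (- (1 / (2 * (2 + ac Q b))))"
 proof -
  have "- (1 / 2) * (1 / (2 + ac Q b)) = - (1 / (2 * (2 + ac Q b)))" by simp
  then show ?thesis unfolding powr_powr by (simp only:)
 qed
 finally show ?thesis by (simp only: mult.assoc)
qed

text \<open>Below this threshold the edge weights at a vertex sum to at most 1/2, so the expected
  number of open simple paths from \<open>r\<close> inside a window, and with it the expected size
  of the visible cluster, is at most 2. Markov's inequality then applies, and the windows
  \<open>I k\<close> exhaust a finite cluster.\<close>

theorem tail_small:
 assumes b: "bt <= 1 / (4 * DJ)" and N: "1 <= N"
 shows "measure nu (Av N r) <= 2 / N"
proof -
 define I where "I k = {e. to_nat_on (UNIV :: 'e set) e <= k}" for k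
 have finI: "finite (I k)" for k unfolding I_def by (rule finite_index_prefix[OF countable_E])
 define U where "U k = {om. N <= card (cl ep (Collect om Int I k) r)}" for k
 have mU: "U k : sets nu" for k unfolding U_def by (rule sets_cyl_pred[OF finI, of "%A. N <= card (cl ep A r)"])
 have half: "2 * bt * DJ <= 1 / 2"
 proof -
  have "bt * (4 * DJ) <= 1" using b DJ_pos by (simp add: pos_le_divide_eq)
  then show ?thesis by simp
 qed
 have bnd: "N * measure nu (U k) <= 2" for k
 proof -
  define L where "L = {l. wk r l & distinct (vs r l) & set l \<subseteq> I k}"
  have Ln: "length l <= card (I k)" if "l : L" for l using that wk_distinct[of r l] card_mono[OF finI[of k], of "set l"] by (auto simp: L_def distinct_card)
  have finL: "finite L" by (rule finite_subset[OF _ finite_lists_length_le[OF finI[of k], of "card (I k)"]]) (use Ln in \<open>auto simp: L_def\<close>)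
  have pt: "real N * indicator (U k) om <= (\<Sum>l\<in>L. indicator {om. set l <= Collect om} om)" for om
  proof (cases "om : U k")
   case True
   let ?K = "cl ep (Collect om Int I k) r" and ?L = "{l : L. set l <= Collect om}"
   have "?K \<subseteq> (%l. last (vs r l)) ` ?L"
   proof
   fix y assume "y : ?K"
   from cl_path[OF this] obtain l where "wk r l" "distinct (vs r l)" "set l <= Collect om Int I k" "last (vs r l) = y" by blast
   then show "y : (%l. last (vs r l)) ` ?L" by (auto simp: L_def)
   qed
   then have "card ?K <= card ?L" using finL by (intro surj_card_le) auto
   moreover have "N <= card ?K" using True by (simp add: U_def)
   ultimately have "real N <= real (card ?L)" by simp
   also have "... = (\<Sum>l\<in>L. indicator {om. set l <= Collect om} om)" using finL by (simp add: indicator_def sum.If_cases Int_def)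
   finally show ?thesis using True by simp
  qed (simp add: sum_nonneg)
  have iL: "integrable nu (%om. indicator {om. set l <= Collect om} om :: real)" for l
   by (rule integrable_real_indicator) (auto intro: sets_open simp: nu.emeasure_eq_measure)
  have "N * measure nu (U k) = (\<integral>om. real N * indicator (U k) om \<partial>nu)" by simp
  also have "... <= (\<integral>om. (\<Sum>l\<in>L. indicator {om. set l <= Collect om} om) \<partial>nu)" by (rule integral_mono[OF _ _ pt])
   (auto intro!: Bochner_Integration.integrable_sum iL integrable_mult_right integrable_real_indicator mU simp: nu.emeasure_eq_measure)
  also have "... = (\<Sum>l\<in>L. measure nu {om. set l <= Collect om})" by (subst Bochner_Integration.integral_sum[OF iL]) simp
  also have "... <= (\<Sum>l\<in>L. prod_list (map p l))"
  proof (rule sum_mono)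
   fix l assume "l : L"
   then show "measure nu {om. set l <= Collect om} <= prod_list (map p l)" using dom[of "set l"] prod_walk[of r l] by (auto simp: L_def)
  qed
  also have "... = (\<Sum>j\<in>{..card (I k)}. \<Sum>l\<in>{l : L. length l = j}. prod_list (map p l))" by (rule sum.group[symmetric]) (use finL Ln in auto)
  also have "... <= (\<Sum>j\<in>{..card (I k)}. (2 * bt * DJ) ^ j)"
  proof (rule sum_mono)
   fix j
   show "(\<Sum>l\<in>{l : L. length l = j}. prod_list (map p l)) <= (2 * bt * DJ) ^ j"
   proof (rule walk_sum[where v = r])
   show "0 <= p e" for e by (rule p_bounds)
   show "sum p E <= 2 * bt * DJ" if "finite E" "!!e. e : E ==> v : ep e" for v E by (rule sum_p_le[OF that])
   show "finite {l : L. length l = j}" using finL by simp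
   qed (auto simp: L_def)
  qed
  also have "... <= (\<Sum>j\<in>{..card (I k)}. (1 / 2) ^ j)" by (intro sum_mono power_mono) (use half bt DJ_pos in auto)
  also have "... <= (2 :: real)" by (subst sum_gp0) (simp add: field_simps)
  finally show ?thesis .
 qed
 have inc: "incseq U"
 proof (rule incseq_SucI)
  fix k
  show "U k \<subseteq> U (Suc k)"
  proof
   fix om assume w: "om : U k"
   have "cl ep (Collect om Int I k) r <= cl ep (Collect om Int I (Suc k)) r" by (rule cl_mono) (auto simp: I_def)
   then have "card (cl ep (Collect om Int I k) r) <= card (cl ep (Collect om Int I (Suc k)) r)" by (rule card_mono[OF finite_cl_I[OF finI]])
   then show "om : U (Suc k)" using w by (simp add: U_def)
  qed
 qed
 have cov: "Av N r <= (\<Union>k. U k)"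
 proof
  fix om assume w: "om : Av N r"
  have "\<forall>y\<in>Kl om r. \<exists>l. wk r l & set l <= Collect om & y : set (vs r l)"
  proof
   fix y assume "y : Kl om r"
   from cl_path[OF this] obtain l where l: "wk r l" "set l <= Collect om" "last (vs r l) = y" by blast
   moreover have "last (vs r l) : set (vs r l)" by (rule last_in_set) simp
   ultimately show "\<exists>l. wk r l & set l <= Collect om & y : set (vs r l)" by metis
  qed
  then obtain l where l: "!!y. y : Kl om r ==> wk r (l y) & set (l y) <= Collect om & y : set (vs r (l y))" by metis
  define E where "E = (\<Union>y\<in>Kl om r. set (l y))"
  have fE: "finite E" unfolding E_def using w by (auto simp: Av_def)
  obtain k where Ek: "E \<subseteq> I k" using eventually_happens[OF eventually_index_prefix[OF fE]] by (auto simp: I_def)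
  have "Kl om r <= cl ep (Collect om Int I k) r"
  proof
   fix y assume y: "y : Kl om r"
   have "set (l y) <= Collect om Int I k" using l[OF y] Ek y by (auto simp: E_def)
   then show "y : cl ep (Collect om Int I k) r" using wk_cl[of r "l y" "Collect om Int I k"] l[OF y] by blast
  qed
  then have "card (Kl om r) <= card (cl ep (Collect om Int I k) r)" by (rule card_mono[OF finite_cl_I[OF finI]])
  then have "om : U k" using w by (simp add: Av_def U_def)
  then show "om : (\<Union>k. U k)" by blast
 qed
 have "(%k. measure nu (U k)) \<longlonglongrightarrow> measure nu (\<Union>k. U k)" by (rule nu.finite_Lim_measure_incseq[OF _ inc]) (use mU in auto)
 moreover have "measure nu (U k) <= 2 / N" for k using bnd[of k] N by (simp add: field_simps)
 ultimately have "measure nu (\<Union>k. U k) <= 2 / N" by (intro LIMSEQ_le_const2) auto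
 moreover have "measure nu (Av N r) <= measure nu (\<Union>k. U k)" by (rule nu.finite_measure_mono[OF cov]) (use mU in auto)
 ultimately show ?thesis by linarith
qed

end

section \<open>Comparing finite models\<close>

lemma div_le_cross: "0 < b ==> 0 < d ==> a * d <= c * b ==> a / b <= c / d" for a b c d :: real by (simp add: pos_divide_le_eq pos_le_divide_eq)

text \<open>The ratio decreases in each of the two cluster values; they are changed one after the
  other.\<close>

lemma rat_formula_mono:
 fixes x y x' y' Q :: real
 assumes "0 <= Q" "0 <= x'" "x' <= x" "x <= 1" "0 <= y'" "y' <= y" "y <= 1"
 shows "(1 + Q * (x * y)) / ((1 + Q * x) * (1 + Q * y)) <= (1 + Q * (x' * y')) / ((1 + Q * x') * (1 + Q * y'))"
proof -
 have 1: "(1 + Q * (a * z)) / (1 + Q * a) <= (1 + Q * (b * z)) / (1 + Q * b)"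
  if "0 <= b" "b <= a" "0 <= z" "z <= 1" for a b z :: real
 proof (rule div_le_cross)
  have "0 <= Q * ((a - b) * (1 - z))" using that assms by simp
  then show "(1 + Q * (a * z)) * (1 + Q * b) <= (1 + Q * (b * z)) * (1 + Q * a)" by (simp add: algebra_simps)
 qed (use that assms in \<open>auto intro!: add_pos_nonneg\<close>)
 have "(1 + Q * (x * y)) / (1 + Q * x) / (1 + Q * y) <= (1 + Q * (x' * y)) / (1 + Q * x') / (1 + Q * y)" by (rule divide_right_mono[OF 1]) (use assms in auto)
 also have "... = (1 + Q * (y * x')) / (1 + Q * y) / (1 + Q * x')" by (simp add: mult.commute)
 also have "... <= (1 + Q * (y' * x')) / (1 + Q * y') / (1 + Q * x')" by (rule divide_right_mono[OF 1]) (use assms in auto)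
 finally show ?thesis by (simp add: mult.commute)
qed

text \<open>Domination needs two things at every edge: the second model joins the endpoints whenever
  the first does, and its cluster values are no larger.\<close>

lemma rat_compare:
 assumes m1: "fk_model en1 W1 Q u1" and m2: "fk_model en2 W2 Q u2" and e: "en1 e = {a, b}" "en2 e = {a', b'}"
  and same: "cl en1 A a = cl en1 A b ==> cl en2 B a' = cl en2 B b'"
  and le: "ucl u2 (cl en2 B a') <= ucl u1 (cl en1 A a)" "ucl u2 (cl en2 B b') <= ucl u1 (cl en1 A b)"
 shows "rat en1 Q u1 A e <= rat en2 Q u2 B e"
proof (cases "cl en2 B a' = cl en2 B b'")
 case True
 then show ?thesis using fk_model.rat_same[OF m2 e(2) True] fk_model.rat_le_1[OF m1, of A e] by simp
next
 case False
 then have F1: "cl en1 A a ~= cl en1 A b" using same by blast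
 have Q: "0 <= Q" using m1 by (simp add: fk_model_def)
 show ?thesis unfolding fk_model.rat_diff[OF m1 e(1) F1] fk_model.rat_diff[OF m2 e(2) False]
  using Q le fk_model.ucl_bounds[OF m1] fk_model.ucl_bounds[OF m2] by (intro rat_formula_mono)
qed

lemma (in fk_model) ucl_anti: "finite D ==> C \<subseteq> D ==> ucl u D <= ucl u C"
proof -
 assume D: "finite D" "C \<subseteq> D"
 have "D = C Un (D - C)" using D by auto
 then have "ucl u D = ucl u C * ucl u (D - C)" using ucl_Un[of C "D - C"] D finite_subset[OF D(2,1)] by auto
 also have "... <= ucl u C * 1" by (intro mult_left_mono ucl_bounds)
 finally show ?thesis by simp
qed

text \<open>Holley's inequality with the first weight set to 0 outside \<open>F\<close>: additional
  edges and larger ratios both raise increasing functionals.\<close>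

lemma EE_compare:
 assumes m1: "fk_finite en1 W1 Q u1 x F" and m2: "fk_finite en2 W2 Q u2 x F'" and FF: "F \<subseteq> F'"
  and W1: "!!e. e : F' ==> en1 e \<subseteq> W1"
  and rat: "!!A B e. A \<subseteq> B ==> B \<subseteq> F' ==> e : F' ==> rat en1 Q u1 A e <= rat en2 Q u2 B e"
  and ph: "!!A. 0 <= ph A" "!!A B. A \<subseteq> B ==> ph A <= ph B"
 shows "EE en1 W1 Q u1 x F ph <= EE en2 W2 Q u2 x F' ph"
proof -
 interpret m1: fk_finite en1 W1 Q u1 x F by (rule m1)
 interpret m2: fk_finite en2 W2 Q u2 x F' by (rule m2)
 let ?f = "%A. if A \<subseteq> F then wt en1 W1 Q u1 x A else 0" and ?g = "wt en2 W2 Q u2 x"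
 have sumf: "(\<Sum>A\<in>Pow F'. h A * ?f A) = (\<Sum>A\<in>Pow F. h A * wt en1 W1 Q u1 x A)" for h by (rule sum.mono_neutral_cong_right) (use FF m2.finF in auto)
 have sumf1: "(\<Sum>A\<in>Pow F'. ?f A) = (\<Sum>A\<in>Pow F. wt en1 W1 Q u1 x A)" using sumf[of "%_. 1"] by simp
 have "(\<Sum>A\<in>Pow F'. ph A * ?f A) * sum ?g (Pow F') <= (\<Sum>A\<in>Pow F'. ph A * ?g A) * sum ?f (Pow F')"
 proof (rule holley[OF m2.finF])
  fix A B assume AB: "A \<subseteq> F'" "B \<subseteq> F'"
  show "?f A * ?g B <= ?g (A Un B) * ?f (A Int B)"
  proof (cases "A \<subseteq> F")
   case True
   have fin: "finite A" "finite B" using AB m2.finF finite_subset by auto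
   have k: "kap en1 W1 Q u1 A * kap en2 W2 Q u2 B <= kap en2 W2 Q u2 (A Un B) * kap en1 W1 Q u1 (A Int B)"
   proof (rule lattice_from_ratio[OF m2.finF AB])
   show "0 <= kap en1 W1 Q u1 A" for A using m1.kap_pos[of A] by simp
   show "0 <= kap en2 W2 Q u2 A" for A using m2.kap_pos[of A] by simp
   show "kap en1 W1 Q u1 (insert e S) = kap en1 W1 Q u1 S * rat en1 Q u1 S e" if "S \<subseteq> F'" "e : F'" for S e by (rule m1.kap_insert) (use that W1 in auto)
   show "kap en2 W2 Q u2 (insert e S) = kap en2 W2 Q u2 S * rat en2 Q u2 S e" if "S \<subseteq> F'" "e : F'" for S e by (rule m2.kap_insert) (use that m2.FW in auto)
   show "0 <= rat en1 Q u1 S e" for S e using m1.rat_pos[of S e] by simp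
   qed (rule rat)
   have "(\<Prod>e\<in>A. x e) * (\<Prod>e\<in>B. x e) = (\<Prod>e\<in>A Un B. x e) * (\<Prod>e\<in>A Int B. x e)" by (rule prod.union_inter[OF fin, symmetric])
   moreover have "0 <= (\<Prod>e\<in>A. x e) * (\<Prod>e\<in>B. x e)" using m1.x by (intro mult_nonneg_nonneg prod_nonneg) auto
   ultimately have "((\<Prod>e\<in>A. x e) * (\<Prod>e\<in>B. x e)) * (kap en1 W1 Q u1 A * kap en2 W2 Q u2 B) \<le>
   ((\<Prod>e\<in>A Un B. x e) * (\<Prod>e\<in>A Int B. x e)) * (kap en2 W2 Q u2 (A Un B) * kap en1 W1 Q u1 (A Int B))" using mult_left_mono[OF k] by simp
   moreover have "A Int B \<subseteq> F" using True by auto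
   ultimately show ?thesis using True by (simp add: wt_def ac_simps)
  next
   case False
   then have "?f A * ?g B = 0" by simp
   moreover have "0 <= ?g (A Un B) * ?f (A Int B)" using m1.wt_nonneg m2.wt_nonneg by simp
   ultimately show ?thesis by linarith
  qed
 qed (use m1.wt_nonneg m2.wt_nonneg ph in auto)
 then show ?thesis unfolding EE_def sumf sumf1 by (intro div_le_cross m1.wt_sum_pos m2.wt_sum_pos)
qed

lemma cl_loops:
 assumes "edgy en" "!!e. e : L ==> \<exists>a. en e = {a}"
 shows "cl en (A Un L) v = cl en A v"
proof
 show "cl en (A Un L) v <= cl en A v"
 proof (rule cl_least[OF cl_refl])
  fix e assume e: "e : A Un L" "en e Int cl en A v ~= {}"
  show "en e <= cl en A v"
  proof (cases "e : A")
   case True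
   obtain z where "z : en e" "z : cl en A v" using e(2) by auto
   then show ?thesis by (rule cl_edge[OF assms(1) True])
  next
   case False
   then obtain a where "en e = {a}" using e(1) assms(2) by auto
   then show ?thesis using e(2) by auto
  qed
 qed
 show "cl en A v <= cl en (A Un L) v" by (rule cl_mono) simp
qed

text \<open>Loops never change a cluster, so their weights factor out.\<close>

lemma EE_loops:
 assumes m: "fk_finite en W Q u x (F Un L)" and d: "F Int L = {}" and L: "!!e. e : L ==> \<exists>a. en e = {a}"
  and f: "!!A B. A \<subseteq> F ==> B \<subseteq> L ==> f (A Un B) = f A"
 shows "EE en W Q u x (F Un L) f = EE en W Q u x F f"
proof -
 interpret fk_finite en W Q u x "F Un L" by (rule m)
 have fin: "finite F" "finite L" using finF by auto
 have w: "wt en W Q u x (A Un B) = wt en W Q u x A * (\<Prod>e\<in>B. x e)" if AB: "A \<subseteq> F" "B \<subseteq> L" for A B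
 proof -
  have "kap en W Q u (A Un B) = kap en W Q u A" unfolding kap_def using cl_loops[OF edgy, of B A] L AB by (simp add: subset_iff)
  moreover have "(\<Prod>e\<in>A Un B. x e) = (\<Prod>e\<in>A. x e) * (\<Prod>e\<in>B. x e)" by (rule prod.union_disjoint) (use AB d fin finite_subset in auto)
  ultimately show ?thesis by (simp add: wt_def)
 qed
 let ?c = "\<Sum>B\<in>Pow L. \<Prod>e\<in>B. x e"
 have c: "?c > 0" by (rule sum_pos2[of _ "{}"]) (use fin x in \<open>auto intro: prod_nonneg\<close>)
 have s: "(\<Sum>A\<in>Pow (F Un L). h A * wt en W Q u x A) = ?c * (\<Sum>A\<in>Pow F. h A * wt en W Q u x A)"
  if h: "!!A B. A \<subseteq> F ==> B \<subseteq> L ==> h (A Un B) = h A" for h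
 proof -
  have "(\<Sum>A\<in>Pow (F Un L). h A * wt en W Q u x A) = (\<Sum>B\<in>Pow L. \<Sum>A\<in>Pow F. h (A Un B) * wt en W Q u x (A Un B))" by (rule sum_Pow_Un[OF fin d])
  also have "... = (\<Sum>B\<in>Pow L. \<Sum>A\<in>Pow F. (\<Prod>e\<in>B. x e) * (h A * wt en W Q u x A))" by (intro sum.cong refl) (use w h in auto)
  also have "... = ?c * (\<Sum>A\<in>Pow F. h A * wt en W Q u x A)" by (simp only: sum_product)
  finally show ?thesis .
 qed
 show ?thesis unfolding EE_def using s[OF f] s[of "%_. 1"] c by simp
qed

lemma EE_image:
 assumes ed: "edgy en" and i: "inj ph" "inj ta" and en: "!!e. en' (ta e) = ph ` en e"
  and u: "!!w. u' (ph w) = u w" and x: "!!e. x' (ta e) = x e"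
 shows "EE en' (ph ` W) Q u' x' (ta ` F) f = EE en W Q u x F (%A. f (ta ` A))"
proof -
 have ii: "inj_on g X" if "inj g" for g :: "'z => 'y" and X using that by (rule inj_on_subset) simp
 have w: "wt en' (ph ` W) Q u' x' (ta ` A) = wt en W Q u x A" for A
 proof -
  have c: "cl en' (ta ` A) (ph a) = ph ` cl en A a" for a by (rule cl_image_inj[OF ed i(1)]) (rule en)
  have uc: "ucl u' (ph ` C) = ucl u C" for C unfolding ucl_def by (subst prod.reindex) (use ii[OF i(1)] u in auto)
  have "cl en' (ta ` A) ` (ph ` W) = (`) ph ` (cl en A ` W)" by (simp add: image_image c)
  moreover have "inj_on ((`) ph) (cl en A ` W)" using i(1) by (auto simp: inj_on_def inj_image_eq_iff)
  ultimately have "kap en' (ph ` W) Q u' (ta ` A) = kap en W Q u A" unfolding kap_def by (simp only: prod.reindex o_def uc)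
  moreover have "(\<Prod>e\<in>ta ` A. x' e) = (\<Prod>e\<in>A. x e)" by (subst prod.reindex) (use ii[OF i(2)] x in auto)
  ultimately show ?thesis by (simp add: wt_def)
 qed
 have P: "Pow (ta ` F) = (`) ta ` Pow F" by (rule image_Pow_surj[OF refl, symmetric])
 have I: "inj_on ((`) ta) (Pow F)" using i(2) by (auto simp: inj_on_def inj_image_eq_iff)
 show ?thesis unfolding EE_def P by (simp only: sum.reindex[OF I] o_def w)
qed

text \<open>The new vertices are isolated and contribute a constant factor.\<close>

lemma EE_enlarge:
 assumes m: "fk_finite en W Q u x F" and W: "finite W'" "W \<subseteq> W'" and en: "!!e. e : F ==> en' e = en e"
 shows "EE en' W' Q u x F f = EE en W Q u x F f"
proof -
 interpret fk_finite en W Q u x F by (rule m)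
 let ?c = "\<Prod>v\<in>W' - W. 1 + Q * u v"
 have c: "?c > 0" using Q u by (intro prod_pos) (auto intro!: add_pos_nonneg)
 have w: "wt en' W' Q u x A = ?c * wt en W Q u x A" if A: "A \<subseteq> F" for A
 proof -
  have cc: "cl en' A v = cl en A v" for v by (rule cl_cong) (use A en in auto)
  have s: "cl en A v = {v}" if "v : W' - W" for v
  proof
   show "cl en A v <= {v}" by (rule cl_least) (use that A FW in auto)
  qed simp
  have sub: "cl en A v \<subseteq> W" if "v : W" for v by (rule cl_subset[OF that]) (use A FW in auto)
  have im: "cl en' A ` W' = cl en A ` W Un (%v. {v}) ` (W' - W)"
  proof -
   have "cl en' A ` W' = cl en A ` (W Un (W' - W))" unfolding cc using W(2) by (intro arg_cong[where f = "image _"]) auto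
   also have "... = cl en A ` W Un cl en A ` (W' - W)" by (rule image_Un)
   also have "cl en A ` (W' - W) = (%v. {v}) ` (W' - W)" using s by (rule image_cong[OF refl])
   finally show ?thesis .
  qed
  have dj: "cl en A ` W Int (%v. {v}) ` (W' - W) = {}"
  proof -
   have False if "v : W" "z : W' - W" "cl en A v = {z}" for v z using sub[OF that(1)] that by auto
   then show ?thesis by blast
  qed
  have "kap en' W' Q u A = (\<Prod>C\<in>cl en A ` W. 1 + Q * ucl u C) * (\<Prod>C\<in>(%v. {v}) ` (W' - W). 1 + Q * ucl u C)"
   unfolding kap_def im by (rule prod.union_disjoint[OF _ _ dj]) (use W fin_W in auto)
  also have "(\<Prod>C\<in>(%v. {v}) ` (W' - W). 1 + Q * ucl u C) = ?c" by (subst prod.reindex) (auto simp: ucl_def)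
  finally show ?thesis by (simp add: wt_def kap_def)
 qed
 have s: "(\<Sum>A\<in>Pow F. h A * wt en' W' Q u x A) = ?c * (\<Sum>A\<in>Pow F. h A * wt en W Q u x A)" for h by (simp add: w sum_distrib_left ac_simps)
 show ?thesis unfolding EE_def using s[of f] s[of "%_. 1"] c by simp
qed

text \<open>Only the factor of the root's cluster changes, its value dropping from
  \<open>V = t ^ card\<close> to 0. The weights therefore differ by the factor
  \<open>1 + Q * V\<close>, and expectations by at most \<open>Q\<close> times the mean of
  \<open>V\<close>.\<close>

lemma EE_root:
 assumes m: "fk_finite en W Q (%_. t) x F" and r: "r : W" and ph: "!!A. 0 <= ph A & ph A <= 1"
 defines "u' \<equiv> %w. if w = r then 0 else t"
 shows "\<bar>EE en W Q (%_. t) x F ph - EE en W Q u' x F ph\<bar> <= Q * EE en W Q u' x F (%A. t ^ card (cl en A r))"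
proof -
 interpret fk_finite en W Q "%_. t" x F by (rule m)
 have t: "0 <= t" "t <= 1" using u by auto
 interpret m': fk_finite en W Q u' x F using edgy fin_W Q t x finF FW by unfold_locales (auto simp: u'_def)
 define V where "V A = t ^ card (cl en A r)" for A
 have V: "0 <= V A" "V A <= 1" for A using t by (auto simp: V_def power_le_one)
 have w: "wt en W Q (%_. t) x A = wt en W Q u' x A * (1 + Q * V A)" if A: "A \<subseteq> F" for A
 proof -
  let ?C = "cl en A r"
  have fin: "finite (cl en A v)" if "v : W" for v by (rule finite_cl[OF that]) (use A FW in auto)
  have 0: "ucl u' ?C = 0" unfolding ucl_def using fin[OF r] cl_refl[of r en A] by (intro prod_zero) (auto simp: u'_def)
  have 1: "ucl u' C = ucl (%_. t) C" if "C : cl en A ` W - {?C}" for C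
  proof -
   obtain v where v: "C = cl en A v" "C ~= ?C" using \<open>C : cl en A ` W - {?C}\<close> by auto
   then have "r ~: C" using cl_eq[of r en A v] by auto
   then show ?thesis unfolding ucl_def u'_def by (intro prod.cong) auto
  qed
  have "kap en W Q (%_. t) A = (1 + Q * ucl (%_. t) ?C) * (\<Prod>C\<in>cl en A ` W - {?C}. 1 + Q * ucl (%_. t) C)"
   unfolding kap_def using r fin_W by (subst prod.remove[of _ ?C]) auto
  moreover have "kap en W Q u' A = (1 + Q * ucl u' ?C) * (\<Prod>C\<in>cl en A ` W - {?C}. 1 + Q * ucl u' C)"
   unfolding kap_def using r fin_W by (subst prod.remove[of _ ?C]) auto
  moreover have "(\<Prod>C\<in>cl en A ` W - {?C}. 1 + Q * ucl u' C) = (\<Prod>C\<in>cl en A ` W - {?C}. 1 + Q * ucl (%_. t) C)" by (rule prod.cong) (use 1 in auto)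
  moreover have "ucl (%_. t) ?C = V A" by (simp add: ucl_def V_def)
  ultimately show ?thesis by (simp add: wt_def 0)
 qed
 let ?E = "EE en W Q u' x F" and ?Z = "\<Sum>A\<in>Pow F. wt en W Q u' x A"
 have Z: "?Z > 0" by (rule m'.wt_sum_pos)
 have sm: "(\<Sum>A\<in>Pow F. h A * wt en W Q (%_. t) x A) = ?Z * (?E h + Q * ?E (%A. h A * V A))" for h
 proof -
  have "(\<Sum>A\<in>Pow F. h A * wt en W Q (%_. t) x A) = (\<Sum>A\<in>Pow F. h A * wt en W Q u' x A + Q * ((h A * V A) * wt en W Q u' x A))"
   by (intro sum.cong refl) (simp add: w algebra_simps)
  also have "... = (\<Sum>A\<in>Pow F. h A * wt en W Q u' x A) + Q * (\<Sum>A\<in>Pow F. (h A * V A) * wt en W Q u' x A)" by (simp only: sum.distrib sum_distrib_left)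
  also have "... = ?Z * (?E h + Q * ?E (%A. h A * V A))" unfolding EE_def distrib_left using Z by simp
  finally show ?thesis .
 qed
 have Eb: "?E ph * ?E V <= ?E V" "0 <= ?E ph * ?E V" "0 <= ?E (%A. ph A * V A)" "?E (%A. ph A * V A) <= ?E V" "0 <= ?E V"
 proof -
  show V0: "0 <= ?E V" by (rule m'.EE_nonneg) (rule V)
  have p0: "0 <= ?E ph" by (rule m'.EE_nonneg) (use ph in auto)
  have "?E ph <= ?E (%_. 1)" by (rule m'.EE_mono) (use ph in auto)
  then have p1: "?E ph <= 1" by (simp add: m'.EE_const)
  show "?E ph * ?E V <= ?E V" using mult_right_mono[OF p1 V0] by simp
  show "0 <= ?E ph * ?E V" using p0 V0 by simp
  show "0 <= ?E (%A. ph A * V A)" by (rule m'.EE_nonneg) (use ph V in auto)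
  show "?E (%A. ph A * V A) <= ?E V"
  proof (rule m'.EE_mono)
   fix A
   have "ph A * V A <= 1 * V A" by (rule mult_right_mono) (use ph V in auto)
   then show "ph A * V A <= V A" by simp
  qed
 qed
 have D: "0 < 1 + Q * ?E V" using Q Eb(5) by (simp add: add_pos_nonneg)
 have "EE en W Q (%_. t) x F ph = (?E ph + Q * ?E (%A. ph A * V A)) / (1 + Q * ?E V)"
 proof -
  have "(\<Sum>A\<in>Pow F. wt en W Q (%_. t) x A) = ?Z * (1 + Q * ?E V)" using sm[of "%_. 1"] m'.EE_const[of 1] by simp
  then show ?thesis using Z unfolding EE_def[of en W Q "%_. t"] sm by simp
 qed
 then have "EE en W Q (%_. t) x F ph - ?E ph = Q * (?E (%A. ph A * V A) - ?E ph * ?E V) / (1 + Q * ?E V)" using D by (simp add: field_simps)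
 then have "\<bar>EE en W Q (%_. t) x F ph - ?E ph\<bar> = Q * \<bar>?E (%A. ph A * V A) - ?E ph * ?E V\<bar> / (1 + Q * ?E V)"
  using D Q by (simp add: abs_mult abs_divide)
 also have "... <= Q * ?E V / 1"
 proof (rule frac_le)
  show "Q * \<bar>?E (%A. ph A * V A) - ?E ph * ?E V\<bar> <= Q * ?E V" using Eb Q by (intro mult_left_mono) auto
 qed (use Eb Q in auto)
 finally show ?thesis unfolding V_def by simp
qed

section \<open>Infinite-volume random cluster measures\<close>

lemma cyl_rec: "(g (C Int insert e I) :: 'z) = (if e : C then g (insert e (C Int I)) else g (C Int I))" by (auto simp: insert_absorb intro!: arg_cong[where f = g])

lemma cont_fst_coord: "continuous_on UNIV (%om :: ('e => bool) \<times> ('v => bool). fst om e)"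
 by (rule continuous_on_compose2[OF continuous_on_product_coordinates[of e] continuous_on_fst[OF continuous_on_id]]) auto

lemma cyl_cont:
 assumes "finite I"
 shows "continuous_on UNIV (%om :: ('e => bool) \<times> ('v => bool). g (Collect (fst om) Int I) :: real)" using assms
proof (induction I arbitrary: g rule: finite_induct)
 case empty
 show ?case by simp
next
 case (insert e I)
 have 1: "continuous_on UNIV (of_bool :: bool => real)" by (simp add: continuous_on_open_vimage open_discrete)
 have ob: "continuous_on UNIV (%om :: ('e => bool) \<times> ('v => bool). of_bool (fst om e) :: real)" by (rule continuous_on_compose2[OF 1 cont_fst_coord]) simp
 have "(%om :: ('e => bool) \<times> ('v => bool). g (Collect (fst om) Int insert e I)) =
  (%om. of_bool (fst om e) * g (insert e (Collect (fst om) Int I)) + (1 - of_bool (fst om e)) * g (Collect (fst om) Int I))" by (simp add: fun_eq_iff cyl_rec)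
 moreover have "continuous_on UNIV (%om :: ('e => bool) \<times> ('v => bool). of_bool (fst om e) * g (insert e (Collect (fst om) Int I)) + (1 - of_bool (fst om e)) * g (Collect (fst om) Int I))"
  by (intro continuous_on_add continuous_on_mult continuous_on_diff continuous_on_const ob insert.IH[of "%A. g (insert e A)"] insert.IH)
 ultimately show ?case by (simp only:)
qed

lemma cyl_meas:
 assumes "finite I"
 shows "(%om. g (Collect om Int I) :: real) : borel_measurable (PiM (UNIV :: 'e set) (%_. count_space (UNIV :: bool set)))" using assms
proof (induction I arbitrary: g rule: finite_induct)
 case (insert e I)
 have [measurable]: "(%om. om e) : measurable (PiM (UNIV :: 'e set) (%_. count_space (UNIV :: bool set))) (count_space UNIV)"
  by (rule measurable_component_singleton) simp
 note [measurable] = insert.IH[of "%A. g (insert e A)"] insert.IH[of g]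
 have "(%om. g (Collect om Int insert e I)) = (%om. if om e then g (insert e (Collect om Int I)) else g (Collect om Int I))" by (simp add: fun_eq_iff cyl_rec)
 then show ?case by simp
qed simp

lemma meas_fst:
 assumes "sets \<mu> = sets (borel :: (('e => bool) \<times> ('v => bool)) measure)"
 shows "fst : measurable \<mu> (PiM (UNIV :: 'e set) (%_. count_space (UNIV :: bool set)))"
proof -
 have "(%om :: ('e => bool) \<times> ('v => bool). fst om e) : measurable borel (count_space UNIV)" for e
 proof (rule measurableI)
  fix A :: "bool set"
  have "open ((%om :: ('e => bool) \<times> ('v => bool). fst om e) -` A)"
   by (rule open_vimage[OF _ cont_fst_coord[of e]]) (simp add: discrete_topology_class.open_discrete)
  then show "(%om :: ('e => bool) \<times> ('v => bool). fst om e) -` A Int space borel : sets borel" by simp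
 qed simp
 then have "fst : measurable (borel :: (('e => bool) \<times> ('v => bool)) measure) (PiM UNIV (%_. count_space UNIV))"
  by (intro measurable_PiM_single') (auto simp: PiE_UNIV_domain)
 then show ?thesis by (simp only: measurable_cong_sets[OF assms refl])
qed

context strong
begin

definition bd :: "'v set => 'e set" where "bd X = {e. eps <= J e & card (ep e Int X) = 1}"
definition EB :: "nat => 'e set" where "EB n = {e. to_nat_on (UNIV :: 'e set) e <= n}"

lemma finite_EB: "finite (EB n)" unfolding EB_def by (rule finite_index_prefix[OF countable_E])

lemma ev_EB: "finite I ==> \<forall>\<^sub>F n in sequentially. I <= EB n" unfolding EB_def by (rule eventually_index_prefix)

lemma ev_exh: "exhaustion Vs ==> finite B ==> \<forall>\<^sub>F n in sequentially. B \<subseteq> Vs n"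
proof -
 assume V: "exhaustion Vs" and B: "finite B"
 have inc: "Vs m \<subseteq> Vs n" if "m <= n" for m n by (rule lift_Suc_mono_le[of Vs]) (use V that in \<open>auto simp: exhaustion_def\<close>)
 have "\<forall>\<^sub>F n in sequentially. v : Vs n" for v
 proof -
  have "v : (\<Union>n. Vs n)" using V by (simp add: exhaustion_def)
  then obtain m where "v : Vs m" by blast
  then show ?thesis unfolding eventually_sequentially using inc by blast
 qed
 then have "\<forall>\<^sub>F n in sequentially. \<forall>v\<in>B. v : Vs n" by (intro eventually_ball_finite B) auto
 then show ?thesis by eventually_elim auto
qed

end

text \<open>The finite-volume laws may involve infinitely many edges; they are tied to models with
  finitely many edges up to an error \<open>1 / (n + 1)\<close> that vanishes in the limit.\<close>

locale rc_limit = strong ep J eps c for ep :: "'e => 'v set" and J eps c +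
 fixes Q t bt :: real and M :: "nat => (('e => bool) \<times> ('v => bool)) pmf" and \<mu> :: "(('e => bool) \<times> ('v => bool)) measure"
  and S :: "nat => 'v set" and F :: "nat => 'e set"
 assumes Q: "0 <= Q" and t: "0 < t" "t <= 1" and bt: "0 <= bt"
  and finS: "!!n. finite (S n)" and finF: "!!n. finite (F n)"
  and evS: "!!B. finite B ==> \<forall>\<^sub>F n in sequentially. B \<subseteq> S n"
  and evF: "!!I. finite I ==> \<forall>\<^sub>F n in sequentially. I \<subseteq> F n"
  and wl: "weak_limit (%n. measure_pmf (M n)) \<mu>"
  and app: "!!n \<Psi>. \<bar>measure (M n) {om. \<Psi> {e. fst om e}} -
   EE (epS (S n)) (WW (S n)) Q (%_. t) (%e. exp (2 * bt * J e) - 1) (F n) (%A. of_bool (\<Psi> A))\<bar> <= 1 / real (Suc n)"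
begin

abbreviation "xx \<equiv> %e. exp (2 * bt * J e) - 1"
definition nu :: "('e => bool) measure" where "nu = distr \<mu> (PiM UNIV (%_. count_space UNIV)) fst"

lemma xx0: "0 <= xx e" using bt J_nonneg by simp

lemma mod: "finite S' ==> finite F' ==> (!!w. 0 <= u w & u w <= 1) ==> fk_finite (epS S') (WW S') Q u xx F'" using edgy_epS epS_WW finite_WW Q xx0 by unfold_locales auto

lemma modt: "fk_finite (epS (S n)) (WW (S n)) Q (%_. t) xx (F n)" by (rule mod[OF finS finF]) (use t in auto)

abbreviation "En n \<equiv> EE (epS (S n)) (WW (S n)) Q (%_. t) xx (F n)"

lemma sets_mu: "sets \<mu> = sets borel" and prob_mu: "prob_space \<mu>" using wl by (auto simp: weak_limit_def)

lemma prob_nu: "prob_space nu" and sets_nu: "sets nu = sets (PiM UNIV (%_. count_space UNIV))"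
 unfolding nu_def using prob_space.prob_space_distr[OF prob_mu meas_fst[OF sets_mu]] by simp_all

lemma space_nu: "space nu = UNIV" using sets_eq_imp_space_eq[OF sets_nu] by (simp add: space_PiM)

lemma lim:
 assumes I: "finite I"
 shows "(%n. En n (%A. f (A Int I))) \<longlonglongrightarrow> (\<integral>om. f (Collect om Int I) \<partial>nu)"
proof -
 have fP: "finite (Pow I)" using I by simp
 have fdec: "f (A Int I) = (\<Sum>C\<in>Pow I. f C * of_bool (A Int I = C))" for A
 proof -
  have "(\<Sum>C\<in>Pow I. f C * of_bool (A Int I = C)) = (\<Sum>C\<in>{A Int I}. f C)" by (rule sum.mono_neutral_cong_right[OF fP]) auto
  then show ?thesis by simp
 qed
 let ?f = "%om :: ('e => bool) \<times> ('v => bool). f (Collect (fst om) Int I)"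
 have c: "continuous_on UNIV ?f" by (rule cyl_cont[OF I])
 have "range ?f \<subseteq> f ` Pow I" by auto
 then have "bounded (range ?f)" by (rule bounded_subset[rotated]) (use fP finite_imp_bounded in blast)
 then have l: "(%n. \<integral>om. ?f om \<partial>(measure_pmf (M n))) \<longlonglongrightarrow> (\<integral>om. ?f om \<partial>\<mu>)"
  using wl c unfolding weak_limit_def by blast
 have d: "\<bar>(\<integral>om. ?f om \<partial>(measure_pmf (M n))) - En n (%A. f (A Int I))\<bar> <= (\<Sum>C\<in>Pow I. \<bar>f C\<bar>) * (1 / real (Suc n))" for n
 proof -
  interpret m: fk_finite "epS (S n)" "WW (S n)" Q "%_. t" xx "F n" by (rule modt)
  have 1: "(\<integral>om. ?f om \<partial>(measure_pmf (M n))) = (\<Sum>C\<in>Pow I. f C * measure (M n) {om. {e. fst om e} Int I = C})"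
  proof -
   have "(\<integral>om. ?f om \<partial>(measure_pmf (M n))) = (\<integral>om. (\<Sum>C\<in>Pow I. f C * indicator {om. {e. fst om e} Int I = C} om) \<partial>(measure_pmf (M n)))"
   by (rule Bochner_Integration.integral_cong[OF refl]) (subst fdec, simp add: indicator_def of_bool_def)
   also have "... = (\<Sum>C\<in>Pow I. f C * measure (M n) {om. {e. fst om e} Int I = C})"
   by (subst Bochner_Integration.integral_sum) (auto simp: measure_pmf.emeasure_eq_measure)
   finally show ?thesis .
  qed
  have 2: "En n (%A. f (A Int I)) = (\<Sum>C\<in>Pow I. f C * En n (%A. of_bool (A Int I = C)))" unfolding fdec m.EE_sum[OF fP] m.EE_cmult ..
  have "\<bar>(\<integral>om. ?f om \<partial>(measure_pmf (M n))) - En n (%A. f (A Int I))\<bar> =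
   \<bar>\<Sum>C\<in>Pow I. f C * (measure (M n) {om. {e. fst om e} Int I = C} - En n (%A. of_bool (A Int I = C)))\<bar>"
   unfolding 1 2 by (simp only: sum_subtractf right_diff_distrib)
  also have "... <= (\<Sum>C\<in>Pow I. \<bar>f C\<bar> * (1 / real (Suc n)))"
  proof (rule order.trans[OF sum_abs sum_mono])
   fix C
   show "\<bar>f C * (measure (M n) {om. {e. fst om e} Int I = C} - En n (%A. of_bool (A Int I = C)))\<bar> <= \<bar>f C\<bar> * (1 / real (Suc n))"
   unfolding abs_mult by (rule mult_left_mono[OF app]) simp
  qed
  finally show ?thesis by (simp only: sum_distrib_right)
 qed
 have z: "(%n. (\<Sum>C\<in>Pow I. \<bar>f C\<bar>) * (1 / real (Suc n))) \<longlonglongrightarrow> (\<Sum>C\<in>Pow I. \<bar>f C\<bar>) * 0"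
  using LIMSEQ_inverse_real_of_nat by (intro tendsto_intros) (simp add: inverse_eq_divide)
 have "(%n. (\<integral>om. ?f om \<partial>(measure_pmf (M n))) - En n (%A. f (A Int I))) \<longlonglongrightarrow> 0"
  by (rule Lim_null_comparison[OF _ z[simplified mult_zero_right]]) (use d in \<open>simp only: real_norm_def, simp\<close>)
 from tendsto_diff[OF l this] have "(%n. En n (%A. f (A Int I))) \<longlonglongrightarrow> (\<integral>om. ?f om \<partial>\<mu>)" by simp
 moreover have "(\<integral>om. f (Collect om Int I) \<partial>nu) = (\<integral>om. ?f om \<partial>\<mu>)"
  unfolding nu_def by (rule integral_distr[OF meas_fst[OF sets_mu] cyl_meas[OF I]])
 ultimately show ?thesis by simp
qed

definition L :: "'e set => real" where "L P = measure nu {om. P <= Collect om}"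

lemma lim_L: "finite P ==> (%n. En n (%A. of_bool (P \<subseteq> A))) \<longlonglongrightarrow> L P"
proof -
 assume P: "finite P"
 have eq: "P \<subseteq> A Int P \<longleftrightarrow> P \<subseteq> A" for A by auto
 have "(%om. of_bool (P <= Collect om) :: real) = indicator {om. P <= Collect om}" by (simp add: fun_eq_iff indicator_def of_bool_def)
 then have "(\<integral>om. of_bool (P <= Collect om) \<partial>nu) = L P" by (simp add: L_def space_nu)
 then show ?thesis using lim[OF P, of "%A. of_bool (P \<subseteq> A)"] unfolding eq by simp
qed

lemma to_fk_limit:
 assumes inv: "!!g P. g : Aut ep J ==> finite P ==> L (snd g ` P) = L P"
 shows "fk_limit ep J eps c Q t bt nu S F" by (rule fk_limit.intro, rule strong_axioms, rule fk_limit_axioms.intro)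
  (rule Q, rule t(1), rule t(2), rule bt, rule finS, rule finF, rule evS, assumption, rule evF, assumption,
  rule prob_nu, rule sets_nu, rule lim, assumption, rule inv[unfolded L_def], assumption, assumption)

lemma L_one_sided:
 assumes "!!g P. g : Aut ep J ==> finite P ==> L (snd g ` P) <= L P" "g : Aut ep J" "finite P"
 shows "L (snd g ` P) = L P"
proof (rule antisym[OF assms(1)[OF assms(2,3)]])
 have b: "bij (snd g)" using assms(2) by (simp add: aut_iff)
 have "L (snd (inv (fst g), inv (snd g)) ` snd g ` P) <= L (snd g ` P)" by (rule assms(1)[OF aut_inv[OF assms(2)]]) (use assms(3) in simp)
 moreover have "inv (snd g) ` snd g ` P = P" using b by (simp add: bij_is_inj image_inv_f_f)
 ultimately show "L P <= L (snd g ` P)" by simp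
qed

lemma rat_self:
 assumes "finite S'" "!!w. 0 <= u w & u w <= 1" "A \<subseteq> B"
 shows "rat (epS S') Q u A e <= rat (epS S') Q u B e"
proof -
 have m: "fk_model (epS S') (WW S') Q u" using mod[OF assms(1) finite.emptyI assms(2)] by (simp add: fk_finite_def)
 obtain a b where ab: "epS S' e = {a, b}" using edgy_epS unfolding edgy_def by blast
 have W: "a : WW S'" "b : WW S'" using epS_WW[of S' e] ab by auto
 have f: "finite (cl (epS S') B v)" if "v : WW S'" for v by (rule finite_subset[OF cl_subset[OF that epS_WW] finite_WW[OF assms(1)]])
 show ?thesis
 proof (rule rat_compare[OF m m ab ab])
  show "cl (epS S') B a = cl (epS S') B b" if "cl (epS S') A a = cl (epS S') A b" using that cl_mono[OF assms(3), of "epS S'" a] unfolding cl_eq_iff by blast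
 qed (intro fk_model.ucl_anti[OF m] f W cl_mono assms)+
qed

lemma EE_aut:
 assumes g: "g : Aut ep J" and u: "!!w. u (map_option (fst g) w) = u w"
 shows "EE (epS (fst g ` S')) (WW (fst g ` S')) Q u xx (snd g ` F') f = EE (epS S') (WW S') Q u xx F' (%A. f (snd g ` A))"
proof -
 have g': "inj (fst g)" "inj (snd g)" "!!e. ep (snd g e) = fst g ` ep e" "!!e. J (snd g e) = J e" using g by (auto simp: aut_iff bij_def)
 have W: "WW (fst g ` S') = map_option (fst g) ` WW S'" by (simp add: WW_def image_image)
 have e: "epS (fst g ` S') (snd g e) = map_option (fst g) ` epS S' e" for e
  unfolding epS_def g'(3) image_image by (intro image_cong refl) (simp add: prj_def inj_image_mem_iff[OF g'(1)])
 show ?thesis unfolding W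
  by (rule EE_image[where ph = "map_option (fst g)" and ta = "snd g" and en' = "epS (fst g ` S')" and en = "epS S'" and u' = u and u = u and x' = xx and x = xx])
   (use g' e u in \<open>auto intro: edgy_epS option.inj_map\<close>)
qed

text \<open>Free models increase with the volume. The image of the \<open>n\<close>-th volume under
  \<open>g\<close> eventually lies inside the \<open>m\<close>-th one, and the further edges only
  help increasing events. The inverse automorphism supplies the opposite inequality.\<close>

lemma inv_free:
 assumes sub: "!!n e. e : F n ==> ep e \<subseteq> S n" and g: "g : Aut ep J" and P: "finite P"
 shows "L (snd g ` P) = L P"
proof -
 have ge: "L P <= L (snd g ` P)" if g: "g : Aut ep J" and P: "finite P" for g P
 proof -
  have g': "inj (snd g)" "!!e. ep (snd g e) = fst g ` ep e" using g by (auto simp: aut_iff bij_def)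
  have "En n (%A. of_bool (P \<subseteq> A)) <= L (snd g ` P)" for n
  proof -
   have fin: "finite (fst g ` S n)" "finite (snd g ` F n)" "finite (snd g ` P)" using finS finF P by auto
   have "\<forall>\<^sub>F m in sequentially. En n (%A. of_bool (P \<subseteq> A)) <= En m (%A. of_bool (snd g ` P \<subseteq> A))" using evS[OF fin(1)] evF[OF fin(2)]
   proof eventually_elim
   case (elim m)
   let ?ph = "%A. of_bool (snd g ` P \<subseteq> A) :: real"
   have "En n (%A. of_bool (P \<subseteq> A)) = En n (%A. ?ph (snd g ` A))" by (simp only: inj_image_subset_iff[OF g'(1)])
   also have "... = EE (epS (fst g ` S n)) (WW (fst g ` S n)) Q (%_. t) xx (snd g ` F n) ?ph" by (rule EE_aut[OF g, symmetric]) simp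
   also have "... = EE (epS (S m)) (WW (S m)) Q (%_. t) xx (snd g ` F n) ?ph"
   proof (rule EE_enlarge[symmetric])
   show "fk_finite (epS (fst g ` S n)) (WW (fst g ` S n)) Q (%_. t) xx (snd g ` F n)" by (rule mod[OF fin(1,2)]) (use t in auto)
   show "finite (WW (S m))" by (rule finite_WW[OF finS])
   show "WW (fst g ` S n) <= WW (S m)" using elim(1) by (auto simp: WW_def)
   fix e assume "e : snd g ` F n"
   then obtain e0 where "e = snd g e0" "e0 : F n" by auto
   then have "ep e \<subseteq> fst g ` S n" using sub[of e0 n] g'(2)[of e0] by auto
   then show "epS (S m) e = epS (fst g ` S n) e" unfolding epS_def using elim(1) by (intro image_cong refl) (auto simp: prj_def)
   qed
   also have "... <= En m ?ph"
   proof (rule EE_compare[OF _ modt elim(2)])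
   show "fk_finite (epS (S m)) (WW (S m)) Q (%_. t) xx (snd g ` F n)" by (rule mod[OF finS fin(2)]) (use t in auto)
   show "rat (epS (S m)) Q (%_. t) A e <= rat (epS (S m)) Q (%_. t) B e" if "A \<subseteq> B" for A B e by (rule rat_self[OF finS _ that]) (use t in auto)
   qed (use epS_WW in auto)
   finally show ?case .
   qed
   then show ?thesis by (intro tendsto_lowerbound[OF lim_L[OF fin(3)]]) auto
  qed
  then show ?thesis by (intro LIMSEQ_le_const2[OF lim_L[OF P]]) auto
 qed
 have b: "bij (snd g)" using g by (simp add: aut_iff)
 have "L (snd g ` P) <= L (snd (inv (fst g), inv (snd g)) ` snd g ` P)" by (rule ge[OF aut_inv[OF g]]) (use P in simp)
 moreover have "inv (snd g) ` snd g ` P = P" using b by (simp add: bij_is_inj image_inv_f_f)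
 ultimately show ?thesis using ge[OF g P] by simp
qed

text \<open>The value 0 ties the contracted vertex to the ghost. With the value \<open>t\<close>
  there, contraction would replace many factors \<open>t\<close> by a single one and could raise a
  cluster value, which spoils the comparison of volumes. Without a field, that is for
  \<open>t = 1\<close>, all values are 1 and nothing has to be altered.\<close>

definition u0 :: "'v option => real" where "u0 w = (if w = None & t < 1 then 0 else t)"

lemma u0: "0 <= u0 w & u0 w <= 1" using t by (simp add: u0_def)

text \<open>Contracting further vertices can only join more. For \<open>t < 1\<close>, a cluster
  that reaches \<open>None\<close> gets the value 0, and one that does not is untouched by the
  contraction.\<close>

lemma rat_contract:
 assumes S': "finite S'" "S'' \<subseteq> S'" and AB: "A \<subseteq> B"
 shows "rat (epS S') Q u0 A e <= rat (epS S'') Q u0 B e"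
proof -
 have S2: "finite S''" using S' finite_subset by blast
 have m1: "fk_model (epS S') (WW S') Q u0" and m2: "fk_model (epS S'') (WW S'') Q u0"
  using mod[OF S'(1) finite.emptyI u0] mod[OF S2 finite.emptyI u0] by (simp_all add: fk_finite_def)
 define ps where "ps w = (case w of None => None | Some v => prj S'' v)" for w :: "'v option"
 have ps: "epS S'' e = ps ` epS S' e" for e unfolding epS_def image_image by (intro image_cong refl) (use S' in \<open>auto simp: prj_def ps_def\<close>)
 obtain a b where ab: "epS S' e = {a, b}" using edgy_epS unfolding edgy_def by blast
 have ab2: "epS S'' e = {ps a, ps b}" using ab by (simp add: ps)
 have W: "ps a : WW S''" "ps b : WW S''" using epS_WW[of S'' e] ab2 by auto
 have f: "finite (cl (epS S'') B v)" if "v : WW S''" for v by (rule finite_subset[OF cl_subset[OF that epS_WW] finite_WW[OF S2]])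
 have sub: "ps ` cl (epS S') A v <= cl (epS S'') B (ps v)" for v
 proof -
  have "ps ` cl (epS S') A v <= cl (epS S'') (id ` A) (ps v)" by (rule cl_image[OF edgy_epS]) (simp add: ps)
  also have "... <= cl (epS S'') B (ps v)" by (rule cl_mono) (use AB in simp)
  finally show ?thesis .
 qed
 have le: "ucl u0 (cl (epS S'') B (ps v)) <= ucl u0 (cl (epS S') A v)" if v: "ps v : WW S''" for v
 proof (cases "t < 1 & None ~: cl (epS S'') B (ps v)")
  case True
  have "ps w = w" if "w : cl (epS S') A v" for w
  proof -
   have "ps w : cl (epS S'') B (ps v)" using sub[of v] that by (meson image_subset_iff)
   then have "ps w ~= None" using True by metis
   then show ?thesis by (auto simp: ps_def prj_def split: option.splits if_splits)
  qed
  then have "cl (epS S') A v <= cl (epS S'') B (ps v)" using sub[of v] by force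
  then show ?thesis by (rule fk_model.ucl_anti[OF m2 f[OF v]])
 next
  case False
  show ?thesis
  proof (cases "t < 1")
   case True
   then have "ucl u0 (cl (epS S'') B (ps v)) = 0" unfolding ucl_def using False f[OF v] by (intro prod_zero) (auto simp: u0_def intro!: bexI[of _ None])
   then show ?thesis using fk_model.ucl_bounds(1)[OF m1] by simp
  next
   case False
   then have "u0 w = 1" for w unfolding u0_def using t by simp
   then have "u0 = (%_. 1)" by (simp add: fun_eq_iff)
   then show ?thesis by (simp add: ucl_def)
  qed
 qed
 show ?thesis
 proof (rule rat_compare[OF m1 m2 ab ab2])
  show "cl (epS S'') B (ps a) = cl (epS S'') B (ps b)" if h: "cl (epS S') A a = cl (epS S') A b"
  proof -
   have "b : cl (epS S') A a" using h unfolding cl_eq_iff .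
   then have "ps b : cl (epS S'') B (ps a)" using sub[of a] by blast
   then show ?thesis unfolding cl_eq_iff .
  qed
 qed (rule le, rule W)+
qed

text \<open>The base in \<open>EE_closed_bound\<close> when \<open>m\<close> is the odds of an edge
  of coupling \<open>eps\<close> and every open edge counts \<open>t powr (1 / deg)\<close>. The
  exponent reflects that a vertex meets \<open>deg\<close> strong edges.\<close>

definition kpa :: real where
 "kpa = (1 + Q + t powr (1 / deg) * (exp (2 * bt * eps) - 1)) / (1 + Q + (exp (2 * bt * eps) - 1))"

text \<open>With many strong boundary edges the wired vertex has a large cluster, so its ghost
 weight is irrelevant.\<close>

lemma wired_err:
 assumes S': "finite S'" and F': "finite F'" "bd S' \<subseteq> F'" and ph: "!!A. 0 <= ph A & ph A <= 1"
 shows "\<bar>EE (epS S') (WW S') Q (%_. t) xx F' ph - EE (epS S') (WW S') Q u0 xx F' ph\<bar> <= Q * kpa ^ card (bd S')"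
proof -
 let ?m = "exp (2 * bt * eps) - 1" and ?s = "t powr (1 / deg)"
 have m0: "0 <= ?m" using bt eps by simp
 have s: "0 < ?s" "?s <= 1" using t deg_pos by (auto intro: powr_le1)
 have k0: "0 <= kpa" unfolding kpa_def using Q m0 s by (intro divide_nonneg_nonneg add_nonneg_nonneg mult_nonneg_nonneg) auto
 show ?thesis
 proof (cases "t < 1")
  case False
  then have "u0 w = t" for w unfolding u0_def by simp
  then have "u0 = (%_. t)" by (rule ext)
  then show ?thesis using Q k0 by simp
 next
  case True
  then have u0e: "u0 = (%w. if w = None then 0 else t)" by (simp add: u0_def fun_eq_iff)
  interpret m': fk_finite "epS S'" "WW S'" Q u0 xx F' by (rule mod[OF S' F'(1) u0])
  have "\<bar>EE (epS S') (WW S') Q (%_. t) xx F' ph - EE (epS S') (WW S') Q u0 xx F' ph\<bar> \<le>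
   Q * EE (epS S') (WW S') Q u0 xx F' (%A. t ^ card (cl (epS S') A None))"
   unfolding u0e by (rule EE_root[OF mod[OF S' F'(1)] _ ph]) (use t in \<open>auto simp: WW_def\<close>)
  also have "EE (epS S') (WW S') Q u0 xx F' (%A. t ^ card (cl (epS S') A None)) \<le>
   EE (epS S') (WW S') Q u0 xx F' (%A. \<Prod>e\<in>bd S'. if e : A then ?s else 1)"
  proof (rule m'.EE_mono)
   fix A assume A: "A \<subseteq> F'"
   have fb: "finite (bd S')" using F' finite_subset by blast
   let ?C = "{v : S'. Some v : cl (epS S') A None}" and ?K = "cl (epS S') A None"
   have fC: "finite ?C" using S' by simp
   have fK: "finite ?K" by (rule finite_subset[OF cl_subset[OF _ epS_WW] finite_WW[OF S']]) (simp add: WW_def)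
   \<comment> \<open>An open strong boundary edge puts its inner endpoint into the cluster of
     \<open>None\<close>, so this cluster has at least the number of such edges divided by
     \<open>deg\<close> vertices.\<close>
   have "bd S' Int A <= (\<Union>v\<in>?C. St v)"
   proof
   fix e assume e: "e : bd S' Int A"
   then have J: "eps <= J e" and c1: "card (ep e Int S') = 1" and eA: "e : A" by (auto simp: bd_def)
   obtain v where v: "ep e Int S' = {v}" using c1 by (rule card_1_singletonE)
   have "ep e ~= {v}" using card_ep[of e] by auto
   then obtain w where w: "w : ep e" "w ~: S'" using v by blast
   have N: "None : epS S' e" using w by (force simp: epS_def prj_def)
   have "epS S' e <= ?K" by (rule cl_edge[OF edgy_epS eA N cl_refl])
   moreover have "Some v : epS S' e" using v by (force simp: epS_def prj_def)
   ultimately have "v : ?C" using v by auto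
   moreover have "e : St v" using v J by (auto simp: St_def)
   ultimately show "e : (\<Union>v\<in>?C. St v)" by blast
   qed
   then have "card (bd S' Int A) <= card (\<Union>v\<in>?C. St v)" by (rule card_mono[rotated]) (use fC finite_St in auto)
   also have "... <= (\<Sum>v\<in>?C. card (St v))" by (rule card_UN_le[OF fC])
   finally have "real (card (bd S' Int A)) <= real (\<Sum>v\<in>?C. card (St v))" by (simp only: of_nat_le_iff)
   then have "real (card (bd S' Int A)) <= deg * card ?C" by (simp add: card_St mult.commute)
   also have "card ?C <= card ?K" by (rule card_inj_on_le[of Some]) (use fK in auto)
   finally have le: "real (card (bd S' Int A)) / deg <= card ?K" using deg_pos by (simp add: field_simps)
   have "t ^ card ?K = t powr (real (card ?K))" using t by (simp add: powr_realpow)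
   also have "... <= t powr (real (card (bd S' Int A)) / deg)" by (rule powr_mono'[OF le]) (use t in auto)
   also have "... = ?s ^ card (bd S' Int A)" using t by (simp add: powr_realpow[symmetric] powr_powr)
   also have "... = (\<Prod>e\<in>bd S'. if e : A then ?s else 1)" using fb by (simp add: prod.If_cases Int_def)
   finally show "t ^ card ?K <= (\<Prod>e\<in>bd S'. if e : A then ?s else 1)" .
  qed
  also have "... <= kpa ^ card (bd S')" unfolding kpa_def
  proof (rule m'.EE_closed_bound[OF F'(2)])
   fix e assume "e : bd S'"
   then have "eps <= J e" by (simp add: bd_def)
   then show "?m <= xx e" using bt by (simp add: mult_left_mono)
  qed (use s m0 in auto)
  finally show ?thesis using Q by (simp add: mult_left_mono)
 qed
qed

text \<open>By expansion the number of strong boundary edges tends to infinity with the volume,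
  while \<open>kpa < 1\<close> as soon as there is a field.\<close>

lemma err_lim: "0 < bt ==> (%n. Q * kpa ^ card (bd (S n))) \<longlonglongrightarrow> 0 | t = 1"
proof -
 assume b: "0 < bt"
 show ?thesis
 proof (cases "t = 1")
  case False
  then have t1: "t < 1" using t by simp
  have m0: "0 < exp (2 * bt * eps) - 1" using b eps by simp
  have s: "0 < t powr (1 / deg)" "t powr (1 / deg) < 1" using t t1 deg_pos powr_less_mono2[of "1 / deg" t 1] by auto
  have "t powr (1 / deg) * (exp (2 * bt * eps) - 1) < 1 * (exp (2 * bt * eps) - 1)" using s m0 by (intro mult_strict_right_mono)
  then have "t powr (1 / deg) * (exp (2 * bt * eps) - 1) < exp (2 * bt * eps) - 1" by (simp only: mult_1_left)
  then have lt: "1 + Q + t powr (1 / deg) * (exp (2 * bt * eps) - 1) < 1 + Q + (exp (2 * bt * eps) - 1)" by (rule add_strict_left_mono)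
  have pos: "0 < 1 + Q + (exp (2 * bt * eps) - 1)" using Q m0 by linarith
  have k: "0 <= kpa" "kpa < 1"
  proof -
   show "kpa < 1" unfolding kpa_def divide_less_eq_1_pos[OF pos] by (rule lt)
   have "0 <= t powr (1 / deg) * (exp (2 * bt * eps) - 1)" using s m0 by simp
   then show "0 <= kpa" unfolding kpa_def by (intro divide_nonneg_pos[OF add_nonneg_nonneg pos]) (use Q in simp)
  qed
  have "filterlim (%n. card (bd (S n))) at_top sequentially" unfolding filterlim_at_top
  proof
   fix N :: nat
   obtain B :: "'v set" where B: "finite B" "card B = nat \<lceil>real N / c\<rceil>" using infinite_arbitrarily_large[OF inf] by blast
   show "\<forall>\<^sub>F n in sequentially. N <= card (bd (S n))" using evS[OF B(1)]
   proof eventually_elim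
   case (elim n)
   have "real N / c <= card B" using B(2) c by (simp add: real_nat_ceiling_ge)
   also have "card B <= card (S n)" by (rule card_mono[OF finS elim])
   finally have "real N <= c * card (S n)" using c by (simp add: pos_divide_le_eq mult.commute)
   also have "... <= card (bd (S n))" unfolding bd_def by (rule expand[OF finS])
   finally show ?case by simp
   qed
  qed
  from filterlim_compose[OF LIMSEQ_realpow_zero[OF k] this]
  have "(%n. Q * kpa ^ card (bd (S n))) \<longlonglongrightarrow> Q * 0" by (intro tendsto_intros)
  then show ?thesis by simp
 qed simp
qed

text \<open>With \<open>u0\<close>, wired models decrease in the volume: contracting a large volume
  to the image of the \<open>n\<close>-th one raises increasing probabilities. The passage between
  \<open>u0\<close> and the constant \<open>t\<close> costs \<open>err\<close> at both ends. For
  \<open>bt = 0\<close> the base \<open>kpa\<close> is 1 and this error need not vanish, but then no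
  edge is ever open.\<close>

lemma inv_wired:
 assumes F1: "!!n. F n <= {e. ep e Int S n ~= {}}" and F2: "!!n. bd (S n) \<subseteq> F n"
  and app': "!!n F' \<Psi>. finite F' ==> F n \<subseteq> F' ==> F' <= {e. ep e Int S n ~= {}} ==> \<bar>measure (M n) {om. \<Psi> {e. fst om e}} -
   EE (epS (S n)) (WW (S n)) Q (%_. t) xx F' (%A. of_bool (\<Psi> A))\<bar> <= 1 / real (Suc n)"
  and g: "g : Aut ep J" and P: "finite P"
 shows "L (snd g ` P) = L P"
proof (cases "bt = 0")
 case True
 have z: "L R = (if R = {} then 1 else 0)" if R: "finite R" for R
 proof (cases "R = {}")
  case True
  interpret prob_space nu by (rule prob_nu)
  show ?thesis using True prob_space by (simp add: L_def space_nu)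
 next
  case False
  then obtain r where r: "r : R" by auto
  have "\<forall>\<^sub>F n in sequentially. En n (%A. of_bool (R \<subseteq> A)) <= 0" using evF[OF R]
  proof eventually_elim
   case (elim n)
   interpret m: fk_finite "epS (S n)" "WW (S n)" Q "%_. t" xx "F n" by (rule modt)
   have "(\<Prod>e\<in>R. xx e / (1 + xx e)) = 0" using True r R by (intro prod_zero) auto
   then show ?case using m.EE_dominated[OF elim] by simp
  qed
  then have "L R <= 0" by (intro tendsto_upperbound[OF lim_L[OF R]]) auto
  then show ?thesis using False measure_nonneg[of nu] by (simp add: L_def order.antisym)
 qed
 show ?thesis using z[OF P] z[of "snd g ` P"] P by simp
next
 case False
 then have b: "0 < bt" using bt by simp
 define err where "err n = (if t = 1 then 0 else Q * kpa ^ card (bd (S n)))" for n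
 have el: "err \<longlonglongrightarrow> 0" using err_lim[OF b] by (cases "t = 1") (auto simp: err_def[abs_def])
 have er: "\<bar>EE (epS (S n)) (WW (S n)) Q (%_. t) xx F' ph - EE (epS (S n)) (WW (S n)) Q u0 xx F' ph\<bar> <= err n"
  if "finite F'" "F n \<subseteq> F'" "!!A. 0 <= ph A & ph A <= 1" for n F' ph
 proof (cases "t = 1")
  case True
  then have "u0 w = t" for w unfolding u0_def by simp
  then have ue: "u0 = (%_. t)" by (rule ext)
  have "err n = 0" unfolding err_def using True by simp
  then show ?thesis unfolding ue by simp
 next
  case False
  then show ?thesis using wired_err[OF finS that(1) _ that(3), of n] F2[of n] that(2) by (auto simp: err_def)
 qed
 show ?thesis
 proof (rule L_one_sided[OF _ g P])
  fix g P assume g: "g : Aut ep J" and P: "finite (P :: 'e set)"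
  have g': "inj (snd g)" "bij (snd g)" using g by (auto simp: aut_iff bij_def)
  have fP: "finite (snd g ` P)" using P by simp
  let ?ph = "%A. of_bool (snd g ` P \<subseteq> A) :: real"
  let ?p = "%A. of_bool (P \<subseteq> A) :: real"
  have st: "L (snd g ` P) <= En n ?p + err n + 2 / real (Suc n)" if Pn: "P \<subseteq> F n" for n
  proof -
   have fin: "finite (fst g ` S n)" using finS by simp
   have "\<forall>\<^sub>F m in sequentially. En m ?ph <= err m + (En n ?p + err n + 2 / real (Suc n))" using evS[OF fin]
   proof eventually_elim
   case (elim m)
   define F1' where "F1' = inv (snd g) ` F m"
   have Fm: "snd g ` F1' = F m" unfolding F1'_def using g' by (simp add: image_f_inv_f bij_is_surj)
   \<comment> \<open>Pulled back by \<open>g\<close>, the edges of the large model either meet the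
     small volume or become loops at \<open>None\<close>. Adding \<open>F n\<close> to the former
     gives an edge set admissible for \<open>app'\<close>; the latter, \<open>Lp\<close>, are
     removed by \<open>EE_loops\<close>.\<close>
   define H where "H = (F1' Int {e. ep e Int S n ~= {}}) Un F n"
   define Lp where "Lp = F1' - H"
   have f1: "finite F1'" "finite H" "finite Lp" "finite (H Un Lp)" using finF by (auto simp: F1'_def H_def Lp_def)
   have Hs: "F n \<subseteq> H" "H <= {e. ep e Int S n ~= {}}" using F1[of n] by (auto simp: H_def)
   have "En m ?ph <= EE (epS (S m)) (WW (S m)) Q u0 xx (F m) ?ph + err m" using er[OF finF order.refl, of ?ph m] by (simp add: abs_le_iff)
   also have "EE (epS (S m)) (WW (S m)) Q u0 xx (F m) ?ph <= EE (epS (fst g ` S n)) (WW (fst g ` S n)) Q u0 xx (F m) ?ph"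
   proof (rule EE_compare[OF mod[OF finS finF u0] mod[OF fin finF u0] order.refl])
   show "rat (epS (S m)) Q u0 A e <= rat (epS (fst g ` S n)) Q u0 B e" if "A \<subseteq> B" for A B e by (rule rat_contract[OF finS elim that])
   qed (use epS_WW in auto)
   also have "... = EE (epS (S n)) (WW (S n)) Q u0 xx F1' (%A. ?ph (snd g ` A))" unfolding Fm[symmetric] by (rule EE_aut[OF g]) (simp add: u0_def)
   also have "... = EE (epS (S n)) (WW (S n)) Q u0 xx F1' ?p" by (simp only: inj_image_subset_iff[OF g'(1)])
   also have "... <= EE (epS (S n)) (WW (S n)) Q u0 xx (H Un Lp) ?p"
   proof (rule EE_compare[OF mod[OF finS f1(1) u0] mod[OF finS f1(4) u0]])
   show "F1' \<subseteq> H Un Lp" by (auto simp: Lp_def)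
   show "rat (epS (S n)) Q u0 A e <= rat (epS (S n)) Q u0 B e" if "A \<subseteq> B" for A B e by (rule rat_self[OF finS u0 that])
   qed (use epS_WW in auto)
   also have "... = EE (epS (S n)) (WW (S n)) Q u0 xx H ?p"
   proof (rule EE_loops[OF mod[OF finS f1(4) u0]])
   show "H Int Lp = {}" by (auto simp: Lp_def)
   fix e assume "e : Lp"
   then have "ep e Int S n = {}" by (auto simp: Lp_def H_def)
   then have "epS (S n) e = (%_. None) ` ep e" unfolding epS_def by (intro image_cong refl) (auto simp: prj_def)
   moreover have "ep e ~= {}" using card_ep[of e] by auto
   ultimately show "\<exists>a. epS (S n) e = {a}" by auto
   next
   fix A B assume "A \<subseteq> H" "B \<subseteq> Lp"
   then have "P \<subseteq> A Un B \<longleftrightarrow> P \<subseteq> A" using Pn Hs(1) unfolding Lp_def by blast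
   then show "?p (A Un B) = ?p A" by simp
   qed
   also have "... <= EE (epS (S n)) (WW (S n)) Q (%_. t) xx H ?p + err n" using er[OF f1(2) Hs(1), of ?p] by (simp add: abs_le_iff)
   also have "EE (epS (S n)) (WW (S n)) Q (%_. t) xx H ?p <= En n ?p + 2 / real (Suc n)"
   using app'[OF f1(2) Hs, of "%A. P \<subseteq> A"] app[of n "%A. P \<subseteq> A"] by (simp add: abs_le_iff)
   finally show ?case by linarith
   qed
   moreover have "(%m. err m + (En n ?p + err n + 2 / real (Suc n))) \<longlonglongrightarrow> 0 + (En n ?p + err n + 2 / real (Suc n))" by (intro tendsto_intros el)
   ultimately have "L (snd g ` P) <= 0 + (En n ?p + err n + 2 / real (Suc n))" by (intro tendsto_le[OF _ _ lim_L[OF fP]]) auto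
   then show ?thesis by simp
  qed
  have "\<forall>\<^sub>F n in sequentially. L (snd g ` P) <= En n ?p + err n + 2 / real (Suc n)" using evF[OF P] by eventually_elim (rule st)
  moreover have "(%n. En n ?p + err n + 2 * inverse (real (Suc n))) \<longlonglongrightarrow> L P + 0 + 2 * 0"
   by (intro tendsto_intros lim_L[OF P] el LIMSEQ_inverse_real_of_nat)
  ultimately show "L (snd g ` P) <= L P" by (intro tendsto_lowerbound[of _ "L P" sequentially]) (auto simp: inverse_eq_divide)
 qed
qed

end

context strong
begin

lemma free_limit:
 assumes q: "q \<ge> 1" and b: "bt \<ge> 0" and h: "h \<ge> 0" and V: "exhaustion Vs" and rc: "is_rc_free q bt h J ep Vs \<mu>"
 shows "\<exists>F. fk_limit ep J eps c (q - 1) (exp (- (2 * bt * h))) bt (distr \<mu> (PiM UNIV (%_. count_space UNIV)) fst) Vs F"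
proof -
 have fV: "finite (Vs n)" for n using V by (simp add: exhaustion_def)
 have "\<forall>n. \<exists>F0. finite F0 & F0 <= {e. ep e \<subseteq> Vs n} & (\<forall>F'. finite F' --> F0 \<subseteq> F' --> F' <= {e. ep e \<subseteq> Vs n} -->
  (\<forall>\<Psi>. \<bar>measure (rc_free_fin q bt h J ep (Vs n)) {om. \<Psi> {e. fst om e}} -
   EE (epS (Vs n)) (WW (Vs n)) (q - 1) (%_. exp (- (2 * bt * h))) (%e. exp (2 * bt * J e) - 1) F' (%A. of_bool (\<Psi> A))\<bar> <= 1 / real (Suc n)))"
  by (rule allI, rule approx_free[OF fV q b h]) simp
 from choice[OF this] obtain F0 where F0': "\<forall>n. finite (F0 n) & F0 n <= {e. ep e \<subseteq> Vs n} & (\<forall>F'. finite F' --> F0 n \<subseteq> F' --> F' <= {e. ep e \<subseteq> Vs n} --> (\<forall>\<Psi>. \<bar>measure (rc_free_fin q bt h J ep (Vs n)) {om. \<Psi> {e. fst om e}} -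
   EE (epS (Vs n)) (WW (Vs n)) (q - 1) (%_. exp (- (2 * bt * h))) (%e. exp (2 * bt * J e) - 1) F' (%A. of_bool (\<Psi> A))\<bar> <= 1 / real (Suc n)))" by (rule exE)
 have F0: "finite (F0 n)" "F0 n <= {e. ep e \<subseteq> Vs n}" for n by (rule conjunct1[OF spec[OF F0', of n]], rule conjunct1[OF conjunct2[OF spec[OF F0', of n]]])
 have F03: "\<bar>measure (rc_free_fin q bt h J ep (Vs n)) {om. \<Psi> {e. fst om e}} -
   EE (epS (Vs n)) (WW (Vs n)) (q - 1) (%_. exp (- (2 * bt * h))) (%e. exp (2 * bt * J e) - 1) F' (%A. of_bool (\<Psi> A))\<bar> <= 1 / real (Suc n)" if "finite F'" "F0 n \<subseteq> F'" "F' <= {e. ep e \<subseteq> Vs n}" for n F' \<Psi>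
  by (rule spec[OF F0', of n, THEN conjunct2, THEN conjunct2, rule_format, OF that])
 \<comment> \<open>\<open>F0 n\<close> secures the approximation, and the initial segment
   \<open>EB n\<close> of an enumeration makes the sets exhaust all edges.\<close>
 define F where "F n = F0 n Un ({e. ep e \<subseteq> Vs n} Int EB n)" for n
 have fF: "finite (F n)" for n using F0(1) finite_EB by (simp add: F_def)
 have Fs: "F n <= {e. ep e \<subseteq> Vs n}" for n using F0(2)[of n] by (auto simp: F_def)
 have F0F: "F0 n \<subseteq> F n" for n by (simp add: F_def)
 have evF: "\<forall>\<^sub>F n in sequentially. I \<subseteq> F n" if I: "finite I" for I
 proof -
  have fI: "finite (\<Union>e\<in>I. ep e)" using I finite_ep by blast
  show ?thesis using ev_exh[OF V fI] ev_EB[OF I] by eventually_elim (auto simp: F_def)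
 qed
 have wl: "weak_limit (%n. measure_pmf (rc_free_fin q bt h J ep (Vs n))) \<mu>" using rc by (simp add: is_rc_free_def)
 interpret R: rc_limit ep J eps c "q - 1" "exp (- (2 * bt * h))" bt "%n. rc_free_fin q bt h J ep (Vs n)" \<mu> Vs F
  by unfold_locales ((use q in simp), simp, (use b h in simp), rule b, rule fV, rule fF, rule ev_exh[OF V], assumption,
   rule evF, assumption, rule wl, rule F03[OF fF F0F Fs])
 have "fk_limit ep J eps c (q - 1) (exp (- (2 * bt * h))) bt R.nu Vs F"
 proof (rule R.to_fk_limit)
  fix g P assume "g : Aut ep J" "finite (P :: 'e set)"
  then show "R.L (snd g ` P) = R.L P" by (rule R.inv_free[rotated]) (use Fs in auto)
 qed
 then show ?thesis unfolding R.nu_def by blast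
qed

lemma wired_limit:
 assumes q: "q \<ge> 1" and b: "bt \<ge> 0" and h: "h \<ge> 0" and V: "exhaustion Vs" and rc: "is_rc_wired q bt h J ep Vs \<mu>"
 shows "\<exists>F. fk_limit ep J eps c (q - 1) (exp (- (2 * bt * h))) bt (distr \<mu> (PiM UNIV (%_. count_space UNIV)) fst) Vs F"
proof -
 have fV: "finite (Vs n)" for n using V by (simp add: exhaustion_def)
 have "\<forall>n. \<exists>F0. finite F0 & F0 <= {e. ep e Int Vs n ~= {}} & (\<forall>F'. finite F' --> F0 \<subseteq> F' --> F' <= {e. ep e Int Vs n ~= {}} -->
  (\<forall>\<Psi>. \<bar>measure (rc_wired_fin q bt h J ep (Vs n)) {om. \<Psi> {e. fst om e}} -
   EE (epS (Vs n)) (WW (Vs n)) (q - 1) (%_. exp (- (2 * bt * h))) (%e. exp (2 * bt * J e) - 1) F' (%A. of_bool (\<Psi> A))\<bar> <= 1 / real (Suc n)))"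
  by (rule allI, rule approx_wired[OF fV q b h]) simp
 from choice[OF this] obtain F0 where F0': "\<forall>n. finite (F0 n) & F0 n <= {e. ep e Int Vs n ~= {}} & (\<forall>F'. finite F' --> F0 n \<subseteq> F' --> F' <= {e. ep e Int Vs n ~= {}} --> (\<forall>\<Psi>. \<bar>measure (rc_wired_fin q bt h J ep (Vs n)) {om. \<Psi> {e. fst om e}} -
   EE (epS (Vs n)) (WW (Vs n)) (q - 1) (%_. exp (- (2 * bt * h))) (%e. exp (2 * bt * J e) - 1) F' (%A. of_bool (\<Psi> A))\<bar> <= 1 / real (Suc n)))" by (rule exE)
 have F0: "finite (F0 n)" "F0 n <= {e. ep e Int Vs n ~= {}}" for n by (rule conjunct1[OF spec[OF F0', of n]], rule conjunct1[OF conjunct2[OF spec[OF F0', of n]]])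
 have F03: "\<bar>measure (rc_wired_fin q bt h J ep (Vs n)) {om. \<Psi> {e. fst om e}} -
   EE (epS (Vs n)) (WW (Vs n)) (q - 1) (%_. exp (- (2 * bt * h))) (%e. exp (2 * bt * J e) - 1) F' (%A. of_bool (\<Psi> A))\<bar> <= 1 / real (Suc n)" if "finite F'" "F0 n \<subseteq> F'" "F' <= {e. ep e Int Vs n ~= {}}" for n F' \<Psi>
  by (rule spec[OF F0', of n, THEN conjunct2, THEN conjunct2, rule_format, OF that])
 \<comment> \<open>As in the free case, with the strong boundary added so that the wired error
   estimate applies.\<close>
 define F where "F n = F0 n Un ({e. ep e Int Vs n ~= {}} Int EB n) Un bd (Vs n)" for n
 have bds: "bd (Vs n) <= near (Vs n)" for n by (auto simp: bd_def near_def card_eq_0_iff)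
 have fF: "finite (F n)" for n using F0(1) finite_EB finite_subset[OF bds finite_near[OF fV]] by (simp add: F_def)
 have Fs: "F n <= {e. ep e Int Vs n ~= {}}" for n using F0(2)[of n] bds[of n] by (auto simp: F_def near_def)
 have F0F: "F0 n \<subseteq> F n" for n by (auto simp: F_def)
 have evF: "\<forall>\<^sub>F n in sequentially. I \<subseteq> F n" if I: "finite I" for I
 proof -
  have fI: "finite (\<Union>e\<in>I. ep e)" using I finite_ep by blast
  show ?thesis using ev_exh[OF V fI] ev_EB[OF I]
  proof eventually_elim
   case (elim n)
   have "ep e Int Vs n ~= {}" if "e : I" for e
   proof -
   have "ep e \<subseteq> Vs n" using elim(1) that by blast
   moreover have "ep e ~= {}" using card_ep[of e] by auto
   ultimately show ?thesis by blast
   qed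
   then show ?case using elim(2) by (auto simp: F_def)
  qed
 qed
 have wl: "weak_limit (%n. measure_pmf (rc_wired_fin q bt h J ep (Vs n))) \<mu>" using rc by (simp add: is_rc_wired_def)
 interpret R: rc_limit ep J eps c "q - 1" "exp (- (2 * bt * h))" bt "%n. rc_wired_fin q bt h J ep (Vs n)" \<mu> Vs F
  by unfold_locales ((use q in simp), simp, (use b h in simp), rule b, rule fV, rule fF, rule ev_exh[OF V], assumption,
   rule evF, assumption, rule wl, rule F03[OF fF F0F Fs])
 have "fk_limit ep J eps c (q - 1) (exp (- (2 * bt * h))) bt R.nu Vs F"
 proof (rule R.to_fk_limit)
  fix g P assume g: "g : Aut ep J" "finite (P :: 'e set)"
  show "R.L (snd g ` P) = R.L P"
  proof (rule R.inv_wired[OF Fs _ _ g])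
   show "bd (Vs n) \<subseteq> F n" for n by (simp add: F_def)
  qed (rule F03, assumption, rule order.trans[OF F0F], assumption, assumption)
 qed
 then show ?thesis unfolding R.nu_def by blast
qed

end

theorem theorem1p8:
  fixes ep :: "'e \<Rightarrow> 'v set" and J :: "'e \<Rightarrow> real" and root :: 'v and q :: real
  assumes "weighted_graph ep J"
    and "infinite (UNIV :: 'v set)"
    and "graph_connected ep"
    and "vertex_transitive ep J"
    and "nonamenable ep J"
    and "unimodular ep J"
    and "q \<ge> 1"
  shows "\<exists>C > 0. \<exists>\<delta> > 0. \<forall>n::nat. \<forall>\<beta> \<ge> 0. \<forall>h \<ge> 0. \<forall>Vs \<mu>.
           n \<ge> 1 \<longrightarrow> exhaustion Vs \<longrightarrow>
           (is_rc_free q \<beta> h J ep Vs \<mu> \<or> is_rc_wired q \<beta> h J ep Vs \<mu>) \<longrightarrow>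
           measure \<mu> {\<omega>. finite (cluster ep root \<omega>) \<and> n \<le> card (cluster ep root \<omega>)}
             \<le> C * real n powr (- \<delta>)"
proof -
 interpret G: ugraph ep J using assms by unfold_locales
 obtain eps and c :: real where ec: "eps > 0" "c > 0"
  "!!K. finite K ==> c * real (card K) <= real (card {e. eps <= J e & card (ep e Int K) = 1})" using G.strong_expansion[OF assms(5)] by blast
 interpret strong ep J eps c using ec by unfold_locales auto
 define D where "D = fk_limit.DJ ep J"
 \<comment> \<open>The threshold of \<open>tail_small\<close>. Positivity of \<open>D\<close> is
   available only once a limit measure is given, so the case distinction secures
   \<open>b > 0\<close> beforehand.\<close>
 define b where "b = (if D > 0 then 1 / (4 * D) else 1)"
 have b0: "0 < b" by (simp add: b_def)
 let ?Q = "q - 1"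
 have Q: "0 <= ?Q" using assms(7) by simp
 have xm: "0 < xm b" using b0 eps by (simp add: xm_def)
 have "0 <= (1 + ?Q) / xm b" using Q xm by simp
 then have "1 <= Bc ?Q b" by (simp add: Bc_def)
 then have a: "0 <= ac ?Q b" unfolding ac_def using rho by (intro divide_nonneg_pos) auto
 \<comment> \<open>The summand 2 serves the range up to \<open>b\<close>, where the tail decays like
   \<open>1 / n\<close> and \<open>dl <= 1\<close> suffices; the other summand is the constant of
   \<open>tail_large\<close> above \<open>b\<close>.\<close>
 define C where "C = 2 + 2 * (sc ?Q b * (Bc ?Q b)\<^sup>2) powr (1 / (2 + ac ?Q b))"
 define dl where "dl = 1 / (2 * (2 + ac ?Q b))"
 have C: "2 <= C" "2 * (sc ?Q b * (Bc ?Q b)\<^sup>2) powr (1 / (2 + ac ?Q b)) <= C" by (simp_all add: C_def)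
 have d: "0 < dl" "dl <= 1" using a by (auto simp: dl_def divide_le_eq)
 have "measure \<mu> {om. finite (cluster ep root om) & n <= card (cluster ep root om)} <= C * real n powr (- dl)"
  if n: "n \<ge> 1" and bh: "bt \<ge> 0" "h \<ge> 0" and V: "exhaustion Vs" and rc: "is_rc_free q bt h J ep Vs \<mu> | is_rc_wired q bt h J ep Vs \<mu>"
  for n :: nat and bt h Vs \<mu>
 proof -
  let ?P = "PiM (UNIV :: 'e set) (%_. count_space (UNIV :: bool set))"
  obtain F where F: "fk_limit ep J eps c ?Q (exp (- (2 * bt * h))) bt (distr \<mu> ?P fst) Vs F"
   using rc free_limit[OF assms(7) bh V] wired_limit[OF assms(7) bh V] by blast
  interpret fk_uni ep J eps c ?Q "exp (- (2 * bt * h))" bt "distr \<mu> ?P fst" Vs F by (rule fk_uni.intro[OF F G.ugraph_axioms])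
  have sm: "sets \<mu> = sets borel" using rc by (auto simp: is_rc_free_def is_rc_wired_def weak_limit_def)
  have sp: "space \<mu> = UNIV" using sets_eq_imp_space_eq[OF sm] by simp
  have cl: "cluster ep root om = cl ep (Collect (fst om)) root" for om by (simp add: cluster_def cl_def adj_def)
  have AvP: "Av n root : sets ?P" using sets_Av[of n root] by simp
  have "measure (distr \<mu> ?P fst) (Av n root) = measure \<mu> (fst -` Av n root Int space \<mu>)" by (rule measure_distr[OF meas_fst[OF sm] AvP])
  also have "fst -` Av n root Int space \<mu> = {om. finite (cluster ep root om) & n <= card (cluster ep root om)}" unfolding cl by (auto simp: Av_def sp)
  finally have eq: "measure \<mu> {om. finite (cluster ep root om) & n <= card (cluster ep root om)} = measure (distr \<mu> ?P fst) (Av n root)" ..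
  show ?thesis
  proof (cases "bt <= b")
   case True
   have "D > 0" unfolding D_def by (rule DJ_pos)
   then have "bt <= 1 / (4 * DJ)" using True by (simp add: b_def D_def)
   then have "measure (distr \<mu> ?P fst) (Av n root) <= 2 / n" by (rule tail_small[OF _ n])
   also have "2 / real n = 2 * real n powr (- 1)" using n by (simp add: powr_minus_divide)
   also have "... <= C * real n powr (- dl)"
   proof (rule mult_mono[OF C(1)])
   show "real n powr (- 1) <= real n powr (- dl)" by (rule powr_mono) (use d n in auto)
   qed (use C in auto)
   finally show ?thesis unfolding eq .
  next
   case False
   then have "measure (distr \<mu> ?P fst) (Av n root) <= 2 * (sc ?Q b * (Bc ?Q b)\<^sup>2) powr (1 / (2 + ac ?Q b)) * real n powr (- dl)"
   unfolding dl_def by (intro tail_large[OF b0 _ n]) simp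
   also have "... <= C * real n powr (- dl)" by (rule mult_right_mono[OF C(2)]) simp
   finally show ?thesis unfolding eq .
  qed
 qed
 then show ?thesis using C(1) d(1) by (intro exI[of _ C] exI[of _ dl] conjI) auto
qed

end
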